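(* Let $(M,\omega)$ be a $C^2$ compact symplectic manifold of (real) dimension $2n$ with $C^2$ boundary. Let $H:M\to\mathbb R$ be a $C^2$ function with Hamiltonian vector field $X_H$, defined by $\omega(X_H(\xi),Y)=-dH(\xi)Y$ for $Y\in T_\xi M$, and assume $X_H$ is complete, i.e. its flow $\varphi(t,\xi)$ ($\frac{d}{dt}\varphi(t,\xi)=X_H(\varphi(t,\xi))$, $\varphi(0,\xi)=\xi$) is defined for all $(t,\xi)\in\mathbb R\times M$. Assume there is a $C^1$ symplectic trivialization $f:TM\to M\times\mathbb R^{2n}$ of the tangent bundle. For $\tau>0$ and $\xi\in M$ let $i_\tau(\xi)$ be the Maslov-type index of the linearized flow along $t\mapsto\varphi(t,\xi)$, $t\in[0,\tau]$, in this trivialization. Then there is a Borel function $F:M\to\mathbb R$ such that $$F\circ\varphi(t,\cdot)=F\quad\text{for all }t\ge 0,$$ and $\frac{i_\tau}{\tau}\to F$ as $\tau\to+\infty$, the convergence being in $L^1$ and almost everywhere with respect to the Liouville measure given by $\mu_M=\frac{\omega^n}{n!}$.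
   Context: Let $\omega_0(x,y)=\langle J_0x,y\rangle$ be the standard symplectic form on $\mathbb R^{2n}$, with $\langle x,y\rangle=y^Tx$ and $J_0=\begin{pmatrix}0&-I_n\\ I_n&0\end{pmatrix}$. A $C^1$ symplectic trivialization $f:TM\to M\times\mathbb R^{2n}$ is a $C^1$ bundle isomorphism over the identity of $M$ with $f^*\omega_0=\omega$. For $\xi\in M$ let $\Phi(\xi):\mathbb R^{2n}\to T_\xi M$ be the linear isomorphism with $f(\Phi(\xi)x)=(\xi,x)$. Put $$\gamma_0(t,\xi):=\Phi(\varphi(t,\xi))^{-1}\,d_\xi\varphi(t,\xi)\,\Phi(\xi)\in \mathrm{Sp}(2n,\mathbb R),\qquad i_\tau(\xi):=i_1\big(\gamma_0(\cdot,\xi)|_{[0,\tau]}\big).$$ Here real symplectic matrices are regarded as elements of $\mathrm{Sp}(V)$, $V=\mathbb C^{2n}$ with the skew-Hermitian form $\omega_0(x,y)=\langle J_0x,y\rangle$ (Hermitian inner product, linear in the first variable), where $\mathrm{Sp}(V)$ is the group of linear maps preserving $\omega_0$. Maslov index. Let $(X,\Omega)$ be a complex vector space of dimension $2N$ with a non-degenerate skew-Hermitian form $\Omega$, possessing Lagrangian subspaces (subspaces equal to their $\Omega$-annihilator). Choose an inner product (linear in the first variable) and $J\in \mathrm{GL}(X)$ with $\Omega(x,y)=\langle Jx,y\rangle$; $iJ$ is self-adjoint. Let $X^-$ (resp. $X^+$) be the span of eigenvectors of $iJ$ with positive (resp. negative) eigenvalues. For a continuous path $(\lambda(s),\mu(s))$,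 $s\in[a,b]$, of pairs of Lagrangian subspaces, write them as graphs of $U_\lambda(s),U_\mu(s):X^-\to X^+$; the operators $U_\lambda(s)U_\mu(s)^{-1}$ are unitary on $(X^+,-i\Omega|_{X^+})$ with eigenvalues $e^{i\theta_j(s)}$, $\theta_j$ continuous real, $j=1,\dots,N$. With $E(x)$ the smallest integer $\ge x$, $\mathrm{Mas}\{\lambda,\mu\}:=\sum_j\big(E(\theta_j(b)/2\pi)-E(\theta_j(a)/2\pi)\big)$ (independent of choices). Maslov-type index. $V\oplus V$ carries the symplectic form $(-\omega_0)\oplus\omega_0$; for $A\in \mathrm{Sp}(V)$ the graph $\mathrm{Gr}(A)=\{(x,Ax)\}$ is Lagrangian. For a path $\gamma$ in $\mathrm{Sp}(V)$, $i_1(\gamma):=\mathrm{Mas}\{\mathrm{Gr}\circ\gamma,\mathrm{Gr}(I_V)\}$ (second entry constant). *)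

theory Defs
  imports "HOL-Analysis.Analysis"
begin

section \<open>The standard symplectic form\<close>

text \<open>The space of dimension \<open>2n\<close> is \<open>_ ^ ('n + 'n)\<close> with \<open>n = CARD('n)\<close>; the indices \<open>Inl k\<close> form
  the first block and \<open>Inr k\<close> the second block.\<close>

definition J0 :: "'r::ring_1 ^ ('n::finite + 'n) ^ ('n + 'n)" where
  "J0 = (\<chi> i j. case (i, j) of
      (Inl k, Inr l) \<Rightarrow> if k = l then - 1 else 0
    | (Inr k, Inl l) \<Rightarrow> if k = l then 1 else 0
    | _ \<Rightarrow> 0)"

definition omega0 :: "real ^ ('n::finite + 'n) \<Rightarrow> real ^ ('n + 'n) \<Rightarrow> real" where
  "omega0 x y = (J0 *v x) \<bullet> y"

definition cdot :: "complex ^ 'k::finite \<Rightarrow> complex ^ 'k \<Rightarrow> complex" where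
  "cdot x y = (\<Sum>i\<in>UNIV. x $ i * cnj (y $ i))"

definition comega0 :: "complex ^ ('n::finite + 'n) \<Rightarrow> complex ^ ('n + 'n) \<Rightarrow> complex" where
  "comega0 x y = cdot (J0 *v x) y"


section \<open>The Maslov index\<close>

text \<open>The complex symplectic space is \<open>X = complex ^ 'k\<close>, \<open>CARD('k) = 2N\<close>, with a non-degenerate
  skew-Hermitian form \<open>\<Omega>\<close>. The Maslov index does not depend on the inner product; the
  standard one is used.\<close>

definition form_op :: "(complex ^ 'k::finite \<Rightarrow> complex ^ 'k \<Rightarrow> complex) \<Rightarrow> complex ^ 'k ^ 'k" where
  "form_op \<Omega> = (THE J. \<forall>x y. \<Omega> x y = cdot (J *v x) y)"

definition X_minus :: "(complex ^ 'k::finite \<Rightarrow> complex ^ 'k \<Rightarrow> complex) \<Rightarrow> (complex ^ 'k) set" where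
  "X_minus \<Omega> = vec.span {x. \<exists>r>0. \<i> *s (form_op \<Omega> *v x) = complex_of_real r *s x}"

definition X_plus :: "(complex ^ 'k::finite \<Rightarrow> complex ^ 'k \<Rightarrow> complex) \<Rightarrow> (complex ^ 'k) set" where
  "X_plus \<Omega> = vec.span {x. \<exists>r<0. \<i> *s (form_op \<Omega> *v x) = complex_of_real r *s x}"

text \<open>The operator \<open>U : X_minus \<rightarrow> X_plus\<close> with \<open>L = {x + U x | x \<in> X_minus}\<close>.\<close>

definition lag_op ::
  "(complex ^ 'k::finite \<Rightarrow> complex ^ 'k \<Rightarrow> complex) \<Rightarrow> (complex ^ 'k) set \<Rightarrow> complex ^ 'k \<Rightarrow> complex ^ 'k" where
  "lag_op \<Omega> L x = (THE y. y \<in> X_plus \<Omega> \<and> x + y \<in> L)"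

text \<open>If \<open>U\<close>, \<open>U'\<close> are the operators of \<open>L\<close>, \<open>L'\<close>, this is \<open>U\<close> composed with the inverse of \<open>U'\<close>; only
  its values on \<open>X_plus\<close> matter.\<close>

definition lag_quot ::
  "(complex ^ 'k::finite \<Rightarrow> complex ^ 'k \<Rightarrow> complex) \<Rightarrow> (complex ^ 'k) set \<Rightarrow> (complex ^ 'k) set
    \<Rightarrow> complex ^ 'k \<Rightarrow> complex ^ 'k" where
  "lag_quot \<Omega> L L' y = lag_op \<Omega> L (inv_into (X_minus \<Omega>) (lag_op \<Omega> L') y)"

text \<open>Continuous real angles \<open>\<theta> j\<close>, \<open>j < N\<close>, such that the \<open>exp (\<i> \<theta> j s)\<close> are the eigenvalues of
  \<open>lag_quot\<close> at \<open>s\<close>, repeated according to multiplicity. The operators are unitary, so the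
  multiplicity is the dimension of the eigenspace.\<close>

definition angle_lift ::
  "(complex ^ 'k::finite \<Rightarrow> complex ^ 'k \<Rightarrow> complex) \<Rightarrow> (real \<Rightarrow> (complex ^ 'k) set)
    \<Rightarrow> (real \<Rightarrow> (complex ^ 'k) set) \<Rightarrow> real \<Rightarrow> real \<Rightarrow> (nat \<Rightarrow> real \<Rightarrow> real) \<Rightarrow> bool" where
  "angle_lift \<Omega> lam mu a b \<theta> \<longleftrightarrow>
     (\<forall>j < CARD('k) div 2. continuous_on {a..b} (\<theta> j)) \<and>
     (\<forall>s\<in>{a..b}. \<forall>z. card {j. j < CARD('k) div 2 \<and> cis (\<theta> j s) = z}
        = vec.dim {y \<in> X_plus \<Omega>. lag_quot \<Omega> (lam s) (mu s) y = z *s y})"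

definition Mas ::
  "(complex ^ 'k::finite \<Rightarrow> complex ^ 'k \<Rightarrow> complex) \<Rightarrow> (real \<Rightarrow> (complex ^ 'k) set)
    \<Rightarrow> (real \<Rightarrow> (complex ^ 'k) set) \<Rightarrow> real \<Rightarrow> real \<Rightarrow> int" where
  "Mas \<Omega> lam mu a b = (THE m. \<exists>\<theta>. angle_lift \<Omega> lam mu a b \<theta> \<and>
     m = (\<Sum>j < CARD('k) div 2. \<lceil>\<theta> j b / (2 * pi)\<rceil> - \<lceil>\<theta> j a / (2 * pi)\<rceil>))"


section \<open>The Maslov-type index of a path of symplectic matrices\<close>

text \<open>\<open>V \<oplus> V\<close> is modelled by vectors indexed by the disjoint sum of two copies of the index type.\<close>

definition vpair :: "'r ^ 'k::finite \<Rightarrow> 'r ^ 'l::finite \<Rightarrow> 'r ^ ('k + 'l)" where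
  "vpair x y = (\<chi> i. case i of Inl k \<Rightarrow> x $ k | Inr l \<Rightarrow> y $ l)"

definition vfst :: "'r ^ ('k::finite + 'l::finite) \<Rightarrow> 'r ^ 'k" where
  "vfst z = (\<chi> k. z $ Inl k)"

definition vsnd :: "'r ^ ('k::finite + 'l::finite) \<Rightarrow> 'r ^ 'l" where
  "vsnd z = (\<chi> l. z $ Inr l)"

definition double_form ::
  "complex ^ (('n::finite + 'n) + ('n + 'n)) \<Rightarrow> complex ^ (('n + 'n) + ('n + 'n)) \<Rightarrow> complex" where
  "double_form z w = - comega0 (vfst z) (vfst w) + comega0 (vsnd z) (vsnd w)"

definition Gr :: "complex ^ 'k::finite ^ 'k \<Rightarrow> (complex ^ ('k + 'k)) set" where
  "Gr A = range (\<lambda>x. vpair x (A *v x))"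

definition i1 :: "(real \<Rightarrow> complex ^ ('n::finite + 'n) ^ ('n + 'n)) \<Rightarrow> real \<Rightarrow> real \<Rightarrow> int" where
  "i1 \<gamma> a b = Mas double_form (\<lambda>s. Gr (\<gamma> s)) (\<lambda>_. Gr (mat 1)) a b"


section \<open>Differentiability on subsets of normed spaces\<close>

text \<open>On a set that is not open, a map is \<open>C\<^sup>k\<close> if locally it extends to a \<open>C\<^sup>k\<close> map on an open set.\<close>

definition C1_on :: "'a::real_normed_vector set \<Rightarrow> ('a \<Rightarrow> 'b::real_normed_vector) \<Rightarrow> bool" where
  "C1_on S g \<longleftrightarrow> (\<forall>x\<in>S. \<exists>W h (h' :: 'a \<Rightarrow> ('a, 'b) blinfun).
     open W \<and> x \<in> W \<and> (\<forall>y\<in>S \<inter> W. h y = g y) \<and>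
     (\<forall>y\<in>W. (h has_derivative blinfun_apply (h' y)) (at y)) \<and> continuous_on W h')"

definition C2_on :: "'a::real_normed_vector set \<Rightarrow> ('a \<Rightarrow> 'b::real_normed_vector) \<Rightarrow> bool" where
  "C2_on S g \<longleftrightarrow> (\<forall>x\<in>S. \<exists>W h (h' :: 'a \<Rightarrow> ('a, 'b) blinfun)
       (h'' :: 'a \<Rightarrow> ('a, ('a, 'b) blinfun) blinfun).
     open W \<and> x \<in> W \<and> (\<forall>y\<in>S \<inter> W. h y = g y) \<and>
     (\<forall>y\<in>W. (h has_derivative blinfun_apply (h' y)) (at y)) \<and>
     (\<forall>y\<in>W. (h' has_derivative blinfun_apply (h'' y)) (at y)) \<and> continuous_on W h'')"


section \<open>Manifolds with boundary\<close>

text \<open>The manifold is the whole type \<open>'a\<close>. A chart is a pair of its domain and its coordinate map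
  into \<open>real ^ 'm\<close>; the values of the coordinate map outside the domain are irrelevant.\<close>

type_synonym ('a, 'm) chart = "'a set \<times> ('a \<Rightarrow> real ^ 'm)"

definition chart_image :: "('a, 'm::finite) chart \<Rightarrow> (real ^ 'm) set" where
  "chart_image c = snd c ` fst c"

definition chart_inv :: "('a, 'm::finite) chart \<Rightarrow> real ^ 'm \<Rightarrow> 'a" where
  "chart_inv c = inv_into (fst c) (snd c)"

definition charts_at :: "('a, 'm::finite) chart set \<Rightarrow> 'a \<Rightarrow> ('a, 'm) chart set" where
  "charts_at \<A> \<xi> = {c \<in> \<A>. \<xi> \<in> fst c}"

text \<open>Charts take values in relatively open subsets of a closed half-space \<open>{x. 0 \<le> v \<bullet> x}\<close>, which
  may depend on the chart; \<open>v = 0\<close> gives the interior charts, with values in open subsets of the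
  whole space.\<close>

definition C2_manifold_with_boundary :: "('a::topological_space, 'm::finite) chart set \<Rightarrow> bool" where
  "C2_manifold_with_boundary \<A> \<longleftrightarrow>
     (\<Union>c\<in>\<A>. fst c) = UNIV \<and>
     (\<forall>c\<in>\<A>. open (fst c) \<and>
        (\<exists>v. openin (top_of_set {x. 0 \<le> v \<bullet> x}) (chart_image c)) \<and>
        homeomorphism (fst c) (chart_image c) (snd c) (chart_inv c)) \<and>
     (\<forall>c\<in>\<A>. \<forall>c'\<in>\<A>. C2_on (snd c ` (fst c \<inter> fst c')) (\<lambda>x. snd c' (chart_inv c x)))"

definition C2_function :: "('a, 'm::finite) chart set \<Rightarrow> ('a \<Rightarrow> real) \<Rightarrow> bool" where
  "C2_function \<A> H \<longleftrightarrow> (\<forall>c\<in>\<A>. C2_on (chart_image c) (\<lambda>x. H (chart_inv c x)))"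


section \<open>Tangent vectors\<close>

text \<open>A tangent vector at \<open>\<xi>\<close> is the family of its components in the charts at \<open>\<xi>\<close>, transforming by
  the derivatives of the coordinate changes; it is set to \<open>0\<close> at all other charts.\<close>

type_synonym ('a, 'm) tangent = "('a, 'm) chart \<Rightarrow> real ^ 'm"

definition transition_deriv ::
  "('a, 'm::finite) chart \<Rightarrow> ('a, 'm) chart \<Rightarrow> 'a \<Rightarrow> real ^ 'm \<Rightarrow> real ^ 'm" where
  "transition_deriv c c' \<xi> = frechet_derivative (\<lambda>x. snd c' (chart_inv c x))
     (at (snd c \<xi>) within snd c ` (fst c \<inter> fst c'))"

definition tangent_space :: "('a, 'm::finite) chart set \<Rightarrow> 'a \<Rightarrow> ('a, 'm) tangent set" where
  "tangent_space \<A> \<xi> = {v.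
     (\<forall>c\<in>charts_at \<A> \<xi>. \<forall>c'\<in>charts_at \<A> \<xi>. v c' = transition_deriv c c' \<xi> (v c)) \<and>
     (\<forall>c. c \<notin> charts_at \<A> \<xi> \<longrightarrow> v c = 0)}"

definition tangent_bundle :: "('a, 'm::finite) chart set \<Rightarrow> ('a \<times> ('a, 'm) tangent) set" where
  "tangent_bundle \<A> = Sigma UNIV (tangent_space \<A>)"

text \<open>The tangent vector at \<open>\<xi>\<close> with component \<open>u\<close> in the chart \<open>c\<close>. This isomorphism transports the
  vector space structure of \<open>real ^ 'm\<close> to the tangent space.\<close>

definition tvec ::
  "('a, 'm::finite) chart set \<Rightarrow> ('a, 'm) chart \<Rightarrow> 'a \<Rightarrow> real ^ 'm \<Rightarrow> ('a, 'm) tangent" where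
  "tvec \<A> c \<xi> u = (\<lambda>c'. if c' \<in> charts_at \<A> \<xi> then transition_deriv c c' \<xi> u else 0)"

text \<open>Differentials are computed in an arbitrary chart at the base point.\<close>

definition dfun ::
  "('a, 'm::finite) chart set \<Rightarrow> ('a \<Rightarrow> real) \<Rightarrow> 'a \<Rightarrow> ('a, 'm) tangent \<Rightarrow> real" where
  "dfun \<A> H \<xi> v = (let c = (SOME c. c \<in> charts_at \<A> \<xi>) in
     frechet_derivative (\<lambda>x. H (chart_inv c x)) (at (snd c \<xi>) within chart_image c) (v c))"

definition dmap ::
  "('a, 'm::finite) chart set \<Rightarrow> ('a \<Rightarrow> 'a) \<Rightarrow> 'a \<Rightarrow> ('a, 'm) tangent \<Rightarrow> ('a, 'm) tangent" where
  "dmap \<A> g \<xi> v = (let c = (SOME c. c \<in> charts_at \<A> \<xi>) in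
     (\<lambda>c'. if c' \<in> charts_at \<A> (g \<xi>)
       then frechet_derivative (\<lambda>x. snd c' (g (chart_inv c x)))
         (at (snd c \<xi>) within snd c ` {\<eta> \<in> fst c. g \<eta> \<in> fst c'}) (v c)
       else 0))"


section \<open>Symplectic forms, Hamiltonian flows and symplectic trivializations\<close>

type_synonym ('a, 'm) two_form = "'a \<Rightarrow> ('a, 'm) tangent \<Rightarrow> ('a, 'm) tangent \<Rightarrow> real"

definition form_in_chart ::
  "('a, 'm::finite) chart set \<Rightarrow> ('a, 'm) two_form \<Rightarrow> ('a, 'm) chart
    \<Rightarrow> real ^ 'm \<Rightarrow> real ^ 'm \<Rightarrow> real ^ 'm \<Rightarrow> real" where
  "form_in_chart \<A> \<omega> c x u w =
     \<omega> (chart_inv c x) (tvec \<A> c (chart_inv c x) u) (tvec \<A> c (chart_inv c x) w)"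

text \<open>The exterior derivative of a 2-form \<open>\<beta>\<close> on \<open>S\<close>.\<close>

definition ext_deriv ::
  "'e::real_normed_vector set \<Rightarrow> ('e \<Rightarrow> 'e \<Rightarrow> 'e \<Rightarrow> real) \<Rightarrow> 'e \<Rightarrow> 'e \<Rightarrow> 'e \<Rightarrow> 'e \<Rightarrow> real" where
  "ext_deriv S \<beta> x u v w =
       frechet_derivative (\<lambda>y. \<beta> y v w) (at x within S) u
     - frechet_derivative (\<lambda>y. \<beta> y u w) (at x within S) v
     + frechet_derivative (\<lambda>y. \<beta> y u v) (at x within S) w"

text \<open>The tangent bundle of a \<open>C\<^sup>2\<close> manifold is only of class \<open>C\<^sup>1\<close>, so \<open>C\<^sup>1\<close> is the natural regularity
  of a symplectic form.\<close>

definition symplectic_form :: "('a, 'm::finite) chart set \<Rightarrow> ('a, 'm) two_form \<Rightarrow> bool" where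
  "symplectic_form \<A> \<omega> \<longleftrightarrow>
     (\<forall>c\<in>\<A>. \<forall>x\<in>chart_image c. bilinear (form_in_chart \<A> \<omega> c x)) \<and>
     (\<forall>\<xi>. \<forall>v\<in>tangent_space \<A> \<xi>. \<omega> \<xi> v v = 0) \<and>
     (\<forall>\<xi>. \<forall>v\<in>tangent_space \<A> \<xi>. (\<forall>w\<in>tangent_space \<A> \<xi>. \<omega> \<xi> v w = 0) \<longrightarrow> v = (\<lambda>_. 0)) \<and>
     (\<forall>c\<in>\<A>. \<forall>u w. C1_on (chart_image c) (\<lambda>x. form_in_chart \<A> \<omega> c x u w)) \<and>
     (\<forall>c\<in>\<A>. \<forall>x\<in>chart_image c. \<forall>u v w.
        ext_deriv (chart_image c) (form_in_chart \<A> \<omega> c) x u v w = 0)"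

definition hamiltonian_vector_field ::
  "('a, 'm::finite) chart set \<Rightarrow> ('a, 'm) two_form \<Rightarrow> ('a \<Rightarrow> real) \<Rightarrow> ('a \<Rightarrow> ('a, 'm) tangent) \<Rightarrow> bool" where
  "hamiltonian_vector_field \<A> \<omega> H X \<longleftrightarrow>
     (\<forall>\<xi>. X \<xi> \<in> tangent_space \<A> \<xi> \<and> (\<forall>Y\<in>tangent_space \<A> \<xi>. \<omega> \<xi> (X \<xi>) Y = - dfun \<A> H \<xi> Y))"

text \<open>A complete flow of \<open>X\<close>. Continuity of the orbits is needed for the derivative in a
  chart to be meaningful.\<close>

definition complete_flow ::
  "('a::topological_space, 'm::finite) chart set \<Rightarrow> ('a \<Rightarrow> ('a, 'm) tangent)
    \<Rightarrow> (real \<Rightarrow> 'a \<Rightarrow> 'a) \<Rightarrow> bool" where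
  "complete_flow \<A> X \<phi> \<longleftrightarrow>
     (\<forall>\<xi>. \<phi> 0 \<xi> = \<xi>) \<and>
     (\<forall>t \<xi>. isCont (\<lambda>s. \<phi> s \<xi>) t \<and>
        (\<forall>c\<in>charts_at \<A> (\<phi> t \<xi>).
           ((\<lambda>s. snd c (\<phi> s \<xi>)) has_vector_derivative X (\<phi> t \<xi>) c) (at t)))"

text \<open>In the coordinates \<open>(x, u) \<mapsto> tvec u\<close> of the tangent bundle, both the fibre part of \<open>f\<close> and the
  fibre part of its inverse are required to be of class \<open>C\<^sup>1\<close>.\<close>

definition C1_symplectic_trivialization ::
  "('a, 'n::finite + 'n) chart set \<Rightarrow> ('a, 'n + 'n) two_form
    \<Rightarrow> ('a \<times> ('a, 'n + 'n) tangent \<Rightarrow> 'a \<times> (real ^ ('n + 'n))) \<Rightarrow> bool" where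
  "C1_symplectic_trivialization \<A> \<omega> f \<longleftrightarrow>
     bij_betw f (tangent_bundle \<A>) UNIV \<and>
     (\<forall>p\<in>tangent_bundle \<A>. fst (f p) = fst p) \<and>
     (\<forall>\<xi>. \<forall>c\<in>charts_at \<A> \<xi>. linear (\<lambda>u. snd (f (\<xi>, tvec \<A> c \<xi> u)))) \<and>
     (\<forall>c\<in>\<A>. C1_on (chart_image c \<times> UNIV)
        (\<lambda>(x, u). snd (f (chart_inv c x, tvec \<A> c (chart_inv c x) u)))) \<and>
     (\<forall>c\<in>\<A>. C1_on (chart_image c \<times> UNIV)
        (\<lambda>(x, a). snd (inv_into (tangent_bundle \<A>) f (chart_inv c x, a)) c)) \<and>
     (\<forall>\<xi>. \<forall>v\<in>tangent_space \<A> \<xi>. \<forall>w\<in>tangent_space \<A> \<xi>.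
        \<omega> \<xi> v w = omega0 (snd (f (\<xi>, v))) (snd (f (\<xi>, w))))"


section \<open>The index along the linearized flow\<close>

definition Phi ::
  "('a, 'n::finite + 'n) chart set \<Rightarrow> ('a \<times> ('a, 'n + 'n) tangent \<Rightarrow> 'a \<times> (real ^ ('n + 'n)))
    \<Rightarrow> 'a \<Rightarrow> real ^ ('n + 'n) \<Rightarrow> ('a, 'n + 'n) tangent" where
  "Phi \<A> f \<xi> x = snd (inv_into (tangent_bundle \<A>) f (\<xi>, x))"

definition gamma0 ::
  "('a, 'n::finite + 'n) chart set \<Rightarrow> ('a \<times> ('a, 'n + 'n) tangent \<Rightarrow> 'a \<times> (real ^ ('n + 'n)))
    \<Rightarrow> (real \<Rightarrow> 'a \<Rightarrow> 'a) \<Rightarrow> real \<Rightarrow> 'a \<Rightarrow> real ^ ('n + 'n) ^ ('n + 'n)" where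
  "gamma0 \<A> f \<phi> t \<xi> =
     matrix (\<lambda>x. inv (Phi \<A> f (\<phi> t \<xi>)) (dmap \<A> (\<phi> t) \<xi> (Phi \<A> f \<xi> x)))"

definition flow_index ::
  "('a, 'n::finite + 'n) chart set \<Rightarrow> ('a \<times> ('a, 'n + 'n) tangent \<Rightarrow> 'a \<times> (real ^ ('n + 'n)))
    \<Rightarrow> (real \<Rightarrow> 'a \<Rightarrow> 'a) \<Rightarrow> real \<Rightarrow> 'a \<Rightarrow> int" where
  "flow_index \<A> f \<phi> \<tau> \<xi> = i1 (\<lambda>t. map_matrix complex_of_real (gamma0 \<A> f \<phi> t \<xi>)) 0 \<tau>"


section \<open>The Liouville measure\<close>

text \<open>\<open>\<beta>\<^sup>n / n!\<close> evaluated at the \<open>2n\<close> vectors \<open>e i\<close>, ordered as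
  \<open>Inl k\<^sub>1, Inr k\<^sub>1, Inl k\<^sub>2, Inr k\<^sub>2, \<dots>\<close>: the \<open>n\<close>-fold wedge product is
  \<open>2\<^sup>-\<^sup>n\<close> times the alternating sum over all permutations. The order matters only for
  the sign.\<close>

definition wedge_power_fact :: "('e \<Rightarrow> 'e \<Rightarrow> real) \<Rightarrow> ('n::finite + 'n \<Rightarrow> 'e) \<Rightarrow> real" where
  "wedge_power_fact \<beta> e =
     (\<Sum>p | p permutes UNIV. of_int (sign p) * (\<Prod>k\<in>(UNIV::'n set). \<beta> (e (p (Inl k))) (e (p (Inr k)))))
       / (2 ^ CARD('n) * fact CARD('n))"

definition is_liouville_measure ::
  "('a::topological_space, 'n::finite + 'n) chart set \<Rightarrow> ('a, 'n + 'n) two_form \<Rightarrow> 'a measure \<Rightarrow> bool" where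
  "is_liouville_measure \<A> \<omega> \<mu> \<longleftrightarrow> sets \<mu> = sets borel \<and>
     (\<forall>c\<in>\<A>. \<forall>B\<in>sets borel. B \<subseteq> fst c \<longrightarrow>
        emeasure \<mu> B = (\<integral>\<^sup>+ x. ennreal \<bar>wedge_power_fact (form_in_chart \<A> \<omega> c x) (\<lambda>i. axis i 1)\<bar>
          * indicator (snd c ` B) x \<partial>lborel))"

definition liouville_measure ::
  "('a::topological_space, 'n::finite + 'n) chart set \<Rightarrow> ('a, 'n + 'n) two_form \<Rightarrow> 'a measure" where
  "liouville_measure \<A> \<omega> = (THE \<mu>. is_liouville_measure \<A> \<omega> \<mu>)"

end

theory Submission
  imports Defs "HOL-Real_Asymp.Real_Asymp" "HOL-Computational_Algebra.Fundamental_Theorem_Algebra"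
begin

text \<open>Under the unitary correspondence between Lagrangian subspaces and unitary operators, the index of a
  path of symplectic matrices is, up to a bounded error, minus the variation of a continuous argument of
  \<open>det (Q + P A)\<close> divided by \<open>\<pi>\<close>, where \<open>P\<close> and \<open>Q\<close> are the spectral projections of \<open>\<i> J0\<close>. A homotopy to
  the case \<open>B = 1\<close> shows that this argument along \<open>A s B\<close> differs by a bounded amount from the argument along
  \<open>A s\<close>. With the cocycle identity for the linearized flow it follows that the index is quasi-additive
  over the flow. The flow preserves the symplectic form, hence the Liouville measure, and quasi-additive
  processes over a measure preserving map satisfy an ergodic theorem with an invariant limit.\<close>

section \<open>Quasi-additive processes over a measure preserving map\<close>

text \<open>The unitary operator of a graph has determinant \<open>det (Cm A) / det (Dm A)\<close>.
  For a real matrix these two determinants are conjugate, so the eigenvalue angles sum to minus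
  twice the argument of \<open>det (Dm A)\<close>, and rounding the 2n angles up changes an
  increment by at most 2n. The error of the homotopy is uniform because the determinant is a
  polynomial of degree at most 2n in the homotopy parameter without zeros in the closed unit disc:
  each root lets the argument turn by at most a quarter turn. F has to be invariant at every point,
  so it is taken as the upper limit along integer times, not as a limit that exists only almost
  everywhere. Two obstacles shape the rest. The space need not be simply connected, so an argument
  continuous in time and point is lifted from its constant value at time 0. And \<open>X_H\<close>
  is only C^1 in charts whose images may have a boundary, while the flow is given through its orbits
  alone: its continuity, differentiability and symplecticity come from estimates on short time
  intervals and are extended by the cocycle identity.\<close>

lemma subadditive_block_bound:
  fixes b :: "nat \<Rightarrow> 'a \<Rightarrow> real" and g :: "'a \<Rightarrow> real" and N :: nat
  assumes sub: "\<And>m n x. b (m + n) x \<le> b m x + b n ((T ^^ m) x)"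
    and bd: "\<And>n x. b n x \<le> (real n + 1) * K" and K: "0 \<le> K"
    and inv: "\<And>x. g (T x) = g x" and gK: "\<And>x. - K \<le> g x"
    and good: "\<And>x. x \<notin> B \<Longrightarrow> \<exists>s\<in>{1..N}. b s x \<le> real s * g x"
    and N: "1 \<le> N"
  shows "b n x \<le> real n * g x + (\<Sum>k<n. 3 * K * indicator B ((T ^^ k) x)) + (2 * real N + 1) * K"
\<comment> \<open>The time interval is cut into blocks. From a point outside \<open>B\<close> the
  next block has some length s at most N with \<open>b s x \<le> s * g x\<close>; from a point of
  \<open>B\<close> it has length one and is paid for by the indicator. The remainder of length at
  most N is absorbed by the constant last term.\<close>
proof (induction n arbitrary: x rule: less_induct)
  case (less n)
  have invs: "g ((T ^^ k) x) = g x" for k x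
    by (induction k) (auto simp: inv)
  have pos: "0 \<le> (\<Sum>k<m. 3 * K * indicator B ((T ^^ k) y))" for m y
    using K by (auto intro!: sum_nonneg)
  show ?case
  proof (cases "n \<le> N")
    case True
    have "b n x \<le> (real n + 1) * K" by (rule bd)
    also have "\<dots> \<le> real n * g x + (2 * real n + 1) * K"
    proof -
      have "real n * - K \<le> real n * g x" by (intro mult_left_mono gK) simp
      then show ?thesis by (simp add: algebra_simps)
    qed
    also have "\<dots> \<le> real n * g x + (2 * real N + 1) * K"
      using True K by (intro add_left_mono mult_right_mono) auto
    finally show ?thesis using pos[of x n] by linarith
  next
    case False
    obtain s where s: "1 \<le> s" "s \<le> N" "b s x \<le> real s * g x + 3 * K * indicator B x"
    proof (cases "x \<in> B")
      case True
      \<comment> \<open>\<open>b 1 x\<close> is at most 2 K and \<open>g x\<close> at least - K: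
        this is the origin of the penalty 3 K.\<close>
      have "b 1 x \<le> real 1 * g x + 3 * K * indicator B x"
        using bd[of 1 x] gK[of x] True by simp
      then show ?thesis using that[of 1] N by simp
    next
      case False
      then show ?thesis using good[OF False] that by force
    qed
    have "b n x = b (s + (n - s)) x" using s False by simp
    also have "\<dots> \<le> b s x + b (n - s) ((T ^^ s) x)" by (rule sub)
    also have "b (n - s) ((T ^^ s) x) \<le> real (n - s) * g x
        + (\<Sum>k<n - s. 3 * K * indicator B ((T ^^ (k + s)) x)) + (2 * real N + 1) * K"
    proof -
      have "b (n - s) y \<le> real (n - s) * g y + (\<Sum>k<n - s. 3 * K * indicator B ((T ^^ k) y)) + (2 * real N + 1) * K" for y
        by (rule less) (use s False in auto)
      from this[of "(T ^^ s) x"] show ?thesis by (simp add: invs funpow_add)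
    qed
    also have "(\<Sum>k<n - s. 3 * K * indicator B ((T ^^ (k + s)) x))
        = (\<Sum>k\<in>{s..<n}. 3 * K * indicator B ((T ^^ k) x))"
      using False s by (intro sum.reindex_bij_witness[of _ "\<lambda>k. k - s" "\<lambda>k. k + s"]) auto
    finally have 1: "b n x \<le> real s * g x + real (n - s) * g x + 3 * K * indicator B x
        + (\<Sum>k\<in>{s..<n}. 3 * K * indicator B ((T ^^ k) x)) + (2 * real N + 1) * K"
      using s by linarith
    have "real s * g x + real (n - s) * g x = real n * g x"
      using False s by (simp add: of_nat_diff algebra_simps)
    moreover have "3 * K * indicator B x + (\<Sum>k\<in>{s..<n}. 3 * K * indicator B ((T ^^ k) x))
        = (\<Sum>k\<in>insert 0 {s..<n}. 3 * K * indicator B ((T ^^ k) x))"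
      using s by (subst sum.insert) auto
    moreover have "\<dots> \<le> (\<Sum>k<n. 3 * K * indicator B ((T ^^ k) x))"
      using False s K by (intro sum_mono2) auto
    ultimately show ?thesis using 1 by linarith
  qed
qed

lemma funpow_measurable:
  assumes "T \<in> measurable M M" shows "(T ^^ k) \<in> measurable M M"
  by (induction k) (auto intro: measurable_compose[OF _ assms] simp: comp_def)

lemma measure_preserving_funpow:
  assumes T: "T \<in> measurable M M" and d: "distr M M T = M" and B: "B \<in> sets M"
  shows "measure M ((T ^^ k) -` B \<inter> space M) = measure M B"
proof (induction k)
  case (Suc k)
  have eq: "(T ^^ Suc k) -` B \<inter> space M = T -` ((T ^^ k) -` B \<inter> space M) \<inter> space M"
    using measurable_space[OF T] by (auto simp: funpow_swap1)
  have "measure M ((T ^^ Suc k) -` B \<inter> space M)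
      = measure (distr M M T) ((T ^^ k) -` B \<inter> space M)"
    using measurable_sets[OF funpow_measurable[OF T] B] unfolding eq by (simp add: measure_distr[OF T])
  then show ?case using Suc d by metis
qed (use sets.sets_into_space[OF B] in \<open>simp add: Int_absorb2\<close>)

text \<open>For large N the set of points without a good block of length at most N has measure at
  most e, and the map preserves the measure, so integrating the block bound costs only about 3 K e
  per step. In the applications f is the lower limit of \<open>b n / n\<close>, for which
  \<open>inf\<close> holds.\<close>

lemma (in finite_measure) subadditive_integral_le:
  fixes b :: "nat \<Rightarrow> 'a \<Rightarrow> real"
  assumes sp: "space M = UNIV" and T: "T \<in> measurable M M" and d: "distr M M T = M"
    and b[measurable]: "\<And>n. b n \<in> borel_measurable M"
    and sub: "\<And>m n x. b (m + n) x \<le> b m x + b n ((T ^^ m) x)"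
    and bd: "\<And>n x. \<bar>b n x\<bar> \<le> (real n + 1) * K" and K: "0 < K"
    and f[measurable]: "f \<in> borel_measurable M" and fK: "\<And>x. \<bar>f x\<bar> \<le> K"
    and inv: "\<And>x. f (T x) = f x"
    and inf: "\<And>x e. 0 < e \<Longrightarrow> \<exists>n\<ge>1. b n x \<le> real n * (f x + e)"
    and e': "0 < e'"
  shows "\<forall>\<^sub>F n in sequentially. (\<integral>x. b n x \<partial>M) / n \<le> (\<integral>x. f x \<partial>M) + e'"
proof -
  define \<mu> where "\<mu> = measure M (space M)"
  have \<mu>0: "0 \<le> \<mu>" by (simp add: \<mu>_def)
  \<comment> \<open>The error per step is \<open>e * \<mu> + 3 * (K + e) * e\<close>. With e at most
    1 it is bounded by \<open>e * (\<mu> + 3 * K + 3)\<close>, which this choice keeps at most e' /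
    2.\<close>
  define e where "e = min 1 (e' / 2 / (\<mu> + 3 * K + 3))"
  have e: "0 < e" using e' K \<mu>0 by (simp add: e_def)
  have e1: "e \<le> 1" by (simp add: e_def)
  have "e * (\<mu> + 3 * K + 3) \<le> e' / 2"
    proof -
    have "e \<le> e' / 2 / (\<mu> + 3 * K + 3)" by (simp add: e_def)
    then have "e * (\<mu> + 3 * K + 3) \<le> e' / 2 / (\<mu> + 3 * K + 3) * (\<mu> + 3 * K + 3)"
      using \<mu>0 K by (intro mult_right_mono) auto
    also have "\<dots> = e' / 2" by (rule nonzero_eq_divide_eq[THEN iffD1, OF _ refl]) (use \<mu>0 K in linarith)
    finally show ?thesis .
  qed
  then have ee: "e * (\<mu> + 3 * K + 3) < e'" using e' by linarith
  \<comment> \<open>By \<open>inf\<close> these increasing sets exhaust the space.\<close>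
  define A where "A N = {x \<in> space M. \<exists>n\<in>{1..N}. b n x \<le> real n * (f x + e)}" for N :: nat
  have A[measurable]: "A N \<in> sets M" for N by (simp add: A_def)
  have "(\<lambda>N. measure M (A N)) \<longlonglongrightarrow> measure M (\<Union>N. A N)"
    by (rule finite_Lim_measure_incseq) (force simp: A_def incseq_def)+
  moreover have "(\<Union>N. A N) = space M"
    using inf[OF e] by (force simp: A_def)
  ultimately have lm: "(\<lambda>N. measure M (A N)) \<longlonglongrightarrow> \<mu>" by (simp add: \<mu>_def)
  then have "\<forall>\<^sub>F N in sequentially. \<mu> - e < measure M (A N)"
    using e by (intro order_tendstoD) auto
  then have "\<forall>\<^sub>F N in sequentially. \<mu> - e < measure M (A N) \<and> 1 \<le> N"
    by (intro eventually_conj eventually_ge_at_top)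
  then obtain N where N: "\<mu> - e < measure M (A N)" "1 \<le> N"
    using eventually_happens'[OF sequentially_bot] by blast
  define B where "B = space M - A N"
  have B[measurable]: "B \<in> sets M" by (simp add: B_def)
  have Be: "measure M B \<le> e" using N by (simp add: B_def finite_measure_compl \<mu>_def)
  have fint: "integrable M f" by (rule integrable_const_bound[where B=K]) (auto simp: fK)
  have bint: "integrable M (b n)" for n
    by (rule integrable_const_bound[where B="(real n + 1) * K"]) (auto simp: bd)
  have Bset: "(T ^^ k) -` B \<inter> space M \<in> sets M" for k
    using measurable_sets[OF funpow_measurable[OF T] B] .
  have bnd: "(\<integral>x. b n x \<partial>M) \<le> real n * ((\<integral>x. f x \<partial>M) + e * \<mu> + 3 * (K + e) * e) + (2 * real N + 1) * (K + e) * \<mu>" for n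
  proof -
    let ?h = "\<lambda>x. (real n * (f x + e) + (\<Sum>k<n. 3 * (K + e) * indicator ((T ^^ k) -` B) x)
        + (2 * real N + 1) * (K + e))"
    have Bset': "(T ^^ k) -` B \<in> sets M" for k using Bset[of k] by (simp add: sp)
    have hint: "integrable M ?h"
      using Bset' fint by (intro Bochner_Integration.integrable_add integrable_mult_right
            Bochner_Integration.integrable_sum integrable_real_indicator) (auto simp: emeasure_eq_measure)
    have "(\<integral>x. b n x \<partial>M) \<le> (\<integral>x. ?h x \<partial>M)"
    proof (rule integral_mono[OF bint hint])
      fix x assume x: "x \<in> space M"
      have "b n x \<le> real n * (f x + e) + (\<Sum>k<n. 3 * (K + e) * indicator B ((T ^^ k) x)) + (2 * real N + 1) * (K + e)"
      proof (rule subadditive_block_bound[where T=T and B=B])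
        show "b n x \<le> (real n + 1) * (K + e)" for n x
        proof -
          have "b n x \<le> (real n + 1) * K" using bd[of n x] by linarith
          also have "\<dots> \<le> (real n + 1) * (K + e)" using e by (intro mult_left_mono) auto
          finally show ?thesis .
        qed
        show "- (K + e) \<le> f x + e" for x using fK[of x] e by (simp add: abs_le_iff)
        show "\<exists>s\<in>{1..N}. b s x \<le> real s * (f x + e)" if "x \<notin> B" for x
          using that by (auto simp: B_def A_def sp)
      qed (use sub inv K e N in auto)
      then show "b n x \<le> ?h x" by (simp add: indicator_def)
    qed
    also have "\<dots> = real n * ((\<integral>x. f x \<partial>M) + e * \<mu>)
        + (\<Sum>k<n. 3 * (K + e) * measure M ((T ^^ k) -` B)) + (2 * real N + 1) * (K + e) * \<mu>"
    proof -
      have "integrable M (\<lambda>x. real n * (f x + e))" using fint by auto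
      moreover have "integrable M (\<lambda>x. \<Sum>k<n. 3 * (K + e) * indicator ((T ^^ k) -` B) x)"
        using Bset' by (intro Bochner_Integration.integrable_sum integrable_mult_right integrable_real_indicator)
          (auto simp: emeasure_eq_measure)
      moreover have "(\<integral>x. (\<Sum>k<n. 3 * (K + e) * indicator ((T ^^ k) -` B) x) \<partial>M)
          = (\<Sum>k<n. 3 * (K + e) * measure M ((T ^^ k) -` B))"
        using Bset' by (subst Bochner_Integration.integral_sum) (auto simp: sp emeasure_eq_measure)
      moreover have "(\<integral>x. real n * (f x + e) \<partial>M) = real n * ((\<integral>x. f x \<partial>M) + e * \<mu>)"
        using fint by (simp add: \<mu>_def)
      ultimately show ?thesis by (simp add: \<mu>_def)
    qed
    also have "(\<Sum>k<n. 3 * (K + e) * measure M ((T ^^ k) -` B)) = n * (3 * (K + e) * measure M B)"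
      using measure_preserving_funpow[OF T d B] by (simp add: sp)
    also have "\<dots> \<le> n * (3 * (K + e) * e)"
      using Be K e by (intro mult_left_mono) auto
    finally show ?thesis by (simp add: ring_distribs)
  qed
  have "(\<integral>x. f x \<partial>M) + e * \<mu> + 3 * (K + e) * e \<le> (\<integral>x. f x \<partial>M) + e * (\<mu> + 3 * K + 3)"
    using e mult_left_mono[of e 1 e] by (simp add: algebra_simps e1)
  also have "\<dots> < (\<integral>x. f x \<partial>M) + e'" using ee by simp
  finally have R: "(\<integral>x. f x \<partial>M) + e * \<mu> + 3 * (K + e) * e + 0 < (\<integral>x. f x \<partial>M) + e'" by simp
  have "(\<lambda>n. ((\<integral>x. f x \<partial>M) + e * \<mu> + 3 * (K + e) * e) + (2 * real N + 1) * (K + e) * \<mu> / real n)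
      \<longlonglongrightarrow> ((\<integral>x. f x \<partial>M) + e * \<mu> + 3 * (K + e) * e) + 0"
    by (intro tendsto_add tendsto_const lim_const_over_n)
  from order_tendstoD(2)[OF this R] eventually_gt_at_top[of 0]
  show ?thesis
  proof eventually_elim
    case (elim n)
    then show ?case using divide_right_mono[OF bnd[of n], of "real n"] by (simp add: add_divide_distrib)
  qed
qed

lemma limsup_eq_of_diff_tendsto_0:
  fixes u v :: "nat \<Rightarrow> real"
  assumes "(\<lambda>n. u n - v n) \<longlonglongrightarrow> 0"
  shows "limsup (\<lambda>n. ereal (u n)) = limsup (\<lambda>n. ereal (v n))"
    and "liminf (\<lambda>n. ereal (u n)) = liminf (\<lambda>n. ereal (v n))"
proof -
  have *: "(\<lambda>n. ereal (u n)) = (\<lambda>n. ereal (u n - v n) + ereal (v n))" by auto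
  have d: "(\<lambda>n. ereal (u n - v n)) \<longlonglongrightarrow> 0"
    using assms by (simp add: zero_ereal_def)
  show "limsup (\<lambda>n. ereal (u n)) = limsup (\<lambda>n. ereal (v n))"
    unfolding * by (subst ereal_limsup_lim_add[OF d]) auto
  show "liminf (\<lambda>n. ereal (u n)) = liminf (\<lambda>n. ereal (v n))"
    unfolding * by (subst ereal_liminf_lim_add[OF d]) auto
qed

lemma bounded_limsup_bound:
  fixes u :: "nat \<Rightarrow> real"
  assumes "\<And>n. 1 \<le> n \<Longrightarrow> \<bar>u n\<bar> \<le> K"
  shows "\<bar>limsup (\<lambda>n. ereal (u n))\<bar> \<noteq> \<infinity>" "\<bar>liminf (\<lambda>n. ereal (u n))\<bar> \<noteq> \<infinity>"
    and "\<bar>real_of_ereal (limsup (\<lambda>n. ereal (u n)))\<bar> \<le> K"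
    and "\<bar>real_of_ereal (liminf (\<lambda>n. ereal (u n)))\<bar> \<le> K"
proof -
  have ev: "\<forall>\<^sub>F n in sequentially. ereal (u n) \<le> ereal K" "\<forall>\<^sub>F n in sequentially. ereal (- K) \<le> ereal (u n)"
    using eventually_ge_at_top[of 1] by (rule eventually_mono, use assms in \<open>fastforce simp: abs_le_iff\<close>)+
  have le: "liminf (\<lambda>n. ereal (u n)) \<le> limsup (\<lambda>n. ereal (u n))"
    by (rule Liminf_le_Limsup) simp
  have hi: "limsup (\<lambda>n. ereal (u n)) \<le> ereal K"
    by (rule Limsup_bounded[OF ev(1)])
  have lo: "ereal (- K) \<le> liminf (\<lambda>n. ereal (u n))"
    by (rule Liminf_bounded[OF ev(2)])
  show "\<bar>limsup (\<lambda>n. ereal (u n))\<bar> \<noteq> \<infinity>" "\<bar>liminf (\<lambda>n. ereal (u n))\<bar> \<noteq> \<infinity>"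
    "\<bar>real_of_ereal (limsup (\<lambda>n. ereal (u n)))\<bar> \<le> K"
    "\<bar>real_of_ereal (liminf (\<lambda>n. ereal (u n)))\<bar> \<le> K"
    using le hi lo
    by (cases "limsup (\<lambda>n. ereal (u n))"; cases "liminf (\<lambda>n. ereal (u n))"; simp add: abs_le_iff)+
qed

text \<open>Quasi-additivity makes both \<open>g + C\<close> and \<open>C - g\<close> subadditive
  along the time-one map. The integral bound for the two shows that the upper limit
  \<open>hi\<close> has an integral at most that of the lower limit \<open>lo\<close>, so they agree
  almost everywhere. The choice \<open>F = hi\<close>, which is defined everywhere, makes the
  invariance hold at every point.\<close>

theorem quasi_additive_ergodic:
  fixes \<phi> :: "real \<Rightarrow> 'a \<Rightarrow> 'a" and g :: "real \<Rightarrow> 'a \<Rightarrow> real"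
  assumes M: "finite_measure M" and sp: "space M = UNIV"
    and \<phi>0: "\<And>x. \<phi> 0 x = x" and \<phi>: "\<And>s t x. 0 \<le> s \<Longrightarrow> 0 \<le> t \<Longrightarrow> \<phi> (t + s) x = \<phi> s (\<phi> t x)"
    and T: "\<phi> 1 \<in> measurable M M" and d: "distr M M (\<phi> 1) = M"
    and g[measurable]: "\<And>t. 0 \<le> t \<Longrightarrow> g t \<in> borel_measurable M"
    and qa: "\<And>s t x. 0 \<le> s \<Longrightarrow> 0 \<le> t \<Longrightarrow> \<bar>g (t + s) x - g t x - g s (\<phi> t x)\<bar> \<le> C"
    and bd: "\<And>t x. 0 \<le> t \<Longrightarrow> t \<le> 1 \<Longrightarrow> \<bar>g t x\<bar> \<le> C"
  shows "\<exists>F. F \<in> borel_measurable M \<and> (\<forall>t\<ge>0. F \<circ> \<phi> t = F) \<and> integrable M F \<and>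
    (\<forall>\<tau>>0. integrable M (g \<tau>)) \<and>
    ((\<lambda>\<tau>. \<integral>x. \<bar>g \<tau> x / \<tau> - F x\<bar> \<partial>M) \<longlongrightarrow> 0) at_top \<and>
    (AE x in M. ((\<lambda>\<tau>. g \<tau> x / \<tau>) \<longlongrightarrow> F x) at_top)"
proof -
  interpret finite_measure M by fact
  have C: "0 \<le> C" using bd[of 0 undefined] by linarith
  have bn: "\<bar>g (real n) x\<bar> \<le> (2 * real n + 1) * C" for n x
  proof (induction n arbitrary: x)
    case (Suc n)
    show ?case using Suc[of x] qa[of 1 "real n" x] bd[of 1 "\<phi> (real n) x"]
      by (simp add: algebra_simps)
  qed (use bd[of 0] in simp)
  \<comment> \<open>A time t is compared with its integer part: on the remaining time, at most 1, g
    is bounded by C, and the splitting costs another C.\<close>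
  have gb: "\<bar>g t x\<bar> \<le> 3 * (t + 1) * C" and gfl: "\<bar>g t x - g (real (nat \<lfloor>t\<rfloor>)) x\<bar> \<le> 2 * C" if "0 \<le> t" for t x
  proof -
    define n where "n = nat \<lfloor>t\<rfloor>"
    have n: "real n \<le> t" "t - real n \<le> 1" using that by (auto simp: n_def) linarith
    have "\<bar>g (t - real n) (\<phi> (real n) x)\<bar> \<le> C" using n by (intro bd) auto
    moreover have "\<bar>g t x - g (real n) x - g (t - real n) (\<phi> (real n) x)\<bar> \<le> C"
      using qa[of "t - real n" "real n" x] n by simp
    ultimately show 1: "\<bar>g t x - g (real (nat \<lfloor>t\<rfloor>)) x\<bar> \<le> 2 * C" unfolding n_def[symmetric] by linarith
    have "(2 * real n + 1) * C \<le> (2 * t + 1) * C" using n C by (intro mult_right_mono) auto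
    then have "\<bar>g t x\<bar> \<le> (2 * t + 1) * C + 2 * C" using 1 bn[of n x] unfolding n_def by linarith
    also have "\<dots> \<le> 3 * (t + 1) * C" using C that by (simp add: algebra_simps)
    finally show "\<bar>g t x\<bar> \<le> 3 * (t + 1) * C" .
  qed
  define u where "u x n = g (real n) x / real n" for x n
  define hi where "hi x = real_of_ereal (limsup (\<lambda>n. ereal (u x n)))" for x
  define lo where "lo x = real_of_ereal (liminf (\<lambda>n. ereal (u x n)))" for x
  \<comment> \<open>For times t at least 1 the bound \<open>3 * (t + 1) * C\<close> is at most
    \<open>6 * t * C\<close>; the summand 1 keeps K positive.\<close>
  define K where "K = 6 * C + 1"
  have K: "0 < K" using C by (simp add: K_def)
  have ub: "\<bar>u x n\<bar> \<le> K" if "1 \<le> n" for x n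
  proof -
    have "3 * (real n + 1) * C \<le> 6 * real n * C" using that C by (intro mult_right_mono) auto
    also have "\<dots> \<le> K * real n" using C by (simp add: K_def algebra_simps)
    finally have "\<bar>g (real n) x\<bar> \<le> K * real n" using gb[of "real n" x] by simp
    then show ?thesis using that by (simp add: u_def abs_divide pos_divide_le_eq)
  qed
  note ubs = bounded_limsup_bound[of "u x" K for x, OF ub]
  have hi: "limsup (\<lambda>n. ereal (u x n)) = ereal (hi x)" and lo: "liminf (\<lambda>n. ereal (u x n)) = ereal (lo x)" for x
    using ubs(1,2)[of x] by (auto simp: hi_def lo_def ereal_real')
  have hm[measurable]: "hi \<in> borel_measurable M" and lm[measurable]: "lo \<in> borel_measurable M"
    unfolding hi_def[abs_def] lo_def[abs_def] u_def by measurable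
  have hK: "\<bar>hi x\<bar> \<le> K" and lK: "\<bar>lo x\<bar> \<le> K" for x
    using ubs(3,4)[of x] by (auto simp: hi_def lo_def)
  \<comment> \<open>Splitting \<open>t + n\<close> in the two possible orders compares
    \<open>g n (\<phi> t x)\<close> with \<open>g n x\<close> up to terms that do not grow with
    n.\<close>
  have du: "(\<lambda>n. u (\<phi> t x) n - u x n) \<longlonglongrightarrow> 0" if "0 \<le> t" for t x
  proof (rule Lim_null_comparison)
    let ?B = "2 * C + 2 * (3 * (t + 1) * C)"
    show "\<forall>\<^sub>F n in sequentially. norm (u (\<phi> t x) n - u x n) \<le> ?B / real n"
    proof (rule always_eventually, rule allI)
      fix n
      have "\<bar>g (real n) (\<phi> t x) - g (real n) x\<bar> \<le> ?B"
        using qa[of "real n" t x] qa[of t "real n" x] gb[OF that, of x] gb[OF that, of "\<phi> (real n) x"] that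
        by (simp add: add.commute)
      then show "norm (u (\<phi> t x) n - u x n) \<le> ?B / real n"
        by (simp add: u_def diff_divide_distrib[symmetric] abs_divide divide_right_mono)
    qed
  qed (rule lim_const_over_n)
  have hinv: "hi (\<phi> t x) = hi x" and linv: "lo (\<phi> t x) = lo x" if "0 \<le> t" for t x
    unfolding hi_def lo_def using limsup_eq_of_diff_tendsto_0[OF du[OF that]] by simp_all
  have pw: "(\<phi> 1 ^^ n) x = \<phi> (real n) x" for n x
  proof (induction n)
    case (Suc n)
    show ?case using \<phi>[of 1 "real n" x] by (simp add: Suc add.commute)
  qed (simp add: \<phi>0)
  have cn: "\<forall>\<^sub>F n in sequentially. C / real n < e" if "0 < e" for e
    by (rule order_tendstoD(2)[OF lim_const_over_n that])
  have l1: "\<forall>\<^sub>F n in sequentially. (\<integral>x. g (real n) x + C \<partial>M) / n \<le> (\<integral>x. lo x \<partial>M) + e" if "0 < e" for e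
  proof (rule subadditive_integral_le[OF sp T d, where K=K])
    show "g (real (m + n)) x + C \<le> g (real m) x + C + (g (real n) ((\<phi> 1 ^^ m) x) + C)" for m n x
      using qa[of "real n" "real m" x] by (simp add: pw)
    show "\<bar>g (real n) x + C\<bar> \<le> (real n + 1) * K" for n x
    proof -
      have "0 \<le> real n * C" using C by simp
      then show ?thesis using bn[of n x] C by (simp add: K_def algebra_simps)
    qed
    fix x and e :: real assume e: "0 < e"
    show "\<exists>n\<ge>1. g (real n) x + C \<le> real n * (lo x + e)"
    \<comment> \<open>Otherwise \<open>u x n\<close> exceeds \<open>lo x + e - C / n\<close> for all
      n from 1 on, hence eventually \<open>lo x + e / 2\<close>, against the definition of the lower
      limit.\<close>
    proof (rule ccontr)
      assume no: "\<not> ?thesis"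
      have "\<forall>\<^sub>F n in sequentially. ereal (lo x + e / 2) \<le> ereal (u x n)"
        using cn[OF half_gt_zero[OF e]] eventually_ge_at_top[of 1]
      proof eventually_elim
        case (elim n)
        then have "real n * (lo x + e) < g (real n) x + C" using no by force
        then have "lo x + e < (g (real n) x + C) / real n"
          using elim by (simp add: pos_less_divide_eq mult.commute)
        then have "lo x + e < u x n + C / real n" by (simp add: u_def add_divide_distrib)
        then have "lo x + e / 2 \<le> u x n" using elim by linarith
        then show ?case by simp
      qed
      from Liminf_bounded[OF this] show False using e by (simp add: lo)
    qed
  qed (use K lK linv[of 1] that in auto)
  have l2: "\<forall>\<^sub>F n in sequentially. (\<integral>x. C - g (real n) x \<partial>M) / n \<le> (\<integral>x. - hi x \<partial>M) + e" if "0 < e" for e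
  proof (rule subadditive_integral_le[OF sp T d, where K=K])
    show "C - g (real (m + n)) x \<le> C - g (real m) x + (C - g (real n) ((\<phi> 1 ^^ m) x))" for m n x
      using qa[of "real n" "real m" x] by (simp add: pw)
    show "\<bar>C - g (real n) x\<bar> \<le> (real n + 1) * K" for n x
    proof -
      have "0 \<le> real n * C" using C by simp
      then show ?thesis using bn[of n x] C by (simp add: K_def algebra_simps)
    qed
    fix x and e :: real assume e: "0 < e"
    show "\<exists>n\<ge>1. C - g (real n) x \<le> real n * (- hi x + e)"
    proof (rule ccontr)
      assume no: "\<not> ?thesis"
      have "\<forall>\<^sub>F n in sequentially. ereal (u x n) \<le> ereal (hi x - e / 2)"
        using cn[OF half_gt_zero[OF e]] eventually_ge_at_top[of 1]
      proof eventually_elim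
        case (elim n)
        then have "real n * (- hi x + e) < C - g (real n) x" using no by force
        then have "- hi x + e < (C - g (real n) x) / real n"
          using elim by (simp add: pos_less_divide_eq mult.commute)
        then have "- hi x + e < C / real n - u x n" by (simp add: u_def diff_divide_distrib)
        then have "u x n \<le> hi x - e / 2" using elim by linarith
        then show ?case by simp
      qed
      from Limsup_bounded[OF this] show False using e by (simp add: hi)
    qed
  qed (use K hK hinv[of 1] that in auto)
  have gint: "integrable M (g t)" if "0 \<le> t" for t
    using gb[OF that] g[OF that] by (intro integrable_const_bound[where B="3 * (t + 1) * C"]) auto
  have hint: "integrable M hi" "integrable M lo"
    using hK lK by (auto intro!: integrable_const_bound[where B=K])
  have "(\<integral>x. hi x \<partial>M) \<le> (\<integral>x. lo x \<partial>M)"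
  proof (rule field_le_epsilon)
    fix e :: real assume e: "0 < e"
    then have e3: "0 < e / 3" by simp
    have "\<forall>\<^sub>F n::nat in sequentially. (\<integral>x. hi x \<partial>M) \<le> (\<integral>x. lo x \<partial>M) + e"
      using l1[OF e3] l2[OF e3]
    proof eventually_elim
      case (elim n)
      \<comment> \<open>In the sum of the two integrals g cancels and the rest is nonnegative;
        adding the two upper bounds therefore compares \<open>hi\<close> with
        \<open>lo\<close>.\<close>
      have "(\<integral>x. g (real n) x + C \<partial>M) / n + (\<integral>x. C - g (real n) x \<partial>M) / n
          = 2 * C * measure M (space M) / real n"
        using gint[of "real n"] by (simp add: add_divide_distrib[symmetric])
      moreover have "(\<integral>x. - hi x \<partial>M) = - (\<integral>x. hi x \<partial>M)" by simp
      moreover have "0 \<le> 2 * C * measure M (space M) / real n" using C by simp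
      ultimately show ?case using elim e by linarith
    qed
    then show "(\<integral>x. hi x \<partial>M) \<le> (\<integral>x. lo x \<partial>M) + e"
      by (simp add: eventually_const)
  qed
  have lohi: "lo x \<le> hi x" for x
    using Liminf_le_Limsup[of sequentially "\<lambda>n. ereal (u x n)"] by (simp add: hi lo)
  have "(\<integral>x. hi x - lo x \<partial>M) = 0"
  proof (rule antisym)
    show "0 \<le> (\<integral>x. hi x - lo x \<partial>M)" using lohi by (intro integral_nonneg_AE) auto
  qed (use \<open>(\<integral>x. hi x \<partial>M) \<le> _\<close> hint in simp)
  then have "AE x in M. hi x - lo x = 0"
    using hint lohi by (subst (asm) integral_nonneg_eq_0_iff_AE) auto
  then have conv: "AE x in M. ((\<lambda>\<tau>. g \<tau> x / \<tau>) \<longlongrightarrow> hi x) at_top"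
  proof eventually_elim
    case (elim x)
    then have "(\<lambda>n. ereal (u x n)) \<longlonglongrightarrow> ereal (hi x)"
      using hi[of x] lo[of x] by (intro Liminf_eq_Limsup) auto
    then have lim: "u x \<longlonglongrightarrow> hi x" by simp
    have fl: "filterlim (\<lambda>\<tau>::real. nat \<lfloor>\<tau>\<rfloor>) sequentially at_top"
      by (rule filterlim_compose[OF filterlim_nat_sequentially filterlim_floor_sequentially])
    have r1: "((\<lambda>\<tau>::real. real (nat \<lfloor>\<tau>\<rfloor>) / \<tau>) \<longlongrightarrow> 1) at_top"
    proof (rule real_tendsto_sandwich)
      show "((\<lambda>\<tau>::real. 1 - 1 / \<tau>) \<longlongrightarrow> 1) at_top" by real_asymp
      show "\<forall>\<^sub>F \<tau>::real in at_top. 1 - 1 / \<tau> \<le> real (nat \<lfloor>\<tau>\<rfloor>) / \<tau>"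
        using eventually_gt_at_top[of 0]
      proof eventually_elim
        case (elim \<tau>)
        then have "\<tau> - 1 \<le> real (nat \<lfloor>\<tau>\<rfloor>)" by linarith
        then have "(\<tau> - 1) / \<tau> \<le> real (nat \<lfloor>\<tau>\<rfloor>) / \<tau>" using elim by (intro divide_right_mono) auto
        then show ?case using elim by (simp add: diff_divide_distrib)
      qed
      show "\<forall>\<^sub>F \<tau>::real in at_top. real (nat \<lfloor>\<tau>\<rfloor>) / \<tau> \<le> 1"
        using eventually_gt_at_top[of 0] by eventually_elim simp
    qed simp
    have r2: "((\<lambda>\<tau>. (g \<tau> x - g (real (nat \<lfloor>\<tau>\<rfloor>)) x) / \<tau>) \<longlongrightarrow> 0) at_top"
    proof (rule Lim_null_comparison)
      show "((\<lambda>\<tau>::real. 2 * C / \<tau>) \<longlongrightarrow> 0) at_top" by real_asymp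
      show "\<forall>\<^sub>F \<tau> in at_top. norm ((g \<tau> x - g (real (nat \<lfloor>\<tau>\<rfloor>)) x) / \<tau>) \<le> 2 * C / \<tau>"
        using eventually_gt_at_top[of 0]
        by eventually_elim (use gfl in \<open>auto simp: abs_divide intro!: divide_right_mono\<close>)
    qed
    have "((\<lambda>\<tau>. u x (nat \<lfloor>\<tau>\<rfloor>) * (real (nat \<lfloor>\<tau>\<rfloor>) / \<tau>) + (g \<tau> x - g (real (nat \<lfloor>\<tau>\<rfloor>)) x) / \<tau>)
        \<longlongrightarrow> hi x * 1 + 0) at_top"
      by (intro tendsto_add tendsto_mult r1 r2 filterlim_compose[OF lim fl])
    moreover have "\<forall>\<^sub>F \<tau> in at_top. u x (nat \<lfloor>\<tau>\<rfloor>) * (real (nat \<lfloor>\<tau>\<rfloor>) / \<tau>)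
        + (g \<tau> x - g (real (nat \<lfloor>\<tau>\<rfloor>)) x) / \<tau> = g \<tau> x / \<tau>"
      using eventually_ge_at_top[of 1]
    proof eventually_elim
      case (elim \<tau>)
      have *: "a / b * (b / c) = a / c" if "b \<noteq> 0" for a b c :: real using that by simp
      have "1 \<le> \<lfloor>\<tau>\<rfloor>" using elim by linarith
      then have nz: "real (nat \<lfloor>\<tau>\<rfloor>) \<noteq> 0" unfolding of_nat_eq_0_iff by linarith
      show ?case unfolding u_def *[OF nz] by (simp add: diff_divide_distrib)
    qed
    ultimately show ?case using tendsto_cong by force
  qed
  show ?thesis
  proof (intro exI[of _ hi] conjI)
    show "((\<lambda>\<tau>. \<integral>x. \<bar>g \<tau> x / \<tau> - hi x\<bar> \<partial>M) \<longlongrightarrow> 0) at_top"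
    proof -
      \<comment> \<open>The cut-off at 1 serves domination, since the quotient is bounded by K from
        there on, and measurability at all real \<tau>, since g is assumed measurable at nonnegative
        times.\<close>
      let ?s = "\<lambda>\<tau> x. if 1 \<le> \<tau> then \<bar>g \<tau> x / \<tau> - hi x\<bar> else 0"
      have "((\<lambda>\<tau>. \<integral>x. ?s \<tau> x \<partial>M) \<longlongrightarrow> (\<integral>x. 0 \<partial>M)) at_top"
      proof (rule integral_dominated_convergence_at_top)
        show "?s \<tau> \<in> borel_measurable M" for \<tau> by (cases "1 \<le> \<tau>") auto
        show "integrable M (\<lambda>x. K + K)" by simp
        show "\<forall>\<^sub>F \<tau> in at_top. AE x in M. norm (?s \<tau> x) \<le> K + K"
        proof (rule always_eventually, intro allI AE_I2)
          fix \<tau> x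
          have "\<bar>g \<tau> x / \<tau>\<bar> \<le> K" if "1 \<le> \<tau>"
          proof -
            have "3 * (\<tau> + 1) * C \<le> 6 * \<tau> * C" using that C by (intro mult_right_mono) auto
            also have "\<dots> \<le> K * \<tau>" using that by (simp add: K_def algebra_simps)
            finally have "\<bar>g \<tau> x\<bar> \<le> K * \<tau>" using gb[of \<tau> x] that by simp
            then show ?thesis using that by (simp add: abs_divide pos_divide_le_eq)
          qed
          moreover have "\<bar>g \<tau> x / \<tau> - hi x\<bar> \<le> \<bar>g \<tau> x / \<tau>\<bar> + \<bar>hi x\<bar>" by (rule abs_triangle_ineq4)
          ultimately show "norm (?s \<tau> x) \<le> K + K" using hK[of x] K by force
        qed
        show "AE x in M. ((\<lambda>\<tau>. ?s \<tau> x) \<longlongrightarrow> 0) at_top"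
          using conv
        proof eventually_elim
          case (elim x)
          then have "((\<lambda>\<tau>. \<bar>g \<tau> x / \<tau> - hi x\<bar>) \<longlongrightarrow> 0) at_top"
            by (intro tendsto_rabs_zero) (simp add: LIM_zero_iff)
          moreover have "\<forall>\<^sub>F \<tau> in at_top. ?s \<tau> x = \<bar>g \<tau> x / \<tau> - hi x\<bar>"
            using eventually_ge_at_top[of 1] by eventually_elim auto
          ultimately show ?case using tendsto_cong by force
        qed
      qed auto
      moreover have "\<forall>\<^sub>F \<tau> in at_top. (\<integral>x. ?s \<tau> x \<partial>M) = (\<integral>x. \<bar>g \<tau> x / \<tau> - hi x\<bar> \<partial>M)"
        using eventually_ge_at_top[of 1] by eventually_elim auto
      ultimately show ?thesis using tendsto_cong by force
    qed
  qed (use hinv hint gint conv in \<open>auto simp: fun_eq_iff\<close>)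
qed

section \<open>Continuous choice of angles\<close>

lemma image_mset_eqI:
  assumes "finite I" "finite K" "\<And>z. card {j\<in>I. f j = z} = card {j\<in>K. g j = z}"
  shows "image_mset f (mset_set I) = image_mset g (mset_set K)"
proof (rule multiset_eqI)
  fix z
  have "f -` {z} \<inter> I = {j\<in>I. f j = z}" "g -` {z} \<inter> K = {j\<in>K. g j = z}" by auto
  then show "count (image_mset f (mset_set I)) z = count (image_mset g (mset_set K)) z"
    using assms by (simp add: count_image_mset)
qed

lemma sum_image_mset_cong:
  fixes h :: "'c \<Rightarrow> 'd::comm_monoid_add"
  assumes "image_mset f (mset_set I) = image_mset g (mset_set K)"
  shows "(\<Sum>j\<in>I. h (f j)) = (\<Sum>j\<in>K. h (g j))"
proof -
  have "(\<Sum>j\<in>I. h (f j)) = sum_mset (image_mset h (image_mset f (mset_set I)))"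
    by (simp add: sum_unfold_sum_mset image_mset.compositionality comp_def)
  then show ?thesis
    unfolding assms by (simp add: sum_unfold_sum_mset image_mset.compositionality comp_def)
qed

lemma prod_image_mset_cong:
  fixes h :: "'c \<Rightarrow> 'd::comm_monoid_mult"
  assumes "image_mset f (mset_set I) = image_mset g (mset_set K)"
  shows "(\<Prod>j\<in>I. h (f j)) = (\<Prod>j\<in>K. h (g j))"
proof -
  have "(\<Prod>j\<in>I. h (f j)) = prod_mset (image_mset h (image_mset f (mset_set I)))"
    by (simp add: prod_unfold_prod_mset image_mset.compositionality comp_def)
  then show ?thesis
    unfolding assms by (simp add: prod_unfold_prod_mset image_mset.compositionality comp_def)
qed

text \<open>A polynomial is determined by its values at infinitely many points, and it determines
  its multiset of roots. Sampling at the natural numbers lets a root multiset be recorded by a point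
  of the countable product \<open>nat \<Rightarrow> complex\<close>.\<close>

lemma image_mset_eq_of_prod_linear:
  fixes f :: "'i \<Rightarrow> complex" and g :: "'j \<Rightarrow> complex"
  assumes "finite I" "finite K" and eq: "\<And>k::nat. (\<Prod>j\<in>I. of_nat k - f j) = (\<Prod>j\<in>K. of_nat k - g j)"
  shows "image_mset f (mset_set I) = image_mset g (mset_set K)"
proof -
  have pr: "proots (\<Prod>j\<in>J. [:- h j, 1:]) = image_mset h (mset_set J)" if "finite J"
    for J :: "'k set" and h :: "'k \<Rightarrow> complex"
    using that
  proof (induction J)
    case (insert x F)
    then show ?case by (subst prod.insert) (auto simp: proots_mult prod_zero_iff simp del: mult_pCons_left)
  qed simp
  have "(\<Prod>j\<in>I. [:- f j, 1:]) = (\<Prod>j\<in>K. [:- g j, 1:])" (is "?p = ?q")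
  proof (rule ccontr)
    assume "?p \<noteq> ?q"
    then have "finite {z. poly (?p - ?q) z = 0}" by (intro poly_roots_finite) auto
    moreover have "range (of_nat :: nat \<Rightarrow> complex) \<subseteq> {z. poly (?p - ?q) z = 0}"
      using eq by (auto simp: poly_prod)
    ultimately show False using finite_subset range_inj_infinite[OF inj_of_nat] by blast
  qed
  then show ?thesis using pr[OF assms(1)] pr[OF assms(2)] by metis
qed

lemma cis_eqD:
  assumes "cis a = cis b" obtains k :: int where "a = b + 2 * pi * of_int k"
  using assms sin_cos_eq_iff[of a b] by (auto simp: complex_eq_iff)

text \<open>The ceiling defect is a function on the circle: a full turn adds the same integer to
  both terms. Sums of ceilings thereby split into a sum of angles and a quantity that depends only
  on the points \<open>cis a\<close>.\<close>

lemma ceiling_angle_defect_cong: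
  assumes "cis a = cis b"
  shows "of_int \<lceil>a / (2 * pi)\<rceil> - a / (2 * pi) = of_int \<lceil>b / (2 * pi)\<rceil> - b / (2 * pi)"
proof -
  obtain k :: int where "a = b + 2 * pi * of_int k" using cis_eqD[OF assms] .
  then have "a / (2 * pi) = b / (2 * pi) + of_int k" by (simp add: field_simps)
  then show ?thesis by simp
qed

lemma floor_angle_defect_cong:
  assumes "cis a = cis b"
  shows "of_int \<lfloor>(t - a) / (2 * pi)\<rfloor> - (t - a) / (2 * pi) = of_int \<lfloor>(t - b) / (2 * pi)\<rfloor> - (t - b) / (2 * pi)"
proof -
  obtain k :: int where "a = b + 2 * pi * of_int k" using cis_eqD[OF assms] .
  then have "(t - a) / (2 * pi) = (t - b) / (2 * pi) - of_int k" by (simp add: field_simps)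
  then show ?thesis by simp
qed

lemma sum_angle_cong:
  fixes F :: "real \<Rightarrow> real"
  assumes "image_mset (\<lambda>j. cis (x j)) (mset_set I) = image_mset (\<lambda>j. cis (y j)) (mset_set K)"
    and "\<And>a b. cis a = cis b \<Longrightarrow> F a = F b"
  shows "(\<Sum>j\<in>I. F (x j)) = (\<Sum>j\<in>K. F (y j))"
proof -
  have "F a = F (Arg (cis a))" for a
    by (rule assms(2)) (simp add: cis_Arg_unique cis_Arg sgn_eq)
  then show ?thesis using sum_image_mset_cong[OF assms(1), of "\<lambda>z. F (Arg z)"] by simp
qed

text \<open>N unordered points of the circle, together with a compatible real value for the sum of
  their angles, have exactly one representative here: the angles in increasing order inside a window
  of length 2 pi. The coordinates from N on are fixed so that the set becomes compact in the
  function space once the sum is bounded.\<close>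

definition angle_config :: "nat \<Rightarrow> (nat \<Rightarrow> real) set" where
  "angle_config N = {x. (\<forall>i<N. \<forall>j<N. i \<le> j \<longrightarrow> x i \<le> x j) \<and> (\<forall>i<N. \<forall>j<N. x j \<le> x i + 2 * pi)
     \<and> (\<forall>i\<ge>N. x i = 0)}"

lemma angle_configD:
  assumes "x \<in> angle_config N"
  shows "\<And>i j. i < N \<Longrightarrow> j < N \<Longrightarrow> i \<le> j \<Longrightarrow> x i \<le> x j" "\<And>i j. i < N \<Longrightarrow> j < N \<Longrightarrow> x j \<le> x i + 2 * pi"
  using assms by (auto simp: angle_config_def)

text \<open>The counting function \<open>t \<mapsto> \<Sum>i. \<lfloor>(t - x i) / 2\<pi>\<rfloor>\<close> depends only on the sum of the angles and on
  the points of the circle, and it determines an ordered configuration.\<close>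

lemma angle_config_le_iff:
  assumes "x \<in> angle_config N" "j < N"
  shows "x j \<le> t \<longleftrightarrow> int j - int N < (\<Sum>i<N. \<lfloor>(t - x i) / (2 * pi)\<rfloor>)"
proof -
  note x = angle_configD[OF assms(1)]
  have split: "{..<N} = {..j} \<union> {j<..<N}" "{..<N} = {..<j} \<union> {j..<N}" using assms by auto
  \<comment> \<open>If \<open>x j \<le> t\<close>, the first j + 1 terms are at least 0 and the
    window keeps the other N - 1 - j terms at least - 1, so the sum is at least j + 1 - N. Otherwise
    the first j terms are at most 0 and the remaining ones at most - 1, so the sum is at most j -
    N.\<close>
  show ?thesis
  proof
    assume t: "x j \<le> t"
    have "(\<Sum>i\<in>{..j}. 0) + (\<Sum>i\<in>{j<..<N}. - 1) \<le> (\<Sum>i\<in>{..j}. \<lfloor>(t - x i) / (2 * pi)\<rfloor>) + (\<Sum>i\<in>{j<..<N}. \<lfloor>(t - x i) / (2 * pi)\<rfloor>)"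
    proof (intro add_mono sum_mono)
      fix i assume "i \<in> {..j}"
      then show "0 \<le> \<lfloor>(t - x i) / (2 * pi)\<rfloor>" using x(1)[of i j] t assms by simp
    next
      fix i assume "i \<in> {j<..<N}"
      then have "x i \<le> t + 2 * pi" using x(2)[of j i] t assms by simp
      then show "- 1 \<le> \<lfloor>(t - x i) / (2 * pi)\<rfloor>" by (simp add: le_floor_iff field_simps)
    qed
    also have "\<dots> = (\<Sum>i<N. \<lfloor>(t - x i) / (2 * pi)\<rfloor>)"
      unfolding split(1) by (rule sum.union_disjoint[symmetric]) auto
    finally show "int j - int N < (\<Sum>i<N. \<lfloor>(t - x i) / (2 * pi)\<rfloor>)" using assms by (simp add: of_nat_diff)
  next
    assume a: "int j - int N < (\<Sum>i<N. \<lfloor>(t - x i) / (2 * pi)\<rfloor>)"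
    show "x j \<le> t"
    proof (rule ccontr)
      assume t: "\<not> x j \<le> t"
      have "(\<Sum>i<N. \<lfloor>(t - x i) / (2 * pi)\<rfloor>) = (\<Sum>i\<in>{..<j}. \<lfloor>(t - x i) / (2 * pi)\<rfloor>) + (\<Sum>i\<in>{j..<N}. \<lfloor>(t - x i) / (2 * pi)\<rfloor>)"
        unfolding split(2) by (rule sum.union_disjoint) auto
      also have "\<dots> \<le> (\<Sum>i\<in>{..<j}. 0) + (\<Sum>i\<in>{j..<N}. - 1)"
      proof (intro add_mono sum_mono)
        fix i assume "i \<in> {..<j}"
        then have "t - x i < 2 * pi" using x(2)[of i j] t assms by simp
        then have "(t - x i) / (2 * pi) < 1" by simp
        then show "\<lfloor>(t - x i) / (2 * pi)\<rfloor> \<le> 0" by linarith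
      next
        fix i assume "i \<in> {j..<N}"
        then have "t - x i < 0" using x(1)[of j i] t assms by simp
        then have "(t - x i) / (2 * pi) < 0" by (simp add: divide_neg_pos)
        then show "\<lfloor>(t - x i) / (2 * pi)\<rfloor> \<le> - 1" by linarith
      qed
      finally show False using a assms by (simp add: of_nat_diff)
    qed
  qed
qed

text \<open>With equal sums, the floor defects, which only see the points of the circle, force equal
  counting functions for every t; the threshold criterion then compares each pair of
  coordinates.\<close>

lemma angle_config_unique:
  assumes x: "x \<in> angle_config N" and y: "y \<in> angle_config N"
    and s: "(\<Sum>j<N. x j) = (\<Sum>j<N. y j)"
    and p: "\<And>k::nat. (\<Prod>j<N. of_nat k - cis (x j)) = (\<Prod>j<N. of_nat k - cis (y j))"
  shows "x = y"
proof
  fix j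
  have m: "image_mset (\<lambda>j. cis (x j)) (mset_set {..<N}) = image_mset (\<lambda>j. cis (y j)) (mset_set {..<N})"
    by (rule image_mset_eq_of_prod_linear) (auto simp: p)
  have "(\<Sum>i<N. \<lfloor>(t - x i) / (2 * pi)\<rfloor>) = (\<Sum>i<N. \<lfloor>(t - y i) / (2 * pi)\<rfloor>)" for t
  proof -
    have "(\<Sum>i<N. of_int \<lfloor>(t - x i) / (2 * pi)\<rfloor> - (t - x i) / (2 * pi)) = (\<Sum>i<N. of_int \<lfloor>(t - y i) / (2 * pi)\<rfloor> - (t - y i) / (2 * pi))"
      by (rule sum_angle_cong[OF m]) (rule floor_angle_defect_cong)
    moreover have "(\<Sum>i<N. (t - x i) / (2 * pi)) = (\<Sum>i<N. (t - y i) / (2 * pi))"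
      using s by (simp add: sum_divide_distrib[symmetric] sum_subtractf)
    ultimately have "real_of_int (\<Sum>i<N. \<lfloor>(t - x i) / (2 * pi)\<rfloor>) = real_of_int (\<Sum>i<N. \<lfloor>(t - y i) / (2 * pi)\<rfloor>)"
      by (simp add: sum_subtractf)
    then show ?thesis by linarith
  qed
  then have "x j \<le> t \<longleftrightarrow> y j \<le> t" if "j < N" for t
    using angle_config_le_iff[OF x that] angle_config_le_iff[OF y that] by simp
  then show "x j = y j"
    using x y by (cases "j < N") (auto intro: antisym simp: angle_config_def)
qed

text \<open>The lowest angle is moved one full turn up and becomes the last one. The window
  condition is what keeps the new list ordered, and the old order gives the new window
  condition.\<close>

lemma angle_config_shift:
  assumes x: "x \<in> angle_config N" and N: "0 < N"
  obtains y where "y \<in> angle_config N" "(\<Sum>j<N. y j) = (\<Sum>j<N. x j) + 2 * pi"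
    "\<And>z. (\<Prod>j<N. z - cis (y j)) = (\<Prod>j<N. z - cis (x j))"
proof -
  obtain n where n: "N = Suc n" using N by (cases N) auto
  define y where "y i = (if i < n then x (Suc i) else if i = n then x 0 + 2 * pi else 0)" for i
  have "y \<in> angle_config N"
    unfolding angle_config_def
  proof (intro CollectI conjI allI impI)
    have m: "x i \<le> x j" if "i < N" "j < N" "i \<le> j" for i j using angle_configD(1)[OF x that] .
    have sp: "x j \<le> x i + 2 * pi" if "i < N" "j < N" for i j using angle_configD(2)[OF x that] .
    have sp4: "x j \<le> 4 * pi + x i" if "i < N" "j < N" for i j using sp[OF that] pi_gt_zero by linarith
    fix i j assume ij: "i < N" "j < N"
    show "y i \<le> y j" if "i \<le> j"
      using ij that m[of "Suc i" "Suc j"] sp[of "0" "Suc i"] by (auto simp: y_def n)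
    show "y j \<le> y i + 2 * pi"
      using ij m[of 0 "Suc i"] sp[of "Suc i" "Suc j"] sp4[of 0 "Suc j"] by (auto simp: y_def n)
  qed (simp add: y_def n)
  moreover have "(\<Sum>j<N. y j) = (\<Sum>j<N. x j) + 2 * pi"
    unfolding n sum.lessThan_Suc_shift[of x] by (simp add: y_def)
  moreover have "(\<Prod>j<N. z - cis (y j)) = (\<Prod>j<N. z - cis (x j))" for z
  proof -
    have "cis (x 0 + 2 * pi) = cis (x 0)" by (simp add: complex_eq_iff)
    then show ?thesis unfolding n prod.lessThan_Suc_shift[of "\<lambda>j. z - cis (x j)"] by (simp add: y_def mult.commute)
  qed
  ultimately show ?thesis using that by blast
qed

lemma angle_config_unshift:
  assumes x: "x \<in> angle_config N" and N: "0 < N"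
  obtains y where "y \<in> angle_config N" "(\<Sum>j<N. y j) = (\<Sum>j<N. x j) - 2 * pi"
    "\<And>z. (\<Prod>j<N. z - cis (y j)) = (\<Prod>j<N. z - cis (x j))"
proof -
  obtain n where n: "N = Suc n" using N by (cases N) auto
  define y where "y i = (if i = 0 then x n - 2 * pi else if i \<le> n then x (i - 1) else 0)" for i
  have "y \<in> angle_config N"
    unfolding angle_config_def
  proof (intro CollectI conjI allI impI)
    have m: "x i \<le> x j" if "i < N" "j < N" "i \<le> j" for i j using angle_configD(1)[OF x that] .
    have sp: "x j \<le> x i + 2 * pi" if "i < N" "j < N" for i j using angle_configD(2)[OF x that] .
    have sp4: "x j \<le> 4 * pi + x i" if "i < N" "j < N" for i j using sp[OF that] pi_gt_zero by linarith
    fix i j assume ij: "i < N" "j < N"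
    then have p: "i - 1 < N" "j - 1 < N" by auto
    show "y i \<le> y j" if "i \<le> j"
      using ij that p m[of "i - 1" "j - 1"] sp[of "j - 1" "n"] by (auto simp: y_def n)
    show "y j \<le> y i + 2 * pi"
      using ij p m[of "j - 1" "n"] sp[of "i - 1" "j - 1"] sp4[of "i - 1" n] by (auto simp: y_def n)
  qed (simp add: y_def n)
  moreover have "(\<Sum>j<N. y j) = (\<Sum>j<N. x j) - 2 * pi"
    unfolding n by (subst sum.lessThan_Suc_shift) (simp add: y_def)
  moreover have "(\<Prod>j<N. z - cis (y j)) = (\<Prod>j<N. z - cis (x j))" for z
  proof -
    have "cis (x n - 2 * pi) = cis (x n)" by (simp add: complex_eq_iff cos_diff sin_diff)
    then show ?thesis unfolding n by (subst prod.lessThan_Suc_shift) (simp add: y_def mult.commute)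
  qed
  ultimately show ?thesis using that by blast
qed

lemma angle_config_shift_int:
  fixes k :: int
  assumes x: "x \<in> angle_config N" and N: "0 < N"
  shows "\<exists>y. y \<in> angle_config N \<and> (\<Sum>j<N. y j) = (\<Sum>j<N. x j) + 2 * pi * of_int k
    \<and> (\<forall>z. (\<Prod>j<N. z - cis (y j)) = (\<Prod>j<N. z - cis (x j)))"
proof (induction k rule: int_induct[where k=0])
  case base
  show ?case using x by (intro exI[of _ x]) simp
next
  case (step1 i)
  then obtain y where y: "y \<in> angle_config N" "(\<Sum>j<N. y j) = (\<Sum>j<N. x j) + 2 * pi * of_int i"
    "\<forall>z. (\<Prod>j<N. z - cis (y j)) = (\<Prod>j<N. z - cis (x j))" by blast
  obtain w where "w \<in> angle_config N" "(\<Sum>j<N. w j) = (\<Sum>j<N. y j) + 2 * pi"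
    "\<And>z. (\<Prod>j<N. z - cis (w j)) = (\<Prod>j<N. z - cis (y j))" using angle_config_shift[OF y(1) N] by metis
  then show ?case using y by (intro exI[of _ w]) (simp add: algebra_simps)
next
  case (step2 i)
  then obtain y where y: "y \<in> angle_config N" "(\<Sum>j<N. y j) = (\<Sum>j<N. x j) + 2 * pi * of_int i"
    "\<forall>z. (\<Prod>j<N. z - cis (y j)) = (\<Prod>j<N. z - cis (x j))" by blast
  obtain w where "w \<in> angle_config N" "(\<Sum>j<N. w j) = (\<Sum>j<N. y j) - 2 * pi"
    "\<And>z. (\<Prod>j<N. z - cis (w j)) = (\<Prod>j<N. z - cis (y j))" using angle_config_unshift[OF y(1) N] by metis
  then show ?case using y by (intro exI[of _ w]) (simp add: algebra_simps)
qed

text \<open>The principal arguments are sorted into a window, and then single points are moved by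
  whole turns until the sum is S. The product of the points fixes the sum modulo 2 pi, so the number
  of turns is an integer.\<close>

lemma angle_config_exists:
  fixes N :: nat
  assumes N: "0 < N" and s: "cis (\<Sum>j<N. a j) = cis S"
  obtains x where "x \<in> angle_config N" "(\<Sum>j<N. x j) = S"
    "\<And>z. (\<Prod>j<N. z - cis (x j)) = (\<Prod>j<N. z - cis (a j))"
proof -
  define xs where "xs = sort (map (\<lambda>j. Arg2pi (cis (a j))) [0..<N])"
  define x0 where "x0 i = (if i < N then xs ! i else 0)" for i
  have len: "length xs = N" by (simp add: xs_def)
  have rng: "0 \<le> x0 i" "x0 i < 2 * pi" if "i < N" for i
  proof -
    have "x0 i \<in> set xs" using that len by (auto simp: x0_def)
    then show "0 \<le> x0 i" "x0 i < 2 * pi" by (auto simp: xs_def Arg2pi_ge_0 Arg2pi_lt_2pi)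
  qed
  have "x0 \<in> angle_config N"
    unfolding angle_config_def
  proof (intro CollectI conjI allI impI)
    fix i j assume "i < N" "j < N" "i \<le> j"
    then show "x0 i \<le> x0 j" using len sorted_nth_mono[of xs i j] by (simp add: x0_def xs_def)
  next
    fix i j assume "i < N" "j < N"
    then show "x0 j \<le> x0 i + 2 * pi" using rng[of i] rng[of j] by linarith
  qed (simp add: x0_def)
  moreover have pe: "(\<Prod>j<N. z - cis (x0 j)) = (\<Prod>j<N. z - cis (a j))" for z
  proof -
    have "(\<Prod>j<N. z - cis (x0 j)) = prod_list (map (\<lambda>t. z - cis t) xs)"
      using len by (simp add: x0_def prod.list_conv_set_nth atLeast0LessThan)
    also have "\<dots> = prod_mset (image_mset (\<lambda>t. z - cis t) (mset xs))"
      by (metis mset_map prod_mset_prod_list)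
    also have "\<dots> = prod_list (map (\<lambda>j. z - cis (Arg2pi (cis (a j)))) [0..<N])"
      by (simp add: xs_def image_mset.compositionality comp_def flip: prod_mset_prod_list)
    also have "\<dots> = (\<Prod>j<N. z - cis (Arg2pi (cis (a j))))"
      by (simp add: prod.list_conv_set_nth atLeast0LessThan)
    also have "\<dots> = (\<Prod>j<N. z - cis (a j))"
      using Arg2pi_eq[of "cis _"] by (simp add: cis_conv_exp mult.commute)
    finally show ?thesis .
  qed
  have "cis (\<Sum>j<N. x0 j) = cis S"
  proof -
    have "image_mset (\<lambda>j. cis (x0 j)) (mset_set {..<N}) = image_mset (\<lambda>j. cis (a j)) (mset_set {..<N})"
      by (rule image_mset_eq_of_prod_linear) (auto simp: pe)
    from prod_image_mset_cong[OF this, of id] have "(\<Prod>j<N. cis (x0 j)) = (\<Prod>j<N. cis (a j))" by simp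
    then show ?thesis using s by (simp add: cis_conv_exp exp_sum sum_distrib_left)
  qed
  then obtain k :: int where "S = (\<Sum>j<N. x0 j) + 2 * pi * of_int k" by (metis cis_eqD)
  moreover note angle_config_shift_int[of x0 N k]
  ultimately obtain y where "y \<in> angle_config N" "(\<Sum>j<N. y j) = S"
    "\<forall>z. (\<Prod>j<N. z - cis (y j)) = (\<Prod>j<N. z - cis (x0 j))" using N by auto
  then show ?thesis using that pe by simp
qed

text \<open>The window and the bound on the sum confine each coordinate to one interval, so this is
  a closed subset of a product of compact intervals.\<close>

lemma compact_angle_config:
  fixes N :: nat
  assumes N: "0 < N"
  shows "compact (angle_config N \<inter> {x. \<bar>\<Sum>j<N. x j\<bar> \<le> R})" (is "compact ?K")
proof -
  define B where "B = \<bar>R\<bar> + 2 * pi"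
  have cp: "compact (PiE UNIV (\<lambda>i::nat. {- B .. B}))"
    using compactin_PiE[of "\<lambda>_. euclideanreal" UNIV "\<lambda>_. {-B..B}"]
    by (simp add: euclidean_product_topology)
  have "closed ?K"
  proof -
    have c: "continuous_on UNIV (\<lambda>x::nat \<Rightarrow> real. x i)" for i by (rule continuous_on_product_coordinates)
    have "?K = {x. \<forall>i j. i < N \<and> j < N \<and> i \<le> j \<longrightarrow> x i \<le> x j} \<inter> {x. \<forall>i j. i < N \<and> j < N \<longrightarrow> x j \<le> x i + 2 * pi}
        \<inter> {x. \<forall>i. N \<le> i \<longrightarrow> x i = 0} \<inter> {x. \<bar>\<Sum>j<N. x j\<bar> \<le> R}"
      by (auto simp: angle_config_def)
    also have "closed \<dots>"
      by (intro closed_Int closed_Collect_all closed_Collect_imp closed_Collect_le closed_Collect_eq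
          open_Collect_const continuous_intros c)
    finally show ?thesis .
  qed
  moreover have sub: "?K \<subseteq> PiE UNIV (\<lambda>i::nat. {- B .. B})"
  proof
    fix x assume x: "x \<in> ?K"
    have "- B \<le> x i \<and> x i \<le> B" for i
    proof (cases "i < N")
      case True
      have xi: "x i \<le> x j + 2 * pi" "x j \<le> x i + 2 * pi" if "j < N" for j
        using x that True angle_configD(2)[of x N] by auto
      have "(\<Sum>j<N. x i - 2 * pi) \<le> (\<Sum>j<N. x j)" "(\<Sum>j<N. x j) \<le> (\<Sum>j<N. x i + 2 * pi)"
        by (rule sum_mono, use xi in force)+
      then have "N * (x i - 2 * pi) \<le> \<bar>R\<bar>" "- \<bar>R\<bar> \<le> N * (x i + 2 * pi)"
        using x by auto
      moreover have "\<bar>R\<bar> \<le> N * \<bar>R\<bar>" using N by (simp add: mult_le_cancel_right1)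
      ultimately have "N * (x i - 2 * pi) \<le> N * \<bar>R\<bar>" "N * - \<bar>R\<bar> \<le> N * (x i + 2 * pi)" by linarith+
      then have "x i - 2 * pi \<le> \<bar>R\<bar>" "- \<bar>R\<bar> \<le> x i + 2 * pi"
        using N by (auto simp only: mult_le_cancel_left_pos of_nat_0_less_iff)
      then show ?thesis by (simp add: B_def)
    next
      case False
      then have "x i = 0" using x by (auto simp: angle_config_def)
      moreover have "0 \<le> B" by (simp add: B_def add_nonneg_nonneg)
      ultimately show ?thesis by simp
    qed
    then show "x \<in> PiE UNIV (\<lambda>i::nat. {- B .. B})" by auto
  qed
  moreover have "?K = PiE UNIV (\<lambda>i. {- B .. B}) \<inter> ?K" using sub by blast
  ultimately show ?thesis using compact_Int_closed[OF cp, of ?K] by simp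
qed

text \<open>A continuous injection of a compact set into a Hausdorff space has a continuous inverse
  on its image. Applied to \<open>F\<close>, which records the sum of the angles and the sampled
  polynomial, this yields angles that are jointly continuous over an arbitrary space U, without
  following individual eigenvalues through collisions.\<close>

theorem continuous_angles:
  fixes S :: "'u::topological_space \<Rightarrow> real" and p :: "'u \<Rightarrow> complex \<Rightarrow> complex" and N :: nat
  assumes N: "0 < N" and S: "continuous_on U S" "\<And>\<xi>. \<xi> \<in> U \<Longrightarrow> \<bar>S \<xi>\<bar> \<le> R"
    and p: "\<And>z. continuous_on U (\<lambda>\<xi>. p \<xi> z)"
    and ex: "\<And>\<xi>. \<xi> \<in> U \<Longrightarrow> \<exists>a. (\<forall>z. p \<xi> z = (\<Prod>j<N. z - cis (a j))) \<and> cis (\<Sum>j<N. a j) = cis (S \<xi>)"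
  obtains x where "\<And>j. continuous_on U (\<lambda>\<xi>. x \<xi> j)"
    "\<And>\<xi> z. \<xi> \<in> U \<Longrightarrow> p \<xi> z = (\<Prod>j<N. z - cis (x \<xi> j))" "\<And>\<xi>. \<xi> \<in> U \<Longrightarrow> (\<Sum>j<N. x \<xi> j) = S \<xi>"
proof -
  define K where "K = angle_config N \<inter> {x. \<bar>\<Sum>j<N. x j\<bar> \<le> R}"
  define F where "F x = ((\<Sum>j<N. x j), (\<lambda>k::nat. \<Prod>j<N. of_nat k - cis (x j)))" for x :: "nat \<Rightarrow> real"
  define G where "G = inv_into K F"
  have "inj_on F K"
  proof (rule inj_onI)
    fix x y assume xy: "x \<in> K" "y \<in> K" "F x = F y"
    then have "(\<Sum>j<N. x j) = (\<Sum>j<N. y j)"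
      and "\<And>k::nat. (\<Prod>j<N. of_nat k - cis (x j)) = (\<Prod>j<N. of_nat k - cis (y j))"
      by (auto simp: F_def fun_eq_iff)
    then show "x = y" using xy(1,2) by (intro angle_config_unique) (auto simp: K_def)
  qed
  moreover have "continuous_on K F"
    unfolding F_def using continuous_on_subset[OF continuous_on_product_coordinates]
    by (intro continuous_intros continuous_on_coordinatewise_then_product) auto
  moreover have "compact K" unfolding K_def by (rule compact_angle_config[OF N])
  ultimately have G: "continuous_on (F ` K) G"
    unfolding G_def by (intro continuous_on_inv) auto
  define q where "q \<xi> = (S \<xi>, (\<lambda>k::nat. p \<xi> (of_nat k)))" for \<xi>
  have m: "q \<xi> \<in> F ` K" if "\<xi> \<in> U" for \<xi>
  proof -
    from ex[OF that] obtain a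
      where a: "\<And>z. p \<xi> z = (\<Prod>j<N. z - cis (a j))" "cis (\<Sum>j<N. a j) = cis (S \<xi>)" by blast
    obtain x where x: "x \<in> angle_config N" "(\<Sum>j<N. x j) = S \<xi>"
      "\<And>z. (\<Prod>j<N. z - cis (x j)) = (\<Prod>j<N. z - cis (a j))" using angle_config_exists[OF N a(2)] by metis
    have "F x = q \<xi>" unfolding F_def q_def x(2,3) a(1) ..
    moreover have "x \<in> K" using x(1,2) S(2)[OF that] by (simp add: K_def)
    ultimately show ?thesis by (metis imageI)
  qed
  have FG: "F (G (q \<xi>)) = q \<xi>" if "\<xi> \<in> U" for \<xi>
    unfolding G_def by (rule f_inv_into_f[OF m[OF that]])
  have "continuous_on U q"
    unfolding q_def using S p by (intro continuous_on_Pair continuous_on_coordinatewise_then_product) auto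
  then have "continuous_on U (\<lambda>\<xi>. G (q \<xi>))"
    using m by (intro continuous_on_compose2[OF G]) auto
  then have c: "continuous_on U (\<lambda>\<xi>. G (q \<xi>) j)" for j
    by (rule continuous_on_product_then_coordinatewise)
  show ?thesis
  proof (rule that[OF c])
    fix \<xi> z assume \<xi>: "\<xi> \<in> U"
    let ?x = "G (q \<xi>)"
    from FG[OF \<xi>] have FG': "(\<Sum>j<N. ?x j) = S \<xi>"
      "\<And>k::nat. (\<Prod>j<N. of_nat k - cis (?x j)) = p \<xi> (of_nat k)"
      by (simp_all add: F_def q_def fun_eq_iff)
    show "(\<Sum>j<N. ?x j) = S \<xi>" by (rule FG')
    from ex[OF \<xi>] obtain a where a: "\<And>z. p \<xi> z = (\<Prod>j<N. z - cis (a j))" by blast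
    have "image_mset (\<lambda>j. cis (a j)) (mset_set {..<N}) = image_mset (\<lambda>j. cis (?x j)) (mset_set {..<N})"
      by (rule image_mset_eq_of_prod_linear) (simp_all add: FG' flip: a)
    from prod_image_mset_cong[OF this, of "\<lambda>w. z - w"]
    show "p \<xi> z = (\<Prod>j<N. z - cis (?x j))" by (rule trans[OF a])
  qed
qed

section \<open>Unitary matrices\<close>

lemma cdot_simps:
  "cdot (x + y) z = cdot x z + cdot y z" "cdot x (y + z) = cdot x y + cdot x z"
  "cdot (x - y) z = cdot x z - cdot y z" "cdot x (y - z) = cdot x y - cdot x z"
  "cdot (c *s x) z = c * cdot x z" "cdot x (c *s z) = cnj c * cdot x z"
  "cdot (- x) z = - cdot x z" "cdot x (- z) = - cdot x z"
  "cdot 0 z = 0" "cdot x 0 = 0"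
  by (simp_all add: cdot_def sum.distrib sum_subtractf sum_distrib_left sum_negf algebra_simps)

lemma cdot_self: "cdot x x = of_real ((norm x)\<^sup>2)"
  by (simp add: cdot_def norm_vec_def L2_set_def sum_nonneg complex_norm_square del: of_real_power)

lemma cdot_self_eq_0: "cdot x x = 0 \<longleftrightarrow> x = 0"
  by (simp add: cdot_self)

lemma Re_cdot: "Re (cdot x y) = x \<bullet> y"
  by (simp add: cdot_def inner_vec_def inner_complex_def)

lemma cdot_eqI: "(\<And>y. cdot x y = cdot x' y) \<Longrightarrow> x = x'"
  using cdot_self_eq_0[of "x - x'"] by (simp add: cdot_simps)

text \<open>The iterates of x under W are dependent, so some nonzero polynomial in W kills x. One of
  least degree p has a root a, and the cofactor of \<open>X - a\<close>, applied to x, is an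
  eigenvector; it is nonzero by minimality and lies in R by invariance.\<close>

lemma invariant_subspace_eigenvector:
  fixes W :: "complex ^ 'k ^ 'k::finite"
  assumes R: "vec.subspace R" and W: "\<And>x. x \<in> R \<Longrightarrow> W *v x \<in> R" and x: "x \<in> R" "x \<noteq> 0"
  obtains y z where "y \<in> R" "y \<noteq> 0" "W *v y = z *s y"
proof -
  define v where "v i = (((*v) W) ^^ i) x" for i
  have vS: "v (Suc i) = W *v v i" and v0: "v 0 = x" for i by (simp_all add: v_def)
  have vR: "v i \<in> R" for i by (induction i) (auto simp: vS v0 W x)
  define m where "m = CARD('k)"
  define E where "E p = (\<Sum>i\<le>m. coeff p i *s v i)" for p
  have ER: "E p \<in> R" for p unfolding E_def
    using R vR by (intro vec.subspace_sum vec.subspace_scale) auto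
  have "\<exists>p. p \<noteq> 0 \<and> degree p \<le> m \<and> E p = 0"
  proof -
    have "\<exists>c. (\<exists>i\<le>m. c i \<noteq> 0) \<and> (\<Sum>i\<le>m. c i *s v i) = 0"
    \<comment> \<open>More than m distinct vectors in dimension m are dependent; if two of the
      iterates coincide, their difference is the relation.\<close>
    proof (cases "inj_on v {..m}")
      case True
      then have "card (v ` {..m}) = Suc m" by (simp add: card_image)
      then have "vec.dependent (v ` {..m})"
        using vec.independent_card_le_dim[OF subset_UNIV, of "v ` {..m}"] unfolding vec_dim_card m_def
        by (metis Suc_n_not_le_n)
      then obtain u where u: "\<exists>w\<in>v ` {..m}. u w \<noteq> 0" "(\<Sum>w\<in>v ` {..m}. u w *s w) = 0"
        by (auto simp: vec.dependent_finite)
      then show ?thesis using True by (intro exI[of _ "u \<circ> v"]) (auto simp: sum.reindex)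
    next
      case False
      then obtain i j where ij: "i \<le> m" "j \<le> m" "i \<noteq> j" "v i = v j" by (auto simp: inj_on_def)
      let ?c = "\<lambda>l. if l = i then 1 else if l = j then - 1 else (0::complex)"
      have "(\<Sum>l\<le>m. ?c l *s v l) = (\<Sum>l\<le>m. (if l = i then v l else 0) - (if l = j then v l else 0))"
        using ij by (intro sum.cong) auto
      also have "\<dots> = 0" using ij by (simp add: sum_subtractf)
      finally show ?thesis using ij by (intro exI[of _ ?c]) auto
    qed
    then obtain c where c: "\<exists>i\<le>m. c i \<noteq> 0" "(\<Sum>i\<le>m. c i *s v i) = 0" by blast
    let ?p = "\<Sum>i\<le>m. monom (c i) i"
    have co: "coeff ?p i = (if i \<le> m then c i else 0)" for i
        by (simp add: coeff_sum)
    then have "?p \<noteq> 0" using c(1) by (metis coeff_0)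
    moreover have "degree ?p \<le> m" by (rule degree_le) (simp add: co)
    ultimately show ?thesis using c(2) by (intro exI[of _ ?p]) (simp add: E_def co)
  qed
  then obtain p where p: "p \<noteq> 0" "degree p \<le> m" "E p = 0"
    and least: "\<And>q. q \<noteq> 0 \<Longrightarrow> degree q \<le> m \<Longrightarrow> E q = 0 \<Longrightarrow> degree p \<le> degree q"
    using ex_has_least_nat[of "\<lambda>p. p \<noteq> 0 \<and> degree p \<le> m \<and> E p = 0" _ degree] by blast
  have "degree p \<noteq> 0"
  proof
    assume "degree p = 0"
    then obtain c where pc: "p = [:c:]" by (metis degree_eq_zeroE)
    have "E p = (\<Sum>i\<in>{..m}. if i = 0 then c *s x else 0)"
      unfolding E_def by (intro sum.cong) (auto simp: pc coeff_pCons v0 split: nat.splits)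
    then show False using p x by (simp add: pc)
  qed
  then obtain a where "poly p a = 0"
    using fundamental_theorem_of_algebra[of p] by (auto simp: constant_degree)
  then obtain q where q: "p = [:- a, 1:] * q" by (auto simp: poly_eq_0_iff_dvd)
  have q0: "q \<noteq> 0" using p q by auto
  then have dq: "degree p = Suc (degree q)" unfolding q by (subst degree_mult_eq) auto
  have pq: "p = pCons 0 q - smult a q" by (simp add: q)
  have "E (pCons 0 q) = (\<Sum>i<m. coeff q i *s v (Suc i))"
    unfolding E_def lessThan_Suc_atMost[symmetric] by (subst sum.lessThan_Suc_shift) simp
  also have "\<dots> = W *v (\<Sum>i<m. coeff q i *s v i)"
    by (simp add: vS vec.sum vec.scale)
  also have "(\<Sum>i<m. coeff q i *s v i) = E q"
    using dq p by (simp add: E_def lessThan_Suc_atMost[symmetric] coeff_eq_0)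
  finally have "E p = W *v E q - a *s E q"
    by (simp add: pq E_def sum_subtractf vec.scale_left_diff_distrib vec.scale_sum_right)
  then have "W *v E q = a *s E q" using p by simp
  moreover have "E q \<noteq> 0" using least[of q] q0 dq p by auto
  ultimately show ?thesis using that ER by blast
qed

text \<open>The vectors orthogonal to all eigenvectors form a subspace that W preserves, since the
  eigenvalue of a nonzero eigenvector is nonzero. A nontrivial such subspace would contain an
  eigenvector, which would be orthogonal to itself.\<close>

lemma unitary_span_eigenvectors:
  fixes W :: "complex ^ 'k ^ 'k::finite"
  assumes U: "\<And>x y. cdot (W *v x) (W *v y) = cdot x y"
  shows "vec.span {x. \<exists>z. W *v x = z *s x} = UNIV"
proof (rule ccontr)
  let ?E = "{x. \<exists>z. W *v x = z *s x}"
  let ?S = "vec.span ?E"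
  assume ne: "?S \<noteq> UNIV"
  have sc: "r *\<^sub>R x = complex_of_real r *s x" for r and x :: "complex ^ 'k"
    by (simp add: vec_eq_iff) (simp add: scaleR_conv_of_real)
  \<comment> \<open>The complex span is also a real subspace, so an orthogonal vector is first found
    for the real inner product; testing against \<open>\<i> *s y\<close> as well as y turns this
    into complex orthogonality below.\<close>
  have rs: "span ?S = ?S"
    by (simp only: span_eq_iff) (auto simp: subspace_def sc vec.span_zero vec.span_add vec.span_scale)
  then have "span ?S \<subset> span UNIV" using ne unfolding rs span_UNIV by blast
  then have "\<exists>x. x \<noteq> 0 \<and> (\<forall>y\<in>span ?S. orthogonal x y)"
    by (rule orthogonal_to_subspace_exists_gen) fast
  then obtain x where x0: "x \<noteq> 0" "\<forall>y\<in>span ?S. orthogonal x y" by (elim exE conjE)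
  have x: "x \<noteq> 0" "\<And>y. y \<in> ?S \<Longrightarrow> x \<bullet> y = 0"
    using x0 unfolding rs orthogonal_def by auto
  define R where "R = {x. \<forall>y\<in>?E. cdot x y = 0}"
  have "cdot x y = 0" if "y \<in> ?S" for y
  proof (rule complex_eqI)
    show "Re (cdot x y) = Re 0" using x(2)[OF that] by (simp add: Re_cdot)
    have "Re (cdot x (\<i> *s y)) = 0" using x(2)[OF vec.span_scale[OF that]] by (simp add: Re_cdot)
    then show "Im (cdot x y) = Im 0" by (simp add: cdot_simps)
  qed
  then have xR: "x \<in> R" by (auto simp: R_def intro: vec.span_base)
  have sR: "vec.subspace R" by (auto simp: R_def vec.subspace_def cdot_simps)
  have WR: "W *v x \<in> R" if "x \<in> R" for x
    unfolding R_def
  proof (rule CollectI, rule ballI)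
    fix y assume y: "y \<in> ?E"
    then obtain z where z: "W *v y = z *s y" by blast
    have 0: "cdot x y = 0" using that y by (auto simp: R_def)
    have "z * cnj z * cdot y y = cdot y y" using U[of y y] by (simp add: z cdot_simps mult_ac)
    then have "y = 0 \<or> z \<noteq> 0" using cdot_self_eq_0 by force
    moreover have "cnj z * cdot (W *v x) y = 0" using U[of x y] 0 by (simp add: z cdot_simps)
    ultimately show "cdot (W *v x) y = 0" by (auto simp: cdot_simps)
  qed
  have "\<exists>y z. y \<in> R \<and> y \<noteq> 0 \<and> W *v y = z *s y"
    by (rule invariant_subspace_eigenvector[OF sR WR xR x(1)]) fast+
  then obtain y z where y: "y \<in> R" "y \<noteq> 0" "W *v y = z *s y" by blast
  then have "\<forall>w\<in>?E. cdot y w = 0" "y \<in> ?E" unfolding R_def by blast+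
  then have "cdot y y = 0" by blast
  then show False using y by (simp add: cdot_self_eq_0)
qed

lemma if_zero_mult: "(if P then a else 0) * b = (if P then a * b else (0::'a::mult_zero))"
  by simp

lemma matrix_vector_mult_mat: "mat c *v x = c *s (x :: 'a::comm_semiring_1 ^ 'n)"
  by (simp add: vec_eq_iff matrix_vector_mult_def mat_def if_zero_mult cong: if_cong)

text \<open>A basis of eigenvectors, taken as columns, conjugates W to a diagonal matrix. A single
  list of eigenvalues then accounts both for the characteristic polynomial, which varies
  continuously, and for the eigenspace dimensions, in terms of which the index is defined.\<close>

lemma unitary_diagonalization:
  fixes W :: "complex ^ 'k ^ 'k::finite"
  assumes U: "\<And>x y. cdot (W *v x) (W *v y) = cdot x y"
  obtains l :: "'k \<Rightarrow> complex" where "\<And>i. cmod (l i) = 1" "\<And>z. det (mat z - W) = (\<Prod>i\<in>UNIV. z - l i)"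
    "\<And>z. vec.dim {x. W *v x = z *s x} = card {i. l i = z}"
proof -
  let ?E = "{x. \<exists>z. W *v x = z *s x}"
  obtain B where B: "B \<subseteq> ?E" "vec.independent B" "?E \<subseteq> vec.span B"
    using vec.maximal_independent_subset .
  have spB: "vec.span B = UNIV"
    using vec.span_mono[OF B(3)] unitary_span_eigenvectors[OF U] by (simp add: vec.span_span top_unique)
  have "card B = CARD('k)"
    using vec.dim_eq_card[OF _ B(2), of UNIV] spB unfolding vec_dim_card by simp
  moreover have fB: "finite B" by (rule vec.finiteI_independent[OF B(2)])
  ultimately obtain b where b: "bij_betw b (UNIV::'k set) B"
    using finite_same_card_bij[of "UNIV::'k set" B] by auto
  have bE: "b i \<in> ?E" for i using b B(1) by (auto simp: bij_betw_def)
  then have "\<forall>i. \<exists>z. W *v b i = z *s b i" by blast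
  then obtain l where l: "\<And>i. W *v b i = l i *s b i" by metis
  have b0: "b i \<noteq> 0" for i using b B(2) vec.dependent_zero[of B] by (auto simp: bij_betw_def)
  have l1: "cmod (l i) = 1" for i
  proof -
    have "l i * cnj (l i) * cdot (b i) (b i) = cdot (b i) (b i)"
      using U[of "b i" "b i"] by (simp add: l cdot_simps mult_ac)
    then have "l i * cnj (l i) = 1" using b0[of i] by (simp add: cdot_self_eq_0 mult.commute)
    then have "(cmod (l i))\<^sup>2 = 1" by (metis complex_norm_square of_real_1 of_real_eq_iff)
    then show ?thesis by (simp add: power2_eq_1_iff) (use norm_ge_zero[of "l i"] in linarith)
  qed
  define V :: "complex ^ 'k ^ 'k" where "V = (\<chi> j i. b i $ j)"
  define L :: "complex ^ 'k ^ 'k" where "L = (\<chi> i j. if i = j then l i else 0)"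
  have Vx: "V *v x = (\<Sum>i\<in>UNIV. x $ i *s b i)" for x
    by (simp add: V_def vec_eq_iff matrix_vector_mult_def) (simp add: mult.commute)
  have Lx: "(L *v x) $ i = l i * x $ i" for x i
    by (simp add: L_def matrix_vector_mult_def if_zero_mult cong: if_cong)
  have WV: "W *v (V *v x) = V *v (L *v x)" for x
    by (simp only: Vx vec.sum vec.scale l Lx vec.scale_scale) (simp only: mult.commute)
  have inj: "x = 0" if "V *v x = 0" for x
  proof -
    have "(\<Sum>w\<in>B. x $ inv_into UNIV b w *s w) = (\<Sum>i\<in>UNIV. x $ i *s b i)"
      using b by (subst sum.reindex_bij_betw[OF b, symmetric]) (auto simp: bij_betw_def)
    then have "\<forall>w\<in>B. x $ inv_into UNIV b w = 0"
      using that B(2) fB by (auto simp: Vx vec.dependent_finite)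
    then have "x $ i = 0" for i using b by (auto simp: bij_betw_def)
    then show ?thesis by (simp add: vec_eq_iff)
  qed
  have inV: "invertible V"
    using inj by (auto simp: invertible_left_inverse matrix_left_invertible_ker)
  have detW: "det (mat z - W) = (\<Prod>i\<in>UNIV. z - l i)" for z
  proof -
    have "(mat z - W) ** V = V ** (mat z - L)"
      unfolding matrix_eq
      by (simp add: matrix_vector_mul_assoc[symmetric] matrix_vector_mult_diff_rdistrib matrix_vector_mult_mat WV vec.diff vec.scale)
    then have "det (mat z - W) * det V = det V * det (mat z - L)" by (metis det_mul)
    then have "det (mat z - W) = det (mat z - L)"
      using inV by (simp add: invertible_det_nz mult.commute)
    also have "\<dots> = (\<Prod>i\<in>UNIV. z - l i)"
      by (subst det_diagonal) (auto simp: L_def mat_def)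
    finally show ?thesis .
  qed
  have "vec.dim {x. W *v x = z *s x} = card {i. l i = z}" for z
  proof -
    have surj: "surj ((*v) V)" using inV by (simp add: invertible_right_inverse matrix_right_invertible_surjective)
    have "W *v (V *v x) = z *s (V *v x) \<longleftrightarrow> L *v x = z *s x" for x
    proof -
      have "W *v (V *v x) = z *s (V *v x) \<longleftrightarrow> V *v (L *v x - z *s x) = 0"
        by (simp add: WV vec.diff vec.scale)
      also have "\<dots> \<longleftrightarrow> L *v x - z *s x = 0" using inj[of "L *v x - z *s x"] by (metis vec.zero)
      finally show ?thesis by simp
    qed
    note lk = this
    have eq: "{x. W *v x = z *s x} = (*v) V ` {x. \<forall>i. i \<notin> {i. l i = z} \<longrightarrow> x $ i = 0}"
    proof (intro set_eqI iffI)
      fix y assume y: "y \<in> {x. W *v x = z *s x}"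
      obtain x where x: "y = V *v x" using surj by (metis surjD)
      then have "L *v x = z *s x" using y lk by simp
      then have "l i * x $ i = z * x $ i" for i by (metis Lx vector_smult_component)
      then show "y \<in> (*v) V ` {x. \<forall>i. i \<notin> {i. l i = z} \<longrightarrow> x $ i = 0}" using x by auto
    next
      fix y assume "y \<in> (*v) V ` {x. \<forall>i. i \<notin> {i. l i = z} \<longrightarrow> x $ i = 0}"
      then obtain x where x: "y = V *v x" "\<And>i. l i \<noteq> z \<Longrightarrow> x $ i = 0" by auto
      have "(L *v x) $ i = (z *s x) $ i" for i using x(2)[of i] by (cases "l i = z") (auto simp: Lx)
      then have "L *v x = z *s x" by (simp add: vec_eq_iff)
      then show "y \<in> {x. W *v x = z *s x}" using x lk by simp
    qed
    have injV: "inj ((*v) V)" using inj by (simp add: vec.inj_iff_eq_0)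
    have "vec.dim {x. W *v x = z *s x} = vec.dim {x::complex^'k. \<forall>i. i \<notin> {i. l i = z} \<longrightarrow> x $ i = 0}"
      unfolding eq by (rule vec.dim_image_eq) (auto intro: inj_on_subset[OF injV])
    then show ?thesis by (simp only: dim_substandard_cart)
  qed
  then show ?thesis using that l1 detW by blast
qed

section \<open>The Maslov-type index as a sum of angles\<close>

lemma vpair_simps [simp]:
  "vfst (vpair x y) = x" "vsnd (vpair x y) = y" "vpair (vfst z) (vsnd z) = z"
  by (auto simp: vfst_def vsnd_def vpair_def vec_eq_iff split: sum.split)

lemma vpair_eq_iff [simp]: "vpair x y = vpair x' y' \<longleftrightarrow> x = x' \<and> y = y'"
  by (metis vpair_simps(1,2))

lemma vpair_add: "vpair x y + vpair x' y' = vpair (x + x') (y + y')"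
  by (auto simp: vpair_def vec_eq_iff split: sum.split)

lemma vpair_scale: "c *s vpair x y = vpair (c *s x) (c *s y)"
  by (auto simp: vpair_def vec_eq_iff split: sum.split)

lemma vfst_vsnd_linear:
  "vfst (x + y) = vfst x + vfst y" "vsnd (x + y) = vsnd x + vsnd y"
  "vfst (c *s x) = c *s vfst x" "vsnd (c *s x) = c *s vsnd x"
  by (auto simp: vfst_def vsnd_def vec_eq_iff)

lemma sum_UNIV_plus: "(\<Sum>i\<in>UNIV. f i) = (\<Sum>i\<in>UNIV. f (Inl i)) + (\<Sum>i\<in>UNIV. f (Inr i))"
  for f :: "'a::finite + 'b::finite \<Rightarrow> 'c::comm_monoid_add"
  by (simp add: UNIV_Plus_UNIV[symmetric] sum.Plus del: UNIV_Plus_UNIV)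

lemma cdot_vpair: "cdot (vpair x y) (vpair x' y') = cdot x x' + cdot y y'"
  by (simp add: cdot_def sum_UNIV_plus vpair_def)

lemma J0_mult: "J0 *v (x :: 'r::ring_1 ^ ('n::finite + 'n)) = vpair (- vsnd x) (vfst x)"
proof (rule vec_eq_iff[THEN iffD2], rule allI)
  fix i :: "'n + 'n"
  show "(J0 *v x) $ i = vpair (- vsnd x) (vfst x) $ i"
    by (cases i) (auto simp: J0_def matrix_vector_mult_def vpair_def vfst_def vsnd_def sum_UNIV_plus
        if_zero_mult cong: if_cong)
qed

lemma J0_J0: "J0 *v (J0 *v x) = - (x :: 'r::ring_1 ^ ('n::finite + 'n))"
proof -
  have "- x = vpair (vfst (- x)) (vsnd (- x))" by simp
  also have "\<dots> = vpair (- vfst x) (- vsnd x)" by (auto simp: vfst_def vsnd_def vec_eq_iff vpair_def split: sum.split)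
  finally show ?thesis by (simp add: J0_mult)
qed

lemma cdot_J0: "cdot (J0 *v x) y = - cdot x (J0 *v y)"
proof -
  have "cdot (J0 *v x) (vpair (vfst y) (vsnd y)) = - cdot (vpair (vfst x) (vsnd x)) (J0 *v y)"
    unfolding J0_mult cdot_vpair by (simp add: cdot_simps)
  then show ?thesis by simp
qed

text \<open>The orthogonal projections onto the eigenspaces of \<open>\<i> J0\<close> for the eigenvalues \<open>1\<close> and \<open>- 1\<close>.\<close>

definition Pm :: "complex ^ ('n::finite + 'n) ^ ('n + 'n)" where
  "Pm = mat (1/2) + mat (\<i>/2) ** J0"

definition Qm :: "complex ^ ('n::finite + 'n) ^ ('n + 'n)" where
  "Qm = mat (1/2) - mat (\<i>/2) ** J0"

lemma Pm_mult: "Pm *v x = (1/2) *s x + (\<i>/2) *s (J0 *v x)"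
  by (simp add: Pm_def matrix_vector_mult_add_rdistrib matrix_vector_mult_mat matrix_vector_mul_assoc[symmetric])

lemma Qm_mult: "Qm *v x = (1/2) *s x - (\<i>/2) *s (J0 *v x)"
  by (simp add: Qm_def matrix_vector_mult_diff_rdistrib matrix_vector_mult_mat matrix_vector_mul_assoc[symmetric])

lemma PQ_sum: "Pm *v x + Qm *v x = x" "Qm *v x + Pm *v x = x"
  by (simp_all add: Pm_mult Qm_mult vec_eq_iff)

lemma PQ_proj [simp]:
  "Pm *v (Pm *v x) = Pm *v x" "Qm *v (Qm *v x) = Qm *v x" "Pm *v (Qm *v x) = 0" "Qm *v (Pm *v x) = 0"
  by (simp_all add: Pm_mult Qm_mult vec.add vec.diff vec.scale J0_J0 vec_eq_iff)

lemma iJ0: "\<i> *s (J0 *v x) = Pm *v x - Qm *v x"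
  by (simp add: Pm_mult Qm_mult vec_eq_iff)

lemma cdot_PQ:
  "cdot (Pm *v x) y = cdot x (Pm *v y)" "cdot (Qm *v x) y = cdot x (Qm *v y)"
  "cdot (Pm *v x) (Qm *v y) = 0" "cdot (Qm *v x) (Pm *v y) = 0"
proof -
  show 1: "cdot (Pm *v x) y = cdot x (Pm *v y)" "cdot (Qm *v x) y = cdot x (Qm *v y)" for x y
    by (simp_all add: Pm_mult Qm_mult cdot_simps cdot_J0)
  show "cdot (Pm *v x) (Qm *v y) = 0" "cdot (Qm *v x) (Pm *v y) = 0"
    by (simp_all add: 1 cdot_simps)
qed

text \<open>Multiplied by i, the skew form is an indefinite Hermitian form, positive on the range of
  \<open>Pm\<close> and negative on that of \<open>Qm\<close>; symplectic maps are its
  isometries.\<close>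

lemma comega0_PQ: "\<i> * comega0 x y = cdot (Pm *v x) (Pm *v y) - cdot (Qm *v x) (Qm *v y)"
proof -
  have "\<i> * comega0 x y = cdot (\<i> *s (J0 *v x)) (Pm *v y + Qm *v y)"
    by (simp add: comega0_def cdot_simps PQ_sum)
  then show ?thesis unfolding iJ0 by (simp add: cdot_simps cdot_PQ)
qed

section \<open>Symplectic maps and the exchange of inputs with outputs\<close>

definition csymplectic :: "complex ^ ('n::finite + 'n) ^ ('n + 'n) \<Rightarrow> bool" where
  "csymplectic A \<longleftrightarrow> (\<forall>x y. comega0 (A *v x) (A *v y) = comega0 x y)"

lemma csymplectic_PQ:
  assumes "csymplectic A"
  shows "cdot (Pm *v (A *v x)) (Pm *v (A *v y)) + cdot (Qm *v x) (Qm *v y)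
    = cdot (Qm *v (A *v x)) (Qm *v (A *v y)) + cdot (Pm *v x) (Pm *v y)"
proof -
  have "\<i> * comega0 (A *v x) (A *v y) = \<i> * comega0 x y" using assms by (simp add: csymplectic_def)
  then show ?thesis unfolding comega0_PQ by (simp add: algebra_simps)
qed

text \<open>If \<open>x\<close> is decomposed along \<open>Pm\<close> and \<open>Qm\<close>, the graph of \<open>A\<close> is the graph of the operator that sends
  \<open>Dm A x\<close> to \<open>Cm A x\<close>, up to the identification of the two definite subspaces with \<open>V\<close>.\<close>

definition Dm :: "complex ^ ('n::finite + 'n) ^ ('n + 'n) \<Rightarrow> complex ^ ('n + 'n) ^ ('n + 'n)" where
  "Dm A = Qm + Pm ** A"

definition Cm :: "complex ^ ('n::finite + 'n) ^ ('n + 'n) \<Rightarrow> complex ^ ('n + 'n) ^ ('n + 'n)" where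
  "Cm A = Pm + Qm ** A"

lemma Dm_mult: "Dm A *v x = Qm *v x + Pm *v (A *v x)"
  and Cm_mult: "Cm A *v x = Pm *v x + Qm *v (A *v x)"
  by (simp_all add: Dm_def Cm_def matrix_vector_mult_add_rdistrib matrix_vector_mul_assoc)

text \<open>Moving the negative terms to the other side turns invariance of an indefinite form into
  equality of two positive ones: \<open>Dm A *v x\<close> collects the \<open>Qm\<close> part of the
  input and the \<open>Pm\<close> part of the output, \<open>Cm A *v x\<close> the other two. This
  is the Potapov-Ginzburg transform; it makes \<open>Cm A\<close> after the inverse of
  \<open>Dm A\<close> unitary.\<close>

lemma cdot_Cm_Dm:
  assumes "csymplectic A"
  shows "cdot (Cm A *v x) (Cm A *v y) = cdot (Dm A *v x) (Dm A *v y)"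
  using csymplectic_PQ[OF assms, of x y] by (simp add: Dm_mult Cm_mult cdot_simps cdot_PQ(3,4) algebra_simps)

text \<open>A kernel vector has no \<open>Qm\<close> part; by the equality of norms
  \<open>Cm A\<close> kills it as well, so it has no \<open>Pm\<close> part.\<close>

lemma Dm_inj:
  assumes "csymplectic A" "Dm A *v x = 0"
  shows "x = 0"
proof -
  have D: "Qm *v (Dm A *v x) = Qm *v x" by (simp add: Dm_mult vec.add)
  have "cdot (Cm A *v x) (Cm A *v x) = 0" using assms(2) by (simp add: cdot_Cm_Dm[OF assms(1)] cdot_simps)
  then have C: "Cm A *v x = 0" by (simp add: cdot_self_eq_0)
  have "Pm *v (Cm A *v x) = Pm *v x" by (simp add: Cm_mult vec.add)
  then show ?thesis using C D assms(2) PQ_sum(1)[of x] by simp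
qed

lemma invertible_Dm: "csymplectic A \<Longrightarrow> invertible (Dm A)"
  using Dm_inj by (auto simp: invertible_left_inverse matrix_left_invertible_ker)

lemma Dm_surj:
  assumes "csymplectic A"
  obtains x where "Dm A *v x = v"
  using invertible_Dm[OF assms] by (metis invertible_right_inverse matrix_right_invertible_surjective surj_def)

lemma matrix_inv_left: "invertible A \<Longrightarrow> matrix_inv A ** A = mat 1"
  unfolding invertible_def matrix_inv_def by (metis (mono_tags, lifting) someI_ex)

lemma csymplectic_mat_1: "csymplectic (mat 1)"
  by (simp add: csymplectic_def)

section \<open>Eigenspaces of the doubled symplectic form\<close>

lemma form_op_eq:
  assumes "Vector_Spaces.linear (*s) (*s) g" "\<And>x y. \<Omega> x y = cdot (g x) y"
  shows "form_op \<Omega> *v x = g x"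
proof -
  have "form_op \<Omega> = matrix g"
    unfolding form_op_def
  proof (rule the_equality)
    show "\<forall>x y. \<Omega> x y = cdot (matrix g *v x) y" by (simp add: matrix_works[OF assms(1)] assms(2))
    fix J assume J: "\<forall>x y. \<Omega> x y = cdot (J *v x) y"
    show "J = matrix g"
      unfolding matrix_eq using J by (auto simp: matrix_works[OF assms(1)] assms(2) intro!: cdot_eqI)
  qed
  then show ?thesis by (simp add: matrix_works[OF assms(1)])
qed

lemma form_op_double: "form_op double_form *v z = vpair (- (J0 *v vfst z)) (J0 *v vsnd z)"
proof (rule form_op_eq)
  show "Vector_Spaces.linear (*s) (*s) (\<lambda>z. vpair (- (J0 *v vfst z)) (J0 *v vsnd z))"
    by unfold_locales (simp_all add: vec.scale_right_distrib vec.scale_left_distrib vfst_vsnd_linear vec.add vec.scale vpair_add vpair_scale)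
  fix x y :: "complex ^ (('a + 'a) + ('a + 'a))"
  have "cdot (vpair (- (J0 *v vfst x)) (J0 *v vsnd x)) y = cdot (vpair (- (J0 *v vfst x)) (J0 *v vsnd x)) (vpair (vfst y) (vsnd y))"
    by simp
  also have "\<dots> = double_form x y" unfolding cdot_vpair by (simp add: double_form_def comega0_def cdot_simps)
  finally show "double_form x y = cdot (vpair (- (J0 *v vfst x)) (J0 *v vsnd x)) y" by simp
qed

text \<open>Projecting the eigenvalue equation leaves only the eigenvalues 1 and - 1, so a condition
  on the sign of an eigenvalue selects one of the two projections.\<close>

lemma PQ_eigen:
  assumes "\<i> *s (J0 *v x) = c *s x"
  shows "c * c = 1 \<or> x = 0" "c \<noteq> 1 \<Longrightarrow> Pm *v x = 0" "c \<noteq> - 1 \<Longrightarrow> Qm *v x = 0"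
proof -
  have "Pm *v x - Qm *v x = c *s (Pm *v x + Qm *v x)" using assms by (simp add: iJ0 PQ_sum)
  then have "Pm *v (Pm *v x - Qm *v x) = Pm *v (c *s (Pm *v x + Qm *v x))"
    "Qm *v (Pm *v x - Qm *v x) = Qm *v (c *s (Pm *v x + Qm *v x))" by simp_all
  then have PQ: "Pm *v x = c *s (Pm *v x)" "- (Qm *v x) = c *s (Qm *v x)"
    by (simp_all add: vec.diff vec.add vec.scale)
  show P: "Pm *v x = 0" if "c \<noteq> 1" using PQ(1) that by (auto simp: vec_eq_iff)
  show Q: "Qm *v x = 0" if "c \<noteq> - 1"
  proof -
    have "(Qm *v x) $ i = 0" for i
    proof -
      have "(- (Qm *v x)) $ i = (c *s (Qm *v x)) $ i" using PQ(2) by simp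
      then have "- (Qm *v x) $ i = c * (Qm *v x) $ i" by simp
      moreover have "(c + 1) * (Qm *v x) $ i = c * (Qm *v x) $ i + (Qm *v x) $ i" by (simp add: distrib_right)
      ultimately have "(c + 1) * (Qm *v x) $ i = 0" by (metis add.left_inverse)
      then show ?thesis using that by (simp add: eq_neg_iff_add_eq_0)
    qed
    then show ?thesis by (simp add: vec_eq_iff)
  qed
  show "c * c = 1 \<or> x = 0" using P Q PQ_sum(1)[of x] by (cases "c = 1"; cases "c = -1") auto
qed

text \<open>The first copy of V carries the opposite form. The eigenvalue - 1 of the doubled
  operator therefore joins the \<open>Pm\<close> part of the first copy with the \<open>Qm\<close>
  part of the second, and the eigenvalue 1 joins the other two.\<close>

lemma X_plus_double: "X_plus (double_form :: complex ^ (('n::finite + 'n) + ('n + 'n)) \<Rightarrow> _)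
      = {vpair (Pm *v x) (Qm *v y) |x y. True}" (is "_ = ?R")
  and X_minus_double: "X_minus (double_form :: complex ^ (('n::finite + 'n) + ('n + 'n)) \<Rightarrow> _)
      = {vpair (Qm *v x) (Pm *v y) |x y. True}" (is "_ = ?L")
proof -
  have sub: "vec.subspace ?R" "vec.subspace ?L"
    unfolding vec.subspace_def by (auto simp: vpair_add vpair_scale simp flip: vec.add vec.scale)
      (rule exI[of _ 0], rule exI[of _ 0], simp add: vpair_def vec_eq_iff vec.zero split: sum.split)+
  have zero: "Pm *v x = x" if "Qm *v x = 0" for x :: "complex ^ ('n + 'n)" using PQ_sum(1)[of x] that by simp
  have zero': "Qm *v x = x" if "Pm *v x = 0" for x :: "complex ^ ('n + 'n)" using PQ_sum(1)[of x] that by simp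
  have dec: "\<i> *s (form_op double_form *v z) = complex_of_real r *s z \<longleftrightarrow>
    \<i> *s (J0 *v vfst z) = complex_of_real (- r) *s vfst z \<and> \<i> *s (J0 *v vsnd z) = complex_of_real r *s vsnd z"
    for r and z :: "complex ^ (('n + 'n) + ('n + 'n))"
  proof -
    have "\<i> *s (form_op double_form *v z) = complex_of_real r *s z \<longleftrightarrow>
      vpair (- (\<i> *s (J0 *v vfst z))) (\<i> *s (J0 *v vsnd z)) = vpair (complex_of_real r *s vfst z) (complex_of_real r *s vsnd z)"
      by (simp only: form_op_double vpair_scale vec.scale_minus_right vpair_simps(3)) (simp add: vpair_scale[symmetric])
    also have "\<dots> \<longleftrightarrow> \<i> *s (J0 *v vfst z) = complex_of_real (- r) *s vfst z \<and> \<i> *s (J0 *v vsnd z) = complex_of_real r *s vsnd z"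
    proof -
      have neg: "- a = b \<longleftrightarrow> a = - b" for a b :: "complex ^ ('n + 'n)" by (metis minus_minus)
      show ?thesis unfolding vpair_eq_iff neg of_real_minus vec.scale_minus_left ..
    qed
    finally show ?thesis .
  qed
  have *: "\<i> *s (J0 *v (Pm *v x)) = Pm *v x" "\<i> *s (J0 *v (Qm *v x)) = - (Qm *v x)" for x :: "complex ^ ('n + 'n)"
    by (simp_all add: iJ0)
  have "{x. \<exists>r<0. \<i> *s (form_op double_form *v x) = complex_of_real r *s x} = ?R"
  proof (intro set_eqI iffI)
    fix z :: "complex ^ (('n + 'n) + ('n + 'n))"
    assume "z \<in> {x. \<exists>r<0. \<i> *s (form_op double_form *v x) = complex_of_real r *s x}"
    then obtain r where r: "r < 0" "\<i> *s (J0 *v vfst z) = complex_of_real (- r) *s vfst z"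
      "\<i> *s (J0 *v vsnd z) = complex_of_real r *s vsnd z" by (auto simp: dec)
    have "complex_of_real (- r) \<noteq> - 1" "complex_of_real r \<noteq> 1"
      using r(1) by (auto simp: complex_eq_iff)
    then have "Pm *v vfst z = vfst z" "Qm *v vsnd z = vsnd z"
      using PQ_eigen(3)[OF r(2)] PQ_eigen(2)[OF r(3)] zero zero' by auto
    then have "z = vpair (Pm *v vfst z) (Qm *v vsnd z)" by simp
    then show "z \<in> ?R" by blast
  next
    fix z assume "z \<in> ?R"
    then obtain x y where z: "z = vpair (Pm *v x) (Qm *v y)" by auto
    have "\<i> *s (form_op double_form *v z) = complex_of_real (- 1) *s z"
      unfolding dec by (simp add: z *)
    then show "z \<in> {x. \<exists>r<0. \<i> *s (form_op double_form *v x) = complex_of_real r *s x}"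
      by (intro CollectI exI[of _ "- 1"]) simp
  qed
  then show "X_plus double_form = ?R" unfolding X_plus_def using sub(1) by simp
  have "{x. \<exists>r>0. \<i> *s (form_op double_form *v x) = complex_of_real r *s x} = ?L"
  proof (intro set_eqI iffI)
    fix z :: "complex ^ (('n + 'n) + ('n + 'n))"
    assume "z \<in> {x. \<exists>r>0. \<i> *s (form_op double_form *v x) = complex_of_real r *s x}"
    then obtain r where r: "r > 0" "\<i> *s (J0 *v vfst z) = complex_of_real (- r) *s vfst z"
      "\<i> *s (J0 *v vsnd z) = complex_of_real r *s vsnd z" by (auto simp: dec)
    have "complex_of_real (- r) \<noteq> 1" "complex_of_real r \<noteq> - 1"
      using r(1) by (auto simp: complex_eq_iff)
    then have "Qm *v vfst z = vfst z" "Pm *v vsnd z = vsnd z"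
      using PQ_eigen(2)[OF r(2)] PQ_eigen(3)[OF r(3)] zero zero' by auto
    then have "z = vpair (Qm *v vfst z) (Pm *v vsnd z)" by simp
    then show "z \<in> ?L" by blast
  next
    fix z assume "z \<in> ?L"
    then obtain x y where z: "z = vpair (Qm *v x) (Pm *v y)" by auto
    have "\<i> *s (form_op double_form *v z) = complex_of_real 1 *s z"
      unfolding dec by (simp add: z *)
    then show "z \<in> {x. \<exists>r>0. \<i> *s (form_op double_form *v x) = complex_of_real r *s x}"
      by (intro CollectI exI[of _ 1]) simp
  qed
  then show "X_minus double_form = ?L" unfolding X_minus_def using sub(2) by simp
qed

text \<open>A point \<open>vpair x (A *v x)\<close> of the graph splits into a part in
  \<open>X_minus\<close>, made of the two components of \<open>Dm A *v x\<close>, and a part in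
  \<open>X_plus\<close>, made of those of \<open>Cm A *v x\<close>. Uniqueness is the injectivity of
  \<open>Dm A\<close>.\<close>

lemma lag_op_Gr:
  assumes A: "csymplectic A"
  shows "lag_op double_form (Gr A) (vpair (Qm *v (Dm A *v x)) (Pm *v (Dm A *v x)))
    = vpair (Pm *v x) (Qm *v (A *v x))"
  unfolding lag_op_def
proof (rule the_equality)
  have D: "Qm *v (Dm A *v x) = Qm *v x" "Pm *v (Dm A *v x) = Pm *v (A *v x)"
    by (simp_all add: Dm_mult vec.add)
  show "vpair (Pm *v x) (Qm *v (A *v x)) \<in> X_plus double_form \<and>
      vpair (Qm *v (Dm A *v x)) (Pm *v (Dm A *v x)) + vpair (Pm *v x) (Qm *v (A *v x)) \<in> Gr A"
    by (auto simp: X_plus_double D vpair_add PQ_sum Gr_def)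
  fix y assume y: "y \<in> X_plus double_form \<and> vpair (Qm *v (Dm A *v x)) (Pm *v (Dm A *v x)) + y \<in> Gr A"
  then obtain p q x' where pq: "y = vpair (Pm *v p) (Qm *v q)"
    "vpair (Qm *v x + Pm *v p) (Pm *v (A *v x) + Qm *v q) = vpair x' (A *v x')"
    by (auto simp: X_plus_double vpair_add Gr_def D)
  then have x': "x' = Qm *v x + Pm *v p" "A *v x' = Pm *v (A *v x) + Qm *v q" by auto
  have "Dm A *v x' = Dm A *v x"
    unfolding Dm_mult x'(2) by (simp add: x'(1) vec.add)
  then have "Dm A *v (x' - x) = 0" by (simp add: vec.diff)
  then have "x' = x" using Dm_inj[OF A] by force
  moreover have "Pm *v x' = Pm *v p" "Qm *v (A *v x') = Qm *v q"
    unfolding x'(2) by (simp_all add: x'(1) vec.add)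
  ultimately show "y = vpair (Pm *v x) (Qm *v (A *v x))" by (simp add: pq)
qed

text \<open>\<open>Dm (mat 1)\<close> is the identity, so the operator of the diagonal merely
  exchanges the two entries of a pair of projections. Dividing by it identifies
  \<open>X_minus\<close> with \<open>X_plus\<close>, and what remains is the operator that sends
  \<open>Dm A *v x\<close> to \<open>Cm A *v x\<close>.\<close>

lemma lag_quot_Gr:
  fixes A :: "complex ^ ('n::finite + 'n) ^ ('n + 'n)"
  assumes A: "csymplectic A"
  shows "lag_quot double_form (Gr A) (Gr (mat 1)) (vpair (Pm *v (Dm A *v x)) (Qm *v (Dm A *v x)))
    = vpair (Pm *v x) (Qm *v (A *v x))"
proof -
  have D1: "Dm (mat 1) *v v = v" for v :: "complex ^ ('n + 'n)" by (simp add: Dm_mult PQ_sum)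
  have op1: "lag_op double_form (Gr (mat 1)) (vpair (Qm *v v) (Pm *v v)) = vpair (Pm *v v) (Qm *v v)"
    for v :: "complex ^ ('n + 'n)"
    using lag_op_Gr[OF csymplectic_mat_1, of v] by (simp add: D1)
  have Xm: "z \<in> X_minus double_form \<longleftrightarrow> (\<exists>v. z = vpair (Qm *v v) (Pm *v v))" for z :: "complex ^ (('n + 'n) + ('n + 'n))"
  proof
    assume "z \<in> X_minus double_form"
    then obtain x y where "z = vpair (Qm *v x) (Pm *v y)" by (auto simp: X_minus_double)
    then show "\<exists>v. z = vpair (Qm *v v) (Pm *v v)"
      by (intro exI[of _ "Qm *v x + Pm *v y"]) (simp add: vec.add)
  qed (auto simp: X_minus_double)
  have "inj_on (lag_op double_form (Gr (mat 1))) (X_minus (double_form :: complex ^ (('n + 'n) + ('n + 'n)) \<Rightarrow> _))"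
  proof (rule inj_onI)
    fix y z :: "complex ^ (('n + 'n) + ('n + 'n))"
    assume "y \<in> X_minus double_form" "z \<in> X_minus double_form"
      and eq: "lag_op double_form (Gr (mat 1)) y = lag_op double_form (Gr (mat 1)) z"
    then obtain v w where "y = vpair (Qm *v v) (Pm *v v)" "z = vpair (Qm *v w) (Pm *v w)" by (auto simp: Xm)
    then show "y = z" using eq by (simp add: op1)
  qed
  then have inv: "inv_into (X_minus double_form) (lag_op double_form (Gr (mat 1))) (vpair (Pm *v v) (Qm *v v))
      = vpair (Qm *v v) (Pm *v v)" for v :: "complex ^ ('n + 'n)"
    by (rule inv_into_f_eq) (auto simp: Xm op1)
  show ?thesis unfolding lag_quot_def inv by (rule lag_op_Gr[OF A])
qed

text \<open>The map \<open>h\<close> is an isomorphism of V onto \<open>X_plus\<close>. Since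
  \<open>Dm A\<close> is onto, knowing the quotient on the vectors \<open>h (Dm A *v x)\<close> is
  enough to carry it over to a matrix on V.\<close>

lemma dim_lag_quot_eigenspace:
  fixes A :: "complex ^ ('n::finite + 'n) ^ ('n + 'n)"
  assumes A: "csymplectic A"
  shows "vec.dim {y \<in> X_plus double_form. lag_quot double_form (Gr A) (Gr (mat 1)) y = z *s y}
    = vec.dim {x. (Cm A ** matrix_inv (Dm A)) *v x = z *s x}" (is "vec.dim ?Y = vec.dim ?X")
proof -
  define h :: "complex ^ ('n + 'n) \<Rightarrow> complex ^ (('n + 'n) + ('n + 'n))" where "h v = vpair (Pm *v v) (Qm *v v)" for v
  have lin: "Vector_Spaces.linear (*s) (*s) h"
    unfolding h_def
    by unfold_locales (simp_all add: vec.scale_right_distrib vec.scale_left_distrib vec.add vec.scale vpair_add vpair_scale)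
  have inj: "inj h"
    by (rule injI) (metis PQ_sum(1) h_def vpair_eq_iff)
  have W: "(Cm A ** matrix_inv (Dm A)) *v (Dm A *v x) = Cm A *v x" for x
    using matrix_inv_left[OF invertible_Dm[OF A]]
    by (simp add: matrix_vector_mul_assoc matrix_mul_assoc[symmetric])
  have "h ` ?X = ?Y"
  proof (rule set_eqI)
    fix y
    have "y \<in> X_plus double_form \<longleftrightarrow> (\<exists>x. y = h (Dm A *v x))"
    proof
      assume "y \<in> X_plus double_form"
      then obtain p q where pq: "y = vpair (Pm *v p) (Qm *v q)" by (auto simp: X_plus_double)
      obtain x where "Dm A *v x = Pm *v p + Qm *v q" using Dm_surj[OF A] .
      then show "\<exists>x. y = h (Dm A *v x)" using pq by (intro exI[of _ x]) (simp add: h_def vec.add)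
    qed (auto simp: h_def X_plus_double)
    note Xp = this
    have lq: "lag_quot double_form (Gr A) (Gr (mat 1)) (h (Dm A *v x)) = z *s h (Dm A *v x)
        \<longleftrightarrow> Dm A *v x \<in> ?X" for x
    proof -
      have "lag_quot double_form (Gr A) (Gr (mat 1)) (h (Dm A *v x)) = h (Cm A *v x)"
        unfolding h_def lag_quot_Gr[OF A] by (simp add: Cm_mult vec.add)
      moreover have "z *s h (Dm A *v x) = h (z *s (Dm A *v x))"
        by (simp add: h_def vpair_scale vec.scale)
      ultimately show ?thesis using inj by (auto simp: W inj_eq)
    qed
    show "y \<in> h ` ?X \<longleftrightarrow> y \<in> ?Y"
    proof
      assume "y \<in> h ` ?X"
      then obtain v where v: "v \<in> ?X" "y = h v" by blast
      obtain x where "Dm A *v x = v" using Dm_surj[OF A] .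
      then have "y = h (Dm A *v x)" "Dm A *v x \<in> ?X" using v by simp_all
      then show "y \<in> ?Y" using lq[of x] Xp by blast
    next
      assume y: "y \<in> ?Y"
      then obtain x where x: "y = h (Dm A *v x)" using Xp by blast
      then have "Dm A *v x \<in> ?X" using lq[of x] y by blast
      then show "y \<in> h ` ?X" using x by blast
    qed
  qed
  moreover have "vec.dim (h ` ?X) = vec.dim ?X"
    by (rule vec.dim_image_eq[OF lin]) (rule inj_on_subset[OF inj subset_UNIV])
  ultimately show ?thesis by simp
qed

text \<open>The characteristic polynomial of the unitary operator attached to \<open>A\<close>.\<close>

definition char_lag :: "complex ^ ('n::finite + 'n) ^ ('n + 'n) \<Rightarrow> complex \<Rightarrow> complex" where
  "char_lag A z = det (mat z ** Dm A - Cm A) / det (Dm A)"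

lemma char_lag_eigenvalues:
  assumes A: "csymplectic (A :: complex ^ ('n::finite + 'n) ^ ('n + 'n))"
  obtains a :: "nat \<Rightarrow> real" where
    "\<And>z. char_lag A z = (\<Prod>j<CARD('n + 'n). z - cis (a j))"
    "\<And>z. vec.dim {y \<in> X_plus double_form. lag_quot double_form (Gr A) (Gr (mat 1)) y = z *s y}
      = card {j\<in>{..<CARD('n + 'n)}. cis (a j) = z}"
    "det (Cm A) / det (Dm A) = (\<Prod>j<CARD('n + 'n). cis (a j))"
proof -
  define W where "W = Cm A ** matrix_inv (Dm A)"
  note inv = invertible_Dm[OF A]
  have WD: "W ** Dm A = Cm A"
    unfolding W_def by (simp add: matrix_mul_assoc[symmetric] matrix_inv_left[OF inv])
  have U: "cdot (W *v x) (W *v y) = cdot x y" for x y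
  proof -
    obtain x' where x: "Dm A *v x' = x" using Dm_surj[OF A] .
    obtain y' where y: "Dm A *v y' = y" using Dm_surj[OF A] .
    have "W *v x = Cm A *v x'" "W *v y = Cm A *v y'" by (simp_all add: matrix_vector_mul_assoc WD flip: x y)
    then show ?thesis using cdot_Cm_Dm[OF A, of x' y'] by (simp add: x y)
  qed
  obtain l :: "'n + 'n \<Rightarrow> complex" where l: "\<And>i. cmod (l i) = 1" "\<And>z. det (mat z - W) = (\<Prod>i\<in>UNIV. z - l i)"
    "\<And>z. vec.dim {x. W *v x = z *s x} = card {i. l i = z}" using unitary_diagonalization[OF U] by blast
  obtain e where e: "bij_betw e {..<CARD('n + 'n)} (UNIV :: ('n + 'n) set)"
    using ex_bij_betw_nat_finite[of "UNIV :: ('n + 'n) set"] by (auto simp: atLeast0LessThan)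
  define a where "a j = Arg (l (e j))" for j
  have ca: "cis (a j) = l (e j)" for j
  proof -
    have "l (e j) \<noteq> 0" using l(1)[of "e j"] by auto
    then show ?thesis using l(1)[of "e j"] by (simp add: a_def cis_Arg sgn_eq)
  qed
  have d0: "det (Dm A) \<noteq> 0" using inv by (simp add: invertible_det_nz)
  show ?thesis
  proof (rule that[of a])
    fix z
    have "mat z ** Dm A - Cm A = (mat z - W) ** Dm A"
      unfolding matrix_eq WD[symmetric]
      by (simp add: matrix_vector_mul_assoc[symmetric] matrix_vector_mult_diff_rdistrib matrix_vector_mult_mat)
    then show "char_lag A z = (\<Prod>j<CARD('n + 'n). z - cis (a j))"
      unfolding ca prod.reindex_bij_betw[OF e, of "\<lambda>i. z - l i"] using d0 by (simp add: char_lag_def det_mul l(2))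
    have "bij_betw e {j\<in>{..<CARD('n + 'n)}. cis (a j) = z} {i. l i = z}"
      using e by (auto simp: ca bij_betw_def inj_on_def)
    then show "vec.dim {y \<in> X_plus double_form. lag_quot double_form (Gr A) (Gr (mat 1)) y = z *s y}
      = card {j\<in>{..<CARD('n + 'n)}. cis (a j) = z}"
      unfolding dim_lag_quot_eigenspace[OF A] W_def[symmetric] l(3) by (metis bij_betw_same_card)
  next
    \<comment> \<open>The dimension is even, so W and its negative have the same
      determinant.\<close>
    have ev: "even CARD('n + 'n)" by simp
    have "mat 0 - W = mat (- 1) ** W"
      unfolding matrix_eq matrix_vector_mul_assoc[symmetric] matrix_vector_mult_diff_rdistrib matrix_vector_mult_mat
      by simp
    moreover have "det (mat (- 1) :: complex ^ ('n + 'n) ^ ('n + 'n)) = 1"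
      by (subst det_diagonal) (auto simp: mat_def)
    ultimately have "det (mat 0 - W) = det W" by (simp add: det_mul)
    then have "det W = (\<Prod>i\<in>UNIV. l i)" using l(2)[of 0] ev by (simp add: prod_uminus)
    moreover have "det (Cm A) = det W * det (Dm A)" by (simp flip: WD add: det_mul)
    ultimately show "det (Cm A) / det (Dm A) = (\<Prod>j<CARD('n + 'n). cis (a j))"
      unfolding ca prod.reindex_bij_betw[OF e] using d0 by simp
  qed
qed

text \<open>The difference of two lifts takes values in the multiples of 2 pi, a discrete set, hence
  is constant on a connected one.\<close>

lemma cis_lift_unique:
  fixes f g :: "'a::topological_space \<Rightarrow> real"
  assumes S: "connected S" and f: "continuous_on S f" and g: "continuous_on S g"
    and eq: "\<And>x. x \<in> S \<Longrightarrow> cis (f x) = cis (g x)" and ab: "a \<in> S" "b \<in> S"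
  shows "f b - f a = g b - g a"
proof -
  have k: "\<exists>k::int. f x - g x = 2 * pi * of_int k" if x: "x \<in> S" for x
  proof -
    from eq[OF x] obtain k :: int where "f x = g x + 2 * pi * of_int k" by (rule cis_eqD)
    then show ?thesis by auto
  qed
  have "(\<lambda>x. f x - g x) constant_on S"
  proof (rule continuous_discrete_range_constant[OF S])
    show "continuous_on S (\<lambda>x. f x - g x)" using f g by (intro continuous_intros)
    fix x assume x: "x \<in> S"
    have "2 * pi \<le> norm (f y - g y - (f x - g x))" if y: "y \<in> S" "f y - g y \<noteq> f x - g x" for y
    proof -
      obtain k l :: int where kl: "f x - g x = 2 * pi * of_int k" "f y - g y = 2 * pi * of_int l"
        using k[OF x] k[OF y(1)] by blast
      then have "l \<noteq> k" using y by auto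
      then have "1 \<le> \<bar>l - k\<bar>" by linarith
      then have "1 \<le> \<bar>of_int (l - k) :: real\<bar>" by linarith
      then have "2 * pi * 1 \<le> 2 * pi * \<bar>of_int (l - k)\<bar>" by (intro mult_left_mono) auto
      also have "\<dots> = \<bar>2 * pi * of_int l - 2 * pi * of_int k\<bar>" by (simp add: abs_mult flip: right_diff_distrib)
      finally show ?thesis unfolding kl by simp
    qed
    then show "\<exists>e>0. \<forall>y. y \<in> S \<and> f y - g y \<noteq> f x - g x \<longrightarrow> e \<le> norm (f y - g y - (f x - g x))"
      by (intro exI[of _ "2 * pi"]) auto
  qed
  then have "f b - g b = f a - g a" using ab by (auto simp: constant_on_def)
  then show ?thesis by linarith
qed

lemma card_eq_of_image_mset_eq:
  assumes "finite I" "finite K" "image_mset f (mset_set I) = image_mset g (mset_set K)"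
  shows "card {j\<in>I. f j = z} = card {j\<in>K. g j = z}"
proof -
  have "f -` {z} \<inter> I = {j\<in>I. f j = z}" "g -` {z} \<inter> K = {j\<in>K. g j = z}" by auto
  then show ?thesis using arg_cong[OF assms(3), of "\<lambda>M. count M z"] assms(1,2) by (simp add: count_image_mset)
qed

text \<open>Each ceiling is its angle plus a defect. The defects at the two ends depend only on the
  eigenvalues there, and the sum of the angles lifts their product, so its increment is unique. The
  index is thus well defined although the angles of the two families are not matched one by
  one.\<close>

lemma sum_ceiling_angles:
  fixes x y :: "nat \<Rightarrow> real \<Rightarrow> real"
  assumes ab: "a \<le> b" and c: "\<And>j. j < N \<Longrightarrow> continuous_on {a..b} (x j)" "\<And>j. j < N \<Longrightarrow> continuous_on {a..b} (y j)"
    and m: "\<And>s. s \<in> {a..b} \<Longrightarrow> image_mset (\<lambda>j. cis (x j s)) (mset_set {..<N}) = image_mset (\<lambda>j. cis (y j s)) (mset_set {..<N})"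
  shows "(\<Sum>j<N. \<lceil>x j b / (2 * pi)\<rceil> - \<lceil>x j a / (2 * pi)\<rceil>) = (\<Sum>j<N. \<lceil>y j b / (2 * pi)\<rceil> - \<lceil>y j a / (2 * pi)\<rceil>)"
proof -
  have "(\<Sum>j<N. x j b) - (\<Sum>j<N. x j a) = (\<Sum>j<N. y j b) - (\<Sum>j<N. y j a)"
  proof (rule cis_lift_unique[of "{a..b}"])
    fix s assume "s \<in> {a..b}"
    from prod_image_mset_cong[OF m[OF this], of id]
    show "cis (\<Sum>j<N. x j s) = cis (\<Sum>j<N. y j s)" by (simp add: cis_conv_exp exp_sum sum_distrib_left)
  qed (use ab c in \<open>auto intro!: continuous_intros\<close>)
  then have S: "(\<Sum>j<N. x j b) / (2 * pi) - (\<Sum>j<N. x j a) / (2 * pi) = (\<Sum>j<N. y j b) / (2 * pi) - (\<Sum>j<N. y j a) / (2 * pi)"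
    by (simp only: diff_divide_distrib[symmetric])
  have E: "(\<Sum>j<N. of_int \<lceil>z j s / (2 * pi)\<rceil> - z j s / (2 * pi))
      = real_of_int (\<Sum>j<N. \<lceil>z j s / (2 * pi)\<rceil>) - (\<Sum>j<N. z j s) / (2 * pi)" for z :: "nat \<Rightarrow> real \<Rightarrow> real" and s
    by (simp add: sum_subtractf sum_divide_distrib)
  have D: "(\<Sum>j<N. of_int \<lceil>x j s / (2 * pi)\<rceil> - x j s / (2 * pi)) = (\<Sum>j<N. of_int \<lceil>y j s / (2 * pi)\<rceil> - y j s / (2 * pi))"
    if "s \<in> {a..b}" for s
    by (rule sum_angle_cong[OF m[OF that]]) (rule ceiling_angle_defect_cong)
  have "a \<in> {a..b}" "b \<in> {a..b}" using ab by auto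
  note D[OF this(1), unfolded E] D[OF this(2), unfolded E]
  then have "real_of_int ((\<Sum>j<N. \<lceil>x j b / (2 * pi)\<rceil>) - (\<Sum>j<N. \<lceil>x j a / (2 * pi)\<rceil>))
    = real_of_int ((\<Sum>j<N. \<lceil>y j b / (2 * pi)\<rceil>) - (\<Sum>j<N. \<lceil>y j a / (2 * pi)\<rceil>))"
    using S unfolding of_int_diff by linarith
  then show ?thesis unfolding of_int_eq_iff sum_subtractf .
qed

text \<open>This trades the definite description in \<open>Mas\<close> for a formula in any
  continuous angles of \<open>char_lag\<close>: such angles are an admissible lift, and all lifts
  give the same integer.\<close>

lemma i1_eq_sum_ceiling:
  fixes \<gamma> :: "real \<Rightarrow> complex ^ ('n::finite + 'n) ^ ('n + 'n)"
  assumes ab: "a \<le> b" and \<gamma>: "\<And>s. s \<in> {a..b} \<Longrightarrow> csymplectic (\<gamma> s)"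
    and x: "\<And>j. continuous_on {a..b} (x j)"
    and ch: "\<And>s z. s \<in> {a..b} \<Longrightarrow> char_lag (\<gamma> s) z = (\<Prod>j<CARD('n + 'n). z - cis (x j s))"
  shows "i1 \<gamma> a b = (\<Sum>j<CARD('n + 'n). \<lceil>x j b / (2 * pi)\<rceil> - \<lceil>x j a / (2 * pi)\<rceil>)"
proof -
  have N: "CARD(('n + 'n) + ('n + 'n)) div 2 = CARD('n + 'n)" by simp
  let ?L = "angle_lift (double_form :: complex ^ (('n + 'n) + ('n + 'n)) \<Rightarrow> _) (\<lambda>s. Gr (\<gamma> s)) (\<lambda>_. Gr (mat 1)) a b"
  have L: "?L \<theta> \<longleftrightarrow> (\<forall>j<CARD('n + 'n). continuous_on {a..b} (\<theta> j)) \<and> (\<forall>s\<in>{a..b}. \<forall>z.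
      card {j\<in>{..<CARD('n + 'n)}. cis (\<theta> j s) = z} = card {j\<in>{..<CARD('n + 'n)}. cis (x j s) = z})" for \<theta>
  proof -
    have "vec.dim {y \<in> X_plus double_form. lag_quot double_form (Gr (\<gamma> s)) (Gr (mat 1)) y = z *s y}
      = card {j\<in>{..<CARD('n + 'n)}. cis (x j s) = z}" if s: "s \<in> {a..b}" for s z
    proof -
      obtain e :: "nat \<Rightarrow> real" where e: "\<And>z. char_lag (\<gamma> s) z = (\<Prod>j<CARD('n + 'n). z - cis (e j))"
        "\<And>z. vec.dim {y \<in> X_plus double_form. lag_quot double_form (Gr (\<gamma> s)) (Gr (mat 1)) y = z *s y}
          = card {j\<in>{..<CARD('n + 'n)}. cis (e j) = z}"
        by (rule char_lag_eigenvalues[OF \<gamma>[OF s]]) (rule that)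
      have "image_mset (\<lambda>j. cis (e j)) (mset_set {..<CARD('n + 'n)}) = image_mset (\<lambda>j. cis (x j s)) (mset_set {..<CARD('n + 'n)})"
        by (rule image_mset_eq_of_prod_linear) (simp_all only: finite_lessThan e(1)[symmetric] ch[OF s, symmetric])
      then show ?thesis unfolding e(2) by (intro card_eq_of_image_mset_eq) auto
    qed
    then show ?thesis unfolding angle_lift_def N by (simp add: lessThan_def)
  qed
  show ?thesis
    unfolding i1_def Mas_def N
  proof (rule the_equality)
    show "\<exists>\<theta>. ?L \<theta> \<and> (\<Sum>j<CARD('n + 'n). \<lceil>x j b / (2 * pi)\<rceil> - \<lceil>x j a / (2 * pi)\<rceil>)
        = (\<Sum>j<CARD('n + 'n). \<lceil>\<theta> j b / (2 * pi)\<rceil> - \<lceil>\<theta> j a / (2 * pi)\<rceil>)"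
      using x by (intro exI[of _ x]) (simp add: L)
    fix m assume "\<exists>\<theta>. ?L \<theta> \<and> m = (\<Sum>j<CARD('n + 'n). \<lceil>\<theta> j b / (2 * pi)\<rceil> - \<lceil>\<theta> j a / (2 * pi)\<rceil>)"
    then obtain \<theta> where \<theta>: "?L \<theta>" "m = (\<Sum>j<CARD('n + 'n). \<lceil>\<theta> j b / (2 * pi)\<rceil> - \<lceil>\<theta> j a / (2 * pi)\<rceil>)" by blast
    show "m = (\<Sum>j<CARD('n + 'n). \<lceil>x j b / (2 * pi)\<rceil> - \<lceil>x j a / (2 * pi)\<rceil>)"
      unfolding \<theta>(2)
    proof (rule sum_ceiling_angles[OF ab])
      fix s assume "s \<in> {a..b}"
      then show "image_mset (\<lambda>j. cis (\<theta> j s)) (mset_set {..<CARD('n + 'n)}) = image_mset (\<lambda>j. cis (x j s)) (mset_set {..<CARD('n + 'n)})"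
        using \<theta>(1) unfolding L by (intro image_mset_eqI) auto
    qed (use \<theta>(1) x in \<open>auto simp: L\<close>)
  qed
qed

section \<open>Real symplectic matrices\<close>

definition rsymplectic :: "real ^ ('n::finite + 'n) ^ ('n + 'n) \<Rightarrow> bool" where
  "rsymplectic A \<longleftrightarrow> (\<forall>x y. omega0 (A *v x) (A *v y) = omega0 x y)"

abbreviation cmat :: "real ^ 'm ^ 'k \<Rightarrow> complex ^ 'm ^ 'k" where
  "cmat \<equiv> map_matrix complex_of_real"

lemma cmat_mult: "cmat (A ** B) = cmat A ** cmat (B :: real ^ 'm ^ 'l::finite)"
  by (simp add: vec_eq_iff matrix_matrix_mult_def)

lemma cmat_J0: "cmat J0 = J0"
  by (auto simp: vec_eq_iff J0_def split: sum.split)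

lemma cmat_mat_1: "cmat (mat 1) = mat 1"
  by (simp add: vec_eq_iff mat_def)

lemma rsymplectic_iff: "rsymplectic A \<longleftrightarrow> transpose A ** J0 ** A = J0"
proof -
  have "omega0 (A *v x) (A *v y) = ((transpose A ** J0 ** A) *v x) \<bullet> y" for x y
    by (simp add: omega0_def matrix_vector_mul_assoc[symmetric] dot_lmul_matrix[symmetric])
  then show ?thesis
    unfolding rsymplectic_def omega0_def matrix_eq by (metis vector_eq_rdot)
qed

lemma cdot_cmat: "cdot x (cmat A *v y) = cdot (cmat (transpose A) *v x) y"
proof -
  have "cdot x (cmat A *v y) = (\<Sum>i\<in>UNIV. \<Sum>j\<in>UNIV. x $ i * of_real (A $ i $ j) * cnj (y $ j))"
    by (simp add: cdot_def matrix_vector_mult_def sum_distrib_left mult.assoc)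
  also have "\<dots> = (\<Sum>j\<in>UNIV. \<Sum>i\<in>UNIV. x $ i * of_real (A $ i $ j) * cnj (y $ j))"
    by (rule sum.swap)
  also have "\<dots> = cdot (cmat (transpose A) *v x) y"
    by (simp add: cdot_def matrix_vector_mult_def sum_distrib_left sum_distrib_right transpose_def mult_ac)
  finally show ?thesis .
qed

lemma csymplectic_cmat:
  assumes "rsymplectic A" shows "csymplectic (cmat A)"
proof -
  have "comega0 (cmat A *v x) (cmat A *v y) = comega0 x y" for x y
  proof -
    have "comega0 (cmat A *v x) (cmat A *v y) = cdot (cmat (transpose A ** J0 ** A) *v x) y"
      by (simp add: comega0_def cdot_cmat cmat_mult cmat_J0 matrix_vector_mul_assoc matrix_mul_assoc)
    then show ?thesis using assms by (simp add: rsymplectic_iff cmat_J0 comega0_def)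
  qed
  then show ?thesis by (simp add: csymplectic_def)
qed

lemma det_map_cnj: "det (map_matrix cnj A) = cnj (det A)"
  by (simp add: det_def)

lemma map_cnj_mult: "map_matrix cnj (A ** B) = map_matrix cnj A ** map_matrix cnj (B :: complex ^ 'm ^ 'l::finite)"
  by (simp add: vec_eq_iff matrix_matrix_mult_def)

text \<open>Conjugation fixes a real A and exchanges \<open>Pm\<close> with \<open>Qm\<close>, hence
  \<open>Dm\<close> with \<open>Cm\<close>. The determinant of the unitary operator is therefore the
  conjugate of \<open>det (Dm A)\<close> divided by \<open>det (Dm A)\<close>, with minus twice the
  argument of the latter.\<close>

lemma det_Cm_cmat:
  fixes A :: "real ^ ('n::finite + 'n) ^ ('n + 'n)"
  shows "det (Cm (cmat A)) = cnj (det (Dm (cmat A)))"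
proof -
  have J: "map_matrix cnj J0 = (J0 :: complex ^ ('n + 'n) ^ ('n + 'n))"
    by (auto simp: vec_eq_iff J0_def split: sum.split)
  have m: "map_matrix cnj (mat c) = mat (cnj c)" for c by (simp add: vec_eq_iff mat_def)
  have pm: "map_matrix cnj (M + N) = map_matrix cnj M + map_matrix cnj N"
    "map_matrix cnj (M - N) = map_matrix cnj M - map_matrix cnj N" for M N :: "complex ^ 'm ^ 'k"
    by (simp_all add: vec_eq_iff)
  have neg: "mat (- c) ** M = - (mat c ** M)" for c and M :: "complex ^ ('n + 'n) ^ ('n + 'n)"
    by (simp add: matrix_eq matrix_vector_mul_assoc[symmetric] matrix_vector_mult_mat) 
      (simp add: vec_eq_iff matrix_vector_mult_def matrix_matrix_mult_def mat_def if_zero_mult sum_negf sum_distrib_left mult.assoc)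
  have "map_matrix cnj Pm = (Qm :: complex ^ ('n + 'n) ^ ('n + 'n))" "map_matrix cnj Qm = (Pm :: complex ^ ('n + 'n) ^ ('n + 'n))"
    by (simp_all add: Pm_def Qm_def pm map_cnj_mult m J neg)
  moreover have "map_matrix cnj (cmat A) = cmat A" by (simp add: vec_eq_iff)
  ultimately have "map_matrix cnj (Dm (cmat A)) = Cm (cmat A)"
    by (simp add: Dm_def Cm_def pm map_cnj_mult)
  then show ?thesis by (metis det_map_cnj)
qed

section \<open>Quasi-additivity of the argument\<close>

text \<open>For such r and s the number \<open>1 - s / r\<close> stays in the right half-plane,
  where the principal logarithm is continuous with imaginary part below pi / 2 in absolute
  value.\<close>

lemma exists_log_prod_linear:
  assumes "\<And>r. r \<in># R \<Longrightarrow> 1 < cmod r"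
  shows "\<exists>L. continuous_on {0..1} L \<and> L 0 = 0 \<and> (\<forall>s\<in>{0..1}. exp (L s) = (\<Prod>r\<in>#R. 1 - complex_of_real s / r)
    \<and> \<bar>Im (L s)\<bar> \<le> size R * (pi / 2))"
  using assms
proof (induction R)
  case (add r R)
  then obtain L where L: "continuous_on {0..1} L" "L 0 = 0"
    "\<And>s. s \<in> {0..1} \<Longrightarrow> exp (L s) = (\<Prod>r\<in>#R. 1 - complex_of_real s / r)"
    "\<And>s. s \<in> {0..1} \<Longrightarrow> \<bar>Im (L s)\<bar> \<le> size R * (pi / 2)" by auto
  have r: "1 < cmod r" using add.prems by simp
  have pos: "0 < Re (1 - complex_of_real s / r)" if "s \<in> {0..1}" for s
  proof -
    have "s < cmod r" "0 < cmod r" "0 \<le> s" using that r by auto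
    then have "cmod (complex_of_real s / r) < 1" by (simp add: norm_divide)
    then have "Re (complex_of_real s / r) < 1" using complex_Re_le_cmod order_le_less_trans by blast
    then show ?thesis by simp
  qed
  have npos: "1 - complex_of_real s / r \<notin> \<real>\<^sub>\<le>\<^sub>0" if "s \<in> {0..1}" for s
    using pos[OF that] by (auto simp: complex_nonpos_Reals_iff)
  let ?L = "\<lambda>s. Ln (1 - complex_of_real s / r) + L s"
  have "continuous_on {0..1} ?L"
    using L(1) r by (intro continuous_intros npos) auto
  moreover have "exp (?L s) = (\<Prod>r\<in>#add_mset r R. 1 - complex_of_real s / r)" if "s \<in> {0..1}" for s
  proof -
    have "1 - complex_of_real s / r \<noteq> 0" using pos[OF that] by auto
    then show ?thesis using L(3)[OF that] by (simp add: exp_add)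
  qed
  moreover have "\<bar>Im (?L s)\<bar> \<le> size (add_mset r R) * (pi / 2)" if "s \<in> {0..1}" for s
  proof -
    have "\<bar>Im (Ln (1 - complex_of_real s / r))\<bar> < pi / 2"
    proof -
      have "1 - complex_of_real s / r \<noteq> 0" using pos[OF that] by fastforce
      then show ?thesis using Re_Ln_pos_lt pos[OF that] by blast
    qed
    then have "\<bar>Im (?L s)\<bar> \<le> pi / 2 + size R * (pi / 2)" using L(4)[OF that] by simp
    then show ?thesis by (simp add: distrib_right)
  qed
  ultimately show ?case using L(2) by (intro exI[of _ ?L]) auto
qed (auto intro: exI[of _ "\<lambda>_. 0"])

lemma exp_eq_cis_Im:
  assumes "exp a = exp b" shows "cis (Im a) = cis (Im b)"
proof -
  have "exp a = of_real (exp (Re a)) * cis (Im a)" "exp b = of_real (exp (Re b)) * cis (Im b)"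
    by (simp_all add: exp_eq_polar)
  moreover have "exp (Re a) = exp (Re b)" using assms by (metis norm_exp_eq_Re)
  ultimately show ?thesis using assms by simp
qed

text \<open>Up to a constant factor the polynomial is the product of \<open>1 - s / r\<close> over
  its roots. The bound depends on the degree alone, which makes the later error uniform in the
  matrices.\<close>

lemma poly_arg_variation:
  fixes p :: "complex poly"
  assumes nz: "\<And>z. cmod z \<le> 1 \<Longrightarrow> poly p z \<noteq> 0"
    and g: "continuous_on {0..1} g" "\<And>s. s \<in> {0..1} \<Longrightarrow> exp (g s) = poly p (complex_of_real s)"
  shows "\<bar>Im (g 1) - Im (g 0)\<bar> \<le> degree p * (pi / 2)"
proof -
  have p0: "p \<noteq> 0" using nz[of 0] by auto
  have r: "1 < cmod r" if "r \<in># proots p" for r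
    using that nz[of r] p0 by (force simp: not_le[symmetric])
  obtain L where L: "continuous_on {0..1} L" "L 0 = 0"
    "\<And>s. s \<in> {0..1} \<Longrightarrow> exp (L s) = (\<Prod>r\<in>#proots p. 1 - complex_of_real s / r)"
    "\<And>s. s \<in> {0..1} \<Longrightarrow> \<bar>Im (L s)\<bar> \<le> size (proots p) * (pi / 2)"
    using exists_log_prod_linear[OF r] by blast
  have pp: "poly p s = poly p 0 * (\<Prod>r\<in>#proots p. 1 - s / r)" for s
  proof -
    have e: "poly p s = lead_coeff p * (\<Prod>r\<in>#proots p. s - r)" for s
    proof -
      have "poly p s = poly (smult (lead_coeff p) (\<Prod>x\<in>#proots p. [:-x, 1:])) s"
        by (simp only: complex_poly_decompose_multiset)
      also have "\<dots> = lead_coeff p * (\<Prod>r\<in>#proots p. s - r)"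
        by (simp add: poly_prod_mset image_mset.compositionality comp_def)
      finally show ?thesis .
    qed
    have "(\<Prod>r\<in>#R. s - r) = (\<Prod>r\<in>#R. 0 - r) * (\<Prod>r\<in>#R. 1 - s / r)" if "\<And>r. r \<in># R \<Longrightarrow> 1 < cmod r" for R
      using that
    proof (induction R)
      case (add r R)
      have "r \<noteq> 0" using add.prems[of r] by auto
      then have "s - r = (0 - r) * (1 - s / r)" by (simp add: field_simps)
      then show ?case using add by simp
    qed simp
    from this[of "proots p"] r show ?thesis unfolding e[of s] e[of 0] by (simp only: mult.assoc)
  qed
  have "Im (g 1 - g 0) - Im (g 0 - g 0) = Im (L 1) - Im (L 0)"
  proof (rule cis_lift_unique[of "{0..1}" "\<lambda>s. Im (g s - g 0)" "\<lambda>s. Im (L s)"])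
    fix s :: real assume s: "s \<in> {0..1}"
    have "exp (g s - g 0) = exp (L s)"
      using g(2)[OF s] g(2)[of 0] L(3)[OF s] pp[of "of_real s"] nz[of 0] by (simp add: exp_diff)
    then show "cis (Im (g s - g 0)) = cis (Im (L s))" by (rule exp_eq_cis_Im)
  qed (use g L in \<open>auto intro!: continuous_intros\<close>)
  then show ?thesis using L(2) L(4)[of 1] by (simp add: size_proots_complex)
qed

section \<open>The homotopy from a product of determinants to the determinant of a product\<close>

lemma det_affine_poly:
  fixes M N :: "complex ^ 'k ^ 'k::finite"
  obtains p where "degree p \<le> CARD('k)" "\<And>s. poly p s = det (\<chi> i j. M $ i $ j + s * N $ i $ j)"
proof -
  define p where "p = (\<Sum>q | q permutes (UNIV :: 'k set). [:of_int (sign q):] * (\<Prod>i\<in>UNIV. [:M $ i $ q i, N $ i $ q i:]))"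
  have "degree ([:of_int (sign q):] * (\<Prod>i\<in>UNIV. [:M $ i $ q i, N $ i $ q i:])) \<le> CARD('k)" for q :: "'k \<Rightarrow> 'k"
  proof -
    have "degree (\<Prod>i\<in>UNIV. [:M $ i $ q i, N $ i $ q i:]) \<le> (\<Sum>i\<in>UNIV. degree [:M $ i $ q i, N $ i $ q i:])"
      using degree_prod_sum_le[of UNIV "\<lambda>i. [:M $ i $ q i, N $ i $ q i:]"] by (simp add: comp_def)
    also have "\<dots> \<le> (\<Sum>i\<in>(UNIV::'k set). 1)" by (intro sum_mono) simp
    finally have d: "degree (\<Prod>i\<in>UNIV. [:M $ i $ q i, N $ i $ q i:]) \<le> CARD('k)" by simp
    show ?thesis by (rule order_trans[OF degree_mult_le]) (use d in simp)
  qed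
  then have "degree p \<le> CARD('k)"
    unfolding p_def by (intro degree_sum_le) (auto simp: finite_permutations)
  moreover have "poly p s = det (\<chi> i j. M $ i $ j + s * N $ i $ j)" for s
    unfolding p_def det_def by (simp add: poly_sum poly_prod mult.commute)
  ultimately show ?thesis using that by blast
qed

lemma continuous_on_det:
  fixes M :: "'a::topological_space \<Rightarrow> 'c::{real_normed_field} ^ 'k ^ 'k::finite"
  assumes "\<And>i j. continuous_on S (\<lambda>x. M x $ i $ j)"
  shows "continuous_on S (\<lambda>x. det (M x))"
  unfolding det_def by (intro continuous_intros assms)

lemma continuous_on_matrix_mult:
  fixes A :: "'a::topological_space \<Rightarrow> 'c::{real_normed_field} ^ 'l ^ 'k::finite" and B :: "'a \<Rightarrow> 'c ^ 'm ^ 'l::finite"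
  assumes "\<And>i j. continuous_on S (\<lambda>x. A x $ i $ j)" "\<And>i j. continuous_on S (\<lambda>x. B x $ i $ j)"
  shows "continuous_on S (\<lambda>x. (A x ** B x) $ i $ j)"
  unfolding matrix_matrix_mult_def vec_lambda_beta by (intro continuous_on_sum continuous_on_mult assms)

text \<open>The parameter s scales the difference of \<open>Dm (A ** B)\<close> and
  \<open>Dm A ** Dm B\<close>, which is \<open>Pm ** A\<close> applied to the \<open>Qm\<close> part
  of \<open>B x - x\<close>. The entries are affine in s, so the determinant is a polynomial in s of
  degree at most the dimension.\<close>

definition Em :: "complex ^ ('n::finite + 'n) ^ ('n + 'n) \<Rightarrow> complex ^ ('n + 'n) ^ ('n + 'n) \<Rightarrow> complex \<Rightarrow> complex ^ ('n + 'n) ^ ('n + 'n)" where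
  "Em A B s = (\<chi> i j. (Qm + Pm ** A ** Pm ** B + Pm ** A ** Qm) $ i $ j + s * (Pm ** A ** Qm ** (B - mat 1)) $ i $ j)"

lemma Em_mult: "Em A B s *v x = Qm *v x + Pm *v (A *v (Pm *v (B *v x))) + Pm *v (A *v (Qm *v x))
   + s *s (Pm *v (A *v (Qm *v (B *v x - x))))"
proof -
  have "Em A B s = (Qm + Pm ** A ** Pm ** B + Pm ** A ** Qm) + mat s ** (Pm ** A ** Qm ** (B - mat 1))"
    by (simp add: Em_def vec_eq_iff) (simp add: matrix_matrix_mult_def mat_def if_zero_mult)
  then show ?thesis
    by (simp add: matrix_vector_mult_add_rdistrib matrix_vector_mul_assoc[symmetric] matrix_vector_mult_mat matrix_vector_mult_diff_rdistrib)
qed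

lemma Em_0: "Em A B 0 = Dm A ** Dm B" and Em_1: "Em A B 1 = Dm (A ** B)"
proof -
  show "Em A B 0 = Dm A ** Dm B"
    unfolding matrix_eq Em_mult by (simp add: matrix_vector_mul_assoc[symmetric] Dm_mult vec.add)
  show "Em A B 1 = Dm (A ** B)"
    unfolding matrix_eq Em_mult
  proof
    fix x
    have "Pm *v (A *v (B *v x)) = Pm *v (A *v (Pm *v (B *v x) + Qm *v (B *v x)))" by (simp add: PQ_sum)
    then show "Qm *v x + Pm *v (A *v (Pm *v (B *v x))) + Pm *v (A *v (Qm *v x))
      + 1 *s (Pm *v (A *v (Qm *v (B *v x - x)))) = Dm (A ** B) *v x"
      by (simp add: matrix_vector_mul_assoc[symmetric] Dm_mult vec.add vec.diff)
  qed
qed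

text \<open>A kernel vector x has no \<open>Qm\<close> part. With y and v the \<open>Pm\<close> and
  \<open>Qm\<close> parts of \<open>B x\<close>, invariance under B gives |y|^2 = |v|^2 + |x|^2.
  Invariance under A, applied to y + s v, whose image has no \<open>Pm\<close> part, gives |y| \<le>
  |s v|. For |s| at most 1 this forces x = 0. The whole disc is treated because the bound on the
  argument asks for roots outside it.\<close>

lemma det_Em_nonzero:
  assumes A: "csymplectic A" and B: "csymplectic B" and s: "cmod s \<le> 1"
  shows "det (Em A B s) \<noteq> 0"
proof -
  have "x = 0" if x: "Em A B s *v x = 0" for x
  proof (rule ccontr)
    assume nx: "x \<noteq> 0"
    have "Qm *v (Em A B s *v x) = Qm *v x" by (simp add: Em_mult vec.add vec.scale)
    then have Q: "Qm *v x = 0" using x by simp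
    then have P: "Pm *v x = x" using PQ_sum(1)[of x] by simp
    define y where "y = Pm *v (B *v x)"
    define v where "v = Qm *v (B *v x)"
    have "Pm *v (A *v (y + s *s v)) = 0"
      using x by (simp add: Em_mult Q vec.diff vec.add vec.scale y_def v_def)
    moreover have "Pm *v (y + s *s v) = y" "Qm *v (y + s *s v) = s *s v"
      by (simp_all add: y_def v_def vec.add vec.scale)
    ultimately have "cdot (s *s v) (s *s v) = cdot (Qm *v (A *v (y + s *s v))) (Qm *v (A *v (y + s *s v))) + cdot y y"
      using csymplectic_PQ[OF A, of "y + s *s v" "y + s *s v"] by (simp add: cdot_simps)
    then have "norm (s *s v) ^ 2 = norm (Qm *v (A *v (y + s *s v))) ^ 2 + norm y ^ 2"
      unfolding cdot_self of_real_add[symmetric] of_real_eq_iff .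
    then have 1: "norm y ^ 2 \<le> norm (s *s v) ^ 2" by simp
    have "cdot y y = cdot v v + cdot x x"
      using csymplectic_PQ[OF B, of x x] by (simp add: Q P y_def v_def cdot_simps)
    then have "norm y ^ 2 = norm v ^ 2 + norm x ^ 2"
      unfolding cdot_self of_real_add[symmetric] of_real_eq_iff .
    then have 2: "norm v ^ 2 < norm y ^ 2" using nx by simp
    have "norm (s *s v) ^ 2 = cmod s ^ 2 * norm v ^ 2"
    proof -
      have "complex_of_real (norm (s *s v) ^ 2) = complex_of_real (cmod s ^ 2 * norm v ^ 2)"
        unfolding cdot_self[symmetric] of_real_mult by (simp add: cdot_simps complex_norm_square flip: of_real_power)
      then show ?thesis unfolding of_real_eq_iff .
    qed
    also have "\<dots> \<le> 1 * norm v ^ 2" using s by (intro mult_right_mono) (auto simp: power_le_one)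
    finally show False using 1 2 by linarith
  qed
  then have "invertible (Em A B s)" by (auto simp: invertible_left_inverse matrix_left_invertible_ker)
  then show ?thesis by (simp add: invertible_det_nz)
qed

text \<open>The determinant of \<open>Em\<close> is lifted to a logarithm over the contractible
  rectangle of all (t, r). The edge t = 1 carries u, the edge t = 0 carries w plus the constant
  argument of \<open>det (Dm B)\<close>, and each of the edges r = 0 and r = s contributes at most a
  quarter turn per dimension; these two add up to the bound.\<close>

lemma arg_det_quasi_additive:
  fixes A :: "real \<Rightarrow> complex ^ ('n::finite + 'n) ^ ('n + 'n)"
  assumes s: "0 \<le> s" and A: "\<And>r. r \<in> {0..s} \<Longrightarrow> csymplectic (A r)" and B: "csymplectic B"
    and cA: "\<And>i j. continuous_on {0..s} (\<lambda>r. A r $ i $ j)"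
    and u: "continuous_on {0..s} u" "\<And>r. r \<in> {0..s} \<Longrightarrow> det (Dm (A r ** B)) = of_real (cmod (det (Dm (A r ** B)))) * cis (u r)"
    and w: "continuous_on {0..s} w" "\<And>r. r \<in> {0..s} \<Longrightarrow> det (Dm (A r)) = of_real (cmod (det (Dm (A r)))) * cis (w r)"
  shows "\<bar>(u s - u 0) - (w s - w 0)\<bar> \<le> CARD('n + 'n) * pi"
proof -
  define H where "H = (\<lambda>(t, r). det (Em (A r) B (complex_of_real t)))"
  have cE: "continuous_on ({0..1} \<times> {0..s}) (\<lambda>x. A (snd x) $ i $ j)" for i j
    by (rule continuous_on_compose2[OF cA]) (auto intro!: continuous_intros)
  have cH: "continuous_on ({0..1} \<times> {0..s}) H"
    unfolding H_def case_prod_beta Em_def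
    by (rule continuous_on_det, simp only: vec_lambda_beta vector_add_component)
      (intro continuous_on_add continuous_on_mult continuous_on_matrix_mult cE continuous_on_const
        continuous_on_of_real continuous_on_fst continuous_on_id)
  have ctr: "contractible ({0..1::real} \<times> {0..s})"
    by (rule convex_imp_contractible) (auto intro: convex_Times)
  have nz: "H z \<noteq> 0" if "z \<in> {0..1} \<times> {0..s}" for z
  proof -
    have "csymplectic (A (snd z))" "cmod (complex_of_real (fst z)) \<le> 1" using that A by auto
    from det_Em_nonzero[OF this(1) B this(2)] show ?thesis by (simp add: H_def case_prod_beta)
  qed
  obtain G where G: "continuous_on ({0..1} \<times> {0..s}) G" "\<And>z. z \<in> {0..1} \<times> {0..s} \<Longrightarrow> H z = exp (G z)"
    using continuous_logarithm_on_contractible[OF cH ctr nz] by blast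
  have G1: "continuous_on {0..s} (\<lambda>r. G (t, r))" if "t \<in> {0..1}" for t
    using that by (intro continuous_on_compose2[OF G(1)]) (auto intro!: continuous_intros)
  have G2: "continuous_on {0..1} (\<lambda>t. G (t, r))" if "r \<in> {0..s}" for r
    using that by (intro continuous_on_compose2[OF G(1)]) (auto intro!: continuous_intros)
  have pol: "exp z = of_real (exp (Re z)) * cis (Im z)" for z by (simp add: exp_eq_polar)
  have cisI: "cis (Im z) = cis a" if "exp z = of_real (cmod (exp z)) * cis a" for z a
    using that by (simp add: pol[of z] norm_mult)
  have U: "Im (G (1, s)) - Im (G (1, 0)) = u s - u 0"
  proof (rule cis_lift_unique[of "{0..s}"])
    fix r assume r: "r \<in> {0..s}"
    have "exp (G (1, r)) = det (Dm (A r ** B))" using G(2)[of "(1, r)"] r by (simp add: H_def Em_1)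
    then show "cis (Im (G (1, r))) = cis (u r)" using u(2)[OF r] by (intro cisI) simp
  qed (use s u G1 in \<open>auto intro!: continuous_intros\<close>)
  define b where "b = Arg (det (Dm B))"
  have dB: "det (Dm B) = of_real (cmod (det (Dm B))) * cis b"
    unfolding b_def by (metis Arg_eq cis_conv_exp mult_zero_left norm_zero of_real_0)
  have "Im (G (0, s)) - Im (G (0, 0)) = (w s + b) - (w 0 + b)"
  proof (rule cis_lift_unique[of "{0..s}"])
    fix r assume r: "r \<in> {0..s}"
    have "exp (G (0, r)) = det (Dm (A r)) * det (Dm B)" using G(2)[of "(0, r)"] r by (simp add: H_def Em_0 det_mul)
    moreover have "\<dots> = of_real (cmod (det (Dm (A r)) * det (Dm B))) * cis (w r + b)"
      using w(2)[OF r] dB by (simp add: norm_mult cis_mult[symmetric]) (metis mult.assoc mult.left_commute)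
    ultimately show "cis (Im (G (0, r))) = cis (w r + b)" by (intro cisI) simp
  qed (use s w G1 in \<open>auto intro!: continuous_intros\<close>)
  moreover have "\<bar>Im (G (1, r)) - Im (G (0, r))\<bar> \<le> CARD('n + 'n) * (pi / 2)" if r: "r \<in> {0..s}" for r
  proof -
    obtain p where p: "degree p \<le> CARD('n + 'n)"
      "\<And>z. poly p z = det (\<chi> i j. (Qm + Pm ** A r ** Pm ** B + Pm ** A r ** Qm) $ i $ j + z * (Pm ** A r ** Qm ** (B - mat 1)) $ i $ j)"
      by (rule det_affine_poly[of "Qm + Pm ** A r ** Pm ** B + Pm ** A r ** Qm" "Pm ** A r ** Qm ** (B - mat 1)"])
        (rule that)
    note pE = p(2)[folded Em_def]
    have "\<bar>Im (G (1, r)) - Im (G (0, r))\<bar> \<le> degree p * (pi / 2)"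
    proof (rule poly_arg_variation)
      show "poly p z \<noteq> 0" if "cmod z \<le> 1" for z unfolding pE using A[OF r] B that by (rule det_Em_nonzero)
      show "exp (G (t, r)) = poly p (complex_of_real t)" if "t \<in> {0..1}" for t
        using G(2)[of "(t, r)"] that r by (simp add: H_def pE)
    qed (rule G2[OF r])
    also have "\<dots> \<le> CARD('n + 'n) * (pi / 2)" using p(1) by (intro mult_right_mono) (auto simp only: of_nat_le_iff, simp)
    finally show ?thesis .
  qed
  from this[of 0] this[of s] have "\<bar>Im (G (1, 0)) - Im (G (0, 0))\<bar> \<le> CARD('n + 'n) * (pi / 2)"
    "\<bar>Im (G (1, s)) - Im (G (0, s))\<bar> \<le> CARD('n + 'n) * (pi / 2)" using s by auto
  ultimately show ?thesis using U by (simp add: abs_le_iff) 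
qed

section \<open>Differentiability of local flows\<close>

text \<open>Where the norm is maximal, the mean value inequality bounds the maximum M by
  \<open>norm (z 0) + M / 2 + T * e\<close>. Keeping \<open>L * T\<close> at most 1 / 2 replaces the
  exponential of Gronwall's inequality by the factor 2.\<close>

lemma small_time_gronwall:
  fixes z :: "real \<Rightarrow> 'a::real_normed_vector"
  assumes T: "0 \<le> T" "L * T \<le> 1 / 2" and L: "0 \<le> L" and e: "0 \<le> e"
    and z: "\<And>t. t \<in> {0..T} \<Longrightarrow> (z has_vector_derivative z' t) (at t within {0..T})"
    and b: "\<And>t. t \<in> {0..T} \<Longrightarrow> norm (z' t) \<le> L * norm (z t) + e"
    and t: "t \<in> {0..T}"
  shows "norm (z t) \<le> 2 * norm (z 0) + 2 * T * e"
proof -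
  have "continuous_on {0..T} (\<lambda>t. norm (z t))"
    by (intro continuous_on_norm) (meson z continuous_on_eq_continuous_within has_vector_derivative_continuous)
  then obtain s where s: "s \<in> {0..T}" "\<And>r. r \<in> {0..T} \<Longrightarrow> norm (z r) \<le> norm (z s)"
    using continuous_attains_sup[of "{0..T}" "\<lambda>t. norm (z t)"] T by auto
  define M where "M = norm (z s)"
  have M0: "0 \<le> M" by (simp add: M_def)
  have "norm (z s - z 0) \<le> (L * M + e) * norm (s - 0)"
  proof (rule differentiable_bound)
    show "(z has_derivative (\<lambda>h. h *\<^sub>R z' r)) (at r within {0..T})" if "r \<in> {0..T}" for r
      using z[OF that] by (simp add: has_vector_derivative_def)
    show "onorm (\<lambda>h. h *\<^sub>R z' r) \<le> L * M + e" if "r \<in> {0..T}" for r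
    proof (rule onorm_le)
      fix h :: real
      have "norm (z' r) \<le> L * M + e"
        using b[OF that] mult_left_mono[OF s(2)[OF that] L] by (simp add: M_def)
      then have "\<bar>h\<bar> * norm (z' r) \<le> \<bar>h\<bar> * (L * M + e)" by (rule mult_left_mono) simp
      then show "norm (h *\<^sub>R z' r) \<le> (L * M + e) * norm h" by (simp add: mult.commute)
    qed
  qed (use s T in auto)
  also have "\<dots> \<le> (L * M + e) * T" using s L e M0 by (intro mult_left_mono) auto
  finally have "norm (z s - z 0) \<le> (L * T) * M + e * T" by (simp add: algebra_simps)
  also have "\<dots> \<le> 1 / 2 * M + e * T" using T M0 by (intro add_right_mono mult_right_mono)
  finally have "norm (z s - z 0) \<le> 1 / 2 * M + e * T" .
  moreover have "M \<le> norm (z 0) + norm (z s - z 0)"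
    unfolding M_def by (metis add.commute diff_add_cancel norm_triangle_ineq)
  ultimately have "M \<le> 2 * norm (z 0) + 2 * T * e" by (simp add: algebra_simps)
  then show ?thesis using s(2)[OF t] by (simp add: M_def)
qed

text \<open>On so short an interval the Picard integral operator halves distances. Freezing the time
  outside the interval with \<open>c\<close> places the iteration in the complete space of bounded
  continuous functions on the line.\<close>

lemma small_time_linear_ode:
  fixes F :: "real \<Rightarrow> 'b::banach \<Rightarrow>\<^sub>L 'b"
  assumes T: "0 \<le> T" "l * T \<le> 1 / 2" and F: "continuous_on {0..T} F" "\<And>t. t \<in> {0..T} \<Longrightarrow> norm (F t) \<le> l"
  shows "\<exists>y. y 0 = y0 \<and> (\<forall>t\<in>{0..T}. (y has_vector_derivative F t (y t)) (at t within {0..T}))"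
proof -
  define c where "c t = max 0 (min t T)" for t :: real
  have c: "c t \<in> {0..T}" "t \<in> {0..T} \<Longrightarrow> c t = t" for t using T by (auto simp: c_def)
  have cc: "continuous_on UNIV c" unfolding c_def by (intro continuous_intros)
  define I where "I g t = y0 + integral {0..c t} (\<lambda>s. F s (apply_bcontfun g s))" for g :: "real \<Rightarrow>\<^sub>C 'b" and t
  have cont: "continuous_on {0..T} (\<lambda>s. F s (apply_bcontfun g s))" for g
    using F(1) by (intro continuous_intros) (auto intro: continuous_on_apply_bcontfun)
  have int: "(\<lambda>s. F s (apply_bcontfun g s)) integrable_on {0..c t}" for g t
    using c(1)[of t] by (intro integrable_continuous_real continuous_on_subset[OF cont]) auto
  have Ib: "I g \<in> bcontfun" for g
  proof -
    have ci: "continuous_on {0..T} (\<lambda>u. y0 + integral {0..u} (\<lambda>s. F s (apply_bcontfun g s)))"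
      by (intro continuous_intros indefinite_integral_continuous_1 integrable_continuous_real cont)
    have "continuous_on UNIV (I g)"
      unfolding I_def by (rule continuous_on_compose2[OF ci cc]) (use c in auto)
    moreover have "bounded (range (I g))"
    proof (rule bounded_subset)
      show "bounded ((\<lambda>u. y0 + integral {0..u} (\<lambda>s. F s (apply_bcontfun g s))) ` {0..T})"
        by (intro compact_imp_bounded compact_continuous_image ci) auto
      show "range (I g) \<subseteq> (\<lambda>u. y0 + integral {0..u} (\<lambda>s. F s (apply_bcontfun g s))) ` {0..T}"
        using c(1) by (auto simp: I_def)
    qed
    ultimately show ?thesis by (simp add: bcontfun_def)
  qed
  have "\<exists>!g. Bcontfun (I g) = g"
  proof (rule banach_fix_type)
    show "\<forall>g h. dist (Bcontfun (I g)) (Bcontfun (I h)) \<le> 1 / 2 * dist g h"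
    proof (intro allI dist_bound)
      fix g h t
      have "I g t - I h t = integral {0..c t} (\<lambda>s. F s (apply_bcontfun g s) - F s (apply_bcontfun h s))"
        unfolding I_def by (subst integral_diff[OF int int]) simp
      also have "norm \<dots> \<le> (l * dist g h) * (c t - 0)"
      proof (rule integral_bound)
        show "continuous_on {0..c t} (\<lambda>s. F s (apply_bcontfun g s) - F s (apply_bcontfun h s))"
          using c(1)[of t] by (intro continuous_on_diff continuous_on_subset[OF cont]) auto
        fix s assume "s \<in> {0..c t}"
        then have s: "s \<in> {0..T}" using c(1)[of t] by auto
        have "norm (F s (apply_bcontfun g s) - F s (apply_bcontfun h s)) \<le> norm (F s) * norm (apply_bcontfun g s - apply_bcontfun h s)"
          by (simp add: norm_blinfun flip: blinfun.diff_right)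
        also have "\<dots> \<le> l * dist g h"
          using F(2)[OF s] dist_bounded[of g s h] order_trans[OF norm_ge_zero F(2)[OF s]]
          by (intro mult_mono) (auto simp: dist_norm)
        finally show "norm (F s (apply_bcontfun g s) - F s (apply_bcontfun h s)) \<le> l * dist g h" .
      qed (use c in auto)
      also have "\<dots> \<le> (l * dist g h) * T"
        using c(1)[of t] order_trans[OF norm_ge_zero F(2)[of 0]] T by (intro mult_left_mono) auto
      also have "\<dots> = (l * T) * dist g h" by simp
      also have "\<dots> \<le> 1 / 2 * dist g h" using T by (intro mult_right_mono) auto
      finally show "dist (apply_bcontfun (Bcontfun (I g)) t) (apply_bcontfun (Bcontfun (I h)) t) \<le> 1 / 2 * dist g h"
        by (simp add: Bcontfun_inverse[OF Ib] dist_norm)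
    qed
  qed auto
  then obtain g where "Bcontfun (I g) = g" by blast
  then have g: "apply_bcontfun g = I g" by (metis Bcontfun_inverse Ib)
  have "apply_bcontfun g 0 = y0" using fun_cong[OF g, of 0] c(2)[of 0] T by (simp add: I_def)
  moreover have "(apply_bcontfun g has_vector_derivative F t (apply_bcontfun g t)) (at t within {0..T})" if t: "t \<in> {0..T}" for t
  proof -
    have "((\<lambda>u. y0 + integral {0..u} (\<lambda>s. F s (apply_bcontfun g s))) has_vector_derivative F t (apply_bcontfun g t)) (at t within {0..T})"
      using has_vector_derivative_add[OF has_vector_derivative_const integral_has_vector_derivative[OF cont t]] by simp
    then show ?thesis
    proof (rule has_vector_derivative_transform[OF t, rotated])
      fix u assume "u \<in> {0..T}"
      then show "apply_bcontfun g u = y0 + integral {0..u} (\<lambda>s. F s (apply_bcontfun g s))"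
        using c(2)[of u] fun_cong[OF g, of u] by (simp add: I_def)
    qed
  qed
  ultimately show ?thesis by blast
qed

section \<open>Regularity of a flow with given orbits on a compact convex set\<close>

lemma continuous_on_Times_of_uniform:
  fixes f :: "real \<Rightarrow> 'a::metric_space \<Rightarrow> 'b::metric_space"
  assumes t: "\<And>y. y \<in> S \<Longrightarrow> continuous_on I (\<lambda>t. f t y)"
    and u: "\<And>y e. y \<in> S \<Longrightarrow> 0 < e \<Longrightarrow> \<exists>d>0. \<forall>x\<in>S. dist x y < d \<longrightarrow> (\<forall>t\<in>I. dist (f t x) (f t y) < e)"
  shows "continuous_on (I \<times> S) (\<lambda>p. f (fst p) (snd p))"
  unfolding continuous_on_iff
proof (intro ballI allI impI)
  fix p e assume p: "p \<in> I \<times> S" and e: "0 < (e::real)"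
  obtain d1 where d1: "0 < d1" "\<And>x t. x \<in> S \<Longrightarrow> dist x (snd p) < d1 \<Longrightarrow> t \<in> I \<Longrightarrow> dist (f t x) (f t (snd p)) < e / 2"
    using u[of "snd p" "e / 2"] p e by auto
  obtain d2 where d2: "0 < d2" "\<And>t. t \<in> I \<Longrightarrow> dist t (fst p) < d2 \<Longrightarrow> dist (f t (snd p)) (f (fst p) (snd p)) < e / 2"
    using t[of "snd p"] p e unfolding continuous_on_iff by (metis half_gt_zero mem_Times_iff)
  show "\<exists>d>0. \<forall>q\<in>I \<times> S. dist q p < d \<longrightarrow> dist (f (fst q) (snd q)) (f (fst p) (snd p)) < e"
  proof (intro exI[of _ "min d1 d2"] conjI ballI impI)
    fix q assume q: "q \<in> I \<times> S" "dist q p < min d1 d2"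
    have "dist (snd q) (snd p) < d1" "dist (fst q) (fst p) < d2"
      using q(2) dist_snd_le[of q p] dist_fst_le[of q p] by auto
    then have "dist (f (fst q) (snd q)) (f (fst q) (snd p)) < e / 2" "dist (f (fst q) (snd p)) (f (fst p) (snd p)) < e / 2"
      using d1(2)[of "snd q" "fst q"] d2(2)[of "fst q"] q(1) by auto
    then show "dist (f (fst q) (snd q)) (f (fst p) (snd p)) < e" by metric
  qed (use d1 d2 in auto)
qed

text \<open>The orbits are given, not constructed: \<Psi> will be the flow of the manifold read in a
  chart, and S a set of starting points whose orbits stay in C up to time T. Derivatives of X are
  taken within C, which may reach the boundary of a half-space; the bound on \<open>l * T\<close> is
  the one of the short-time estimates.\<close>

locale local_flow =
  fixes X :: "'a::euclidean_space \<Rightarrow> 'a" and X' :: "'a \<Rightarrow> 'a \<Rightarrow>\<^sub>L 'a" and \<Psi> :: "real \<Rightarrow> 'a \<Rightarrow> 'a"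
    and C S :: "'a set" and T l :: real
  assumes C: "compact C" "convex C"
    and X: "\<And>x. x \<in> C \<Longrightarrow> (X has_derivative X' x) (at x within C)" "continuous_on C X'"
    and l: "\<And>x. x \<in> C \<Longrightarrow> norm (X' x) \<le> l" "0 \<le> l" and T: "0 \<le> T" "l * T \<le> 1 / 2"
    and \<Psi>0: "\<And>x. x \<in> S \<Longrightarrow> \<Psi> 0 x = x"
    and \<Psi>C: "\<And>x t. x \<in> S \<Longrightarrow> t \<in> {0..T} \<Longrightarrow> \<Psi> t x \<in> C"
    and \<Psi>: "\<And>x t. x \<in> S \<Longrightarrow> t \<in> {0..T} \<Longrightarrow> ((\<lambda>t. \<Psi> t x) has_vector_derivative X (\<Psi> t x)) (at t within {0..T})"
begin

lemma X_lipschitz: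
  assumes "x \<in> C" "y \<in> C" shows "norm (X x - X y) \<le> l * norm (x - y)"
  using assms l X C by (intro differentiable_bound[of C X "\<lambda>x. blinfun_apply (X' x)"]) (auto simp: norm_blinfun.rep_eq)

lemma flow_lipschitz:
  assumes x: "x \<in> S" and y: "y \<in> S" and t: "t \<in> {0..T}"
  shows "norm (\<Psi> t x - \<Psi> t y) \<le> 2 * norm (x - y)"
proof -
  have "norm (\<Psi> t x - \<Psi> t y) \<le> 2 * norm (\<Psi> 0 x - \<Psi> 0 y) + 2 * T * 0"
    using x y X_lipschitz \<Psi>C
    by (intro small_time_gronwall[OF T l(2) _ has_vector_derivative_diff[OF \<Psi> \<Psi>] _ t, where e=0]) auto
  then show ?thesis using x y by (simp add: \<Psi>0)
qed

lemma flow_continuous_time: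
  assumes "x \<in> S" shows "continuous_on {0..T} (\<lambda>t. \<Psi> t x)"
  unfolding continuous_on_eq_continuous_within using \<Psi>[OF assms] has_vector_derivative_continuous by blast

lemma flow_continuous: "continuous_on ({0..T} \<times> S) (\<lambda>p. \<Psi> (fst p) (snd p))"
proof (rule continuous_on_Times_of_uniform)
  fix y e assume y: "y \<in> S" and e: "0 < (e::real)"
  have "dist (\<Psi> t x) (\<Psi> t y) < e" if "x \<in> S" "dist x y < e / 2" "t \<in> {0..T}" for x t
    using flow_lipschitz[OF that(1) y that(3)] that(2) by (simp add: dist_norm)
  then show "\<exists>d>0. \<forall>x\<in>S. dist x y < d \<longrightarrow> (\<forall>t\<in>{0..T}. dist (\<Psi> t x) (\<Psi> t y) < e)"
    using e by (intro exI[of _ "e / 2"]) auto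
qed (rule flow_continuous_time)

text \<open>The solution of the variational equation along the orbit of x, operator-valued so that
  one equation handles all directions. The property under \<open>SOME\<close> does not mention the
  time argument, so varying t follows a single solution.\<close>

definition A :: "real \<Rightarrow> 'a \<Rightarrow> 'a \<Rightarrow>\<^sub>L 'a" where
  "A t x = (SOME y. y 0 = id_blinfun \<and>
     (\<forall>t\<in>{0..T}. (y has_vector_derivative X' (\<Psi> t x) o\<^sub>L y t) (at t within {0..T}))) t"

lemma A:
  assumes x: "x \<in> S"
  shows "A 0 x = id_blinfun"
    "\<And>t. t \<in> {0..T} \<Longrightarrow> ((\<lambda>t. A t x) has_vector_derivative X' (\<Psi> t x) o\<^sub>L A t x) (at t within {0..T})"
proof -
  define P where "P y \<longleftrightarrow> y 0 = id_blinfun \<and>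
    (\<forall>t\<in>{0..T}. (y has_vector_derivative X' (\<Psi> t x) o\<^sub>L y t) (at t within {0..T}))" for y :: "real \<Rightarrow> 'a \<Rightarrow>\<^sub>L 'a"
  define F :: "real \<Rightarrow> ('a \<Rightarrow>\<^sub>L 'a) \<Rightarrow>\<^sub>L ('a \<Rightarrow>\<^sub>L 'a)"
    where "F t = Blinfun (\<lambda>B. X' (\<Psi> t x) o\<^sub>L B)" for t
  have F: "blinfun_apply (F t) B = X' (\<Psi> t x) o\<^sub>L B" for t B
    unfolding F_def by (subst bounded_linear_Blinfun_apply) (auto intro: bounded_bilinear.bounded_linear_right bounded_bilinear_blinfun_compose)
  have nF: "norm (F t - F s) \<le> norm (X' (\<Psi> t x) - X' (\<Psi> s x))" for t s
    by (rule norm_blinfun_bound) (auto simp: F blinfun.diff_left intro: order_trans[OF _ norm_blinfun_compose]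
        simp flip: bounded_bilinear.diff_left[OF bounded_bilinear_blinfun_compose])
  have nF': "norm (F t) \<le> norm (X' (\<Psi> t x))" for t
    by (rule norm_blinfun_bound) (auto simp: F intro: norm_blinfun_compose)
  have cX: "continuous_on {0..T} (\<lambda>t. X' (\<Psi> t x))"
    using flow_continuous_time[OF x] \<Psi>C[OF x] by (intro continuous_on_compose2[OF X(2)]) auto
  have "continuous_on {0..T} F"
    using cX nF unfolding continuous_on_iff dist_norm by (meson order_le_less_trans)
  moreover have "norm (F t) \<le> l" if "t \<in> {0..T}" for t
    using nF'[of t] l(1)[OF \<Psi>C[OF x that]] by simp
  ultimately have "\<exists>y. y 0 = id_blinfun \<and> (\<forall>t\<in>{0..T}. (y has_vector_derivative F t (y t)) (at t within {0..T}))"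
    by (intro small_time_linear_ode[OF T])
  then have "\<exists>y. P y" by (simp only: F P_def)
  then have P: "P (SOME y. P y)" by (rule someI_ex)
  have "(\<lambda>t. A t x) = (SOME y. P y)" by (simp add: fun_eq_iff A_def P_def[abs_def])
  then have "P (\<lambda>t. A t x)" using P by simp
  then show "A 0 x = id_blinfun"
    "\<And>t. t \<in> {0..T} \<Longrightarrow> ((\<lambda>t. A t x) has_vector_derivative X' (\<Psi> t x) o\<^sub>L A t x) (at t within {0..T})"
    by (auto simp: P_def)
qed

lemma A_continuous_time:
  assumes "x \<in> S" shows "continuous_on {0..T} (\<lambda>t. A t x)"
  unfolding continuous_on_eq_continuous_within using A(2)[OF assms] has_vector_derivative_continuous by blast

lemma norm_A: "x \<in> S \<Longrightarrow> t \<in> {0..T} \<Longrightarrow> norm (A t x) \<le> 2"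
proof -
  assume x: "x \<in> S" and t: "t \<in> {0..T}"
  have "norm (A t x) \<le> 2 * norm (A 0 x) + 2 * T * 0"
  proof (rule small_time_gronwall[OF T l(2) _ A(2)[OF x] _ t])
    fix t assume t: "t \<in> {0..T}"
    show "norm (X' (\<Psi> t x) o\<^sub>L A t x) \<le> l * norm (A t x) + 0"
      using order_trans[OF norm_blinfun_compose mult_right_mono[OF l(1)[OF \<Psi>C[OF x t]] norm_ge_zero]] by simp
  qed auto
  moreover have "norm (A 0 x) \<le> 1" by (simp add: A(1)[OF x] norm_blinfun_id_le)
  ultimately show ?thesis by simp
qed

lemma uniform_X':
  assumes "0 < e" obtains d where "0 < d" "\<And>p q. p \<in> C \<Longrightarrow> q \<in> C \<Longrightarrow> norm (p - q) < d \<Longrightarrow> norm (X' p - X' q) < e"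
  using compact_uniformly_continuous[OF X(2) C(1)] assms unfolding uniformly_continuous_on_def dist_norm by metis

text \<open>The difference of two solutions solves the linear equation with forcing
  \<open>(X' (\<Psi> t x) - X' (\<Psi> t y)) o\<^sub>L A t y\<close>, which is small by uniform
  continuity of \<open>X'\<close> on C and the bound 2 on the solutions. The resulting error
  \<open>2 * T * (2 * \<eta>)\<close> explains the choice of \<eta>.\<close>

lemma A_continuous: "continuous_on ({0..T} \<times> S) (\<lambda>p. A (fst p) (snd p))"
proof (rule continuous_on_Times_of_uniform)
  fix y e assume y: "y \<in> S" and e: "0 < (e::real)"
  define \<eta> where "\<eta> = e / (4 * T + 4)"
  have \<eta>: "0 < \<eta>" "4 * T * \<eta> < e" using T e by (auto simp: \<eta>_def field_simps)
  obtain d where d: "0 < d" "\<And>p q. p \<in> C \<Longrightarrow> q \<in> C \<Longrightarrow> norm (p - q) < d \<Longrightarrow> norm (X' p - X' q) < \<eta>"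
    using uniform_X'[OF \<eta>(1)] by blast
  have "dist (A t x) (A t y) < e" if x: "x \<in> S" "dist x y < d / 2" and t: "t \<in> {0..T}" for x t
  proof -
    have "norm (A t x - A t y) \<le> 2 * norm (A 0 x - A 0 y) + 2 * T * (2 * \<eta>)"
    proof (rule small_time_gronwall[OF T l(2) _ has_vector_derivative_diff[OF A(2)[OF x(1)] A(2)[OF y]] _ t])
      fix t assume t: "t \<in> {0..T}"
      have "norm (\<Psi> t x - \<Psi> t y) < d" using flow_lipschitz[OF x(1) y t] x(2) by (simp add: dist_norm)
      then have *: "norm (X' (\<Psi> t x) - X' (\<Psi> t y)) \<le> \<eta>"
        using d(2)[OF \<Psi>C[OF x(1) t] \<Psi>C[OF y t]] by simp
      have "(X' (\<Psi> t x) o\<^sub>L A t x) - (X' (\<Psi> t y) o\<^sub>L A t y)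
        = (X' (\<Psi> t x) o\<^sub>L (A t x - A t y)) + ((X' (\<Psi> t x) - X' (\<Psi> t y)) o\<^sub>L A t y)"
        by (rule blinfun_eqI) (simp add: blinfun.bilinear_simps)
      also have "norm \<dots> \<le> norm (X' (\<Psi> t x)) * norm (A t x - A t y) + norm (X' (\<Psi> t x) - X' (\<Psi> t y)) * norm (A t y)"
        by (intro order_trans[OF norm_triangle_ineq] add_mono norm_blinfun_compose)
      also have "\<dots> \<le> l * norm (A t x - A t y) + \<eta> * 2"
        using l(1)[OF \<Psi>C[OF x(1) t]] * norm_A[OF y t] \<eta> l(2) by (intro add_mono mult_mono) auto
      finally show "norm ((X' (\<Psi> t x) o\<^sub>L A t x) - (X' (\<Psi> t y) o\<^sub>L A t y)) \<le> l * norm (A t x - A t y) + 2 * \<eta>"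
        by (simp add: mult.commute)
    qed (use \<eta> in auto)
    then show ?thesis using \<eta> by (simp add: A(1) x y dist_norm)
  qed
  then show "\<exists>d>0. \<forall>x\<in>S. dist x y < d \<longrightarrow> (\<forall>t\<in>{0..T}. dist (A t x) (A t y) < e)"
    using d by (intro exI[of _ "d / 2"]) auto
qed (rule A_continuous_time)

text \<open>Uniform continuity of \<open>X'\<close> on the compact set makes d independent of the
  base point; convexity supplies the segment for the mean value inequality.\<close>

lemma X_linearization:
  assumes "0 < e"
  obtains d where "0 < d" "\<And>p q. p \<in> C \<Longrightarrow> q \<in> C \<Longrightarrow> norm (q - p) < d \<Longrightarrow> norm (X q - X p - X' p (q - p)) \<le> e * norm (q - p)"
proof -
  obtain d where d: "0 < d" "\<And>p q. p \<in> C \<Longrightarrow> q \<in> C \<Longrightarrow> norm (p - q) < d \<Longrightarrow> norm (X' p - X' q) < e"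
    using uniform_X'[OF assms] by blast
  show ?thesis
  proof (rule that[OF d(1)])
    fix p q assume pq: "p \<in> C" "q \<in> C" "norm (q - p) < d"
    have sub: "closed_segment p q \<subseteq> C" using C(2) pq by (simp add: closed_segment_subset)
    have "norm (X q - X p - X' p (q - p)) \<le> norm (q - p) * e"
    proof (rule differentiable_bound_linearization[where S="closed_segment p q" and f'="\<lambda>x. blinfun_apply (X' x)"])
      show "p + t *\<^sub>R (q - p) \<in> closed_segment p q" if "t \<in> {0..1}" for t
        using that by (auto simp: in_segment algebra_simps intro!: exI[of _ t])
      show "(X has_derivative X' x) (at x within closed_segment p q)" if "x \<in> closed_segment p q" for x
        using has_derivative_subset[OF X(1) sub] sub that by blast
      show "onorm (blinfun_apply (X' x) - blinfun_apply (X' p)) \<le> e" if "x \<in> closed_segment p q" for x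
      proof -
        have "norm (x - p) \<le> norm (q - p)" using segment_bound1[OF that] by (simp add: norm_minus_commute)
        then have "norm (X' x - X' p) < e" using d(2)[of x p] sub that pq by auto
        then show ?thesis by (simp add: norm_blinfun.rep_eq minus_blinfun.rep_eq fun_diff_def)
      qed
    qed auto
    then show "norm (X q - X p - X' p (q - p)) \<le> e * norm (q - p)" by (simp add: mult.commute)
  qed
qed

text \<open>The remainder of the linear approximation vanishes at time 0 and solves the variational
  equation up to the linearization error of X. That error is small compared with
  \<open>norm (y - x)\<close>, because orbits separate at most by the factor 2.\<close>

lemma flow_has_derivative:
  assumes x: "x \<in> S" and t: "t \<in> {0..T}"
  shows "(\<Psi> t has_derivative A t x) (at x within S)"
  unfolding has_derivative_within_alt
proof (intro conjI allI impI)
  fix e :: real assume e: "0 < e"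
  define \<eta> where "\<eta> = e / (4 * T + 4)"
  have \<eta>: "0 < \<eta>" "4 * T * \<eta> \<le> e" using T e by (auto simp: \<eta>_def field_simps)
  obtain d where d: "0 < d" "\<And>p q. p \<in> C \<Longrightarrow> q \<in> C \<Longrightarrow> norm (q - p) < d \<Longrightarrow> norm (X q - X p - X' p (q - p)) \<le> \<eta> * norm (q - p)"
    using X_linearization[OF \<eta>(1)] by blast
  have "norm (\<Psi> t y - \<Psi> t x - A t x (y - x)) \<le> e * norm (y - x)" if y: "y \<in> S" "norm (y - x) < d / 2" for y
  proof -
    let ?z = "\<lambda>t. \<Psi> t y - \<Psi> t x - A t x (y - x)"
    have dA: "((\<lambda>t. A t x (y - x)) has_vector_derivative (X' (\<Psi> t x) o\<^sub>L A t x) (y - x)) (at t within {0..T})" if "t \<in> {0..T}" for t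
      using bounded_linear.has_vector_derivative[OF blinfun.bounded_linear_left A(2)[OF x that]] .
    have "norm (?z t) \<le> 2 * norm (?z 0) + 2 * T * (2 * \<eta> * norm (y - x))"
    proof (rule small_time_gronwall[OF T l(2) _ has_vector_derivative_diff[OF has_vector_derivative_diff[OF \<Psi>[OF y(1)] \<Psi>[OF x]] dA] _ t])
      fix t assume t: "t \<in> {0..T}"
      have n: "norm (\<Psi> t y - \<Psi> t x) \<le> 2 * norm (y - x)" using flow_lipschitz[OF y(1) x t] .
      have "X (\<Psi> t y) - X (\<Psi> t x) - (X' (\<Psi> t x) o\<^sub>L A t x) (y - x)
        = X' (\<Psi> t x) (?z t) + (X (\<Psi> t y) - X (\<Psi> t x) - X' (\<Psi> t x) (\<Psi> t y - \<Psi> t x))"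
        by (simp add: blinfun.bilinear_simps)
      also have "norm \<dots> \<le> l * norm (?z t) + \<eta> * norm (\<Psi> t y - \<Psi> t x)"
      proof (intro order_trans[OF norm_triangle_ineq] add_mono)
        show "norm (X' (\<Psi> t x) (?z t)) \<le> l * norm (?z t)"
          using l(1)[OF \<Psi>C[OF x t]] by (intro order_trans[OF norm_blinfun] mult_right_mono) auto
        show "norm (X (\<Psi> t y) - X (\<Psi> t x) - X' (\<Psi> t x) (\<Psi> t y - \<Psi> t x)) \<le> \<eta> * norm (\<Psi> t y - \<Psi> t x)"
          using n y(2) by (intro d(2) \<Psi>C x y t) auto
      qed
      also have "\<dots> \<le> l * norm (?z t) + \<eta> * (2 * norm (y - x))"
        using n \<eta> by (intro add_left_mono mult_left_mono) auto
      finally show "norm (X (\<Psi> t y) - X (\<Psi> t x) - (X' (\<Psi> t x) o\<^sub>L A t x) (y - x)) \<le> l * norm (?z t) + 2 * \<eta> * norm (y - x)"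
        by simp
    qed (use \<eta> in auto)
    also have "2 * norm (?z 0) = 0" using x y by (simp add: \<Psi>0 A(1))
    also have "0 + 2 * T * (2 * \<eta> * norm (y - x)) = (4 * T * \<eta>) * norm (y - x)" by simp
    also have "\<dots> \<le> e * norm (y - x)" using \<eta> by (intro mult_right_mono) auto
    finally show ?thesis .
  qed
  then show "\<exists>d>0. \<forall>y\<in>S. norm (y - x) < d \<longrightarrow> norm (\<Psi> t y - \<Psi> t x - A t x (y - x)) \<le> e * norm (y - x)"
    using d(1) by (intro exI[of _ "d / 2"]) auto
qed (rule blinfun.bounded_linear_right)

text \<open>The hypothesis \<open>lie\<close> says that the Lie derivative of the form \<open>\<beta>\<close> along \<open>X\<close> vanishes.\<close>

lemma flow_preserves_form:
  fixes \<beta> :: "'a \<Rightarrow> 'a \<Rightarrow> 'a \<Rightarrow> real"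
  assumes bil: "\<And>y. y \<in> R \<Longrightarrow> bilinear (\<beta> y)"
    and d: "\<And>y i j. y \<in> R \<Longrightarrow> i \<in> Basis \<Longrightarrow> j \<in> Basis \<Longrightarrow> ((\<lambda>y. \<beta> y i j) has_derivative \<beta>' y i j) (at y within R)"
    and lie: "\<And>y u w. y \<in> R \<Longrightarrow> (\<Sum>i\<in>Basis. \<Sum>j\<in>Basis. (u \<bullet> i) * (w \<bullet> j) * \<beta>' y i j (X y)) + \<beta> y (X' y u) w + \<beta> y u (X' y w) = 0"
    and x: "x \<in> S" and R: "\<And>t. t \<in> {0..T} \<Longrightarrow> \<Psi> t x \<in> R" and t: "t \<in> {0..T}"
  shows "\<beta> (\<Psi> t x) (A t x u) (A t x w) = \<beta> x u w"
proof -
  have ex: "\<beta> y u w = (\<Sum>i\<in>Basis. \<Sum>j\<in>Basis. (u \<bullet> i) * (w \<bullet> j) * \<beta> y i j)" if "y \<in> R" for y u w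
  proof -
    have "\<beta> y u w = \<beta> y (\<Sum>i\<in>Basis. (u \<bullet> i) *\<^sub>R i) (\<Sum>j\<in>Basis. (w \<bullet> j) *\<^sub>R j)" by (simp add: euclidean_representation)
    also have "\<dots> = (\<Sum>(i,j)\<in>Basis \<times> Basis. \<beta> y ((u \<bullet> i) *\<^sub>R i) ((w \<bullet> j) *\<^sub>R j))"
      by (rule bilinear_sum[OF bil[OF that]])
    also have "\<dots> = (\<Sum>i\<in>Basis. \<Sum>j\<in>Basis. (u \<bullet> i) * (w \<bullet> j) * \<beta> y i j)"
      by (simp add: sum.cartesian_product[symmetric] bilinear_lmul[OF bil[OF that]] bilinear_rmul[OF bil[OF that]] mult_ac)
    finally show ?thesis .
  qed
  \<comment> \<open>In coordinates only the scalar coefficients of \<beta> vary with the base point;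
    the product rule then produces the three terms of \<open>lie\<close>.\<close>
  define G where "G s = (\<Sum>i\<in>Basis. \<Sum>j\<in>Basis. (A s x u \<bullet> i) * (A s x w \<bullet> j) * \<beta> (\<Psi> s x) i j)" for s
  have "(G has_derivative (\<lambda>h. 0)) (at s within {0..T})" if s: "s \<in> {0..T}" for s
  proof -
    let ?y = "\<Psi> s x" and ?a = "A s x u" and ?b = "A s x w"
    have dA: "((\<lambda>s. A s x v \<bullet> i) has_derivative (\<lambda>h. h * (X' ?y (A s x v) \<bullet> i))) (at s within {0..T})" for v i
      using bounded_linear.has_vector_derivative[OF bounded_linear_compose[OF bounded_linear_inner_left blinfun.bounded_linear_left] A(2)[OF x s], of v i]
      by (simp add: has_vector_derivative_def)
    have d\<beta>: "((\<lambda>s. \<beta> (\<Psi> s x) i j) has_derivative (\<lambda>h. h * \<beta>' ?y i j (X ?y))) (at s within {0..T})"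
      if ij: "i \<in> Basis" "j \<in> Basis" for i j
    proof -
      have "((\<lambda>y. \<beta> y i j) has_derivative \<beta>' ?y i j) (at ?y within (\<lambda>s. \<Psi> s x) ` {0..T})"
        by (rule has_derivative_subset[OF d[OF R[OF s] ij]]) (use R in auto)
      from has_derivative_in_compose[OF \<Psi>[OF x s, unfolded has_vector_derivative_def] this]
      show ?thesis
        using linear_scale[OF has_derivative_linear[OF d[OF R[OF s] ij]]] by simp
    qed
    have "(G has_derivative (\<lambda>h. \<Sum>i\<in>Basis. \<Sum>j\<in>Basis.
        (?a \<bullet> i) * (?b \<bullet> j) * (h * \<beta>' ?y i j (X ?y)) + ((?a \<bullet> i) * (h * (X' ?y ?b \<bullet> j)) + h * (X' ?y ?a \<bullet> i) * (?b \<bullet> j)) * \<beta> ?y i j))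
        (at s within {0..T})"
      unfolding G_def by (intro has_derivative_sum has_derivative_mult dA d\<beta>)
    moreover have "(\<Sum>i\<in>Basis. \<Sum>j\<in>Basis.
        (?a \<bullet> i) * (?b \<bullet> j) * (h * \<beta>' ?y i j (X ?y)) + ((?a \<bullet> i) * (h * (X' ?y ?b \<bullet> j)) + h * (X' ?y ?a \<bullet> i) * (?b \<bullet> j)) * \<beta> ?y i j)
      = h * ((\<Sum>i\<in>Basis. \<Sum>j\<in>Basis. (?a \<bullet> i) * (?b \<bullet> j) * \<beta>' ?y i j (X ?y)) + \<beta> ?y (X' ?y ?a) ?b + \<beta> ?y ?a (X' ?y ?b))" for h
    proof -
      have 1: "\<beta> ?y (X' ?y ?a) ?b = (\<Sum>i\<in>Basis. \<Sum>j\<in>Basis. (X' ?y ?a \<bullet> i) * (?b \<bullet> j) * \<beta> ?y i j)" by (rule ex[OF R[OF s]])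
      have 2: "\<beta> ?y ?a (X' ?y ?b) = (\<Sum>i\<in>Basis. \<Sum>j\<in>Basis. (?a \<bullet> i) * (X' ?y ?b \<bullet> j) * \<beta> ?y i j)" by (rule ex[OF R[OF s]])
      show ?thesis unfolding 1 2 sum.distrib[symmetric] sum_distrib_left
        by (intro sum.cong refl) (simp add: algebra_simps)
    qed
    ultimately show ?thesis by (simp add: lie[OF R[OF s]])
  qed
  then obtain k where k: "\<And>s. s \<in> {0..T} \<Longrightarrow> G s = k"
    using has_derivative_zero_constant[of "{0..T}" G] by auto
  have "G t = G 0" using k[OF t] k[of 0] T by simp
  moreover have "\<beta> (\<Psi> t x) (A t x u) (A t x w) = G t" unfolding G_def by (rule ex[OF R[OF t]])
  moreover have "\<beta> (\<Psi> 0 x) (A 0 x u) (A 0 x w) = G 0" unfolding G_def by (rule ex[OF R]) (use T in simp)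
  ultimately show ?thesis using x by (simp add: \<Psi>0 A(1))
qed

end

text \<open>The mean value theorem, applied to the first difference in direction u as a function of
  the step in direction w, leaves a difference of two values of \<open>h'\<close>, which is expanded
  at x.\<close>

lemma second_difference:
  fixes h :: "'a::real_normed_vector \<Rightarrow> real" and h' :: "'a \<Rightarrow> 'a \<Rightarrow>\<^sub>L real"
  assumes W: "open W" "x \<in> W" and h: "\<And>y. y \<in> W \<Longrightarrow> (h has_derivative h' y) (at y)"
    and h': "(h' has_derivative h'') (at x)" and e: "0 < e"
  shows "\<exists>d>0. \<forall>s. 0 < s \<and> s < d \<longrightarrow>
    \<bar>h (x + s *\<^sub>R u + s *\<^sub>R w) - h (x + s *\<^sub>R u) - h (x + s *\<^sub>R w) + h x - s\<^sup>2 * h'' u w\<bar> \<le> e * s\<^sup>2"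
proof -
  define c where "c = norm u + norm w + 1"
  have c: "0 < c" by (simp add: c_def add_nonneg_pos)
  \<comment> \<open>Each of the two remainders has norm at most \<open>\<epsilon> * (s * c)\<close>,
    acts on a vector of norm at most c and is multiplied by s; together they make
    \<open>e * s\<^sup>2\<close>.\<close>
  define \<epsilon> where "\<epsilon> = e / (2 * c * c)"
  have \<epsilon>: "0 < \<epsilon>" using e c by (simp add: \<epsilon>_def)
  obtain d1 where d1: "0 < d1" "\<And>y. norm (y - x) < d1 \<Longrightarrow> norm (h' y - h' x - h'' (y - x)) \<le> \<epsilon> * norm (y - x)"
    using h' \<epsilon> unfolding has_derivative_at_alt by blast
  obtain r where r: "0 < r" "ball x r \<subseteq> W" using W openE by blast
  define d where "d = min d1 r / c"
  have d: "0 < d" using d1 r c by (simp add: d_def)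
  have "\<bar>h (x + s *\<^sub>R u + s *\<^sub>R w) - h (x + s *\<^sub>R u) - h (x + s *\<^sub>R w) + h x - s\<^sup>2 * h'' u w\<bar> \<le> e * s\<^sup>2"
    if s: "0 < s" "s < d" for s
  proof -
    have sc: "s * c < min d1 r" using s c by (simp add: d_def pos_less_divide_eq)
    have nv: "norm (k *\<^sub>R u + t *\<^sub>R w) \<le> s * c" if "0 \<le> k" "k \<le> s" "0 \<le> t" "t \<le> s" for k t
    proof -
      have "norm (k *\<^sub>R u + t *\<^sub>R w) \<le> k * norm u + t * norm w"
        using that by (intro order_trans[OF norm_triangle_ineq]) simp
      also have "\<dots> \<le> s * norm u + s * norm w" using that by (intro add_mono mult_right_mono) auto
      also have "\<dots> \<le> s * c" using s by (simp add: c_def algebra_simps)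
      finally show ?thesis .
    qed
    have inW: "x + (k *\<^sub>R u + t *\<^sub>R w) \<in> W" if "0 \<le> k" "k \<le> s" "0 \<le> t" "t \<le> s" for k t
    proof (rule subsetD[OF r(2)])
      have "norm (k *\<^sub>R u + t *\<^sub>R w) < r" using nv[OF that] sc by simp
      then show "x + (k *\<^sub>R u + t *\<^sub>R w) \<in> ball x r" by (simp only: mem_ball dist_commute[of x]) (simp add: dist_norm)
    qed
    define g where "g t = h (x + (s *\<^sub>R u + t *\<^sub>R w)) - h (x + (0 *\<^sub>R u + t *\<^sub>R w))" for t
    have dh: "((\<lambda>t. h (x + (k *\<^sub>R u + t *\<^sub>R w))) has_derivative (\<lambda>q. h' (x + (k *\<^sub>R u + t *\<^sub>R w)) (q *\<^sub>R w))) (at t within {0..s})"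
      if "0 \<le> k" "k \<le> s" "t \<in> {0..s}" for k t
      by (rule has_derivative_compose[where g=h and g'="h' (x + (k *\<^sub>R u + t *\<^sub>R w))" and f="\<lambda>t. x + (k *\<^sub>R u + t *\<^sub>R w)", OF _ h[OF inW]]) (use that in \<open>auto intro!: derivative_eq_intros\<close>)
    have "\<exists>t\<in>{0..s}. g s - g 0 = h' (x + (s *\<^sub>R u + t *\<^sub>R w)) ((s - 0) *\<^sub>R w) - h' (x + (0 *\<^sub>R u + t *\<^sub>R w)) ((s - 0) *\<^sub>R w)"
      unfolding g_def using s by (intro mvt_very_simple has_derivative_diff dh) auto
    then obtain t where t: "t \<in> {0..s}" "g s - g 0 = s * (h' (x + (s *\<^sub>R u + t *\<^sub>R w)) w - h' (x + (0 *\<^sub>R u + t *\<^sub>R w)) w)"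
      by (auto simp: blinfun.scaleR_right algebra_simps)
    define R where "R v = h' (x + v) - h' x - h'' v" for v
    have R: "norm (R (k *\<^sub>R u + t *\<^sub>R w)) \<le> \<epsilon> * (s * c)" if "0 \<le> k" "k \<le> s" for k
    proof -
      have n: "norm (k *\<^sub>R u + t *\<^sub>R w) \<le> s * c" using nv[OF that] t(1) by auto
      have "norm (R (k *\<^sub>R u + t *\<^sub>R w)) \<le> \<epsilon> * norm (k *\<^sub>R u + t *\<^sub>R w)"
        using d1(2)[of "x + (k *\<^sub>R u + t *\<^sub>R w)"] n sc by (simp add: R_def)
      also have "\<dots> \<le> \<epsilon> * (s * c)" using n \<epsilon> by (intro mult_left_mono) auto
      finally show ?thesis .
    qed
    interpret h'': bounded_linear h'' by (rule has_derivative_bounded_linear[OF h'])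
    have "h' (x + (s *\<^sub>R u + t *\<^sub>R w)) - h' (x + (0 *\<^sub>R u + t *\<^sub>R w)) = s *\<^sub>R h'' u + (R (s *\<^sub>R u + t *\<^sub>R w) - R (0 *\<^sub>R u + t *\<^sub>R w))"
      by (simp add: R_def h''.add h''.scaleR)
    then have "h' (x + (s *\<^sub>R u + t *\<^sub>R w)) w - h' (x + (0 *\<^sub>R u + t *\<^sub>R w)) w
      = s * h'' u w + (R (s *\<^sub>R u + t *\<^sub>R w) - R (0 *\<^sub>R u + t *\<^sub>R w)) w"
      by (metis blinfun.add_left blinfun.diff_left blinfun.scaleR_left real_scaleR_def)
    then have "g s - g 0 - s\<^sup>2 * h'' u w = s * ((R (s *\<^sub>R u + t *\<^sub>R w) - R (0 *\<^sub>R u + t *\<^sub>R w)) w)"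
      unfolding t(2) by (simp add: algebra_simps power2_eq_square)
    then have "\<bar>g s - g 0 - s\<^sup>2 * h'' u w\<bar> = s * norm ((R (s *\<^sub>R u + t *\<^sub>R w) - R (0 *\<^sub>R u + t *\<^sub>R w)) w)"
      using s by (simp add: abs_mult)
    also have "\<dots> \<le> s * ((\<epsilon> * (s * c) + \<epsilon> * (s * c)) * c)"
    proof (intro mult_left_mono order_trans[OF norm_blinfun] mult_mono order_trans[OF norm_triangle_ineq4] add_mono)
      show "norm (R (s *\<^sub>R u + t *\<^sub>R w)) \<le> \<epsilon> * (s * c)" using R[of s] s by simp
      show "norm (R (0 *\<^sub>R u + t *\<^sub>R w)) \<le> \<epsilon> * (s * c)" using R[of 0] s by simp
    qed (use s \<epsilon> c in \<open>auto simp: c_def\<close>)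
    also have "\<dots> = e * s\<^sup>2" using c by (simp add: \<epsilon>_def power2_eq_square field_simps)
    finally show ?thesis by (simp add: g_def algebra_simps)
  qed
  then show ?thesis using d by blast
qed

text \<open>The second difference is symmetric in u and w and approximates both values. For the
  Hamiltonian this is the closedness of dH, which makes the flow symplectic.\<close>

lemma symmetric_second_derivative:
  fixes h :: "'a::real_normed_vector \<Rightarrow> real" and h' :: "'a \<Rightarrow> 'a \<Rightarrow>\<^sub>L real"
  assumes W: "open W" "x \<in> W" and h: "\<And>y. y \<in> W \<Longrightarrow> (h has_derivative h' y) (at y)"
    and h': "(h' has_derivative h'') (at x)"
  shows "h'' u w = h'' w u"
proof -
  have "\<bar>h'' u w - h'' w u\<bar> \<le> 0 + e" if e: "0 < e" for e
  proof -
    obtain d1 where d1: "0 < d1" "\<And>s. 0 < s \<Longrightarrow> s < d1 \<Longrightarrow>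
      \<bar>h (x + s *\<^sub>R u + s *\<^sub>R w) - h (x + s *\<^sub>R u) - h (x + s *\<^sub>R w) + h x - s\<^sup>2 * h'' u w\<bar> \<le> e / 2 * s\<^sup>2"
      using second_difference[OF W h h', of "e / 2" u w] e by auto
    obtain d2 where d2: "0 < d2" "\<And>s. 0 < s \<Longrightarrow> s < d2 \<Longrightarrow>
      \<bar>h (x + s *\<^sub>R w + s *\<^sub>R u) - h (x + s *\<^sub>R w) - h (x + s *\<^sub>R u) + h x - s\<^sup>2 * h'' w u\<bar> \<le> e / 2 * s\<^sup>2"
      using second_difference[OF W h h', of "e / 2" w u] e by auto
    define s where "s = min d1 d2 / 2"
    have s: "0 < s" "s < d1" "s < d2" using d1(1) d2(1) by (auto simp: s_def)
    have sw: "x + s *\<^sub>R w + s *\<^sub>R u = x + s *\<^sub>R u + s *\<^sub>R w" by simp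
    have sd: "\<bar>s\<^sup>2 * h'' u w - s\<^sup>2 * h'' w u\<bar> \<le> e * s\<^sup>2"
      using d1(2)[OF s(1,2)] d2(2)[OF s(1,3)] unfolding sw by linarith
    have "s\<^sup>2 * \<bar>h'' u w - h'' w u\<bar> \<le> s\<^sup>2 * e"
    proof -
      have "s\<^sup>2 * \<bar>h'' u w - h'' w u\<bar> = \<bar>s\<^sup>2 * h'' u w - s\<^sup>2 * h'' w u\<bar>"
        by (simp add: abs_mult flip: right_diff_distrib)
      also note sd
      finally show ?thesis by (simp add: mult.commute)
    qed
    then show ?thesis using s by simp
  qed
  then have "\<bar>h'' u w - h'' w u\<bar> \<le> 0" by (rule field_le_epsilon)
  then show ?thesis by simp
qed

section \<open>Functions of class \<open>C\<^sup>1\<close> on subsets\<close>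

text \<open>Continuity of the derivative is asked for each fixed direction instead of in operator
  norm. In finite dimension this is equivalent, and it passes more easily through products and
  sections.\<close>

definition ext_C1 :: "'a::euclidean_space set \<Rightarrow> ('a \<Rightarrow> 'b::real_normed_vector) \<Rightarrow> 'a \<Rightarrow> 'a set \<Rightarrow> ('a \<Rightarrow> 'b) \<Rightarrow> ('a \<Rightarrow> 'a \<Rightarrow> 'b) \<Rightarrow> bool" where
  "ext_C1 S g x W h d \<longleftrightarrow> open W \<and> x \<in> W \<and> (\<forall>y\<in>S \<inter> W. h y = g y) \<and>
     (\<forall>y\<in>W. (h has_derivative d y) (at y)) \<and> (\<forall>i. continuous_on W (\<lambda>y. d y i))"

lemma C1_onI:
  fixes g :: "'a::euclidean_space \<Rightarrow> 'b::real_normed_vector"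
  assumes "\<And>x. x \<in> S \<Longrightarrow> \<exists>W h d. ext_C1 S g x W h d"
  shows "C1_on S g"
  unfolding C1_on_def
proof
  fix x assume "x \<in> S"
  from assms[OF this] obtain W h d where e: "ext_C1 S g x W h d" by (elim exE)
  have W: "open W" "x \<in> W" "\<And>y. y \<in> S \<inter> W \<Longrightarrow> h y = g y" "\<And>y. y \<in> W \<Longrightarrow> (h has_derivative d y) (at y)"
    "\<And>i. continuous_on W (\<lambda>y. d y i)" using e by (auto simp: ext_C1_def)
  define h' where "h' y = Blinfun (d y)" for y
  have b: "blinfun_apply (h' y) = d y" if "y \<in> W" for y
    unfolding h'_def by (rule bounded_linear_Blinfun_apply) (rule has_derivative_bounded_linear[OF W(4)[OF that]])
  have "continuous_on W h'"
  proof (rule continuous_on_blinfun_componentwise)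
    fix i :: 'a
    show "continuous_on W (\<lambda>y. h' y i)" using W(5)[of i] by (rule continuous_on_eq) (simp add: b)
  qed
  then show "\<exists>W h (h' :: 'a \<Rightarrow> 'a \<Rightarrow>\<^sub>L 'b). open W \<and> x \<in> W \<and> (\<forall>y\<in>S \<inter> W. h y = g y) \<and>
     (\<forall>y\<in>W. (h has_derivative blinfun_apply (h' y)) (at y)) \<and> continuous_on W h'"
    using W b by (intro exI[of _ W] exI[of _ h] exI[of _ h']) auto
qed

lemma C1_onD:
  fixes g :: "'a::euclidean_space \<Rightarrow> 'b::real_normed_vector"
  assumes "C1_on S g" "x \<in> S" shows "\<exists>W h d. ext_C1 S g x W h d"
proof -
  obtain W h h' where "open W" "x \<in> W" "\<forall>y\<in>S \<inter> W. h y = g y"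
    "\<forall>y\<in>W. (h has_derivative blinfun_apply (h' y)) (at y)" "continuous_on W h'"
    using bspec[OF assms(1)[unfolded C1_on_def] assms(2)] by (elim exE conjE) (rule that)
  then have "ext_C1 S g x W h (\<lambda>y. blinfun_apply (h' y))"
    unfolding ext_C1_def by (auto intro!: continuous_intros)
  then show ?thesis by blast
qed

lemma C1_on_continuous:
  assumes "C1_on S g" shows "continuous_on S g"
  unfolding continuous_on_eq_continuous_within
proof
  fix x assume x: "x \<in> S"
  obtain W h h' where W: "open W" "x \<in> W" "\<forall>y\<in>S \<inter> W. h y = g y"
    "\<forall>y\<in>W. (h has_derivative blinfun_apply (h' y)) (at y)"
    using bspec[OF assms[unfolded C1_on_def] x] by (elim exE conjE) (rule that)
  have "isCont h x" using has_derivative_continuous[OF bspec[OF W(4,2)]] .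
  then have "(h \<longlongrightarrow> h x) (at x within S)" unfolding isCont_def by (rule tendsto_within_subset[OF _ subset_UNIV])
  moreover have "\<forall>\<^sub>F y in at x within S. h y = g y"
    using W by (auto simp: eventually_at_topological)
  ultimately have "(g \<longlongrightarrow> h x) (at x within S)" using tendsto_cong by force
  then show "continuous (at x within S) g" using W x by (simp add: continuous_within)
qed

lemma C1_on_section:
  fixes g :: "'a::euclidean_space \<times> 'b::euclidean_space \<Rightarrow> 'c::real_normed_vector"
  assumes "C1_on (S \<times> UNIV) g" shows "C1_on S (\<lambda>x. g (x, a))"
proof (rule C1_onI)
  fix x assume "x \<in> S"
  then have "(x, a) \<in> S \<times> UNIV" by simp
  from C1_onD[OF assms this] obtain W h d where e: "ext_C1 (S \<times> UNIV) g (x, a) W h d" by (elim exE)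
  have W: "open W" "(x, a) \<in> W" "\<And>y. y \<in> (S \<times> UNIV) \<inter> W \<Longrightarrow> h y = g y" "\<And>y. y \<in> W \<Longrightarrow> (h has_derivative d y) (at y)"
    "\<And>i. continuous_on W (\<lambda>y. d y i)" using e by (auto simp: ext_C1_def)
  let ?V = "(\<lambda>x. (x, a)) -` W"
  have "((\<lambda>x. h (x, a)) has_derivative (\<lambda>v. d (y, a) (v, 0))) (at y)" if "y \<in> ?V" for y
  proof -
    have "((\<lambda>x. (x, a)) has_derivative (\<lambda>v. (v, 0))) (at y)" by (auto intro!: derivative_eq_intros)
    from has_derivative_compose[OF this W(4)] that show ?thesis by simp
  qed
  moreover have "open ?V" by (intro open_vimage W continuous_intros)
  moreover have "continuous_on ?V (\<lambda>y. d (y, a) (i, 0))" for i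
    by (rule continuous_on_compose2[OF W(5)]) (auto intro!: continuous_intros)
  ultimately have "ext_C1 S (\<lambda>x. g (x, a)) x ?V (\<lambda>x. h (x, a)) (\<lambda>y v. d (y, a) (v, 0))"
    unfolding ext_C1_def using W(2,3) by auto
  then show "\<exists>W h d. ext_C1 S (\<lambda>x. g (x, a)) x W h d" by blast
qed

lemma (in bounded_bilinear) C1_on_prod:
  fixes g :: "'d::euclidean_space \<Rightarrow> 'a" and k :: "'d \<Rightarrow> 'b"
  assumes "C1_on S g" "C1_on S k" shows "C1_on S (\<lambda>x. prod (g x) (k x))"
proof (rule C1_onI)
  fix x assume x: "x \<in> S"
  from C1_onD[OF assms(1) x] obtain W h d where e1: "ext_C1 S g x W h d" by (elim exE)
  from C1_onD[OF assms(2) x] obtain V j e where e2: "ext_C1 S k x V j e" by (elim exE)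
  have "continuous_on W h" "continuous_on V j"
    using e1 e2 unfolding ext_C1_def by (auto intro!: continuous_at_imp_continuous_on has_derivative_continuous)
  then have c: "continuous_on (W \<inter> V) h" "continuous_on (W \<inter> V) j"
    by (auto intro: continuous_on_subset)
  have d: "continuous_on (W \<inter> V) (\<lambda>y. d y i)" "continuous_on (W \<inter> V) (\<lambda>y. e y i)" for i
    using e1 e2 unfolding ext_C1_def by (auto intro: continuous_on_subset)
  have "continuous_on (W \<inter> V) (\<lambda>y. prod (h y) (e y i) + prod (d y i) (j y))" for i
    by (intro continuous_on_add continuous_on c d)
  then have "ext_C1 S (\<lambda>x. prod (g x) (k x)) x (W \<inter> V) (\<lambda>x. prod (h x) (j x)) (\<lambda>y v. prod (h y) (e y v) + prod (d y v) (j y))"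
    using e1 e2 unfolding ext_C1_def by (auto intro!: FDERIV)
  then show "\<exists>W h d. ext_C1 S (\<lambda>x. prod (g x) (k x)) x W h d" by blast
qed

lemma C1_on_add:
  fixes g :: "'d::euclidean_space \<Rightarrow> 'a::real_normed_vector"
  assumes "C1_on S g" "C1_on S k" shows "C1_on S (\<lambda>x. g x + k x)"
proof (rule C1_onI)
  fix x assume x: "x \<in> S"
  from C1_onD[OF assms(1) x] obtain W h d where e1: "ext_C1 S g x W h d" by (elim exE)
  from C1_onD[OF assms(2) x] obtain V j e where e2: "ext_C1 S k x V j e" by (elim exE)
  have "ext_C1 S (\<lambda>x. g x + k x) x (W \<inter> V) (\<lambda>x. h x + j x) (\<lambda>y v. d y v + e y v)"
    using e1 e2 unfolding ext_C1_def by (auto intro!: has_derivative_add continuous_on_add intro: continuous_on_subset)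
  then show "\<exists>W h d. ext_C1 S (\<lambda>x. g x + k x) x W h d" by blast
qed

lemma C1_on_const: "C1_on S (\<lambda>_ :: 'd::euclidean_space. c)"
proof (rule C1_onI)
  fix x :: 'd
  have "ext_C1 S (\<lambda>_. c) x UNIV (\<lambda>_. c) (\<lambda>_ _. 0)" by (simp add: ext_C1_def)
  then show "\<exists>W h d. ext_C1 S (\<lambda>_. c) x W h d" by blast
qed

lemma C1_on_sum:
  fixes g :: "'i \<Rightarrow> 'd::euclidean_space \<Rightarrow> 'a::real_normed_vector"
  assumes "finite I" "\<And>i. i \<in> I \<Longrightarrow> C1_on S (g i)" shows "C1_on S (\<lambda>x. \<Sum>i\<in>I. g i x)"
  using assms by (induction I) (auto intro: C1_on_const C1_on_add)

lemma C1_on_cong: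
  fixes g :: "'a::real_normed_vector \<Rightarrow> 'b::real_normed_vector"
  assumes "C1_on S g" "\<And>x. x \<in> S \<Longrightarrow> g x = k x" shows "C1_on S k"
  unfolding C1_on_def
proof
  fix x assume x: "x \<in> S"
  obtain W h and h' :: "'a \<Rightarrow> 'a \<Rightarrow>\<^sub>L 'b" where "open W" "x \<in> W" "\<forall>y\<in>S \<inter> W. h y = g y"
    "\<forall>y\<in>W. (h has_derivative blinfun_apply (h' y)) (at y)" "continuous_on W h'"
    using bspec[OF assms(1)[unfolded C1_on_def] x] by (elim exE conjE) (rule that)
  then show "\<exists>W h (h' :: 'a \<Rightarrow> 'a \<Rightarrow>\<^sub>L 'b). open W \<and> x \<in> W \<and> (\<forall>y\<in>S \<inter> W. h y = k y) \<and>
     (\<forall>y\<in>W. (h has_derivative blinfun_apply (h' y)) (at y)) \<and> continuous_on W h'"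
    using assms(2) by (intro exI[of _ W] exI[of _ h] exI[of _ h']) auto
qed

lemma C1_on_has_derivative:
  assumes "C1_on S g" "x \<in> S" shows "\<exists>d. (g has_derivative d) (at x within S)"
proof -
  obtain W h h' where W: "open W" "x \<in> W" "\<forall>y\<in>S \<inter> W. h y = g y" "\<forall>y\<in>W. (h has_derivative blinfun_apply (h' y)) (at y)"
    using bspec[OF assms(1)[unfolded C1_on_def] assms(2)] by (elim exE conjE) (rule that)
  have "(h has_derivative blinfun_apply (h' x)) (at x within S)" by (rule has_derivative_at_withinI[OF bspec[OF W(4,2)]])
  then have "(g has_derivative blinfun_apply (h' x)) (at x within S)"
  proof -
    obtain e where e: "0 < e" "ball x e \<subseteq> W" using W(1,2) openE by blast
    have "h y = g y" if "y \<in> S" "dist y x < e" for y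
      using that e(2) W(3) by (auto simp: dist_commute subset_iff)
    then show ?thesis
      by (rule has_derivative_transform_within[OF \<open>(h has_derivative blinfun_apply (h' x)) (at x within S)\<close> e(1) assms(2)])
  qed
  then show ?thesis by blast
qed

lemma C2_on_imp_C1_on:
  fixes g :: "'a::real_normed_vector \<Rightarrow> 'b::real_normed_vector"
  assumes "C2_on S g" shows "C1_on S g"
  unfolding C1_on_def
proof
  fix x assume x: "x \<in> S"
  obtain W h and h' :: "'a \<Rightarrow> 'a \<Rightarrow>\<^sub>L 'b" and h'' :: "'a \<Rightarrow> 'a \<Rightarrow>\<^sub>L ('a \<Rightarrow>\<^sub>L 'b)"
    where W: "open W" "x \<in> W" "\<forall>y\<in>S \<inter> W. h y = g y"
    "\<forall>y\<in>W. (h has_derivative blinfun_apply (h' y)) (at y)" "\<forall>y\<in>W. (h' has_derivative blinfun_apply (h'' y)) (at y)"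
    using bspec[OF assms[unfolded C2_on_def] x] by (elim exE conjE) (rule that)
  have "continuous_on W h'"
    using W(5) by (auto intro!: continuous_at_imp_continuous_on has_derivative_continuous)
  then show "\<exists>W h (h' :: 'a \<Rightarrow> 'a \<Rightarrow>\<^sub>L 'b). open W \<and> x \<in> W \<and> (\<forall>y\<in>S \<inter> W. h y = g y) \<and>
     (\<forall>y\<in>W. (h has_derivative blinfun_apply (h' y)) (at y)) \<and> continuous_on W h'"
    using W by (intro exI[of _ W] exI[of _ h] exI[of _ h']) auto
qed

section \<open>Relatively open subsets of half-spaces\<close>

definition half_open :: "'a::euclidean_space set \<Rightarrow> bool" where
  "half_open S \<longleftrightarrow> (\<exists>v. openin (top_of_set {x. 0 \<le> v \<bullet> x}) S)"

lemma half_open_ball: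
  assumes "openin (top_of_set {x. 0 \<le> v \<bullet> x}) S" "x \<in> S"
  obtains r where "0 < r" "cball x r \<inter> {x. 0 \<le> v \<bullet> x} \<subseteq> S"
  using assms unfolding openin_contains_cball by blast

text \<open>At a boundary point of the half-space at least one of i and - i points inwards for each
  basis vector i, and approach along one side of each axis already determines the
  derivative.\<close>

lemma half_open_derivative_unique:
  fixes S :: "'a::euclidean_space set" and g :: "'a \<Rightarrow> 'b::real_normed_vector"
  assumes S: "half_open S" and x: "x \<in> S"
    and g: "(g has_derivative d) (at x within S)" "(g has_derivative e) (at x within S)"
  shows "d = e"
proof (rule frechet_derivative_unique_within[OF g])
  fix i :: 'a and \<epsilon> :: real assume i: "i \<in> Basis" "0 < \<epsilon>"
  obtain v where v: "openin (top_of_set {x. 0 \<le> v \<bullet> x}) S" using S unfolding half_open_def by blast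
  obtain r where r: "0 < r" "cball x r \<inter> {x. 0 \<le> v \<bullet> x} \<subseteq> S"
    using half_open_ball[OF v x] by blast
  define s :: real where "s = (if 0 \<le> v \<bullet> i then 1 else - 1)"
  define q where "q = s * (min \<epsilon> r / 2)"
  have "0 \<le> v \<bullet> x" using openin_imp_subset[OF v] x by auto
  moreover have "0 \<le> q * (v \<bullet> i)" using r i by (auto simp: q_def s_def zero_le_mult_iff mult_le_0_iff)
  ultimately have "0 \<le> v \<bullet> (x + q *\<^sub>R i)" by (simp add: inner_add_right)
  moreover have aq: "\<bar>q\<bar> = min \<epsilon> r / 2" using r i by (simp add: q_def s_def abs_mult)
  then have "x + q *\<^sub>R i \<in> cball x r" using r i by (simp add: dist_norm)
  ultimately show "\<exists>d. 0 < \<bar>d\<bar> \<and> \<bar>d\<bar> < \<epsilon> \<and> x + d *\<^sub>R i \<in> S"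
    using r aq i by (intro exI[of _ q]) auto
qed

lemma frechet_derivative_half_open:
  assumes "half_open S" "x \<in> S" "(g has_derivative d) (at x within S)"
  shows "frechet_derivative g (at x within S) = d"
proof -
  have "g differentiable (at x within S)" using assms(3) differentiableI by blast
  then show ?thesis using half_open_derivative_unique[OF assms(1,2) _ assms(3)] frechet_derivative_works by blast
qed

section \<open>Derivatives in the symplectic trivialization\<close>

locale sympl_manifold =
  fixes \<A> :: "('a::{t2_space,second_countable_topology}, 'n::finite + 'n) chart set"
    and \<omega> :: "('a, 'n + 'n) two_form"
    and f :: "'a \<times> ('a, 'n + 'n) tangent \<Rightarrow> 'a \<times> (real ^ ('n + 'n))"
  assumes mf: "C2_manifold_with_boundary \<A>" and sf: "symplectic_form \<A> \<omega>"
    and tr: "C1_symplectic_trivialization \<A> \<omega> f"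
begin

lemma charts_atD: "c \<in> charts_at \<A> \<xi> \<Longrightarrow> c \<in> \<A>" "c \<in> charts_at \<A> \<xi> \<Longrightarrow> \<xi> \<in> fst c"
  by (auto simp: charts_at_def)

lemma ex_chart_at: "\<exists>c. c \<in> charts_at \<A> \<xi>"
proof -
  have "\<xi> \<in> (\<Union>c\<in>\<A>. fst c)" using mf unfolding C2_manifold_with_boundary_def by simp
  then show ?thesis unfolding charts_at_def by blast
qed

lemma chart:
  assumes "c \<in> \<A>"
  shows "open (fst c)" "half_open (chart_image c)" "homeomorphism (fst c) (chart_image c) (snd c) (chart_inv c)"
  using mf assms by (auto simp: C2_manifold_with_boundary_def half_open_def)

lemma chart_inv_snd: "c \<in> \<A> \<Longrightarrow> \<xi> \<in> fst c \<Longrightarrow> chart_inv c (snd c \<xi>) = \<xi>"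
  using chart(3) by (auto simp: homeomorphism_def)

lemma snd_chart_inv: "c \<in> \<A> \<Longrightarrow> x \<in> chart_image c \<Longrightarrow> snd c (chart_inv c x) = x"
  using chart(3) by (auto simp: homeomorphism_def)

lemma chart_inv_in: "c \<in> \<A> \<Longrightarrow> x \<in> chart_image c \<Longrightarrow> chart_inv c x \<in> fst c"
  using chart(3)[of c] unfolding homeomorphism_def by blast

lemma snd_in: "\<xi> \<in> fst c \<Longrightarrow> snd c \<xi> \<in> chart_image c"
  by (auto simp: chart_image_def)

lemma continuous_chart: "c \<in> \<A> \<Longrightarrow> continuous_on (fst c) (snd c)"
  and continuous_chart_inv: "c \<in> \<A> \<Longrightarrow> continuous_on (chart_image c) (chart_inv c)"
  using chart(3) by (auto simp: homeomorphism_def)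

lemma chart_image_open:
  assumes c: "c \<in> \<A>" and U: "open U"
  obtains W where "open W" "snd c ` (fst c \<inter> U) = chart_image c \<inter> W"
proof -
  have "openin (top_of_set (chart_image c)) (chart_image c \<inter> chart_inv c -` U)"
    by (rule continuous_openin_preimage_gen[OF continuous_chart_inv[OF c] U])
  then obtain W where W: "open W" "chart_image c \<inter> chart_inv c -` U = chart_image c \<inter> W"
    by (auto simp: openin_open)
  have "snd c ` (fst c \<inter> U) = chart_image c \<inter> chart_inv c -` U"
  proof (intro set_eqI iffI)
    fix x assume "x \<in> snd c ` (fst c \<inter> U)"
    then show "x \<in> chart_image c \<inter> chart_inv c -` U" using c by (auto simp: chart_inv_snd snd_in)
  next
    fix x assume "x \<in> chart_image c \<inter> chart_inv c -` U"
    then have "chart_inv c x \<in> fst c \<inter> U" "snd c (chart_inv c x) = x" using c by (auto simp: chart_inv_in snd_chart_inv)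
    then show "x \<in> snd c ` (fst c \<inter> U)" by (metis imageI)
  qed
  then show ?thesis using that[OF W(1)] W(2) by simp
qed

text \<open>Shrinking the domain of a chart around \<xi> does not change the filter, so the
  derivatives that the definitions take within various overlaps can all be taken within
  \<open>chart_image c\<close>.\<close>

lemma at_chart:
  assumes c: "c \<in> \<A>" and x: "\<xi> \<in> fst c" and U: "open U" "\<xi> \<in> U"
  shows "at (snd c \<xi>) within snd c ` (fst c \<inter> U) = at (snd c \<xi>) within chart_image c"
proof -
  obtain W where W: "open W" "snd c ` (fst c \<inter> U) = chart_image c \<inter> W" by (rule chart_image_open[OF c U(1)]) (rule that)
  have "snd c \<xi> \<in> W" using W(2) x U(2) by blast
  then show ?thesis unfolding W(2) using W(1) by (intro at_within_nhd[of _ W]) auto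
qed

text \<open>A relation instead of a chosen derivative, so that the chain rule and uniqueness apply
  directly. Points that g sends outside the domain of c' give meaningless values, but if g is
  continuous and \<open>g \<xi>\<close> is in that domain, they stay away from \<xi>.\<close>

definition dd :: "('a \<Rightarrow> 'a) \<Rightarrow> ('a, 'n + 'n) chart \<Rightarrow> ('a, 'n + 'n) chart \<Rightarrow> 'a
    \<Rightarrow> (real ^ ('n + 'n) \<Rightarrow> real ^ ('n + 'n)) \<Rightarrow> bool" where
  "dd g c c' \<xi> d \<longleftrightarrow> ((\<lambda>x. snd c' (g (chart_inv c x))) has_derivative d) (at (snd c \<xi>) within chart_image c)"

lemma dd_unique: "c \<in> charts_at \<A> \<xi> \<Longrightarrow> dd g c c' \<xi> d \<Longrightarrow> dd g c c' \<xi> e \<Longrightarrow> d = e"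
  unfolding dd_def by (rule half_open_derivative_unique[OF chart(2) snd_in]) (auto dest: charts_atD)

lemma frechet_dd:
  assumes "c \<in> charts_at \<A> \<xi>" "dd g c c' \<xi> d"
  shows "frechet_derivative (\<lambda>x. snd c' (g (chart_inv c x))) (at (snd c \<xi>) within chart_image c) = d"
  using assms unfolding dd_def
  by (intro frechet_derivative_half_open[OF chart(2) snd_in]) (auto dest: charts_atD)

lemma dd_comp:
  assumes c: "c \<in> charts_at \<A> \<xi>" and c': "c' \<in> charts_at \<A> (g \<xi>)"
    and g: "continuous_on UNIV g" and d: "dd g c c' \<xi> d" and e: "dd h c' c'' (g \<xi>) e"
  shows "dd (\<lambda>\<eta>. h (g \<eta>)) c c'' \<xi> (\<lambda>u. e (d u))"
proof -
  note cA = charts_atD[OF c] and cA' = charts_atD[OF c']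
  let ?U = "g -` fst c'"
  have U: "open ?U" "\<xi> \<in> ?U"
    using chart(1)[OF cA'(1)] g cA' by (auto intro: open_vimage)
  let ?s = "snd c ` (fst c \<inter> ?U)"
  let ?g = "\<lambda>x. snd c' (g (chart_inv c x))"
  have at: "at (snd c \<xi>) within ?s = at (snd c \<xi>) within chart_image c" by (rule at_chart[OF cA U])
  have "(?g has_derivative d) (at (snd c \<xi>) within ?s)" using d by (simp add: dd_def at)
  moreover have "?g ` ?s \<subseteq> chart_image c'" using cA(1) by (auto simp: chart_inv_snd snd_in)
  then have "((\<lambda>x. snd c'' (h (chart_inv c' x))) has_derivative e) (at (?g (snd c \<xi>)) within ?g ` ?s)"
    using e cA by (simp add: dd_def chart_inv_snd has_derivative_subset)
  ultimately have "((\<lambda>x. snd c'' (h (chart_inv c' (?g x)))) has_derivative (\<lambda>u. e (d u))) (at (snd c \<xi>) within ?s)"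
    by (rule has_derivative_in_compose)
  then have "((\<lambda>x. snd c'' (h (g (chart_inv c x)))) has_derivative (\<lambda>u. e (d u))) (at (snd c \<xi>) within ?s)"
    by (rule has_derivative_transform[rotated 2]) (use cA cA' U in \<open>auto simp: chart_inv_snd\<close>)
  then show ?thesis by (simp add: dd_def at)
qed

lemma transition_dd:
  assumes c: "c \<in> charts_at \<A> \<xi>" and c': "c' \<in> charts_at \<A> \<xi>"
  shows "dd (\<lambda>\<eta>. \<eta>) c c' \<xi> (transition_deriv c c' \<xi>)"
proof -
  note cA = charts_atD[OF c] and cA' = charts_atD[OF c']
  have "C1_on (snd c ` (fst c \<inter> fst c')) (\<lambda>x. snd c' (chart_inv c x))"
    using mf cA cA' by (auto simp: C2_manifold_with_boundary_def intro: C2_on_imp_C1_on)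
  then have "\<exists>d. ((\<lambda>x. snd c' (chart_inv c x)) has_derivative d) (at (snd c \<xi>) within snd c ` (fst c \<inter> fst c'))"
    by (rule C1_on_has_derivative) (use cA cA' in auto)
  moreover have at: "at (snd c \<xi>) within snd c ` (fst c \<inter> fst c') = at (snd c \<xi>) within chart_image c"
    by (rule at_chart[OF cA chart(1)[OF cA'(1)] cA'(2)])
  ultimately obtain d where d: "dd (\<lambda>\<eta>. \<eta>) c c' \<xi> d" by (auto simp: dd_def)
  then have "transition_deriv c c' \<xi> = d"
    unfolding transition_deriv_def at by (intro frechet_dd[OF c])
  then show ?thesis using d by simp
qed

lemma transition_comp:
  assumes "c \<in> charts_at \<A> \<xi>" "c' \<in> charts_at \<A> \<xi>" "c'' \<in> charts_at \<A> \<xi>"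
  shows "transition_deriv c' c'' \<xi> (transition_deriv c c' \<xi> u) = transition_deriv c c'' \<xi> u"
proof -
  have "dd (\<lambda>\<eta>. \<eta>) c c'' \<xi> (\<lambda>u. transition_deriv c' c'' \<xi> (transition_deriv c c' \<xi> u))"
    by (rule dd_comp[where g="\<lambda>\<eta>. \<eta>" and h="\<lambda>\<eta>. \<eta>", OF assms(1) assms(2) continuous_on_id
          transition_dd[OF assms(1,2)] transition_dd[OF assms(2,3)]])
  from dd_unique[OF assms(1) this transition_dd[OF assms(1,3)]] show ?thesis by (rule fun_cong)
qed

lemma transition_id:
  assumes c: "c \<in> charts_at \<A> \<xi>" shows "transition_deriv c c \<xi> u = u"
proof -
  note cA = charts_atD[OF c]
  have "((\<lambda>x. x) has_derivative (\<lambda>u. u)) (at (snd c \<xi>) within chart_image c)" by (rule has_derivative_ident)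
  then have "dd (\<lambda>\<eta>. \<eta>) c c \<xi> (\<lambda>u. u)"
    unfolding dd_def by (rule has_derivative_transform[rotated 2]) (use cA in \<open>auto simp: snd_chart_inv snd_in\<close>)
  from dd_unique[OF c transition_dd[OF c c] this] show ?thesis by (rule fun_cong)
qed

lemma tvec_in:
  assumes c: "c \<in> charts_at \<A> \<xi>" shows "tvec \<A> c \<xi> u \<in> tangent_space \<A> \<xi>"
  using transition_comp[OF c] by (auto simp: tvec_def tangent_space_def)

lemma tvec_self: "c \<in> charts_at \<A> \<xi> \<Longrightarrow> tvec \<A> c \<xi> u c = u"
  by (simp add: tvec_def transition_id)

lemma tvec_component:
  assumes c: "c \<in> charts_at \<A> \<xi>" and v: "v \<in> tangent_space \<A> \<xi>"
  shows "tvec \<A> c \<xi> (v c) = v"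
proof
  fix c'
  show "tvec \<A> c \<xi> (v c) c' = v c'"
  proof (cases "c' \<in> charts_at \<A> \<xi>")
    case True
    then have "v c' = transition_deriv c c' \<xi> (v c)" using v c unfolding tangent_space_def by blast
    then show ?thesis using True by (simp add: tvec_def)
  next
    case False
    then have "v c' = 0" using v unfolding tangent_space_def by blast
    then show ?thesis using False by (simp add: tvec_def)
  qed
qed

lemma tvec_change:
  assumes c: "c \<in> charts_at \<A> \<xi>" and c': "c' \<in> charts_at \<A> \<xi>"
  shows "tvec \<A> c' \<xi> (transition_deriv c c' \<xi> u) = tvec \<A> c \<xi> u"
  using transition_comp[OF c c'] by (auto simp: tvec_def fun_eq_iff)

section \<open>The trivialization in chart coordinates\<close>

definition T :: "('a, 'n + 'n) chart \<Rightarrow> 'a \<Rightarrow> real ^ ('n + 'n) \<Rightarrow> real ^ ('n + 'n)" where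
  "T c \<xi> u = snd (f (\<xi>, tvec \<A> c \<xi> u))"

definition Ti :: "('a, 'n + 'n) chart \<Rightarrow> 'a \<Rightarrow> real ^ ('n + 'n) \<Rightarrow> real ^ ('n + 'n)" where
  "Ti c \<xi> a = Phi \<A> f \<xi> a c"

lemma f_bij: "bij_betw f (tangent_bundle \<A>) UNIV"
  and f_fst: "v \<in> tangent_space \<A> \<xi> \<Longrightarrow> fst (f (\<xi>, v)) = \<xi>"
  using tr by (auto simp: C1_symplectic_trivialization_def tangent_bundle_def)

lemma T_linear: "c \<in> charts_at \<A> \<xi> \<Longrightarrow> linear (T c \<xi>)"
  using tr by (auto simp: C1_symplectic_trivialization_def T_def[abs_def])

lemma Phi: "Phi \<A> f \<xi> a \<in> tangent_space \<A> \<xi>" "f (\<xi>, Phi \<A> f \<xi> a) = (\<xi>, a)"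
proof -
  have "inv_into (tangent_bundle \<A>) f (\<xi>, a) \<in> tangent_bundle \<A>"
    using f_bij by (intro inv_into_into) (auto simp: bij_betw_def)
  then obtain \<eta> v where v: "inv_into (tangent_bundle \<A>) f (\<xi>, a) = (\<eta>, v)" "v \<in> tangent_space \<A> \<eta>"
    by (auto simp: tangent_bundle_def)
  have "f (inv_into (tangent_bundle \<A>) f (\<xi>, a)) = (\<xi>, a)"
    using f_bij by (intro f_inv_into_f) (auto simp: bij_betw_def)
  then have 1: "f (\<eta>, v) = (\<xi>, a)" using v by simp
  then have "\<eta> = \<xi>" using f_fst[OF v(2)] by simp
  then show "Phi \<A> f \<xi> a \<in> tangent_space \<A> \<xi>" "f (\<xi>, Phi \<A> f \<xi> a) = (\<xi>, a)"
    using v 1 by (auto simp: Phi_def)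
qed

lemma f_eqD:
  assumes "v \<in> tangent_space \<A> \<xi>" "w \<in> tangent_space \<A> \<xi>" "snd (f (\<xi>, v)) = snd (f (\<xi>, w))"
  shows "v = w"
proof -
  have "f (\<xi>, v) = f (\<xi>, w)" using assms f_fst by (metis prod.collapse)
  moreover have "(\<xi>, v) \<in> tangent_bundle \<A>" "(\<xi>, w) \<in> tangent_bundle \<A>" using assms by (auto simp: tangent_bundle_def)
  ultimately show ?thesis using f_bij by (auto simp: bij_betw_def inj_on_def)
qed

lemma Phi_inj: "Phi \<A> f \<xi> a = Phi \<A> f \<xi> b \<Longrightarrow> a = b"
  by (metis Phi(2) snd_conv)

lemma T_Ti: "c \<in> charts_at \<A> \<xi> \<Longrightarrow> T c \<xi> (Ti c \<xi> a) = a"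
  using Phi[of \<xi> a] by (simp add: T_def Ti_def tvec_component)

lemma Ti_T: "c \<in> charts_at \<A> \<xi> \<Longrightarrow> Ti c \<xi> (T c \<xi> u) = u"
proof -
  assume c: "c \<in> charts_at \<A> \<xi>"
  have "Phi \<A> f \<xi> (T c \<xi> u) = tvec \<A> c \<xi> u"
    by (rule f_eqD[OF Phi(1) tvec_in[OF c]]) (simp add: Phi(2) T_def)
  then show ?thesis by (simp add: Ti_def tvec_self c)
qed

lemma Ti_linear: "c \<in> charts_at \<A> \<xi> \<Longrightarrow> linear (Ti c \<xi>)"
proof (rule linearI)
  assume c: "c \<in> charts_at \<A> \<xi>"
  note l = T_linear[OF c]
  fix a b and r :: real
  show "Ti c \<xi> (a + b) = Ti c \<xi> a + Ti c \<xi> b"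
    using Ti_T[OF c, of "Ti c \<xi> a + Ti c \<xi> b"] by (simp add: linear_add[OF l] T_Ti[OF c])
  show "Ti c \<xi> (r *\<^sub>R a) = r *\<^sub>R Ti c \<xi> a"
    using Ti_T[OF c, of "r *\<^sub>R Ti c \<xi> a"] by (simp add: linear_scale[OF l] T_Ti[OF c])
qed

lemma T_change: "c \<in> charts_at \<A> \<xi> \<Longrightarrow> c' \<in> charts_at \<A> \<xi> \<Longrightarrow> T c' \<xi> (transition_deriv c c' \<xi> u) = T c \<xi> u"
  by (simp add: T_def tvec_change)

lemma form_T:
  assumes c: "c \<in> \<A>" and x: "x \<in> chart_image c"
  shows "form_in_chart \<A> \<omega> c x u w = omega0 (T c (chart_inv c x) u) (T c (chart_inv c x) w)"
proof -
  have "c \<in> charts_at \<A> (chart_inv c x)" using c x by (simp add: charts_at_def chart_inv_in)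
  from tvec_in[OF this] show ?thesis
    using tr by (simp add: form_in_chart_def T_def C1_symplectic_trivialization_def)
qed

lemma C1_T: "c \<in> \<A> \<Longrightarrow> C1_on (chart_image c) (\<lambda>x. T c (chart_inv c x) u)"
  and C1_Ti: "c \<in> \<A> \<Longrightarrow> C1_on (chart_image c) (\<lambda>x. Ti c (chart_inv c x) a)"
  using tr C1_on_section[of "chart_image c" "\<lambda>(x, u). snd (f (chart_inv c x, tvec \<A> c (chart_inv c x) u))" u]
    C1_on_section[of "chart_image c" "\<lambda>(x, a). snd (inv_into (tangent_bundle \<A>) f (chart_inv c x, a)) c" a]
  by (auto simp: C1_symplectic_trivialization_def T_def Ti_def Phi_def)

text \<open>\<open>Dg g \<xi> M\<close>: the matrix of the differential of \<open>g\<close> at \<open>\<xi>\<close> in the trivialization is \<open>M\<close>.\<close>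

definition Dg :: "('a \<Rightarrow> 'a) \<Rightarrow> 'a \<Rightarrow> real ^ ('n + 'n) ^ ('n + 'n) \<Rightarrow> bool" where
  "Dg g \<xi> M \<longleftrightarrow> (\<forall>c\<in>charts_at \<A> \<xi>. \<forall>c'\<in>charts_at \<A> (g \<xi>). dd g c c' \<xi> (\<lambda>u. Ti c' (g \<xi>) (M *v T c \<xi> u)))"

lemma Dg_id: "Dg (\<lambda>\<eta>. \<eta>) \<xi> (mat 1)"
  unfolding Dg_def
proof (intro ballI)
  fix c c' assume c: "c \<in> charts_at \<A> \<xi>" "c' \<in> charts_at \<A> \<xi>"
  have "(\<lambda>u. Ti c' \<xi> (mat 1 *v T c \<xi> u)) = transition_deriv c c' \<xi>"
  proof
    fix u
    show "Ti c' \<xi> (mat 1 *v T c \<xi> u) = transition_deriv c c' \<xi> u"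
      using Ti_T[OF c(2), of "transition_deriv c c' \<xi> u"] by (simp only: T_change[OF c] matrix_vector_mul_lid)
  qed
  then show "dd (\<lambda>\<eta>. \<eta>) c c' \<xi> (\<lambda>u. Ti c' \<xi> (mat 1 *v T c \<xi> u))" using transition_dd[OF c] by simp
qed

lemma Dg_comp:
  assumes g: "continuous_on UNIV g" and M: "Dg g \<xi> M" and N: "Dg h (g \<xi>) N"
  shows "Dg (\<lambda>\<eta>. h (g \<eta>)) \<xi> (N ** M)"
  unfolding Dg_def
proof (intro ballI)
  fix c c'' assume c: "c \<in> charts_at \<A> \<xi>" "c'' \<in> charts_at \<A> (h (g \<xi>))"
  obtain c' where c': "c' \<in> charts_at \<A> (g \<xi>)" using ex_chart_at by blast
  have "dd (\<lambda>\<eta>. h (g \<eta>)) c c'' \<xi> (\<lambda>u. Ti c'' (h (g \<xi>)) (N *v T c' (g \<xi>) (Ti c' (g \<xi>) (M *v T c \<xi> u))))"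
    by (rule dd_comp[OF c(1) c' g bspec[OF bspec[OF M[unfolded Dg_def] c(1)] c'] bspec[OF bspec[OF N[unfolded Dg_def] c'] c(2)]])
  then show "dd (\<lambda>\<eta>. h (g \<eta>)) c c'' \<xi> (\<lambda>u. Ti c'' (h (g \<xi>)) ((N ** M) *v T c \<xi> u))"
    by (simp add: T_Ti[OF c'] matrix_vector_mul_assoc)
qed

text \<open>One pair of charts suffices: transition maps change the chart expression of the
  differential, and \<open>T\<close> and \<open>Ti\<close> absorb them.\<close>

lemma DgI:
  assumes g: "continuous_on UNIV g" and c: "c \<in> charts_at \<A> \<xi>" and c': "c' \<in> charts_at \<A> (g \<xi>)"
    and d: "dd g c c' \<xi> d"
  shows "Dg g \<xi> (matrix (\<lambda>a. T c' (g \<xi>) (d (Ti c \<xi> a))))"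
  unfolding Dg_def
proof (intro ballI)
  fix b b' assume b: "b \<in> charts_at \<A> \<xi>" "b' \<in> charts_at \<A> (g \<xi>)"
  have ld: "linear d" using d by (auto simp: dd_def intro: has_derivative_linear)
  have "linear (\<lambda>a. T c' (g \<xi>) (d (Ti c \<xi> a)))"
    using linear_compose[OF linear_compose[OF Ti_linear[OF c] ld] T_linear[OF c']] by (simp add: comp_def)
  then have m: "matrix (\<lambda>a. T c' (g \<xi>) (d (Ti c \<xi> a))) *v a = T c' (g \<xi>) (d (Ti c \<xi> a))" for a
    by (simp add: matrix_works linear_def scalar_mult_eq_scaleR)
  have "dd (\<lambda>\<eta>. g \<eta>) b c' \<xi> (\<lambda>u. d (transition_deriv b c \<xi> u))"
    by (rule dd_comp[where g="\<lambda>\<eta>. \<eta>" and h=g, OF b(1) c continuous_on_id transition_dd[OF b(1) c] d])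
  then have "dd (\<lambda>\<eta>. g \<eta>) b b' \<xi> (\<lambda>u. transition_deriv c' b' (g \<xi>) (d (transition_deriv b c \<xi> u)))"
    by (rule dd_comp[where g=g and h="\<lambda>\<eta>. \<eta>", OF b(1) c' g _ transition_dd[OF c' b(2)]])
  moreover have "transition_deriv c' b' (g \<xi>) (d (transition_deriv b c \<xi> u))
    = Ti b' (g \<xi>) (matrix (\<lambda>a. T c' (g \<xi>) (d (Ti c \<xi> a))) *v T b \<xi> u)" for u
  proof -
    have "Ti c \<xi> (T b \<xi> u) = transition_deriv b c \<xi> u"
      using Ti_T[OF c, of "transition_deriv b c \<xi> u"] by (simp only: T_change[OF b(1) c])
    moreover have "Ti b' (g \<xi>) (T c' (g \<xi>) w) = transition_deriv c' b' (g \<xi>) w" for w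
      using Ti_T[OF b(2), of "transition_deriv c' b' (g \<xi>) w"] by (simp only: T_change[OF c' b(2)])
    ultimately show ?thesis by (simp add: m)
  qed
  ultimately show "dd g b b' \<xi> (\<lambda>u. Ti b' (g \<xi>) (matrix (\<lambda>a. T c' (g \<xi>) (d (Ti c \<xi> a))) *v T b \<xi> u))" by simp
qed

text \<open>This ties the differential computed in an arbitrarily chosen chart to the chart-free
  matrix; as \<open>Phi\<close> is injective, \<open>gamma0\<close> can then be read off from
  \<open>Dg\<close>.\<close>

lemma dmap_Phi:
  assumes g: "continuous_on UNIV g" and M: "Dg g \<xi> M"
  shows "dmap \<A> g \<xi> (Phi \<A> f \<xi> x) = Phi \<A> f (g \<xi>) (M *v x)"
proof
  fix c'
  define c where "c = (SOME c. c \<in> charts_at \<A> \<xi>)"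
  have c: "c \<in> charts_at \<A> \<xi>" unfolding c_def using ex_chart_at by (rule someI_ex)
  note cA = charts_atD[OF c]
  show "dmap \<A> g \<xi> (Phi \<A> f \<xi> x) c' = Phi \<A> f (g \<xi>) (M *v x) c'"
  proof (cases "c' \<in> charts_at \<A> (g \<xi>)")
    case True
    note cA' = charts_atD[OF True]
    have "{\<eta> \<in> fst c. g \<eta> \<in> fst c'} = fst c \<inter> g -` fst c'" by auto
    moreover have "open (g -` fst c')" "\<xi> \<in> g -` fst c'"
      using chart(1)[OF cA'(1)] g cA' by (auto intro: open_vimage)
    ultimately have at: "at (snd c \<xi>) within snd c ` {\<eta> \<in> fst c. g \<eta> \<in> fst c'} = at (snd c \<xi>) within chart_image c"
      using at_chart[OF cA] by simp
    have d: "dd g c c' \<xi> (\<lambda>u. Ti c' (g \<xi>) (M *v T c \<xi> u))" using M c True by (auto simp: Dg_def)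
    have "dmap \<A> g \<xi> (Phi \<A> f \<xi> x) c' = Ti c' (g \<xi>) (M *v T c \<xi> (Phi \<A> f \<xi> x c))"
      using True by (simp add: dmap_def Let_def c_def[symmetric] at frechet_dd[OF c d])
    also have "T c \<xi> (Phi \<A> f \<xi> x c) = x" using T_Ti[OF c, of x] by (simp add: Ti_def)
    finally show ?thesis by (simp add: Ti_def)
  next
    case False
    then have "Phi \<A> f (g \<xi>) (M *v x) c' = 0" using Phi(1)[of "g \<xi>" "M *v x"] unfolding tangent_space_def by blast
    then show ?thesis using False by (simp add: dmap_def Let_def)
  qed
qed

lemma gamma0_eq:
  assumes "continuous_on UNIV (\<phi> t)" "Dg (\<phi> t) \<xi> M"
  shows "gamma0 \<A> f \<phi> t \<xi> = M"
proof -
  have "inj (Phi \<A> f (\<phi> t \<xi>))" using Phi_inj by (rule injI)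
  then show ?thesis unfolding gamma0_def by (simp add: dmap_Phi[OF assms])
qed

end

section \<open>Hamiltonian vector fields\<close>

locale hamiltonian_flow = sympl_manifold \<A> \<omega> f
  for \<A> :: "('a::{t2_space,second_countable_topology}, 'n::finite + 'n) chart set"
    and \<omega> :: "('a, 'n + 'n) two_form"
    and f :: "'a \<times> ('a, 'n + 'n) tangent \<Rightarrow> 'a \<times> (real ^ ('n + 'n))" +
  fixes H :: "'a \<Rightarrow> real" and X_H :: "'a \<Rightarrow> ('a, 'n + 'n) tangent" and \<phi> :: "real \<Rightarrow> 'a \<Rightarrow> 'a"
  assumes H: "C2_function \<A> H" and X_H: "hamiltonian_vector_field \<A> \<omega> H X_H"
    and flow: "complete_flow \<A> X_H \<phi>" and cpt: "compact (UNIV :: 'a set)"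
begin

definition Hc :: "('a, 'n + 'n) chart \<Rightarrow> real ^ ('n + 'n) \<Rightarrow> real" where
  "Hc c x = H (chart_inv c x)"

definition dH :: "('a, 'n + 'n) chart \<Rightarrow> real ^ ('n + 'n) \<Rightarrow> (real ^ ('n + 'n)) \<Rightarrow>\<^sub>L real" where
  "dH c x = Blinfun (frechet_derivative (Hc c) (at x within chart_image c))"

definition X :: "('a, 'n + 'n) chart \<Rightarrow> real ^ ('n + 'n) \<Rightarrow> real ^ ('n + 'n)" where
  "X c x = X_H (chart_inv c x) c"

text \<open>A local C^2 extension of H, whose derivative agrees with \<open>dH\<close> also at
  boundary points because derivatives on half-open sets are unique.\<close>

lemma Hc_ext:
  assumes c: "c \<in> \<A>" and x: "x \<in> chart_image c"
  obtains W h and h' :: "real ^ ('n + 'n) \<Rightarrow> (real ^ ('n + 'n)) \<Rightarrow>\<^sub>L real"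
    and h'' :: "real ^ ('n + 'n) \<Rightarrow> (real ^ ('n + 'n)) \<Rightarrow>\<^sub>L ((real ^ ('n + 'n)) \<Rightarrow>\<^sub>L real)"
  where "open W" "x \<in> W" "\<And>y. y \<in> W \<Longrightarrow> (h has_derivative h' y) (at y)" "\<And>y. y \<in> W \<Longrightarrow> (h' has_derivative h'' y) (at y)"
    "continuous_on W h''" "\<And>y. y \<in> chart_image c \<inter> W \<Longrightarrow> dH c y = h' y"
    "\<And>y. y \<in> chart_image c \<inter> W \<Longrightarrow> (Hc c has_derivative h' y) (at y within chart_image c)"
proof -
  have "C2_on (chart_image c) (Hc c)"
    using H c unfolding C2_function_def Hc_def[abs_def] by blast
  from bspec[OF this[unfolded C2_on_def] x] obtain W h and h' :: "real ^ ('n + 'n) \<Rightarrow> (real ^ ('n + 'n)) \<Rightarrow>\<^sub>L real"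
    and h'' :: "real ^ ('n + 'n) \<Rightarrow> (real ^ ('n + 'n)) \<Rightarrow>\<^sub>L ((real ^ ('n + 'n)) \<Rightarrow>\<^sub>L real)"
    where W: "open W" "x \<in> W" "\<forall>y\<in>chart_image c \<inter> W. h y = Hc c y"
      "\<forall>y\<in>W. (h has_derivative h' y) (at y)" "\<forall>y\<in>W. (h' has_derivative h'' y) (at y)" "continuous_on W h''"
    by (elim exE conjE) (rule that)
  have d: "(Hc c has_derivative h' y) (at y within chart_image c)" if y: "y \<in> chart_image c \<inter> W" for y
  proof -
    obtain e where e: "0 < e" "ball y e \<subseteq> W" by (rule openE[OF W(1) IntD2[OF y]]) (rule that)
    have "(h has_derivative h' y) (at y within chart_image c)"
      by (rule has_derivative_at_withinI[OF bspec[OF W(4) IntD2[OF y]]])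
    then show ?thesis
    proof (rule has_derivative_transform_within[OF _ e(1) IntD1[OF y]])
      fix z assume z: "z \<in> chart_image c" "dist z y < e"
      then have "z \<in> ball y e" by (simp add: dist_commute)
      then show "h z = Hc c z" using W(3) e(2) z(1) by blast
    qed
  qed
  have dHh: "dH c y = h' y" if y: "y \<in> chart_image c \<inter> W" for y
    unfolding dH_def frechet_derivative_half_open[OF chart(2)[OF c] IntD1[OF y] d[OF y]]
    by (rule blinfun_apply_inverse)
  show ?thesis by (rule that[OF W(1,2) bspec[OF W(4)] bspec[OF W(5)] W(6) dHh d])
qed

lemma Hc_derivative:
  assumes c: "c \<in> \<A>" and x: "x \<in> chart_image c"
  shows "(Hc c has_derivative dH c x) (at x within chart_image c)"
proof -
  obtain W h h' h'' where W: "open W" "x \<in> W"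
    "\<And>y. y \<in> chart_image c \<inter> W \<Longrightarrow> dH c y = h' y"
    "\<And>y. y \<in> chart_image c \<inter> W \<Longrightarrow> (Hc c has_derivative blinfun_apply (h' y)) (at y within chart_image c)"
    by (rule Hc_ext[OF c x]) (rule that)
  then show ?thesis using W(3,4)[OF IntI[OF x W(2)]] by simp
qed

lemma C1_dH:
  assumes c: "c \<in> \<A>" shows "C1_on (chart_image c) (dH c)"
  unfolding C1_on_def
proof
  fix x assume x: "x \<in> chart_image c"
  obtain W h h' h'' where W: "open W" "x \<in> W"
    "\<And>y. y \<in> W \<Longrightarrow> (h' has_derivative blinfun_apply (h'' y)) (at y)" "continuous_on W h''"
    "\<And>y. y \<in> chart_image c \<inter> W \<Longrightarrow> dH c y = h' y"
    by (rule Hc_ext[OF c x]) (rule that)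
  show "\<exists>W h (h' :: real ^ ('n + 'n) \<Rightarrow> (real ^ ('n + 'n)) \<Rightarrow>\<^sub>L _).
    open W \<and> x \<in> W \<and> (\<forall>y\<in>chart_image c \<inter> W. h y = dH c y) \<and>
    (\<forall>y\<in>W. (h has_derivative blinfun_apply (h' y)) (at y)) \<and> continuous_on W h'"
    by (intro exI[of _ W] exI[of _ h'] exI[of _ h''] conjI ballI) (simp_all only: W)
qed

lemma dH_symmetric_derivative:
  assumes c: "c \<in> \<A>" and x: "x \<in> chart_image c"
  obtains d where "(dH c has_derivative d) (at x within chart_image c)" "\<And>u w. blinfun_apply (d u) w = d w u"
proof -
  obtain W h h' h'' where W: "open W" "x \<in> W" "\<And>y. y \<in> W \<Longrightarrow> (h has_derivative blinfun_apply (h' y)) (at y)"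
    "\<And>y. y \<in> W \<Longrightarrow> (h' has_derivative blinfun_apply (h'' y)) (at y)"
    "\<And>y. y \<in> chart_image c \<inter> W \<Longrightarrow> dH c y = h' y"
    by (rule Hc_ext[OF c x]) (rule that)
  obtain e where e: "0 < e" "ball x e \<subseteq> W" by (rule openE[OF W(1,2)]) (rule that)
  have "(h' has_derivative h'' x) (at x within chart_image c)" by (rule has_derivative_at_withinI[OF W(4)[OF W(2)]])
  then have "(dH c has_derivative h'' x) (at x within chart_image c)"
  proof (rule has_derivative_transform_within[OF _ e(1) x])
    fix z assume z: "z \<in> chart_image c" "dist z x < e"
    then have "z \<in> ball x e" by (simp add: dist_commute)
    then have "z \<in> chart_image c \<inter> W" using e(2) z(1) by blast
    then show "h' z = dH c z" using W(5) by simp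
  qed
  moreover have "h'' x u w = h'' x w u" for u w
    by (rule symmetric_second_derivative[OF W(1,2,3) W(4)[OF W(2)]])
  ultimately show ?thesis by (rule that)
qed

lemma dfun_chart:
  assumes c: "c \<in> charts_at \<A> \<xi>"
  shows "dfun \<A> H \<xi> (tvec \<A> c \<xi> u) = dH c (snd c \<xi>) u"
proof -
  define b where "b = (SOME c. c \<in> charts_at \<A> \<xi>)"
  have b: "b \<in> charts_at \<A> \<xi>" unfolding b_def using ex_chart_at by (rule someI_ex)
  note cA = charts_atD[OF c] and bA = charts_atD[OF b]
  let ?s = "snd c ` (fst c \<inter> fst b)" and ?g = "\<lambda>x. snd b (chart_inv c x)"
  have at: "at (snd c \<xi>) within ?s = at (snd c \<xi>) within chart_image c"
    by (rule at_chart[OF cA chart(1)[OF bA(1)] bA(2)])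
  have "(?g has_derivative transition_deriv c b \<xi>) (at (snd c \<xi>) within ?s)"
    using transition_dd[OF c b] by (simp add: dd_def at)
  moreover have "?g ` ?s \<subseteq> chart_image b" using cA(1) by (auto simp: chart_inv_snd snd_in)
  then have "(Hc b has_derivative dH b (snd b \<xi>)) (at (?g (snd c \<xi>)) within ?g ` ?s)"
    using Hc_derivative[OF bA(1) snd_in[OF bA(2)]] cA by (simp add: chart_inv_snd has_derivative_subset)
  ultimately have "((\<lambda>x. Hc b (?g x)) has_derivative (\<lambda>u. dH b (snd b \<xi>) (transition_deriv c b \<xi> u))) (at (snd c \<xi>) within ?s)"
    by (rule has_derivative_in_compose)
  then have "(Hc c has_derivative (\<lambda>u. dH b (snd b \<xi>) (transition_deriv c b \<xi> u))) (at (snd c \<xi>) within ?s)"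
    by (rule has_derivative_transform[rotated 2]) (use cA bA in \<open>auto simp: chart_inv_snd Hc_def\<close>)
  then have "(Hc c has_derivative (\<lambda>u. dH b (snd b \<xi>) (transition_deriv c b \<xi> u))) (at (snd c \<xi>) within chart_image c)"
    by (simp add: at)
  then have "blinfun_apply (dH c (snd c \<xi>)) = (\<lambda>u. dH b (snd b \<xi>) (transition_deriv c b \<xi> u))"
    using half_open_derivative_unique[OF chart(2)[OF cA(1)] snd_in[OF cA(2)] Hc_derivative[OF cA(1) snd_in[OF cA(2)]]] by blast
  moreover have "dfun \<A> H \<xi> (tvec \<A> c \<xi> u) = frechet_derivative (Hc b) (at (snd b \<xi>) within chart_image b) (transition_deriv c b \<xi> u)"
    using b by (simp add: dfun_def Let_def b_def[symmetric] tvec_def Hc_def[abs_def])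
  moreover have "frechet_derivative (Hc b) (at (snd b \<xi>) within chart_image b) = dH b (snd b \<xi>)"
    by (rule frechet_derivative_half_open[OF chart(2)[OF bA(1)] snd_in[OF bA(2)] Hc_derivative[OF bA(1) snd_in[OF bA(2)]]])
  ultimately show ?thesis by simp
qed

text \<open>In the trivialization the form is given by \<open>J0\<close>, whose square is - 1, so
  the defining equation can be solved for the field. The explicit sum exhibits the field as C^1,
  since \<open>dH\<close> and \<open>Ti\<close> are.\<close>

lemma X_formula:
  assumes c: "c \<in> \<A>" and x: "x \<in> chart_image c"
  shows "X c x = (\<Sum>j\<in>Basis. dH c x (Ti c (chart_inv c x) j) *\<^sub>R Ti c (chart_inv c x) (J0 *v j))"
    and "form_in_chart \<A> \<omega> c x (X c x) w = - dH c x w"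
proof -
  let ?\<xi> = "chart_inv c x"
  have c': "c \<in> charts_at \<A> ?\<xi>" using c x by (simp add: charts_at_def chart_inv_in)
  have Xt: "X_H ?\<xi> \<in> tangent_space \<A> ?\<xi>" "\<And>Y. Y \<in> tangent_space \<A> ?\<xi> \<Longrightarrow> \<omega> ?\<xi> (X_H ?\<xi>) Y = - dfun \<A> H ?\<xi> Y"
    using X_H unfolding hamiltonian_vector_field_def by auto
  have Xv: "tvec \<A> c ?\<xi> (X c x) = X_H ?\<xi>" unfolding X_def by (rule tvec_component[OF c' Xt(1)])
  have form: "form_in_chart \<A> \<omega> c x (X c x) w = - dH c x w" for w
    using Xt(2)[OF tvec_in[OF c']] by (simp add: form_in_chart_def Xv dfun_chart[OF c'] snd_chart_inv[OF c x])
  then show "form_in_chart \<A> \<omega> c x (X c x) w = - dH c x w" .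
  define a where "a = T c ?\<xi> (X c x)"
  have a: "(J0 *v a) \<bullet> w = - dH c x (Ti c ?\<xi> w)" for w
    using form[of "Ti c ?\<xi> w"] unfolding form_T[OF c x] by (simp add: omega0_def a_def T_Ti[OF c'])
  have "J0 *v a = (\<Sum>j\<in>Basis. ((J0 *v a) \<bullet> j) *\<^sub>R j)" by (simp add: euclidean_representation)
  also have "\<dots> = - (\<Sum>j\<in>Basis. dH c x (Ti c ?\<xi> j) *\<^sub>R j)" by (simp add: a sum_negf)
  finally have "J0 *v (J0 *v a) = - (J0 *v (\<Sum>j\<in>Basis. dH c x (Ti c ?\<xi> j) *\<^sub>R j))"
    by (simp add: linear_neg[OF matrix_vector_mul_linear])
  then have a': "a = (\<Sum>j\<in>Basis. dH c x (Ti c ?\<xi> j) *\<^sub>R (J0 *v j))"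
    by (simp add: J0_J0 linear_sum[OF matrix_vector_mul_linear] matrix_vector_mult_scaleR)
  have "X c x = Ti c ?\<xi> a" by (simp add: a_def Ti_T[OF c'])
  also have "\<dots> = (\<Sum>j\<in>Basis. dH c x (Ti c ?\<xi> j) *\<^sub>R Ti c ?\<xi> (J0 *v j))"
    unfolding a' by (simp add: linear_sum[OF Ti_linear[OF c']] linear_scale[OF Ti_linear[OF c']])
  finally show "X c x = (\<Sum>j\<in>Basis. dH c x (Ti c ?\<xi> j) *\<^sub>R Ti c ?\<xi> (J0 *v j))" .
qed

lemma C1_X:
  assumes c: "c \<in> \<A>" shows "C1_on (chart_image c) (X c)"
proof (rule C1_on_cong)
  show "C1_on (chart_image c) (\<lambda>x. \<Sum>j\<in>Basis. dH c x (Ti c (chart_inv c x) j) *\<^sub>R Ti c (chart_inv c x) (J0 *v j))"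
    by (intro C1_on_sum bounded_bilinear.C1_on_prod[OF bounded_bilinear_scaleR]
        bounded_bilinear.C1_on_prod[OF bounded_bilinear_blinfun_apply] C1_dH C1_Ti c finite_Basis)
qed (simp add: X_formula(1)[OF c])

section \<open>The Lie derivative of the symplectic form along the Hamiltonian field\<close>

abbreviation \<beta> :: "('a, 'n + 'n) chart \<Rightarrow> real ^ ('n + 'n) \<Rightarrow> real ^ ('n + 'n) \<Rightarrow> real ^ ('n + 'n) \<Rightarrow> real" where
  "\<beta> c \<equiv> form_in_chart \<A> \<omega> c"

definition B :: "('a, 'n + 'n) chart \<Rightarrow> real ^ ('n + 'n) \<Rightarrow> real ^ ('n + 'n) \<Rightarrow> real ^ ('n + 'n) \<Rightarrow> real ^ ('n + 'n) \<Rightarrow> real" where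
  "B c x v w = frechet_derivative (\<lambda>y. \<beta> c y v w) (at x within chart_image c)"

lemma \<beta>_bilinear: "c \<in> \<A> \<Longrightarrow> x \<in> chart_image c \<Longrightarrow> bilinear (\<beta> c x)"
  using sf unfolding symplectic_form_def by blast

lemma \<beta>_antisym:
  assumes c: "c \<in> \<A>" and x: "x \<in> chart_image c" shows "\<beta> c x u w = - \<beta> c x w u"
proof -
  have "c \<in> charts_at \<A> (chart_inv c x)" using c x by (simp add: charts_at_def chart_inv_in)
  from tvec_in[OF this] have z: "\<beta> c x v v = 0" for v
    using sf unfolding symplectic_form_def form_in_chart_def by blast
  note bl = \<beta>_bilinear[OF c x]
  have "\<beta> c x (u + w) (u + w) = \<beta> c x u u + \<beta> c x u w + \<beta> c x w u + \<beta> c x w w"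
    by (simp add: bilinear_ladd[OF bl] bilinear_radd[OF bl])
  then show ?thesis by (simp add: z)
qed

lemma B:
  assumes c: "c \<in> \<A>" and x: "x \<in> chart_image c"
  shows "((\<lambda>y. \<beta> c y v w) has_derivative B c x v w) (at x within chart_image c)"
proof -
  have "C1_on (chart_image c) (\<lambda>y. \<beta> c y v w)" using sf c unfolding symplectic_form_def by blast
  from C1_on_has_derivative[OF this x] have "(\<lambda>y. \<beta> c y v w) differentiable (at x within chart_image c)"
    by (auto simp: differentiable_def)
  then show ?thesis unfolding B_def by (simp add: frechet_derivative_works)
qed

lemma \<beta>_expand:
  assumes c: "c \<in> \<A>" and x: "x \<in> chart_image c"
  shows "\<beta> c x v w = (\<Sum>i\<in>Basis. (v \<bullet> i) * \<beta> c x i w)" "\<beta> c x v w = (\<Sum>j\<in>Basis. (w \<bullet> j) * \<beta> c x v j)"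
proof -
  have l: "linear (\<lambda>v. \<beta> c x v w)" "linear (\<beta> c x v)" using \<beta>_bilinear[OF c x] by (auto simp: bilinear_def)
  show "\<beta> c x v w = (\<Sum>i\<in>Basis. (v \<bullet> i) * \<beta> c x i w)"
    by (subst euclidean_representation[of v, symmetric]) (simp add: linear_sum[OF l(1)] linear_scale[OF l(1)])
  show "\<beta> c x v w = (\<Sum>j\<in>Basis. (w \<bullet> j) * \<beta> c x v j)"
    by (subst euclidean_representation[of w, symmetric]) (simp add: linear_sum[OF l(2)] linear_scale[OF l(2)])
qed

lemma B_eqI:
  assumes c: "c \<in> \<A>" and x: "x \<in> chart_image c"
    and d: "(g has_derivative d) (at x within chart_image c)" and g: "\<And>y. y \<in> chart_image c \<Longrightarrow> g y = \<beta> c y v w"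
  shows "B c x v w u = d u"
proof -
  have "((\<lambda>y. \<beta> c y v w) has_derivative d) (at x within chart_image c)"
    by (rule has_derivative_transform[OF x _ d]) (simp add: g)
  from half_open_derivative_unique[OF chart(2)[OF c] x B[OF c x] this] show ?thesis by (rule fun_cong)
qed

lemma B_expand:
  assumes c: "c \<in> \<A>" and x: "x \<in> chart_image c"
  shows "B c x v w u = (\<Sum>i\<in>Basis. (v \<bullet> i) * B c x i w u)" "B c x v w u = (\<Sum>j\<in>Basis. (w \<bullet> j) * B c x v j u)"
proof -
  show "B c x v w u = (\<Sum>i\<in>Basis. (v \<bullet> i) * B c x i w u)"
    by (rule B_eqI[OF c x has_derivative_sum[OF has_derivative_mult_right[OF B[OF c x]]]]) (simp add: \<beta>_expand(1)[OF c, of _ v w])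
  show "B c x v w u = (\<Sum>j\<in>Basis. (w \<bullet> j) * B c x v j u)"
    by (rule B_eqI[OF c x has_derivative_sum[OF has_derivative_mult_right[OF B[OF c x]]]]) (simp add: \<beta>_expand(2)[OF c, of _ v w])
qed

text \<open>This is Cartan's formula in coordinates. The contraction of the exterior derivative
  vanishes by closedness of the form; the other term is the exterior derivative of - dH, which
  vanishes because the Hessian is symmetric.\<close>

lemma lie_derivative_zero:
  assumes c: "c \<in> \<A>" and x: "x \<in> chart_image c" and Xd: "(X c has_derivative Xd) (at x within chart_image c)"
  shows "(\<Sum>i\<in>Basis. \<Sum>j\<in>Basis. (u \<bullet> i) * (w \<bullet> j) * B c x i j (X c x)) + \<beta> c x (Xd u) w + \<beta> c x u (Xd w) = 0"
proof -
  obtain d2 where d2: "(dH c has_derivative d2) (at x within chart_image c)" "\<And>u w. blinfun_apply (d2 u) w = d2 w u"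
    by (rule dH_symmetric_derivative[OF c x]) (rule that)
  \<comment> \<open>The identity \<open>\<beta> c y (X c y) w = - dH c y w\<close> is differentiated
    in direction u.\<close>
  have E: "\<beta> c x (Xd u) w + B c x (X c x) w u = - d2 u w" for u w
  proof -
    let ?d = "\<lambda>u. \<Sum>i\<in>Basis. (X c x \<bullet> i) * B c x i w u + (Xd u \<bullet> i) * \<beta> c x i w"
    have 1: "((\<lambda>y. \<Sum>i\<in>Basis. (X c y \<bullet> i) * \<beta> c y i w) has_derivative ?d) (at x within chart_image c)"
      by (intro has_derivative_sum has_derivative_mult B[OF c x] has_derivative_inner_left Xd)
    have "((\<lambda>y. - dH c y w) has_derivative (\<lambda>u. - d2 u w)) (at x within chart_image c)"
      by (intro has_derivative_minus bounded_linear.has_derivative[OF blinfun.bounded_linear_left] d2(1))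
    then have 2: "((\<lambda>y. \<Sum>i\<in>Basis. (X c y \<bullet> i) * \<beta> c y i w) has_derivative (\<lambda>u. - d2 u w)) (at x within chart_image c)"
    proof (rule has_derivative_transform[OF x, rotated])
      fix y assume y: "y \<in> chart_image c"
      show "(\<Sum>i\<in>Basis. (X c y \<bullet> i) * \<beta> c y i w) = - dH c y w"
        unfolding \<beta>_expand(1)[OF c y, symmetric] by (rule X_formula(2)[OF c y])
    qed
    have "?d u = - d2 u w"
      using half_open_derivative_unique[OF chart(2)[OF c] x 1 2] by (rule fun_cong)
    then show ?thesis
      unfolding B_expand(1)[OF c x, of "X c x"] \<beta>_expand(1)[OF c x, of "Xd u"] by (simp add: sum.distrib add.commute)
  qed
  have "ext_deriv (chart_image c) (\<beta> c) x (X c x) u w = 0" using sf c x unfolding symplectic_form_def by blast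
  then have ext: "B c x u w (X c x) - B c x (X c x) w u + B c x (X c x) u w = 0" by (simp add: ext_deriv_def B_def)
  have "B c x u w (X c x) = (\<Sum>i\<in>Basis. \<Sum>j\<in>Basis. (u \<bullet> i) * (w \<bullet> j) * B c x i j (X c x))"
  proof -
    have "B c x u w (X c x) = (\<Sum>i\<in>Basis. (u \<bullet> i) * (\<Sum>j\<in>Basis. (w \<bullet> j) * B c x i j (X c x)))"
      unfolding B_expand(2)[OF c x, of _ w, symmetric] by (rule B_expand(1)[OF c x])
    then show ?thesis by (simp add: sum_distrib_left mult.assoc)
  qed
  then show ?thesis using ext E[of u w] E[of w u] d2(2)[of u w] \<beta>_antisym[OF c x, of u "Xd w"] by linarith
qed

section \<open>The linearized flow\<close>

lemma flow_0: "\<phi> 0 \<xi> = \<xi>"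
  and flow_isCont: "isCont (\<lambda>s. \<phi> s \<xi>) t"
  and flow_derivative: "c \<in> charts_at \<A> (\<phi> t \<xi>) \<Longrightarrow> ((\<lambda>s. snd c (\<phi> s \<xi>)) has_vector_derivative X_H (\<phi> t \<xi>) c) (at t)"
  using flow unfolding complete_flow_def by blast+

lemma flow_continuous_time: "continuous_on S (\<lambda>s. \<phi> s \<xi>)"
  using flow_isCont by (simp add: continuous_at_imp_continuous_on)

text \<open>In a small closed ball the chart image coincides with a half-space, hence is compact and
  convex there, and the field has a C^1 extension. The common bound l is kept positive because later
  time spans divide by it.\<close>

lemma chart_nbhd:
  assumes c: "c \<in> \<A>" and x0: "x0 \<in> chart_image c"
  obtains \<rho> l and X' :: "real ^ ('n + 'n) \<Rightarrow> (real ^ ('n + 'n)) \<Rightarrow>\<^sub>L (real ^ ('n + 'n))" where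
    "0 < \<rho>" "0 < l" "\<And>r. r \<le> \<rho> \<Longrightarrow> compact (chart_image c \<inter> cball x0 r)" "convex (chart_image c \<inter> cball x0 \<rho>)"
    "\<And>x. x \<in> chart_image c \<inter> cball x0 \<rho> \<Longrightarrow> (X c has_derivative X' x) (at x within chart_image c)"
    "continuous_on (chart_image c \<inter> cball x0 \<rho>) X'"
    "\<And>x. x \<in> chart_image c \<inter> cball x0 \<rho> \<Longrightarrow> norm (X' x) \<le> l" "\<And>x. x \<in> chart_image c \<inter> cball x0 \<rho> \<Longrightarrow> norm (X c x) \<le> l"
proof -
  obtain v where v: "openin (top_of_set {x. 0 \<le> v \<bullet> x}) (chart_image c)"
    using chart(2)[OF c] unfolding half_open_def by (elim exE) (rule that)
  obtain r where r: "0 < r" "cball x0 r \<inter> {x. 0 \<le> v \<bullet> x} \<subseteq> chart_image c"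
    by (rule half_open_ball[OF v x0]) (rule that)
  obtain W h and h' :: "real ^ ('n + 'n) \<Rightarrow> (real ^ ('n + 'n)) \<Rightarrow>\<^sub>L (real ^ ('n + 'n))" where W: "open W" "x0 \<in> W"
    "\<forall>y\<in>chart_image c \<inter> W. h y = X c y" "\<forall>y\<in>W. (h has_derivative blinfun_apply (h' y)) (at y)" "continuous_on W h'"
    using bspec[OF C1_X[OF c, unfolded C1_on_def] x0] by (elim exE conjE) (rule that)
  obtain e' where e': "0 < e'" "ball x0 e' \<subseteq> W" by (rule openE[OF W(1,2)]) (rule that)
  define e where "e = e' / 2"
  have "cball x0 e \<subseteq> ball x0 e'" using e'(1) by (auto simp: e_def)
  then have e: "0 < e" "cball x0 e \<subseteq> W" using e' by (auto simp: e_def)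
  define \<rho> where "\<rho> = min r e"
  have \<rho>: "0 < \<rho>" using r e by (simp add: \<rho>_def)
  have eq: "chart_image c \<inter> cball x0 s = {x. 0 \<le> v \<bullet> x} \<inter> cball x0 s" if "s \<le> \<rho>" for s
  proof -
    have "cball x0 s \<subseteq> cball x0 r" using that by (simp add: \<rho>_def subset_cball)
    then show ?thesis using r(2) openin_imp_subset[OF v] by blast
  qed
  let ?C = "chart_image c \<inter> cball x0 \<rho>"
  have CW: "?C \<subseteq> W"
  proof -
    have "cball x0 \<rho> \<subseteq> cball x0 e" by (simp add: \<rho>_def subset_cball)
    then show ?thesis using e(2) by blast
  qed
  have cl: "closed {x. 0 \<le> v \<bullet> x}" using closed_halfspace_ge[of 0 v] by simp
  have cC: "compact (chart_image c \<inter> cball x0 s)" if "s \<le> \<rho>" for s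
    unfolding eq[OF that] by (intro closed_Int_compact cl compact_cball)
  have cv: "convex ?C" unfolding eq[OF order_refl]
    by (intro convex_Int convex_cball) (simp add: convex_halfspace_ge[of 0 v, simplified])
  have d: "(X c has_derivative h' x) (at x within chart_image c)" if x: "x \<in> ?C" for x
  proof -
    have xW: "x \<in> W" using x CW by blast
    obtain q where q: "0 < q" "ball x q \<subseteq> W" by (rule openE[OF W(1) xW]) (rule that)
    have "(h has_derivative h' x) (at x within chart_image c)" by (rule has_derivative_at_withinI[OF bspec[OF W(4) xW]])
    then show ?thesis
    proof (rule has_derivative_transform_within[OF _ q(1) IntD1[OF x]])
      fix z assume z: "z \<in> chart_image c" "dist z x < q"
      then have "z \<in> ball x q" by (simp add: dist_commute)
      then show "h z = X c z" using W(3) q(2) z(1) by blast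
    qed
  qed
  have ch: "continuous_on ?C h'" by (rule continuous_on_subset[OF W(5) CW])
  have cX: "continuous_on ?C (X c)" by (rule continuous_on_subset[OF C1_on_continuous[OF C1_X[OF c]]]) simp
  have "bounded (h' ` ?C)" by (rule compact_imp_bounded[OF compact_continuous_image[OF ch cC[OF order_refl]]])
  then obtain b1 where "\<forall>x\<in>h' ` ?C. norm x \<le> b1" unfolding bounded_iff by (elim exE) (rule that)
  then have b1: "norm (h' x) \<le> b1" if "x \<in> ?C" for x using that by blast
  have "bounded ((X c) ` ?C)" by (rule compact_imp_bounded[OF compact_continuous_image[OF cX cC[OF order_refl]]])
  then obtain b2 where "\<forall>x\<in>(X c) ` ?C. norm x \<le> b2" unfolding bounded_iff by (elim exE) (rule that)
  then have b2: "norm (X c x) \<le> b2" if "x \<in> ?C" for x using that by blast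
  define l where "l = max 1 (max b1 b2)"
  have "0 < l" by (simp add: l_def)
  moreover have "norm (h' x) \<le> l" if "x \<in> ?C" for x using b1[OF that] by (simp add: l_def)
  moreover have "norm (X c x) \<le> l" if "x \<in> ?C" for x using b2[OF that] by (simp add: l_def)
  ultimately show ?thesis by (intro that[OF \<rho> _ cC cv d ch])
qed

section \<open>Orbits confined to a chart\<close>

lemma open_chart_ball: "c \<in> \<A> \<Longrightarrow> open {\<eta> \<in> fst c. dist x0 (snd c \<eta>) < r}"
proof -
  assume c: "c \<in> \<A>"
  have "open (fst c \<inter> snd c -` ball x0 r)"
    using continuous_chart[OF c] chart(1)[OF c] open_ball by (rule continuous_open_preimage)
  also have "fst c \<inter> snd c -` ball x0 r = {\<eta> \<in> fst c. dist x0 (snd c \<eta>) < r}" by auto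
  finally show ?thesis .
qed

text \<open>The speed in the chart is controlled only while the orbit is in the chart. Before the
  first time q outside, the orbit lies in the image under \<open>chart_inv c\<close> of the part of
  the chart within radius \<open>s + l * \<tau>\<close>. This image is compact, hence closed, so the
  point at time q lies in it too, a contradiction.\<close>

lemma flow_stays_in_chart:
  assumes c: "c \<in> \<A>" and cpct: "\<And>s. s \<le> r \<Longrightarrow> compact (chart_image c \<inter> cball x0 s)"
    and b: "\<And>x. x \<in> chart_image c \<inter> cball x0 r \<Longrightarrow> norm (X c x) \<le> l"
    and \<eta>: "\<eta> \<in> fst c" "dist x0 (snd c \<eta>) \<le> s" and s: "s + l * \<tau> < r" and l: "0 < l" and t: "t \<in> {0..\<tau>}"
  shows "\<phi> t \<eta> \<in> fst c \<and> dist x0 (snd c (\<phi> t \<eta>)) < r"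
proof (rule ccontr)
  define N where "N = {\<eta> \<in> fst c. dist x0 (snd c \<eta>) < r}"
  assume "\<not> ?thesis"
  then have tN: "\<phi> t \<eta> \<notin> N" by (simp add: N_def)
  have oN: "open N" unfolding N_def by (rule open_chart_ball[OF c])
  define Bad where "Bad = {0..\<tau>} \<inter> (\<lambda>t. \<phi> t \<eta>) -` (- N)"
  have "closed Bad" unfolding Bad_def
    by (rule continuous_closed_preimage[OF flow_continuous_time]) (use oN in auto)
  then have "compact Bad" by (metis Bad_def Int_commute compact_Icc compact_Int_closed inf_left_idem)
  moreover have "Bad \<noteq> {}" using t tN by (auto simp: Bad_def)
  ultimately obtain q where q: "q \<in> Bad" "\<And>p. p \<in> Bad \<Longrightarrow> q \<le> p"
    using compact_attains_inf[of Bad] by blast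
  have \<tau>0: "0 \<le> \<tau>" using t by auto
  have "0 \<le> l * \<tau>" using l \<tau>0 by simp
  then have "\<phi> 0 \<eta> \<in> N" using \<eta> s by (simp add: N_def flow_0)
  then have q0: "0 < q" "q \<le> \<tau>" using q(1) by (auto simp: Bad_def intro: order_neq_le_trans)
  have inN: "\<phi> p \<eta> \<in> N" if "0 \<le> p" "p < q" for p
  proof (rule ccontr)
    assume "\<phi> p \<eta> \<notin> N"
    then have "p \<in> Bad" using that q0 by (simp add: Bad_def)
    then show False using q(2)[of p] that by simp
  qed
  define r1 where "r1 = s + l * \<tau>"
  have inK: "\<phi> p \<eta> \<in> chart_inv c ` (chart_image c \<inter> cball x0 r1)" if p: "0 \<le> p" "p < q" for p
  proof -
    have "norm (snd c (\<phi> p \<eta>) - snd c (\<phi> 0 \<eta>)) \<le> l * norm (p - 0)"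
    proof (rule differentiable_bound[of "{0..p}"])
      fix y assume y: "y \<in> {0..p}"
      then have yN: "\<phi> y \<eta> \<in> N" using p by (intro inN) auto
      then have "c \<in> charts_at \<A> (\<phi> y \<eta>)" using c by (simp add: N_def charts_at_def)
      from flow_derivative[OF this]
      show "((\<lambda>p. snd c (\<phi> p \<eta>)) has_derivative (\<lambda>h. h *\<^sub>R X_H (\<phi> y \<eta>) c)) (at y within {0..p})"
        by (simp add: has_vector_derivative_def has_derivative_at_withinI)
      have "norm (X_H (\<phi> y \<eta>) c) \<le> l"
      proof -
        have "snd c (\<phi> y \<eta>) \<in> chart_image c \<inter> cball x0 r" using yN by (simp add: N_def snd_in)
        from b[OF this] show ?thesis using yN c by (simp add: X_def N_def chart_inv_snd)
      qed
      then show "onorm (\<lambda>h. h *\<^sub>R X_H (\<phi> y \<eta>) c) \<le> l"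
        by (intro onorm_le) (simp add: mult.commute[of l] mult_left_mono)
    qed (use p in auto)
    also have "\<dots> \<le> l * \<tau>" using p q0 l by (intro mult_left_mono) auto
    finally have "dist (snd c \<eta>) (snd c (\<phi> p \<eta>)) \<le> l * \<tau>" by (simp add: flow_0 dist_norm norm_minus_commute)
    then have "dist x0 (snd c (\<phi> p \<eta>)) \<le> r1"
      using \<eta>(2) dist_triangle[of x0 "snd c (\<phi> p \<eta>)" "snd c \<eta>"] by (simp add: r1_def)
    moreover have "\<phi> p \<eta> \<in> fst c" using inN[OF p] by (simp add: N_def)
    ultimately show ?thesis using c by (intro image_eqI[of _ _ "snd c (\<phi> p \<eta>)"]) (simp_all add: chart_inv_snd snd_in)
  qed
  have "compact (chart_inv c ` (chart_image c \<inter> cball x0 r1))"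
    using s by (intro compact_continuous_image continuous_on_subset[OF continuous_chart_inv[OF c]] cpct) (auto simp: r1_def)
  then have cl: "closed (chart_inv c ` (chart_image c \<inter> cball x0 r1))" by (rule compact_imp_closed)
  have "\<phi> q \<eta> \<in> chart_inv c ` (chart_image c \<inter> cball x0 r1)"
  proof (rule Lim_in_closed_set[OF cl, where F="at_left q"])
    show "\<forall>\<^sub>F p in at_left q. \<phi> p \<eta> \<in> chart_inv c ` (chart_image c \<inter> cball x0 r1)"
      using eventually_at_left_real[OF q0(1)] by eventually_elim (auto intro: inK)
    show "((\<lambda>p. \<phi> p \<eta>) \<longlongrightarrow> \<phi> q \<eta>) (at_left q)"
      using flow_isCont[where \<xi>=\<eta> and t=q] unfolding isCont_def by (rule tendsto_within_subset) simp
  qed simp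
  then obtain x where x: "x \<in> chart_image c" "dist x0 x \<le> r1" "\<phi> q \<eta> = chart_inv c x" by auto
  have "\<phi> q \<eta> \<in> N" using x s c by (simp add: N_def chart_inv_in snd_chart_inv r1_def)
  then show False using q(1) by (simp add: Bad_def)
qed

section \<open>Uniqueness of integral curves and the group law\<close>

definition integral_curve :: "(real \<Rightarrow> 'a) \<Rightarrow> bool" where
  "integral_curve \<alpha> \<longleftrightarrow> (\<forall>t. isCont \<alpha> t \<and> (\<forall>c\<in>charts_at \<A> (\<alpha> t).
     ((\<lambda>s. snd c (\<alpha> s)) has_vector_derivative X_H (\<alpha> t) c) (at t)))"

lemma integral_curve_flow: "integral_curve (\<lambda>s. \<phi> (s + a) \<xi>)"
  unfolding integral_curve_def
proof (intro allI conjI ballI)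
  fix t
  show "isCont (\<lambda>s. \<phi> (s + a) \<xi>) t"
    by (rule isCont_o2[where g="\<lambda>s. \<phi> s \<xi>" and f="\<lambda>s. s + a"]) (auto intro: flow_isCont)
  fix c assume "c \<in> charts_at \<A> (\<phi> (t + a) \<xi>)"
  from flow_derivative[OF this] show "((\<lambda>s. snd c (\<phi> (s + a) \<xi>)) has_vector_derivative X_H (\<phi> (t + a) \<xi>) c) (at t)"
    using vector_diff_chain_at[OF has_vector_derivative_add_const[THEN iffD2, OF has_vector_derivative_id], of "\<lambda>s. snd c (\<phi> s \<xi>)"]
    by (simp add: comp_def)
qed

text \<open>In a chart both curves solve the same equation with a Lipschitz field, and their
  difference starts at 0. The sign \<sigma> reverses time, so that the forward estimate also covers
  the past.\<close>

lemma integral_curve_eq_nearby: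
  assumes \<alpha>: "integral_curve \<alpha>" and \<alpha>': "integral_curve \<alpha>'" and eq: "\<alpha> t0 = \<alpha>' t0"
  shows "\<exists>e>0. \<forall>t. \<bar>t - t0\<bar> < e \<longrightarrow> \<alpha> t = \<alpha>' t"
proof -
  obtain c where c: "c \<in> charts_at \<A> (\<alpha> t0)" using ex_chart_at by blast
  note cA = charts_atD[OF c]
  define x0 where "x0 = snd c (\<alpha> t0)"
  obtain \<rho> l and X' :: "real ^ ('n + 'n) \<Rightarrow> (real ^ ('n + 'n)) \<Rightarrow>\<^sub>L (real ^ ('n + 'n))" where \<rho>: "0 < \<rho>" "0 < l"
    "convex (chart_image c \<inter> cball x0 \<rho>)"
    "\<And>x. x \<in> chart_image c \<inter> cball x0 \<rho> \<Longrightarrow> (X c has_derivative X' x) (at x within chart_image c)"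
    "\<And>x. x \<in> chart_image c \<inter> cball x0 \<rho> \<Longrightarrow> norm (X' x) \<le> l"
    by (rule chart_nbhd[OF cA(1) snd_in[OF cA(2)], folded x0_def]) (rule that)
  let ?C = "chart_image c \<inter> cball x0 \<rho>"
  have lip: "norm (X c x - X c y) \<le> l * norm (x - y)" if "x \<in> ?C" "y \<in> ?C" for x y
    using that \<rho> by (intro differentiable_bound[of ?C "X c" "\<lambda>x. blinfun_apply (X' x)"])
      (auto simp: norm_blinfun.rep_eq[symmetric] intro: has_derivative_subset)
  define N where "N = {\<eta> \<in> fst c. dist x0 (snd c \<eta>) < \<rho>}"
  have oN: "open N" unfolding N_def by (rule open_chart_ball[OF cA(1)])
  have NC: "snd c \<eta> \<in> ?C" if "\<eta> \<in> N" for \<eta> using that by (simp add: N_def snd_in)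
  have N0: "\<alpha> t0 \<in> N" "\<alpha>' t0 \<in> N" using cA \<rho> by (auto simp: N_def x0_def eq[symmetric])
  have near: "\<exists>e>0. \<forall>t. dist t t0 < e \<longrightarrow> \<gamma> t \<in> N" if "integral_curve \<gamma>" "\<gamma> t0 \<in> N" for \<gamma>
  proof -
    have "\<forall>\<^sub>F t in nhds t0. \<gamma> t \<in> N"
      using that oN unfolding integral_curve_def by (intro topological_tendstoD[of \<gamma> "\<gamma> t0"]) (auto simp: isCont_def tendsto_at_iff_tendsto_nhds)
    then show ?thesis unfolding eventually_nhds_metric .
  qed
  obtain e1 where e1: "0 < e1" "\<And>t. dist t t0 < e1 \<Longrightarrow> \<alpha> t \<in> N" using near[OF \<alpha> N0(1)] by blast
  obtain e2 where e2: "0 < e2" "\<And>t. dist t t0 < e2 \<Longrightarrow> \<alpha>' t \<in> N" using near[OF \<alpha>' N0(2)] by blast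
  define \<tau> where "\<tau> = min (min e1 e2 / 2) (1 / (2 * l))"
  have "l * \<tau> \<le> l * (1 / (2 * l))" using \<rho>(2) by (intro mult_left_mono) (simp_all add: \<tau>_def)
  then have \<tau>: "0 < \<tau>" "\<tau> < e1" "\<tau> < e2" "l * \<tau> \<le> 1 / 2"
    using e1(1) e2(1) \<rho>(2) by (auto simp: \<tau>_def)
  have key: "\<alpha> (t0 + \<sigma> * t) = \<alpha>' (t0 + \<sigma> * t)" if \<sigma>: "\<bar>\<sigma>\<bar> = 1" and t: "t \<in> {0..\<tau>}" for \<sigma> t
  proof -
    have in1: "\<alpha> (t0 + \<sigma> * t) \<in> N" "\<alpha>' (t0 + \<sigma> * t) \<in> N" if "t \<in> {0..\<tau>}" for t
      using that \<sigma> \<tau> by (auto intro!: e1(2) e2(2) simp: dist_norm abs_mult)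
    have der: "((\<lambda>t. snd c (\<gamma> (t0 + \<sigma> * t))) has_vector_derivative \<sigma> *\<^sub>R X c (snd c (\<gamma> (t0 + \<sigma> * t)))) (at t within {0..\<tau>})"
      if "integral_curve \<gamma>" "\<gamma> (t0 + \<sigma> * t) \<in> N" for \<gamma> t
    proof -
      have "c \<in> charts_at \<A> (\<gamma> (t0 + \<sigma> * t))" using that(2) cA by (simp add: N_def charts_at_def)
      then have 1: "((\<lambda>s. snd c (\<gamma> s)) has_vector_derivative X_H (\<gamma> (t0 + \<sigma> * t)) c) (at (t0 + \<sigma> * t))"
        using that(1) unfolding integral_curve_def by blast
      have 2: "((\<lambda>t. t0 + \<sigma> * t) has_vector_derivative \<sigma>) (at t within {0..\<tau>})"
        by (auto intro!: derivative_eq_intros)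
      have "((\<lambda>s. snd c (\<gamma> s)) \<circ> (\<lambda>t. t0 + \<sigma> * t) has_vector_derivative \<sigma> *\<^sub>R X_H (\<gamma> (t0 + \<sigma> * t)) c) (at t within {0..\<tau>})"
        by (rule vector_diff_chain_within[OF 2 has_vector_derivative_at_within[OF 1]])
      moreover have "X c (snd c (\<gamma> (t0 + \<sigma> * t))) = X_H (\<gamma> (t0 + \<sigma> * t)) c"
        using that(2) cA by (simp add: X_def N_def chart_inv_snd)
      ultimately show ?thesis by (simp add: comp_def)
    qed
    have "norm (snd c (\<alpha> (t0 + \<sigma> * t)) - snd c (\<alpha>' (t0 + \<sigma> * t)))
      \<le> 2 * norm (snd c (\<alpha> (t0 + \<sigma> * 0)) - snd c (\<alpha>' (t0 + \<sigma> * 0))) + 2 * \<tau> * 0"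
    proof (rule small_time_gronwall[OF _ \<tau>(4) _ _ has_vector_derivative_diff[OF der[OF \<alpha> in1(1)] der[OF \<alpha>' in1(2)]] _ t])
      fix t assume t: "t \<in> {0..\<tau>}"
      have "norm (\<sigma> *\<^sub>R X c (snd c (\<alpha> (t0 + \<sigma> * t))) - \<sigma> *\<^sub>R X c (snd c (\<alpha>' (t0 + \<sigma> * t))))
        = norm (X c (snd c (\<alpha> (t0 + \<sigma> * t))) - X c (snd c (\<alpha>' (t0 + \<sigma> * t))))"
        using \<sigma> by (simp flip: scaleR_diff_right)
      also have "\<dots> \<le> l * norm (snd c (\<alpha> (t0 + \<sigma> * t)) - snd c (\<alpha>' (t0 + \<sigma> * t))) + 0"
        using lip[OF NC[OF in1(1)[OF t]] NC[OF in1(2)[OF t]]] by simp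
      finally show "norm (\<sigma> *\<^sub>R X c (snd c (\<alpha> (t0 + \<sigma> * t))) - \<sigma> *\<^sub>R X c (snd c (\<alpha>' (t0 + \<sigma> * t))))
        \<le> l * norm (snd c (\<alpha> (t0 + \<sigma> * t)) - snd c (\<alpha>' (t0 + \<sigma> * t))) + 0" .
    qed (use \<tau> \<rho> in auto)
    then have "snd c (\<alpha> (t0 + \<sigma> * t)) = snd c (\<alpha>' (t0 + \<sigma> * t))" by (simp add: eq)
    then show ?thesis using in1[OF t] chart_inv_snd[OF cA(1)] unfolding N_def by (metis (no_types, lifting) mem_Collect_eq)
  qed
  have "\<alpha> t = \<alpha>' t" if "\<bar>t - t0\<bar> < \<tau>" for t
    using key[of 1 "t - t0"] key[of "- 1" "t0 - t"] that by (cases "t0 \<le> t") auto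
  then show ?thesis using \<tau>(1) by blast
qed

text \<open>The set of agreement is closed in the Hausdorff case and open by local uniqueness, and
  the real line is connected.\<close>

lemma integral_curve_unique:
  assumes \<alpha>: "integral_curve \<alpha>" and \<alpha>': "integral_curve \<alpha>'" and eq: "\<alpha> t0 = \<alpha>' t0"
  shows "\<alpha> = \<alpha>'"
proof -
  let ?E = "{t. \<alpha> t = \<alpha>' t}"
  have "continuous_on UNIV \<alpha>" "continuous_on UNIV \<alpha>'"
    using \<alpha> \<alpha>' by (auto simp: integral_curve_def continuous_on_eq_continuous_at)
  then have "closed ?E" by (rule closed_Collect_eq)
  moreover have "open ?E"
    unfolding open_dist
  proof
    fix t assume "t \<in> ?E"
    then have "\<alpha> t = \<alpha>' t" by simp
    from integral_curve_eq_nearby[OF \<alpha> \<alpha>' this]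
    show "\<exists>e>0. \<forall>y. dist y t < e \<longrightarrow> y \<in> ?E" by (simp add: dist_norm)
  qed
  ultimately have "?E = {} \<or> ?E = UNIV" by (intro clopen[THEN iffD1] conjI)
  then show ?thesis using eq by auto
qed

text \<open>\<open>complete_flow\<close> only describes orbits; the group law follows since both
  sides are integral curves in s with the same value at 0.\<close>

lemma flow_add: "\<phi> (s + t) \<xi> = \<phi> s (\<phi> t \<xi>)"
proof -
  have "(\<lambda>s. \<phi> (s + t) \<xi>) = (\<lambda>s. \<phi> (s + 0) (\<phi> t \<xi>))"
    by (rule integral_curve_unique[of _ _ 0]) (rule integral_curve_flow, rule integral_curve_flow, simp add: flow_0)
  from fun_cong[OF this, of s] show ?thesis by simp
qed

section \<open>The linearized flow for short times\<close>

definition linearized_on :: "real \<Rightarrow> 'a set \<Rightarrow> (real \<Rightarrow> 'a \<Rightarrow> real ^ ('n + 'n) ^ ('n + 'n)) \<Rightarrow> bool" where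
  "linearized_on r U G \<longleftrightarrow> continuous_on ({0..r} \<times> U) (\<lambda>p. \<phi> (fst p) (snd p)) \<and>
     (\<forall>i j. continuous_on ({0..r} \<times> U) (\<lambda>p. G (fst p) (snd p) $ i $ j)) \<and>
     (\<forall>t\<in>{0..r}. \<forall>\<eta>\<in>U. rsymplectic (G t \<eta>) \<and>
       (\<exists>c\<in>charts_at \<A> \<eta> \<inter> charts_at \<A> (\<phi> t \<eta>). dd (\<phi> t) c c \<eta> (\<lambda>u. Ti c (\<phi> t \<eta>) (G t \<eta> *v T c \<eta> u))))"

lemma linearized_on_mono: "linearized_on r U G \<Longrightarrow> r' \<le> r \<Longrightarrow> linearized_on r' U G"
proof -
  assume a: "linearized_on r U G" "r' \<le> r"
  have sub: "{0..r'} \<times> U \<subseteq> {0..r} \<times> U" using a(2) by auto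
  show ?thesis
    using a(1) unfolding linearized_on_def
    by (elim conjE, intro conjI allI) (blast intro: continuous_on_subset[OF _ sub], blast intro: continuous_on_subset[OF _ sub], use a(2) in auto)
qed

lemma T_expand: "c \<in> charts_at \<A> \<xi> \<Longrightarrow> T c \<xi> v = (\<Sum>i\<in>Basis. (v \<bullet> i) *\<^sub>R T c \<xi> i)"
  using linear_sum[OF T_linear, of c \<xi> "\<lambda>i. (v \<bullet> i) *\<^sub>R i" Basis] linear_scale[OF T_linear, of c \<xi>]
  by (simp add: euclidean_representation)

text \<open>Near \<xi>0 and for short times a point and its image lie in one chart, where the flow
  satisfies the assumptions of \<open>local_flow\<close>. The matrix G is the solution of the
  variational equation, transported to the trivialization.\<close>

lemma local_linearized_flow:
  obtains U \<tau> G where "open U" "\<xi>0 \<in> U" "0 < \<tau>" "linearized_on \<tau> U G"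
proof -
  obtain c where c0: "c \<in> charts_at \<A> \<xi>0" using ex_chart_at by blast
  note c = charts_atD(1)[OF c0]
  define x0 where "x0 = snd c \<xi>0"
  obtain \<rho> l and X' :: "real ^ ('n + 'n) \<Rightarrow> (real ^ ('n + 'n)) \<Rightarrow>\<^sub>L (real ^ ('n + 'n))" where \<rho>: "0 < \<rho>" "0 < l"
    "\<And>r. r \<le> \<rho> \<Longrightarrow> compact (chart_image c \<inter> cball x0 r)" "convex (chart_image c \<inter> cball x0 \<rho>)"
    "\<And>x. x \<in> chart_image c \<inter> cball x0 \<rho> \<Longrightarrow> (X c has_derivative X' x) (at x within chart_image c)"
    "continuous_on (chart_image c \<inter> cball x0 \<rho>) X'"
    "\<And>x. x \<in> chart_image c \<inter> cball x0 \<rho> \<Longrightarrow> norm (X' x) \<le> l" "\<And>x. x \<in> chart_image c \<inter> cball x0 \<rho> \<Longrightarrow> norm (X c x) \<le> l"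
    by (rule chart_nbhd[OF c snd_in[OF charts_atD(2)[OF c0]], folded x0_def]) (rule that)
  define C where "C = chart_image c \<inter> cball x0 \<rho>"
  define S where "S = chart_image c \<inter> ball x0 (\<rho> / 2)"
  define U where "U = {\<eta> \<in> fst c. dist x0 (snd c \<eta>) < \<rho> / 2}"
  \<comment> \<open>The first bound lets orbits from the ball of radius \<rho> / 2 move by at most
    \<rho> / 4, so that they stay within \<rho>; the second is the smallness condition of
    \<open>local_flow\<close>.\<close>
  define \<tau> where "\<tau> = min (\<rho> / (4 * l)) (1 / (2 * l))"
  define \<Psi> where "\<Psi> t x = snd c (\<phi> t (chart_inv c x))" for t x
  have \<tau>: "0 < \<tau>" using \<rho>(1,2) by (simp add: \<tau>_def)
  have "l * \<tau> \<le> l * (\<rho> / (4 * l))" "l * \<tau> \<le> l * (1 / (2 * l))"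
    using \<rho>(2) by (intro mult_left_mono; simp add: \<tau>_def)+
  then have l\<tau>: "l * \<tau> \<le> \<rho> / 4" "l * \<tau> \<le> 1 / 2" using \<rho>(2) by simp_all
  have U: "open U" unfolding U_def by (rule open_chart_ball[OF c])
  have \<xi>U: "\<xi>0 \<in> U" using charts_atD(2)[OF c0] \<rho>(1) by (simp add: U_def x0_def)
  have US: "snd c \<eta> \<in> S" if "\<eta> \<in> U" for \<eta> using that by (simp add: U_def S_def snd_in)
  have SU: "chart_inv c x \<in> U" if "x \<in> S" for x
    using that c by (simp add: U_def S_def chart_inv_in snd_chart_inv)
  have SI: "x \<in> chart_image c" if "x \<in> S" for x using that by (simp add: S_def)
  have stay: "\<phi> t \<eta> \<in> fst c" "dist x0 (snd c (\<phi> t \<eta>)) < \<rho>" if "\<eta> \<in> U" "t \<in> {0..\<tau>}" for \<eta> t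
  proof -
    have "\<phi> t \<eta> \<in> fst c \<and> dist x0 (snd c (\<phi> t \<eta>)) < \<rho>"
      by (rule flow_stays_in_chart[where s="\<rho> / 2" and l=l and \<tau>=\<tau>, OF c \<rho>(3) \<rho>(8) _ _ _ \<rho>(2) that(2)])
        (use that(1) l\<tau>(1) \<rho>(1) in \<open>auto simp: U_def\<close>)
    then show "\<phi> t \<eta> \<in> fst c" "dist x0 (snd c (\<phi> t \<eta>)) < \<rho>" by simp_all
  qed
  have cU: "c \<in> charts_at \<A> \<eta>" if "\<eta> \<in> U" for \<eta> using that c by (simp add: U_def charts_at_def)
  have c\<phi>: "c \<in> charts_at \<A> (\<phi> t \<eta>)" if "\<eta> \<in> U" "t \<in> {0..\<tau>}" for \<eta> t
    using stay(1)[OF that] c by (simp add: charts_at_def)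
  interpret L: local_flow "X c" X' \<Psi> C S \<tau> l
  proof
    show "compact C" "convex C" unfolding C_def using \<rho>(3)[OF order_refl] \<rho>(4) by simp_all
    show "(X c has_derivative blinfun_apply (X' x)) (at x within C)" if "x \<in> C" for x
      by (rule has_derivative_subset[OF \<rho>(5)]) (use that in \<open>auto simp: C_def\<close>)
    show "continuous_on C X'" using \<rho>(6) by (simp add: C_def)
    show "norm (X' x) \<le> l" if "x \<in> C" for x using \<rho>(7) that by (simp add: C_def)
    show "0 \<le> l" "0 \<le> \<tau>" "l * \<tau> \<le> 1 / 2" using \<rho>(2) \<tau> l\<tau> by auto
    show "\<Psi> 0 x = x" if "x \<in> S" for x using SI[OF that] c by (simp add: \<Psi>_def flow_0 snd_chart_inv)
    show "\<Psi> t x \<in> C" if "x \<in> S" "t \<in> {0..\<tau>}" for x t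
      using stay[OF SU[OF that(1)] that(2)] by (simp add: \<Psi>_def C_def snd_in)
    show "((\<lambda>t. \<Psi> t x) has_vector_derivative X c (\<Psi> t x)) (at t within {0..\<tau>})" if "x \<in> S" "t \<in> {0..\<tau>}" for x t
    proof -
      have "X c (\<Psi> t x) = X_H (\<phi> t (chart_inv c x)) c"
        using stay(1)[OF SU[OF that(1)] that(2)] c by (simp add: X_def \<Psi>_def chart_inv_snd)
      then show ?thesis
        using has_vector_derivative_at_within[OF flow_derivative[OF c\<phi>[OF SU[OF that(1)] that(2)]]] by (simp add: \<Psi>_def)
    qed
  qed
  have \<Psi>\<phi>: "chart_inv c (\<Psi> t (snd c \<eta>)) = \<phi> t \<eta>" "\<Psi> t (snd c \<eta>) = snd c (\<phi> t \<eta>)" if "\<eta> \<in> U" "t \<in> {0..\<tau>}" for t \<eta>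
    using stay(1)[OF that] that(1) c by (simp_all add: \<Psi>_def U_def chart_inv_snd)
  define G where "G t \<eta> = matrix (\<lambda>a. T c (\<phi> t \<eta>) (L.A t (snd c \<eta>) (Ti c \<eta> a)))" for t \<eta>
  have G: "G t \<eta> *v a = T c (\<phi> t \<eta>) (L.A t (snd c \<eta>) (Ti c \<eta> a))" if "\<eta> \<in> U" "t \<in> {0..\<tau>}" for t \<eta> a
  proof -
    have "linear (\<lambda>a. T c (\<phi> t \<eta>) (L.A t (snd c \<eta>) (Ti c \<eta> a)))"
      using linear_compose[OF linear_compose[OF Ti_linear[OF cU[OF that(1)]] bounded_linear.linear[OF blinfun.bounded_linear_right]] T_linear[OF c\<phi>[OF that]]]
      by (simp add: comp_def)
    then show ?thesis unfolding G_def by (simp add: matrix_works linear_def scalar_mult_eq_scaleR)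
  qed
  let ?D = "{0..\<tau>} \<times> U"
  have cc: "continuous_on ?D (\<lambda>p. snd c (snd p))"
    by (rule continuous_on_compose2[OF continuous_chart[OF c] continuous_on_snd[OF continuous_on_id]]) (auto simp: U_def)
  have c\<Psi>: "continuous_on ?D (\<lambda>p. \<Psi> (fst p) (snd c (snd p)))"
    using continuous_on_compose2[OF L.flow_continuous continuous_on_Pair[OF continuous_on_fst[OF continuous_on_id] cc]]
    by (force simp: US)
  have cA: "continuous_on ?D (\<lambda>p. L.A (fst p) (snd c (snd p)))"
    using continuous_on_compose2[OF L.A_continuous continuous_on_Pair[OF continuous_on_fst[OF continuous_on_id] cc]]
    by (force simp: US)
  have \<Psi>I: "\<Psi> (fst p) (snd c (snd p)) \<in> chart_image c" if "p \<in> ?D" for p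
    using that \<Psi>\<phi>(2) stay(1) by (auto simp: snd_in)
  have "continuous_on ?D (\<lambda>p. chart_inv c (\<Psi> (fst p) (snd c (snd p))))"
    by (rule continuous_on_compose2[OF continuous_chart_inv[OF c] c\<Psi>]) (use \<Psi>I in blast)
  then have c1: "continuous_on ?D (\<lambda>p. \<phi> (fst p) (snd p))" by (rule continuous_on_eq) (auto simp: \<Psi>\<phi>(1))
  have cT: "continuous_on ?D (\<lambda>p. T c (\<phi> (fst p) (snd p)) i)" for i
  proof -
    have "continuous_on ?D (\<lambda>p. T c (chart_inv c (\<Psi> (fst p) (snd c (snd p)))) i)"
      by (rule continuous_on_compose2[OF C1_on_continuous[OF C1_T[OF c]] c\<Psi>]) (use \<Psi>I in blast)
    then show ?thesis by (rule continuous_on_eq) (auto simp: \<Psi>\<phi>(1))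
  qed
  have cTi: "continuous_on ?D (\<lambda>p. Ti c (snd p) a)" for a
  proof -
    have "continuous_on ?D (\<lambda>p. Ti c (chart_inv c (snd c (snd p))) a)"
      by (rule continuous_on_compose2[OF C1_on_continuous[OF C1_Ti[OF c]] cc]) (auto simp: U_def snd_in)
    then show ?thesis by (rule continuous_on_eq) (use c in \<open>auto simp: U_def chart_inv_snd\<close>)
  qed
  have c2: "continuous_on ?D (\<lambda>p. G (fst p) (snd p) $ i $ j)" for i j
  proof -
    have "continuous_on ?D (\<lambda>p. (\<Sum>k\<in>Basis. (L.A (fst p) (snd c (snd p)) (Ti c (snd p) (axis j 1)) \<bullet> k) *\<^sub>R T c (\<phi> (fst p) (snd p)) k) $ i)"
      by (intro continuous_intros cT cTi cA)
    then show ?thesis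
    proof (rule continuous_on_eq)
      fix p assume that: "p \<in> ?D"
      have "G (fst p) (snd p) $ i $ j = (\<Sum>k\<in>Basis. (L.A (fst p) (snd c (snd p)) (Ti c (snd p) (axis j 1)) \<bullet> k) *\<^sub>R T c (\<phi> (fst p) (snd p)) k) $ i"
    proof -
      have "c \<in> charts_at \<A> (\<phi> (fst p) (snd p))" using that c\<phi> by auto
      from T_expand[OF this, of "L.A (fst p) (snd c (snd p)) (Ti c (snd p) (axis j 1))"]
      show ?thesis unfolding G_def matrix_def vec_lambda_beta by (rule arg_cong)
    qed
      then show "(\<Sum>k\<in>Basis. (L.A (fst p) (snd c (snd p)) (Ti c (snd p) (axis j 1)) \<bullet> k) *\<^sub>R T c (\<phi> (fst p) (snd p)) k) $ i = G (fst p) (snd p) $ i $ j"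
        by (rule sym)
    qed
  qed
  \<comment> \<open>The variational solution preserves the form because its Lie derivative vanishes,
    and the form is \<open>omega0\<close> in the trivialization at both ends.\<close>
  have sy: "rsymplectic (G t \<eta>)" if "t \<in> {0..\<tau>}" "\<eta> \<in> U" for t \<eta>
    unfolding rsymplectic_def
  proof (intro allI)
    fix a b
    let ?A = "L.A t (snd c \<eta>)"
    have in1: "\<Psi> t (snd c \<eta>) \<in> chart_image c" using \<Psi>I[of "(t, \<eta>)"] that by simp
    have in0: "snd c \<eta> \<in> chart_image c" using that by (simp add: U_def snd_in)
    have "omega0 (G t \<eta> *v a) (G t \<eta> *v b) = \<beta> c (\<Psi> t (snd c \<eta>)) (?A (Ti c \<eta> a)) (?A (Ti c \<eta> b))"
      unfolding form_T[OF c in1] using that by (simp add: G \<Psi>\<phi>(1))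
    also have "\<dots> = \<beta> c (snd c \<eta>) (Ti c \<eta> a) (Ti c \<eta> b)"
    proof (rule L.flow_preserves_form[where R=C and \<beta>'="B c"])
      fix y assume y: "y \<in> C"
      then have y': "y \<in> chart_image c" by (simp add: C_def)
      show "bilinear (\<beta> c y)" by (rule \<beta>_bilinear[OF c y'])
      show "((\<lambda>y. \<beta> c y i j) has_derivative B c y i j) (at y within C)" for i j
        by (rule has_derivative_subset[OF B[OF c y']]) (simp add: C_def)
      show "(\<Sum>i\<in>Basis. \<Sum>j\<in>Basis. u \<bullet> i * (w \<bullet> j) * B c y i j (X c y)) + \<beta> c y (X' y u) w + \<beta> c y u (X' y w) = 0" for u w
        by (rule lie_derivative_zero[OF c y' \<rho>(5)]) (use y in \<open>simp add: C_def\<close>)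
    qed (use US that L.\<Psi>C in auto)
    also have "\<dots> = omega0 a b"
      unfolding form_T[OF c in0] using cU[OF that(2)] c that(2) by (simp add: U_def chart_inv_snd T_Ti)
    finally show "omega0 (G t \<eta> *v a) (G t \<eta> *v b) = omega0 a b" .
  qed
  have d: "dd (\<phi> t) c c \<eta> (\<lambda>u. Ti c (\<phi> t \<eta>) (G t \<eta> *v T c \<eta> u))" if "t \<in> {0..\<tau>}" "\<eta> \<in> U" for t \<eta>
  proof -
    have "(\<Psi> t has_derivative L.A t (snd c \<eta>)) (at (snd c \<eta>) within S)"
      by (rule L.flow_has_derivative[OF US[OF that(2)] that(1)])
    moreover have "at (snd c \<eta>) within S = at (snd c \<eta>) within chart_image c"
      by (rule at_within_nhd[of _ "ball x0 (\<rho> / 2)"]) (use US[OF that(2)] in \<open>auto simp: S_def\<close>)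
    moreover have "(\<lambda>u. Ti c (\<phi> t \<eta>) (G t \<eta> *v T c \<eta> u)) = L.A t (snd c \<eta>)"
      using that cU[OF that(2)] c\<phi>[OF that(2,1)] by (simp add: G Ti_T fun_eq_iff)
    ultimately show ?thesis by (simp add: dd_def \<Psi>_def[abs_def])
  qed
  have "linearized_on \<tau> U G"
    unfolding linearized_on_def
  proof (intro conjI allI ballI)
    fix t \<eta> assume "t \<in> {0..\<tau>}" "\<eta> \<in> U"
    then show "\<exists>c\<in>charts_at \<A> \<eta> \<inter> charts_at \<A> (\<phi> t \<eta>). dd (\<phi> t) c c \<eta> (\<lambda>u. Ti c (\<phi> t \<eta>) (G t \<eta> *v T c \<eta> u))"
      by (intro bexI[of _ c] d IntI cU c\<phi>)
  qed (use c1 c2 sy in blast)+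
  then show ?thesis by (rule that[OF U \<xi>U \<tau>])
qed

text \<open>Compactness leaves finitely many local time spans, and the least of them serves
  everywhere.\<close>

lemma uniform_linearized_flow:
  obtains \<tau> where "0 < \<tau>" "\<And>\<xi>. \<exists>U G. open U \<and> \<xi> \<in> U \<and> linearized_on \<tau> U G"
proof -
  have "\<exists>p. open (fst p) \<and> \<xi> \<in> fst p \<and> 0 < snd p \<and> (\<exists>G. linearized_on (snd p) (fst p) G)" for \<xi>
  proof -
    obtain U \<tau> G where "open U" "\<xi> \<in> U" "0 < \<tau>" "linearized_on \<tau> U G" by (rule local_linearized_flow) (rule that)
    then show ?thesis by (intro exI[of _ "(U, \<tau>)"]) auto
  qed
  then have "\<forall>\<xi>. \<exists>p. open (fst p) \<and> \<xi> \<in> fst p \<and> 0 < snd p \<and> (\<exists>G. linearized_on (snd p) (fst p) G)" by (rule allI)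
  from choice[OF this] obtain P where P: "\<forall>\<xi>. open (fst (P \<xi>)) \<and> \<xi> \<in> fst (P \<xi>) \<and> 0 < snd (P \<xi>) \<and> (\<exists>G. linearized_on (snd (P \<xi>)) (fst (P \<xi>)) G)"
    by (elim exE) (rule that)
  obtain K where K: "finite K" "UNIV \<subseteq> (\<Union>\<xi>\<in>K. fst (P \<xi>))"
  proof (rule compactE_image[OF cpt, of UNIV "\<lambda>\<xi>. fst (P \<xi>)"])
    show "UNIV \<subseteq> (\<Union>\<xi>\<in>UNIV. fst (P \<xi>))" using P by auto
  qed (use P in auto)
  have "K \<noteq> {}" using K(2) by auto
  define \<tau> where "\<tau> = Min ((\<lambda>\<xi>. snd (P \<xi>)) ` K)"
  have "0 < \<tau>" unfolding \<tau>_def using K(1) \<open>K \<noteq> {}\<close> P by auto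
  moreover have "\<exists>U G. open U \<and> \<xi> \<in> U \<and> linearized_on \<tau> U G" for \<xi>
  proof -
    obtain \<eta> where \<eta>: "\<eta> \<in> K" "\<xi> \<in> fst (P \<eta>)" using K(2) by blast
    have "\<tau> \<le> snd (P \<eta>)" unfolding \<tau>_def using K(1) \<eta>(1) by auto
    then show ?thesis using spec[OF P, of \<eta>] \<eta>(2) linearized_on_mono by blast
  qed
  ultimately show ?thesis by (rule that)
qed

section \<open>From short times to all nonnegative times\<close>

abbreviation \<gamma> :: "real \<Rightarrow> 'a \<Rightarrow> real ^ ('n + 'n) ^ ('n + 'n)" where "\<gamma> \<equiv> gamma0 \<A> f \<phi>"

definition linearized :: "real \<Rightarrow> bool" where
  "linearized r \<longleftrightarrow> continuous_on ({0..r} \<times> UNIV) (\<lambda>p. \<phi> (fst p) (snd p)) \<and>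
     (\<forall>i j. continuous_on ({0..r} \<times> UNIV) (\<lambda>p. \<gamma> (fst p) (snd p) $ i $ j)) \<and>
     (\<forall>t\<in>{0..r}. \<forall>\<eta>. rsymplectic (\<gamma> t \<eta>) \<and> Dg (\<phi> t) \<eta> (\<gamma> t \<eta>))"

lemma linearized_continuous_flow:
  assumes "continuous_on ({0..r} \<times> UNIV) (\<lambda>p. \<phi> (fst p) (snd p))" "t \<in> {0..r}"
  shows "continuous_on UNIV (\<phi> t)"
  using continuous_on_compose2[OF assms(1) continuous_on_Pair[OF continuous_on_const[of UNIV t] continuous_on_id]] assms(2)
  by force

lemma continuous_on_strip:
  assumes "\<And>\<xi>. \<exists>U. open U \<and> \<xi> \<in> U \<and> continuous_on ({0..r::real} \<times> (U :: 'a set)) g"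
  shows "continuous_on ({0..r} \<times> UNIV) g"
  unfolding continuous_on_eq_continuous_within
proof
  fix p :: "real \<times> 'a" assume p: "p \<in> {0..r} \<times> UNIV"
  obtain U where U: "open U" "snd p \<in> U" "continuous_on ({0..r} \<times> U) g" using assms by blast
  have "at p within {0..r} \<times> UNIV = at p within {0..r} \<times> U"
    by (rule at_within_nhd[of _ "UNIV \<times> U"]) (use U p in \<open>auto simp: open_Times mem_Times_iff\<close>)
  then show "continuous (at p within {0..r} \<times> UNIV) g"
    using bspec[OF U(3)[unfolded continuous_on_eq_continuous_within], of p] U(2) p by (simp add: mem_Times_iff)
qed

lemma linearized_small: "\<exists>\<tau>>0. linearized \<tau>"
proof -
  obtain \<tau> where \<tau>: "0 < \<tau>" "\<And>\<xi>. \<exists>U G. open U \<and> \<xi> \<in> U \<and> linearized_on \<tau> U G"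
    by (rule uniform_linearized_flow) (rule that)
  have c: "continuous_on ({0..\<tau>} \<times> UNIV) (\<lambda>p. \<phi> (fst p) (snd p))"
  proof (rule continuous_on_strip)
    fix \<xi>
    obtain U G where "open U" "\<xi> \<in> U" "linearized_on \<tau> U G" using \<tau>(2)[of \<xi>] by (elim exE conjE) (rule that)
    then show "\<exists>U. open U \<and> \<xi> \<in> U \<and> continuous_on ({0..\<tau>} \<times> U) (\<lambda>p. \<phi> (fst p) (snd p))"
      by (intro exI[of _ U]) (simp add: linearized_on_def)
  qed
  \<comment> \<open>The matrix of a differential in the trivialization is unique, so the local
    matrices G all equal \<gamma> and fit together.\<close>
  have eq: "\<gamma> t \<eta> = G t \<eta> \<and> Dg (\<phi> t) \<eta> (G t \<eta>)" if a: "linearized_on \<tau> U G" "t \<in> {0..\<tau>}" "\<eta> \<in> U" for U G t \<eta>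
  proof -
    have ct: "continuous_on UNIV (\<phi> t)" by (rule linearized_continuous_flow[OF c a(2)])
    obtain c where c: "c \<in> charts_at \<A> \<eta>" "c \<in> charts_at \<A> (\<phi> t \<eta>)" "dd (\<phi> t) c c \<eta> (\<lambda>u. Ti c (\<phi> t \<eta>) (G t \<eta> *v T c \<eta> u))"
      using a(1)[unfolded linearized_on_def, THEN conjunct2, THEN conjunct2, rule_format, OF a(2,3)]
      by (elim conjE bexE IntE) (rule that)
    have "Dg (\<phi> t) \<eta> (matrix (\<lambda>a. G t \<eta> *v a))"
      using DgI[OF ct c] by (simp add: T_Ti[OF c(1)] T_Ti[OF c(2)])
    then have D: "Dg (\<phi> t) \<eta> (G t \<eta>)" by simp
    show ?thesis using gamma0_eq[where \<phi>=\<phi>, OF ct D] D by simp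
  qed
  have "continuous_on ({0..\<tau>} \<times> UNIV) (\<lambda>p. \<gamma> (fst p) (snd p) $ i $ j)" for i j
  proof (rule continuous_on_strip)
    fix \<xi>
    obtain U G where U: "open U" "\<xi> \<in> U" "linearized_on \<tau> U G" using \<tau>(2)[of \<xi>] by (elim exE conjE) (rule that)
    then have "continuous_on ({0..\<tau>} \<times> U) (\<lambda>p. G (fst p) (snd p) $ i $ j)" by (simp add: linearized_on_def)
    then have "continuous_on ({0..\<tau>} \<times> U) (\<lambda>p. \<gamma> (fst p) (snd p) $ i $ j)"
      by (rule continuous_on_eq) (use eq[OF U(3)] in auto)
    then show "\<exists>U. open U \<and> \<xi> \<in> U \<and> continuous_on ({0..\<tau>} \<times> U) (\<lambda>p. \<gamma> (fst p) (snd p) $ i $ j)" using U by blast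
  qed
  moreover have "rsymplectic (\<gamma> t \<eta>) \<and> Dg (\<phi> t) \<eta> (\<gamma> t \<eta>)" if t: "t \<in> {0..\<tau>}" for t \<eta>
  proof -
    obtain U G where U: "\<eta> \<in> U" "linearized_on \<tau> U G" using \<tau>(2)[of \<eta>] by (elim exE conjE) (rule that)
    show ?thesis using eq[OF U(2) t U(1)] U t by (auto simp: linearized_on_def)
  qed
  ultimately show ?thesis using c \<tau>(1) unfolding linearized_def by blast
qed

lemma linearized_mono: "linearized r \<Longrightarrow> r' \<le> r \<Longrightarrow> linearized r'"
proof -
  assume a: "linearized r" "r' \<le> r"
  have sub: "{0..r'} \<times> (UNIV :: 'a set) \<subseteq> {0..r} \<times> UNIV" using a(2) by auto
  show ?thesis
    using a(1) unfolding linearized_def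
    by (elim conjE, intro conjI allI) (blast intro: continuous_on_subset[OF _ sub], blast intro: continuous_on_subset[OF _ sub], use a(2) in auto)
qed

lemma linearized_cocycle:
  assumes S: "linearized S" "s \<in> {0..S}" and r: "linearized r" "t \<in> {0..r}"
  shows "Dg (\<phi> (s + t)) \<xi> (\<gamma> s (\<phi> t \<xi>) ** \<gamma> t \<xi>)" "\<gamma> (s + t) \<xi> = \<gamma> s (\<phi> t \<xi>) ** \<gamma> t \<xi>"
proof -
  have ct: "continuous_on UNIV (\<phi> t)" "continuous_on UNIV (\<phi> s)"
    using S r linearized_continuous_flow unfolding linearized_def by blast+
  have "Dg (\<phi> t) \<xi> (\<gamma> t \<xi>)" "Dg (\<phi> s) (\<phi> t \<xi>) (\<gamma> s (\<phi> t \<xi>))" using S r unfolding linearized_def by blast+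
  from Dg_comp[OF ct(1) this] show D: "Dg (\<phi> (s + t)) \<xi> (\<gamma> s (\<phi> t \<xi>) ** \<gamma> t \<xi>)"
    unfolding flow_add[abs_def] .
  have "continuous_on UNIV (\<phi> (s + t))"
    using continuous_on_compose2[OF ct(2) ct(1)] unfolding flow_add[abs_def] by simp
  then show "\<gamma> (s + t) \<xi> = \<gamma> s (\<phi> t \<xi>) ** \<gamma> t \<xi>" using gamma0_eq[where \<phi>=\<phi>] D by blast
qed

text \<open>After time r, flow and matrix are those of the remaining time at the point reached at r,
  the matrix being multiplied by the one at r. Continuity and symplecticity pass through this
  formula.\<close>

lemma linearized_add:
  assumes S: "linearized S" "0 \<le> S" and r: "linearized r" "0 \<le> r"
  shows "linearized (S + r)"
proof -
  let ?D = "{r..S + r} \<times> (UNIV :: 'a set)" and ?E = "{0..r} \<times> (UNIV :: 'a set)"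
  let ?q = "\<lambda>p :: real \<times> 'a. (fst p - r, \<phi> r (snd p))"
  have cT: "continuous_on UNIV (\<phi> r)" by (rule linearized_continuous_flow[of r]) (use r in \<open>auto simp: linearized_def\<close>)
  have c2: "continuous_on ?D (\<lambda>p. \<phi> r (snd p))"
    by (rule continuous_on_compose2[OF cT]) (auto intro!: continuous_intros)
  have q: "continuous_on ?D ?q" "?q ` ?D \<subseteq> {0..S} \<times> UNIV" by (auto intro!: continuous_intros c2)
  have un: "{0..S + r} \<times> (UNIV :: 'a set) = ?E \<union> ?D" using S r by auto
  have split: "\<phi> (fst p) (snd p) = \<phi> (fst (?q p)) (snd (?q p))"
    "\<gamma> (fst p) (snd p) = \<gamma> (fst (?q p)) (snd (?q p)) ** \<gamma> r (snd p)" if "p \<in> ?D" for p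
    using flow_add[of "fst p - r" r "snd p"] linearized_cocycle(2)[OF S(1) _ r(1), of "fst p - r" r "snd p"] that r(2) by auto
  have "continuous_on ?D (\<lambda>p. \<phi> (fst (?q p)) (snd (?q p)))"
    by (rule continuous_on_compose2[OF _ q]) (use S in \<open>simp add: linearized_def\<close>)
  then have 1: "continuous_on ?D (\<lambda>p. \<phi> (fst p) (snd p))" by (rule continuous_on_eq) (use split in auto)
  have "continuous_on ?D (\<lambda>p. \<gamma> (fst (?q p)) (snd (?q p)) $ i $ j)" for i j
    by (rule continuous_on_compose2[OF _ q]) (use S in \<open>simp add: linearized_def\<close>)
  moreover have "continuous_on ?D (\<lambda>p. \<gamma> r (snd p) $ i $ j)" for i j
  proof -
    have "continuous_on ?E (\<lambda>p. \<gamma> (fst p) (snd p) $ i $ j)" using r by (simp add: linearized_def)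
    from continuous_on_compose2[OF this continuous_on_Pair[OF continuous_on_const[of ?D r] continuous_on_snd[OF continuous_on_id]]] r
    show ?thesis by force
  qed
  ultimately have "continuous_on ?D (\<lambda>p. (\<gamma> (fst (?q p)) (snd (?q p)) ** \<gamma> r (snd p)) $ i $ j)" for i j
    by (rule continuous_on_matrix_mult)
  then have 2: "continuous_on ?D (\<lambda>p. \<gamma> (fst p) (snd p) $ i $ j)" for i j
    by (rule continuous_on_eq) (use split in auto)
  have cl: "closed ?E" "closed ?D" by (intro closed_Times closed_atLeastAtMost closed_UNIV)+
  have "rsymplectic (\<gamma> t \<eta>) \<and> Dg (\<phi> t) \<eta> (\<gamma> t \<eta>)" if t: "t \<in> {0..S + r}" for t \<eta>
  proof (cases "t \<le> r")
    case True then show ?thesis using r t by (simp add: linearized_def)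
  next
    case False
    then have s: "t - r \<in> {0..S}" "r \<in> {0..r}" using t r by auto
    note co = linearized_cocycle[OF S(1) s(1) r(1) s(2), of \<eta>]
    have "rsymplectic (\<gamma> (t - r) (\<phi> r \<eta>))" "rsymplectic (\<gamma> r \<eta>)" using S r s by (auto simp: linearized_def)
    then have "rsymplectic (\<gamma> (t - r) (\<phi> r \<eta>) ** \<gamma> r \<eta>)"
      by (simp add: rsymplectic_def flip: matrix_vector_mul_assoc)
    then show ?thesis using co by simp
  qed
  then show ?thesis
    unfolding linearized_def un using r 1 2 cl by (auto intro!: continuous_on_closed_Un simp: linearized_def)
qed

lemma linearized: "linearized r"
proof -
  obtain \<tau> where \<tau>: "0 < \<tau>" "linearized \<tau>" using linearized_small by blast
  have "linearized (real (Suc k) * \<tau>)" for k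
  proof (induction k)
    case (Suc k)
    have "linearized (\<tau> + real (Suc k) * \<tau>)" by (rule linearized_add[OF \<tau>(2) _ Suc]) (use \<tau> in auto)
    then show ?case by (simp add: algebra_simps)
  qed (simp add: \<tau>)
  moreover obtain k where "r / \<tau> \<le> real k" using real_arch_simple by blast
  then have "r \<le> real (Suc k) * \<tau>" using \<tau>(1) by (simp add: field_simps)
  ultimately show ?thesis using linearized_mono by blast
qed

lemma flow_continuous: "continuous_on ({0..r} \<times> UNIV) (\<lambda>p. \<phi> (fst p) (snd p))"
  and \<gamma>_continuous: "continuous_on ({0..r} \<times> UNIV) (\<lambda>p. \<gamma> (fst p) (snd p) $ i $ j)"
  using linearized[of r] by (auto simp: linearized_def)

lemma \<gamma>_symplectic: "0 \<le> t \<Longrightarrow> rsymplectic (\<gamma> t \<xi>)"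
  and \<gamma>_Dg: "0 \<le> t \<Longrightarrow> Dg (\<phi> t) \<xi> (\<gamma> t \<xi>)"
  using linearized[of t] by (auto simp: linearized_def)

lemma \<gamma>_cocycle: "0 \<le> s \<Longrightarrow> 0 \<le> t \<Longrightarrow> \<gamma> (s + t) \<xi> = \<gamma> s (\<phi> t \<xi>) ** \<gamma> t \<xi>"
  using linearized_cocycle(2)[OF linearized[of s] _ linearized[of t]] by auto

lemma flow_continuous_space: "0 \<le> t \<Longrightarrow> continuous_on UNIV (\<phi> t)"
  using linearized_continuous_flow[OF flow_continuous[of t]] by auto

lemma \<gamma>_0: "\<gamma> 0 \<xi> = mat 1"
proof -
  have "\<phi> 0 = (\<lambda>\<eta>. \<eta>)" by (simp add: fun_eq_iff flow_0)
  then show ?thesis using gamma0_eq[where \<phi>=\<phi>, of 0 \<xi> "mat 1"] Dg_id by (simp add: continuous_on_id)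
qed

end

section \<open>The index of the linearized flow\<close>

lemma exp_Ln_near_1:
  assumes "cmod (z - 1) < 1" shows "exp (Ln z) = z" "z \<notin> \<real>\<^sub>\<le>\<^sub>0"
proof -
  have "\<bar>Re (z - 1)\<bar> < 1" using abs_Re_le_cmod[of "z - 1"] assms by linarith
  then have "0 < Re z" by auto
  then have "z \<noteq> 0" "z \<notin> \<real>\<^sub>\<le>\<^sub>0" by (auto simp: complex_nonpos_Reals_iff)
  then show "exp (Ln z) = z" "z \<notin> \<real>\<^sub>\<le>\<^sub>0" by simp_all
qed

text \<open>The lift is built in the time direction from the constant value at time 0. By
  compactness the quotients of values at sufficiently close times are near 1 for all points at once,
  and the principal logarithms of finitely many quotients add up to a logarithm continuous in both
  variables.\<close>

lemma continuous_arg_on_strip: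
  fixes d :: "real \<times> 'a::t2_space \<Rightarrow> complex"
  assumes cpt: "compact (UNIV :: 'a set)" and d: "continuous_on ({0..T} \<times> UNIV) d"
    and nz: "\<And>p. p \<in> {0..T} \<times> UNIV \<Longrightarrow> d p \<noteq> 0" and T: "0 < T"
    and d0: "\<And>\<xi>. d (0, \<xi>) = d0"
  obtains \<rho> where "continuous_on ({0..T} \<times> UNIV) \<rho>"
    "\<And>p. p \<in> {0..T} \<times> UNIV \<Longrightarrow> d p = of_real (cmod (d p)) * cis (\<rho> p)"
proof -
  define D where "D = {0..T} \<times> {0..T} \<times> (UNIV :: 'a set)"
  define q where "q p = d (fst p, snd (snd p)) / d (fst (snd p), snd (snd p))" for p
  have cD: "compact D" unfolding D_def by (intro compact_Times compact_Icc cpt)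
  have q: "continuous_on D q" unfolding q_def
    by (intro continuous_on_divide ballI continuous_on_compose2[OF d] nz) (auto simp: D_def intro!: continuous_intros)
  define Z where "Z = D \<inter> (\<lambda>p. cmod (q p - 1)) -` {1..}"
  have "closed Z" unfolding Z_def
    by (rule continuous_closed_preimage) (auto intro!: continuous_intros q compact_imp_closed[OF cD])
  then have cZ: "compact Z" using compact_Int_closed[OF cD, of Z] by (simp add: Z_def Int_absorb1)
  \<comment> \<open>The least time gap on the compact set \<open>Z\<close> of pairs whose quotient
    is not close to 1; it is positive because the quotient at equal times is 1.\<close>
  obtain e where e: "0 < e" "\<And>s t \<xi>. s \<in> {0..T} \<Longrightarrow> t \<in> {0..T} \<Longrightarrow> \<bar>s - t\<bar> < e \<Longrightarrow> cmod (q (s, t, \<xi>) - 1) < 1"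
  proof (cases "Z = {}")
    case True
    have "cmod (q (s, t, \<xi>) - 1) < 1" if "s \<in> {0..T}" "t \<in> {0..T}" for s t \<xi>
    proof (rule ccontr)
      assume "\<not> ?thesis"
      then have "(s, t, \<xi>) \<in> Z" using that by (simp add: Z_def D_def)
      then show False using True by simp
    qed
    then show ?thesis by (intro that[of 1]) auto
  next
    case False
    have "continuous_on Z (\<lambda>p. \<bar>fst p - fst (snd p)\<bar>)" by (intro continuous_intros)
    from continuous_attains_inf[OF cZ False this] obtain p where p: "p \<in> Z"
      "\<forall>p'\<in>Z. \<bar>fst p - fst (snd p)\<bar> \<le> \<bar>fst p' - fst (snd p')\<bar>" by (elim bexE) (rule that)
    show ?thesis
    proof (rule that[of "\<bar>fst p - fst (snd p)\<bar>"])
      have "fst p \<noteq> fst (snd p)"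
      proof
        assume "fst p = fst (snd p)"
        moreover have "d (fst (snd p), snd (snd p)) \<noteq> 0" using p(1) by (intro nz) (auto simp: Z_def D_def)
        ultimately have "q p = 1" by (simp add: q_def)
        then show False using p(1) by (simp add: Z_def)
      qed
      then show "0 < \<bar>fst p - fst (snd p)\<bar>" by simp
      fix s t \<xi> assume st: "s \<in> {0..T}" "t \<in> {0..T}" "\<bar>s - t\<bar> < \<bar>fst p - fst (snd p)\<bar>"
      show "cmod (q (s, t, \<xi>) - 1) < 1"
      proof (rule ccontr)
        assume "\<not> ?thesis"
        then have "(s, t, \<xi>) \<in> Z" using st by (simp add: Z_def D_def)
        then show False using p(2) st(3) by fastforce
      qed
    qed
  qed
  obtain K :: nat where K: "T / e < real K" using reals_Archimedean2 by blast
  have "0 < T / e" using T e(1) by simp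
  then have K0: "0 < real K" using K by linarith
  \<comment> \<open>The subdivision of [0, t] scales with t. Its nodes therefore depend continuously
    on p, and the product of the quotients telescopes to the value at t over the value at 0.\<close>
  define r where "r k p = q (real (Suc k) * fst p / real K, real k * fst p / real K, snd p)" for k and p :: "real \<times> 'a"
  let ?E = "{0..T} \<times> (UNIV :: 'a set)"
  have node: "real k * fst p / real K \<in> {0..T}" if "p \<in> ?E" "k \<le> K" for k p
  proof -
    have "real k * fst p \<le> real K * T" using that by (intro mult_mono) auto
    then show ?thesis using that K0 by (auto simp: field_simps)
  qed
  have r1: "cmod (r k p - 1) < 1" if "p \<in> ?E" "k < K" for k p
    unfolding r_def
  proof (rule e(2))
    show "real (Suc k) * fst p / real K \<in> {0..T}" "real k * fst p / real K \<in> {0..T}"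
      by (rule node[OF that(1)], use that(2) in simp)+
    have "real (Suc k) * fst p / real K - real k * fst p / real K = fst p / real K"
      by (simp add: diff_divide_distrib[symmetric] algebra_simps)
    moreover have "fst p / real K \<le> T / real K" "0 \<le> fst p / real K" using that K0 by (auto simp: divide_right_mono)
    moreover have "T / real K < e" using K K0 e(1) by (simp add: field_simps)
    ultimately show "\<bar>real (Suc k) * fst p / real K - real k * fst p / real K\<bar> < e" by linarith
  qed
  have cr: "continuous_on ?E (r k)" if "k < K" for k
    unfolding r_def
  proof (rule continuous_on_compose2[OF q])
    show "continuous_on ?E (\<lambda>p. (real (Suc k) * fst p / real K, real k * fst p / real K, snd p))"
      using K0 by (intro continuous_intros) auto
    show "(\<lambda>p. (real (Suc k) * fst p / real K, real k * fst p / real K, snd p)) ` ?E \<subseteq> D"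
    proof (rule image_subsetI)
      fix p assume p: "p \<in> ?E"
      show "(real (Suc k) * fst p / real K, real k * fst p / real K, snd p) \<in> D"
        using node[OF p, of "Suc k"] node[OF p, of k] that by (simp add: D_def)
    qed
  qed
  define L where "L p = (\<Sum>k<K. Ln (r k p))" for p
  have cL: "continuous_on ?E L" unfolding L_def
    by (intro continuous_on_sum continuous_on_Ln' cr exp_Ln_near_1(2) r1) auto
  have tel: "(\<Prod>k<m. r k p) = d (real m * fst p / real K, snd p) / d0" if p: "p \<in> ?E" and m: "m \<le> K" for p m
    using m
  proof (induction m)
    case 0
    have "d0 \<noteq> 0" using nz[of "(0, snd p)"] d0[of "snd p"] T by auto
    then show ?case by (simp add: d0)
  next
    case (Suc m)
    have "d (real m * fst p / real K, snd p) \<noteq> 0" using node[OF p, of m] Suc(2) by (intro nz) auto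
    then show ?case using Suc by (simp add: r_def q_def)
  qed
  have EL: "d p = d0 * exp (L p)" if "p \<in> ?E" for p
  proof -
    have "d0 \<noteq> 0" using nz[of "(0, snd p)"] d0[of "snd p"] T by auto
    moreover have "exp (L p) = (\<Prod>k<K. r k p)" unfolding L_def exp_sum[OF finite_lessThan]
      by (intro prod.cong refl exp_Ln_near_1 r1 that) auto
    moreover have "real K * fst p / real K = fst p" using K0 by simp
    ultimately show ?thesis using tel[OF that order_refl] by simp
  qed
  show ?thesis
  proof (rule that[of "\<lambda>p. Arg d0 + Im (L p)"])
    show "continuous_on ?E (\<lambda>p. Arg d0 + Im (L p))" by (intro continuous_intros cL)
    fix p assume p: "p \<in> ?E"
    have 1: "d0 = of_real (cmod d0) * cis (Arg d0)" using rcis_cmod_Arg[of d0] unfolding rcis_def by (rule sym)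
    have 2: "exp (L p) = of_real (cmod (exp (L p))) * cis (Im (L p))" unfolding norm_exp_eq_Re by (rule exp_eq_polar)
    have "d0 * exp (L p) = (of_real (cmod d0) * cis (Arg d0)) * (of_real (cmod (exp (L p))) * cis (Im (L p)))"
      by (rule arg_cong2[OF 1 2])
    also have "\<dots> = of_real (cmod d0 * cmod (exp (L p))) * (cis (Arg d0) * cis (Im (L p)))" by (simp add: mult_ac)
    finally show "d p = of_real (cmod (d p)) * cis (Arg d0 + Im (L p))"
      unfolding EL[OF p] norm_mult cis_mult .
  qed
qed

lemma sum_ceiling_bounds:
  fixes y :: "nat \<Rightarrow> real"
  shows "(\<Sum>j<N. y j) \<le> of_int (\<Sum>j<N. \<lceil>y j\<rceil>)" "of_int (\<Sum>j<N. \<lceil>y j\<rceil>) \<le> (\<Sum>j<N. y j) + real N"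
proof -
  show "(\<Sum>j<N. y j) \<le> of_int (\<Sum>j<N. \<lceil>y j\<rceil>)" unfolding of_int_sum by (intro sum_mono) simp
  have "of_int (\<Sum>j<N. \<lceil>y j\<rceil>) \<le> (\<Sum>j<N. y j + 1)" unfolding of_int_sum
    by (intro sum_mono) (simp add: of_int_ceiling_le_add_one)
  then show "of_int (\<Sum>j<N. \<lceil>y j\<rceil>) \<le> (\<Sum>j<N. y j) + real N" by (simp add: sum.distrib)
qed

section \<open>Quasi-additivity of the index along the flow\<close>

context hamiltonian_flow
begin

abbreviation index :: "real \<Rightarrow> 'a \<Rightarrow> real" where
  "index t \<xi> \<equiv> real_of_int (flow_index \<A> f \<phi> t \<xi>)"

definition dD :: "real \<times> 'a \<Rightarrow> complex" where "dD p = det (Dm (cmat (\<gamma> (fst p) (snd p))))"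

lemma \<gamma>_csymplectic: "0 \<le> t \<Longrightarrow> csymplectic (cmat (\<gamma> t \<xi>))"
  by (intro csymplectic_cmat \<gamma>_symplectic)

lemma cmat_\<gamma>_continuous: "continuous_on ({0..r} \<times> UNIV) (\<lambda>p. cmat (\<gamma> (fst p) (snd p)) $ i $ j)"
  by (simp add: continuous_on_of_real \<gamma>_continuous)

lemma Dm_Cm_continuous:
  "continuous_on ({0..r} \<times> UNIV) (\<lambda>p. Dm (cmat (\<gamma> (fst p) (snd p))) $ i $ j)"
  "continuous_on ({0..r} \<times> UNIV) (\<lambda>p. Cm (cmat (\<gamma> (fst p) (snd p))) $ i $ j)"
  unfolding Dm_def Cm_def vector_add_component
  by (intro continuous_on_add continuous_on_const continuous_on_matrix_mult cmat_\<gamma>_continuous)+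

lemma dD_continuous: "continuous_on ({0..r} \<times> UNIV) dD"
  unfolding dD_def by (intro continuous_on_det Dm_Cm_continuous)

lemma dD_nonzero: "p \<in> {0..r} \<times> UNIV \<Longrightarrow> dD p \<noteq> 0"
  using invertible_Dm[OF \<gamma>_csymplectic] by (auto simp: dD_def invertible_det_nz)

text \<open>The unitary operator has the conjugate of \<open>dD\<close> over \<open>dD\<close> as
  determinant, so its angles can be chosen with sum \<open>- 2 * \<rho>\<close>, continuously in
  time and point. Rounding up raises the sum at either end by between 0 and 2n, which gives the
  bound. As a finite sum of ceilings of continuous functions the index is Borel.\<close>

lemma index_arg:
  assumes r: "0 < r"
  obtains \<rho> where "continuous_on ({0..r} \<times> UNIV) \<rho>"
    "\<And>p. p \<in> {0..r} \<times> UNIV \<Longrightarrow> dD p = of_real (cmod (dD p)) * cis (\<rho> p)"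
    "\<And>t \<xi>. t \<in> {0..r} \<Longrightarrow> \<bar>index t \<xi> + (\<rho> (t, \<xi>) - \<rho> (0, \<xi>)) / pi\<bar> \<le> CARD('n + 'n)"
    "\<And>t. t \<in> {0..r} \<Longrightarrow> index t \<in> borel_measurable borel"
proof -
  let ?E = "{0..r} \<times> (UNIV :: 'a set)" and ?N = "CARD('n + 'n)"
  have d0: "dD (0, \<xi>) = det (Dm (mat 1 :: complex ^ ('n + 'n) ^ ('n + 'n)))" for \<xi> by (simp add: dD_def \<gamma>_0 cmat_mat_1)
  have nz: "dD p \<noteq> 0" if "p \<in> ?E" for p using that by (rule dD_nonzero)
  obtain \<rho> where \<rho>: "continuous_on ?E \<rho>" "\<And>p. p \<in> ?E \<Longrightarrow> dD p = of_real (cmod (dD p)) * cis (\<rho> p)"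
    by (rule continuous_arg_on_strip[OF cpt dD_continuous nz r d0], assumption, rule that)
  have "compact ?E" by (intro compact_Times compact_Icc cpt)
  from compact_imp_bounded[OF compact_continuous_image[OF \<rho>(1) this]]
  obtain R where R: "\<forall>y\<in>\<rho> ` ?E. norm y \<le> R" unfolding bounded_iff by (elim exE) (rule that)
  let ?p = "\<lambda>p. char_lag (cmat (\<gamma> (fst p) (snd p)))"
  have N: "0 < ?N" by simp
  have S: "continuous_on ?E (\<lambda>p. - 2 * \<rho> p)" by (intro continuous_intros \<rho>)
  have SR: "\<bar>- 2 * \<rho> p\<bar> \<le> 2 * R" if "p \<in> ?E" for p using R that by (auto simp: abs_mult)
  have cp: "continuous_on ?E (\<lambda>p. ?p p z)" for z
    unfolding char_lag_def
    using dD_nonzero[of _ r]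
    by (intro continuous_on_divide continuous_on_det)
      (auto simp: dD_def intro!: Dm_Cm_continuous continuous_on_diff continuous_on_matrix_mult continuous_on_const)
  have ex: "\<exists>a. (\<forall>z. ?p p z = (\<Prod>j<?N. z - cis (a j))) \<and> cis (\<Sum>j<?N. a j) = cis (- 2 * \<rho> p)" if p: "p \<in> ?E" for p
  proof -
    have sy: "csymplectic (cmat (\<gamma> (fst p) (snd p)))" using p by (intro \<gamma>_csymplectic) auto
    obtain a :: "nat \<Rightarrow> real" where a: "\<And>z. ?p p z = (\<Prod>j<?N. z - cis (a j))"
      "det (Cm (cmat (\<gamma> (fst p) (snd p)))) / det (Dm (cmat (\<gamma> (fst p) (snd p)))) = (\<Prod>j<?N. cis (a j))"
      by (rule char_lag_eigenvalues[OF sy]) (rule that)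
    have "cis (\<Sum>j<m. a j) = (\<Prod>j<m. cis (a j))" for m
      by (induction m) (simp_all add: cis_mult[symmetric])
    then have "cis (\<Sum>j<?N. a j) = cnj (dD p) / dD p"
      using a(2) by (simp add: det_Cm_cmat dD_def)
    also have "cnj (dD p) = of_real (cmod (dD p)) * cis (- \<rho> p)"
      using arg_cong[OF \<rho>(2)[OF p], of cnj] by (simp add: cis_cnj)
    also have "of_real (cmod (dD p)) * cis (- \<rho> p) / dD p = of_real (cmod (dD p)) * cis (- \<rho> p) / (of_real (cmod (dD p)) * cis (\<rho> p))"
      using \<rho>(2)[OF p] by simp
    also have "\<dots> = cis (- \<rho> p) / cis (\<rho> p)" using dD_nonzero[OF p] by simp
    also have "\<dots> = cis (- 2 * \<rho> p)" by (simp add: cis_divide)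
    finally show ?thesis using a(1) by (intro exI[of _ a]) simp
  qed
  obtain x :: "real \<times> 'a \<Rightarrow> nat \<Rightarrow> real" where x: "\<And>j. continuous_on ?E (\<lambda>p. x p j)"
    "\<And>p z. p \<in> ?E \<Longrightarrow> ?p p z = (\<Prod>j<?N. z - cis (x p j))" "\<And>p. p \<in> ?E \<Longrightarrow> (\<Sum>j<?N. x p j) = - 2 * \<rho> p"
    by (rule continuous_angles[OF N S SR cp ex], assumption, assumption, rule that)
  have ind: "flow_index \<A> f \<phi> t \<xi> = (\<Sum>j<?N. \<lceil>x (t, \<xi>) j / (2 * pi)\<rceil> - \<lceil>x (0, \<xi>) j / (2 * pi)\<rceil>)"
    if t: "t \<in> {0..r}" for t \<xi>
    unfolding flow_index_def
  proof (rule i1_eq_sum_ceiling[where x="\<lambda>j s. x (s, \<xi>) j"])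
    show "0 \<le> t" using t by simp
    show "csymplectic (cmat (\<gamma> s \<xi>))" if "s \<in> {0..t}" for s using that by (intro \<gamma>_csymplectic) simp
    show "continuous_on {0..t} (\<lambda>s. x (s, \<xi>) j)" for j
      by (rule continuous_on_compose2[OF x(1)]) (use t in \<open>auto intro!: continuous_intros\<close>)
    show "char_lag (cmat (\<gamma> s \<xi>)) z = (\<Prod>j<?N. z - cis (x (s, \<xi>) j))" if "s \<in> {0..t}" for s z
      using x(2)[of "(s, \<xi>)" z] that t by simp
  qed
  show ?thesis
  proof (rule that[OF \<rho>])
    fix t \<xi> assume t: "t \<in> {0..r}"
    have s: "(\<Sum>j<?N. x (s, \<xi>) j / (2 * pi)) = - \<rho> (s, \<xi>) / pi" if "s \<in> {0..r}" for s
      using x(3)[of "(s, \<xi>)"] that by (simp add: sum_divide_distrib[symmetric])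
    have "index t \<xi> = of_int (\<Sum>j<?N. \<lceil>x (t, \<xi>) j / (2 * pi)\<rceil>) - of_int (\<Sum>j<?N. \<lceil>x (0, \<xi>) j / (2 * pi)\<rceil>)"
      unfolding ind[OF t] sum_subtractf of_int_diff ..
    moreover note sum_ceiling_bounds[of "\<lambda>j. x (t, \<xi>) j / (2 * pi)" ?N] sum_ceiling_bounds[of "\<lambda>j. x (0, \<xi>) j / (2 * pi)" ?N]
    moreover have "0 \<in> {0..r}" using r by simp
    ultimately show "\<bar>index t \<xi> + (\<rho> (t, \<xi>) - \<rho> (0, \<xi>)) / pi\<bar> \<le> ?N"
      unfolding s[OF t] s[OF \<open>0 \<in> {0..r}\<close>] diff_divide_distrib by linarith
  next
    fix t assume t: "t \<in> {0..r}"
    have m: "(\<lambda>\<xi>. x (s, \<xi>) j) \<in> borel_measurable borel" if "s \<in> {0..r}" for s j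
      by (rule borel_measurable_continuous_onI, rule continuous_on_compose2[OF x(1)]) (use that in \<open>auto intro!: continuous_intros\<close>)
    have "0 \<in> {0..r}" using r by simp
    note m' = m[OF t] m[OF this]
    show "index t \<in> borel_measurable borel" unfolding ind[OF t] of_int_sum of_int_diff
      using m' by measurable
  qed
qed

lemma index_measurable: "0 \<le> t \<Longrightarrow> index t \<in> borel_measurable borel"
  by (rule index_arg[of "t + 1"]) auto

lemma index_bounded: "\<exists>C. \<forall>t\<in>{0..1}. \<forall>\<xi>. \<bar>index t \<xi>\<bar> \<le> C"
proof -
  let ?E = "{0..1::real} \<times> (UNIV :: 'a set)"
  obtain \<rho> where \<rho>: "continuous_on ?E \<rho>" "\<And>t \<xi>. t \<in> {0..1} \<Longrightarrow> \<bar>index t \<xi> + (\<rho> (t, \<xi>) - \<rho> (0, \<xi>)) / pi\<bar> \<le> CARD('n + 'n)"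
    by (rule index_arg[OF zero_less_one]) (rule that)
  have "compact ?E" by (intro compact_Times compact_Icc cpt)
  from compact_imp_bounded[OF compact_continuous_image[OF \<rho>(1) this]]
  obtain R where R: "\<forall>y\<in>\<rho> ` ?E. norm y \<le> R" unfolding bounded_iff by (elim exE) (rule that)
  have "\<bar>index t \<xi>\<bar> \<le> CARD('n + 'n) + 2 * R / pi" if t: "t \<in> {0..1}" for t \<xi>
  proof -
    have "\<bar>\<rho> (t, \<xi>)\<bar> \<le> R" "\<bar>\<rho> (0, \<xi>)\<bar> \<le> R" using R t by auto
    then have "\<bar>(\<rho> (t, \<xi>) - \<rho> (0, \<xi>)) / pi\<bar> \<le> 2 * R / pi" by (simp add: divide_right_mono)
    then show ?thesis using \<rho>(2)[OF t, of \<xi>] by linarith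
  qed
  then show ?thesis by blast
qed

text \<open>By the cocycle identity the matrix at time \<open>t + q\<close> is the one at time q
  along the shifted orbit times the fixed matrix at time t. The homotopy bound and the three
  replacements of an index by an argument each cost \<open>CARD('n + 'n)\<close>.\<close>

lemma index_quasi_additive:
  assumes t: "0 \<le> t" and s: "0 \<le> s"
  shows "\<bar>index (t + s) \<xi> - index t \<xi> - index s (\<phi> t \<xi>)\<bar> \<le> 4 * CARD('n + 'n)"
proof -
  define r where "r = t + s + 1"
  have r: "0 < r" using t s by (simp add: r_def)
  obtain \<rho> where \<rho>: "continuous_on ({0..r} \<times> UNIV) \<rho>"
    "\<And>p. p \<in> {0..r} \<times> UNIV \<Longrightarrow> dD p = of_real (cmod (dD p)) * cis (\<rho> p)"
    "\<And>t \<xi>. t \<in> {0..r} \<Longrightarrow> \<bar>index t \<xi> + (\<rho> (t, \<xi>) - \<rho> (0, \<xi>)) / pi\<bar> \<le> CARD('n + 'n)"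
    by (rule index_arg[OF r]) (rule that)
  have "\<bar>(\<rho> (t + s, \<xi>) - \<rho> (t + 0, \<xi>)) - (\<rho> (s, \<phi> t \<xi>) - \<rho> (0, \<phi> t \<xi>))\<bar> \<le> CARD('n + 'n) * pi"
  proof (rule arg_det_quasi_additive[OF s, where A="\<lambda>q. cmat (\<gamma> q (\<phi> t \<xi>))" and B="cmat (\<gamma> t \<xi>)" and u="\<lambda>q. \<rho> (t + q, \<xi>)"
        and w="\<lambda>q. \<rho> (q, \<phi> t \<xi>)"])
    show "csymplectic (cmat (\<gamma> t \<xi>))" by (rule \<gamma>_csymplectic[OF t])
    show "continuous_on {0..s} (\<lambda>q. cmat (\<gamma> q (\<phi> t \<xi>)) $ i $ j)" for i j
    proof -
      have "continuous_on {0..s} (\<lambda>q. cmat (\<gamma> (fst (q, \<phi> t \<xi>)) (snd (q, \<phi> t \<xi>))) $ i $ j)"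
        by (rule continuous_on_compose2[OF cmat_\<gamma>_continuous[of s i j]]) (auto intro!: continuous_intros)
      then show ?thesis by (simp only: fst_conv snd_conv)
    qed
    show "continuous_on {0..s} (\<lambda>q. \<rho> (t + q, \<xi>))" "continuous_on {0..s} (\<lambda>q. \<rho> (q, \<phi> t \<xi>))"
      by (rule continuous_on_compose2[OF \<rho>(1)]; use t in \<open>auto simp: r_def intro!: continuous_intros\<close>)+
    fix q assume q: "q \<in> {0..s}"
    show "csymplectic (cmat (\<gamma> q (\<phi> t \<xi>)))" using q by (intro \<gamma>_csymplectic) simp
    have e: "cmat (\<gamma> q (\<phi> t \<xi>)) ** cmat (\<gamma> t \<xi>) = cmat (\<gamma> (t + q) \<xi>)"
      using \<gamma>_cocycle[of q t \<xi>] q t by (simp add: cmat_mult add.commute)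
    have "(t + q, \<xi>) \<in> {0..r} \<times> UNIV" "(q, \<phi> t \<xi>) \<in> {0..r} \<times> UNIV" using q t s by (auto simp: r_def)
    from \<rho>(2)[OF this(1)] \<rho>(2)[OF this(2)]
    show "det (Dm (cmat (\<gamma> q (\<phi> t \<xi>)) ** cmat (\<gamma> t \<xi>))) = of_real (cmod (det (Dm (cmat (\<gamma> q (\<phi> t \<xi>)) ** cmat (\<gamma> t \<xi>))))) * cis (\<rho> (t + q, \<xi>))"
      "det (Dm (cmat (\<gamma> q (\<phi> t \<xi>)))) = of_real (cmod (det (Dm (cmat (\<gamma> q (\<phi> t \<xi>)))))) * cis (\<rho> (q, \<phi> t \<xi>))"
      unfolding e by (simp_all add: dD_def)
  qed
  then have "\<bar>((\<rho> (t + s, \<xi>) - \<rho> (t, \<xi>)) - (\<rho> (s, \<phi> t \<xi>) - \<rho> (0, \<phi> t \<xi>))) / pi\<bar> \<le> CARD('n + 'n)"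
    by (simp add: field_simps)
  then have "\<bar>(\<rho> (t + s, \<xi>) - \<rho> (0, \<xi>)) / pi - (\<rho> (t, \<xi>) - \<rho> (0, \<xi>)) / pi - (\<rho> (s, \<phi> t \<xi>) - \<rho> (0, \<phi> t \<xi>)) / pi\<bar> \<le> CARD('n + 'n)"
    by (simp add: diff_divide_distrib)
  moreover have "t + s \<in> {0..r}" "t \<in> {0..r}" "s \<in> {0..r}" using t s by (auto simp: r_def)
  note \<rho>(3)[OF this(1), of \<xi>] \<rho>(3)[OF this(2), of \<xi>] \<rho>(3)[OF this(3), of "\<phi> t \<xi>"]
  ultimately show ?thesis by linarith
qed

end

section \<open>Change of variables for arbitrary finite index types\<close>

text \<open>The change of variables theorem of the library requires a well-ordered index type.\<close>

typedef 'm ordered_copy = "UNIV :: 'm set" ..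

lemma bij_Rep_ordered_copy: "bij (Rep_ordered_copy :: 'm ordered_copy \<Rightarrow> 'm)"
  by (metis Abs_ordered_copy_inverse Rep_ordered_copy_inverse UNIV_I bijI')

instance ordered_copy :: (finite) finite
proof
  have "finite (Rep_ordered_copy ` (UNIV :: 'a ordered_copy set))" by simp
  then show "finite (UNIV :: 'a ordered_copy set)"
    using bij_is_inj[OF bij_Rep_ordered_copy] by (rule finite_imageD)
qed

definition copy_rank :: "'m::finite ordered_copy \<Rightarrow> nat" where
  "copy_rank = (SOME g. inj g)"

lemma inj_copy_rank: "inj (copy_rank :: 'm::finite ordered_copy \<Rightarrow> nat)"
proof -
  have "\<exists>g :: 'm ordered_copy \<Rightarrow> nat. inj g"
    using finite_imp_inj_to_nat_seg[OF finite, where A="UNIV :: 'm ordered_copy set"] by (elim exE conjE) (rule exI)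
  then show ?thesis unfolding copy_rank_def by (rule someI_ex)
qed

instantiation ordered_copy :: (finite) wellorder
begin

definition less_eq_ordered_copy :: "'a ordered_copy \<Rightarrow> 'a ordered_copy \<Rightarrow> bool" where
  "x \<le> y \<longleftrightarrow> copy_rank x \<le> copy_rank y"

definition less_ordered_copy :: "'a ordered_copy \<Rightarrow> 'a ordered_copy \<Rightarrow> bool" where
  "x < y \<longleftrightarrow> copy_rank x < copy_rank y"

instance
proof
  fix x y :: "'a ordered_copy"
  assume "x \<le> y" "y \<le> x"
  then have "copy_rank x = copy_rank y" by (simp add: less_eq_ordered_copy_def)
  then show "x = y" by (rule injD[OF inj_copy_rank])
next
  fix P :: "'a ordered_copy \<Rightarrow> bool" and a
  assume *: "\<And>x. (\<And>y. y < x \<Longrightarrow> P y) \<Longrightarrow> P x"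
  show "P a"
  proof (induction "copy_rank a" arbitrary: a rule: less_induct)
    case less
    show ?case by (rule *, rule less) (simp add: less_ordered_copy_def)
  qed
qed (auto simp: less_eq_ordered_copy_def less_ordered_copy_def)

end

lemma permutes_UNIV_bij: "p permutes UNIV \<longleftrightarrow> bij p"
  by (auto intro: bij_imp_permutes permutes_bij)

text \<open>Conjugation with g is a sign-preserving bijection between the permutations of the two
  index types.\<close>

lemma det_reindex:
  fixes A :: "'c::comm_ring_1 ^ 'm::finite ^ 'm" and g :: "'k::finite \<Rightarrow> 'm"
  assumes g: "bij g" shows "det (\<chi> i j. A $ g i $ g j) = det A"
proof -
  have inv: "inv g (g x) = x" "g (inv g y) = y" for x y
    using g by (simp_all add: bij_is_inj bij_is_surj surj_f_inv_f)
  have perm: "g \<circ> p \<circ> inv g permutes UNIV" if "p permutes UNIV" for p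
    using bij_comp[OF bij_comp[OF bij_imp_bij_inv[OF g] permutes_bij[OF that]] g] by (simp add: permutes_UNIV_bij comp_assoc)
  have perm': "inv g \<circ> p \<circ> g permutes UNIV" if "p permutes UNIV" for p
    using bij_comp[OF bij_comp[OF g permutes_bij[OF that]] bij_imp_bij_inv[OF g]] by (simp add: permutes_UNIV_bij comp_assoc)
  have sgn: "sign (g \<circ> p \<circ> inv g) = sign p" if "p permutes UNIV" for p
  proof -
    have "map_permutation UNIV g p = g \<circ> p \<circ> inv g"
      using g by (simp add: map_permutation_def restrict_id_def bij_is_surj fun_eq_iff)
    then show ?thesis using sign_map_permutation[OF bij_is_inj[OF g] that] by simp
  qed
  show ?thesis unfolding det_def
  proof (rule sum.reindex_bij_witness[where i="\<lambda>p. inv g \<circ> p \<circ> g" and j="\<lambda>p. g \<circ> p \<circ> inv g"])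
    fix p :: "'k \<Rightarrow> 'k" assume "p \<in> {p. p permutes UNIV}"
    then have p: "p permutes UNIV" by simp
    have "(\<Prod>i\<in>UNIV. A $ i $ (g \<circ> p \<circ> inv g) i) = (\<Prod>i\<in>UNIV. A $ g i $ (g \<circ> p \<circ> inv g) (g i))"
      using prod.reindex_bij_betw[OF g] by (rule sym)
    then show "of_int (sign (g \<circ> p \<circ> inv g)) * (\<Prod>i\<in>UNIV. A $ i $ (g \<circ> p \<circ> inv g) i)
        = of_int (sign p) * (\<Prod>i\<in>UNIV. (\<chi> i j. A $ g i $ g j) $ i $ p i)"
      by (simp add: sgn[OF p] inv)
  qed (use perm[unfolded comp_def] perm'[unfolded comp_def] in \<open>auto simp: inv comp_def\<close>)
qed

definition to_copy :: "real ^ 'm::finite \<Rightarrow> real ^ 'm ordered_copy" where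
  "to_copy x = (\<chi> i. x $ Rep_ordered_copy i)"

definition of_copy :: "real ^ 'm ordered_copy \<Rightarrow> real ^ 'm::finite" where
  "of_copy y = (\<chi> i. y $ Abs_ordered_copy i)"

lemma of_to_copy [simp]: "of_copy (to_copy x) = x" and to_of_copy [simp]: "to_copy (of_copy y) = y"
  by (simp_all add: vec_eq_iff to_copy_def of_copy_def Abs_ordered_copy_inverse Rep_ordered_copy_inverse)

lemma linear_to_copy: "linear to_copy" and linear_of_copy: "linear of_copy"
  by (auto intro!: linearI simp: vec_eq_iff to_copy_def of_copy_def)

lemma bounded_linear_to_copy: "bounded_linear to_copy" and bounded_linear_of_copy: "bounded_linear of_copy"
  using linear_to_copy linear_of_copy by (simp_all add: linear_conv_bounded_linear)

lemma measurable_copy [measurable]: "to_copy \<in> borel_measurable borel" "of_copy \<in> borel_measurable borel"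
  using bounded_linear_to_copy bounded_linear_of_copy
  by (auto intro!: borel_measurable_continuous_onI linear_continuous_on)

lemma prod_Basis_vec: "(\<Prod>b\<in>Basis. (v :: real ^ 'm::finite) \<bullet> b) = (\<Prod>i\<in>UNIV. v $ i)"
proof -
  have B: "(Basis :: (real ^ 'm) set) = (\<lambda>i. axis i 1) ` UNIV" by (auto simp: Basis_vec_def)
  have "inj (\<lambda>i :: 'm. axis i (1 :: real))" by (rule injI) (simp add: axis_eq_axis)
  then show ?thesis unfolding B by (subst prod.reindex) (auto simp: inner_axis)
qed

lemma lborel_to_copy: "distr lborel borel to_copy = (lborel :: (real ^ 'm::finite ordered_copy) measure)"
proof (rule sym, rule lborel_eqI)
  fix l u :: "real ^ 'm ordered_copy" assume lu: "\<And>b. b \<in> Basis \<Longrightarrow> l \<bullet> b \<le> u \<bullet> b"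
  have le: "l $ i \<le> u $ i" for i
  proof -
    have "axis i 1 \<in> (Basis :: (real ^ 'm ordered_copy) set)" by (simp add: axis_in_Basis_iff)
    from lu[OF this] show ?thesis by (simp add: inner_axis)
  qed
  have "to_copy -` box l u = box (of_copy l) (of_copy u)"
  proof (rule set_eqI)
    fix x :: "real ^ 'm"
    have "(\<forall>i. l $ i < to_copy x $ i \<and> to_copy x $ i < u $ i) \<longleftrightarrow> (\<forall>i. of_copy l $ i < x $ i \<and> x $ i < of_copy u $ i)"
    proof (intro iffI allI)
      fix i assume "\<forall>i. l $ i < to_copy x $ i \<and> to_copy x $ i < u $ i"
      from spec[OF this, of "Abs_ordered_copy i"] show "of_copy l $ i < x $ i \<and> x $ i < of_copy u $ i"
        by (simp add: to_copy_def of_copy_def Abs_ordered_copy_inverse)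
    next
      fix i assume "\<forall>i. of_copy l $ i < x $ i \<and> x $ i < of_copy u $ i"
      from spec[OF this, of "Rep_ordered_copy i"] show "l $ i < to_copy x $ i \<and> to_copy x $ i < u $ i"
        by (simp add: to_copy_def of_copy_def Rep_ordered_copy_inverse)
    qed
    then show "x \<in> to_copy -` box l u \<longleftrightarrow> x \<in> box (of_copy l) (of_copy u)" by (simp add: mem_box_cart)
  qed
  then have "emeasure (distr lborel borel to_copy) (box l u) = emeasure lborel (box (of_copy l) (of_copy u))"
    by (subst emeasure_distr) auto
  also have "\<dots> = (\<Prod>b\<in>Basis. (of_copy u - of_copy l) \<bullet> b)"
  proof (rule emeasure_lborel_box)
    fix b :: "real ^ 'm" assume "b \<in> Basis"
    then obtain i where "b = axis i 1" by (auto simp: Basis_vec_def)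
    then show "of_copy l \<bullet> b \<le> of_copy u \<bullet> b" using le by (simp add: inner_axis of_copy_def)
  qed
  also have "(\<Prod>b\<in>Basis. (of_copy u - of_copy l) \<bullet> b) = (\<Prod>b\<in>Basis. (u - l) \<bullet> b)"
    unfolding prod_Basis_vec
    by (subst prod.reindex_bij_betw[OF bij_Rep_ordered_copy, symmetric]) (simp add: of_copy_def Rep_ordered_copy_inverse)
  finally show "emeasure (distr lborel borel to_copy) (box l u) = (\<Prod>b\<in>Basis. (u - l) \<bullet> b)" .
qed simp

text \<open>This bridges absolute integrability and nonnegative integrals, with the infinite value
  included, so that later masses can be compared before they are known to be finite.\<close>

lemma nn_integral_indicator_lborel:
  fixes h :: "'e::euclidean_space \<Rightarrow> real"
  assumes m: "(\<lambda>x. indicator A x * h x) \<in> borel_measurable borel" and h: "\<And>x. x \<in> A \<Longrightarrow> 0 \<le> h x"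
  shows "(\<integral>\<^sup>+ x. ennreal (indicator A x * h x) \<partial>lborel)
    = (if h absolutely_integrable_on A then ennreal (integral A h) else \<infinity>)"
proof -
  let ?k = "\<lambda>x. indicator A x * h x"
  have k0: "0 \<le> ?k x" for x using h by (simp add: indicator_def)
  have m': "?k \<in> borel_measurable lborel" using m by simp
  have iff: "h absolutely_integrable_on A \<longleftrightarrow> integrable lborel ?k"
    unfolding set_integrable_def using integrable_completion[OF m'] by simp
  show ?thesis
  proof (cases "h absolutely_integrable_on A")
    case True
    then have i: "integrable lborel ?k" by (simp add: iff)
    have "integral A h = (\<integral>x. ?k x \<partial>lborel)"
      using set_lebesgue_integral_eq_integral(2)[OF True] integral_completion[OF m'] by (simp add: set_lebesgue_integral_def)
    then show ?thesis using True nn_integral_eq_integral[OF i] k0 by simp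
  next
    case False
    then have ni: "\<not> integrable lborel ?k" by (simp add: iff)
    have "(\<integral>\<^sup>+ x. ennreal (norm (?k x)) \<partial>lborel) = \<infinity>"
    proof (rule ccontr)
      assume "\<not> ?thesis"
      then have "(\<integral>\<^sup>+ x. ennreal (norm (?k x)) \<partial>lborel) < \<infinity>" by (simp only: infinity_ennreal_def less_top)
      then show False using integrableI_bounded[OF m'] ni by blast
    qed
    then show ?thesis using False k0 by simp
  qed
qed

text \<open>The change of variables for absolute integrals is an equivalence for every candidate
  value b. It transfers both integrability and value, so the two sides are either equal finite
  numbers or both infinite.\<close>

lemma nn_integral_change_of_variables_wellorder:
  fixes g :: "real ^ 'm::{finite,wellorder} \<Rightarrow> real ^ 'm::_"
  assumes S: "S \<in> sets borel" and der: "\<And>x. x \<in> S \<Longrightarrow> (g has_derivative g' x) (at x within S)" and inj: "inj_on g S"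
    and f: "\<And>y. y \<in> g ` S \<Longrightarrow> 0 \<le> f y" "(\<lambda>y. indicator (g ` S) y * f y) \<in> borel_measurable borel"
      "(\<lambda>x. indicator S x * (\<bar>det (matrix (g' x))\<bar> * f (g x))) \<in> borel_measurable borel"
  shows "(\<integral>\<^sup>+ y. ennreal (indicator (g ` S) y * f y) \<partial>lborel)
    = (\<integral>\<^sup>+ x. ennreal (indicator S x * (\<bar>det (matrix (g' x))\<bar> * f (g x))) \<partial>lborel)"
proof -
  let ?F = "\<lambda>x. \<bar>det (matrix (g' x))\<bar> * f (g x)"
  have S': "S \<in> sets lebesgue" using S by simp
  have "?F absolutely_integrable_on S \<and> integral S ?F = b \<longleftrightarrow> f absolutely_integrable_on (g ` S) \<and> integral (g ` S) f = b" for b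
    using has_absolute_integral_change_of_variables[OF S' der inj, of "\<lambda>x. vec (f x) :: real ^ 1" "vec b"]
    unfolding absolutely_integrable_on_1_iff integral_on_1_eq by simp
  then have "?F absolutely_integrable_on S \<longleftrightarrow> f absolutely_integrable_on (g ` S)"
    "f absolutely_integrable_on (g ` S) \<Longrightarrow> integral S ?F = integral (g ` S) f" by blast+
  then show ?thesis
    using nn_integral_indicator_lborel[OF f(2) f(1)] nn_integral_indicator_lborel[OF f(3)] f(1) by simp
qed

lemma nn_integral_to_copy:
  fixes F :: "real ^ 'm::finite ordered_copy \<Rightarrow> ennreal"
  assumes "F \<in> borel_measurable borel"
  shows "(\<integral>\<^sup>+ y. F y \<partial>lborel) = (\<integral>\<^sup>+ x. F (to_copy x) \<partial>lborel)"
proof -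
  have "(\<integral>\<^sup>+ y. F y \<partial>lborel) = (\<integral>\<^sup>+ y. F y \<partial>distr lborel borel to_copy)" by (simp only: lborel_to_copy)
  also have "\<dots> = (\<integral>\<^sup>+ x. F (to_copy x) \<partial>lborel)" using assms by (intro nn_integral_distr) auto
  finally show ?thesis .
qed

theorem nn_integral_change_of_variables:
  fixes g :: "real ^ 'm::finite \<Rightarrow> real ^ 'm"
  assumes S: "S \<in> sets borel" and der: "\<And>x. x \<in> S \<Longrightarrow> (g has_derivative g' x) (at x within S)" and inj: "inj_on g S"
    and f: "\<And>y. y \<in> g ` S \<Longrightarrow> 0 \<le> f y" "(\<lambda>y. indicator (g ` S) y * f y) \<in> borel_measurable borel"
      "(\<lambda>x. indicator S x * (\<bar>det (matrix (g' x))\<bar> * f (g x))) \<in> borel_measurable borel"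
  shows "(\<integral>\<^sup>+ y. ennreal (indicator (g ` S) y * f y) \<partial>lborel)
    = (\<integral>\<^sup>+ x. ennreal (indicator S x * (\<bar>det (matrix (g' x))\<bar> * f (g x))) \<partial>lborel)"
proof -
  define h :: "real ^ 'm ordered_copy \<Rightarrow> real ^ 'm ordered_copy" where "h y = to_copy (g (of_copy y))" for y
  define h' :: "real ^ 'm ordered_copy \<Rightarrow> real ^ 'm ordered_copy \<Rightarrow> real ^ 'm ordered_copy"
    where "h' y u = to_copy (g' (of_copy y) (of_copy u))" for y u
  have im: "x \<in> of_copy -` A \<longleftrightarrow> of_copy x \<in> A" for x A by simp
  have S': "of_copy -` S \<in> sets borel" using measurable_sets[OF measurable_copy(2) S] by simp
  have hS: "h ` (of_copy -` S) = of_copy -` (g ` S)"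
  proof (intro set_eqI iffI)
    fix y assume "y \<in> of_copy -` (g ` S)"
    then obtain x where "x \<in> S" "of_copy y = g x" by auto
    then show "y \<in> h ` (of_copy -` S)" by (intro image_eqI[of _ _ "to_copy x"]) (simp_all add: h_def flip: \<open>of_copy y = g x\<close>)
  qed (auto simp: h_def)
  have det: "det (matrix (h' y)) = det (matrix (g' (of_copy y)))" for y
  proof -
    have ax: "of_copy (axis j 1) = axis (Rep_ordered_copy j) 1" for j :: "'m ordered_copy"
      by (auto simp: vec_eq_iff of_copy_def axis_def Abs_ordered_copy_inverse Rep_ordered_copy_inverse)
    have "matrix (h' y) = (\<chi> i j. matrix (g' (of_copy y)) $ Rep_ordered_copy i $ Rep_ordered_copy j)"
      by (simp add: vec_eq_iff matrix_def h'_def to_copy_def ax)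
    then show ?thesis using det_reindex[OF bij_Rep_ordered_copy, of "matrix (g' (of_copy y))"] by simp
  qed
  have ind: "indicator (of_copy -` A) y = (indicator A (of_copy y) :: real)" for A y by (simp add: indicator_def)
  have m1: "(\<lambda>y. indicator (h ` (of_copy -` S)) y * f (of_copy y)) \<in> borel_measurable borel"
    unfolding hS ind by (rule measurable_compose[OF measurable_copy(2) f(2)])
  have m2: "(\<lambda>x. indicator (of_copy -` S) x * (\<bar>det (matrix (h' x))\<bar> * f (of_copy (h x)))) \<in> borel_measurable borel"
    unfolding det ind h_def of_to_copy by (rule measurable_compose[OF measurable_copy(2) f(3)])
  have "(\<integral>\<^sup>+ y. ennreal (indicator (h ` (of_copy -` S)) y * f (of_copy y)) \<partial>lborel)
    = (\<integral>\<^sup>+ x. ennreal (indicator (of_copy -` S) x * (\<bar>det (matrix (h' x))\<bar> * f (of_copy (h x)))) \<partial>lborel)"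
  proof (rule nn_integral_change_of_variables_wellorder[OF S' _ _ _ m1 m2])
    fix y assume y: "y \<in> of_copy -` S"
    have "of_copy ` of_copy -` S \<subseteq> S" by auto
    then have "(g has_derivative g' (of_copy y)) (at (of_copy y) within of_copy ` of_copy -` S)"
      using has_derivative_subset[OF der] y by simp
    from has_derivative_in_compose[OF bounded_linear_imp_has_derivative[OF bounded_linear_of_copy] this]
    have "((\<lambda>y. g (of_copy y)) has_derivative (\<lambda>u. g' (of_copy y) (of_copy u))) (at y within of_copy -` S)" .
    from bounded_linear.has_derivative[OF bounded_linear_to_copy this]
    show "(h has_derivative h' y) (at y within of_copy -` S)" unfolding h_def[abs_def] h'_def[abs_def] .
  next
    show "inj_on h (of_copy -` S)"
    proof (rule inj_onI)
      fix x y assume xy: "x \<in> of_copy -` S" "y \<in> of_copy -` S" "h x = h y"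
      then have "g (of_copy x) = g (of_copy y)" unfolding h_def by (metis of_to_copy)
      then have "of_copy x = of_copy y" using inj_onD[OF inj] xy by simp
      then show "x = y" by (metis to_of_copy)
    qed
    show "0 \<le> f (of_copy y)" if "y \<in> h ` (of_copy -` S)" for y using that f(1) unfolding hS by simp
  qed
  then show ?thesis
    using nn_integral_to_copy[of "\<lambda>y. ennreal (indicator (h ` (of_copy -` S)) y * f (of_copy y))"]
      nn_integral_to_copy[of "\<lambda>x. ennreal (indicator (of_copy -` S) x * (\<bar>det (matrix (h' x))\<bar> * f (of_copy (h x))))"]
    using measurable_compose[OF m1 measurable_ennreal] measurable_compose[OF m2 measurable_ennreal]
    unfolding hS ind det h_def of_to_copy by simp
qed

section \<open>The Liouville density\<close>

lemma omega0_expand: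
  fixes x y :: "real ^ ('n::finite + 'n)"
  shows "omega0 x y = (\<Sum>q\<in>UNIV. J0 $ snd q $ fst q * (x $ fst q * y $ snd q))"
proof -
  have "omega0 x y = (\<Sum>b\<in>UNIV. \<Sum>a\<in>UNIV. J0 $ b $ a * (x $ a * y $ b))"
    by (simp add: omega0_def inner_vec_def matrix_vector_mult_def sum_distrib_right mult.assoc)
  also have "\<dots> = (\<Sum>a\<in>UNIV. \<Sum>b\<in>UNIV. J0 $ b $ a * (x $ a * y $ b))" by (rule sum.swap)
  finally show ?thesis by (simp add: sum.cartesian_product case_prod_beta)
qed

text \<open>When each factor is expanded over pairs of row indices, h records the chosen pairs and
  \<open>e h\<close> the resulting selection of rows. The selection yields plus or minus det M if it
  is a permutation and 0 otherwise. What matters is that \<kappa> is the same for all M, so that it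
  stands in front of every density.\<close>

lemma wedge_power_fact_omega0:
  obtains \<kappa> where "\<And>M :: real ^ ('n::finite + 'n) ^ ('n + 'n).
    wedge_power_fact (\<lambda>u w. omega0 (M *v u) (M *v w)) (\<lambda>i. axis i 1) = \<kappa> * det M"
proof -
  define J :: "('n + 'n) \<times> ('n + 'n) \<Rightarrow> real" where "J q = J0 $ snd q $ fst q" for q
  define e :: "('n \<Rightarrow> ('n + 'n) \<times> ('n + 'n)) \<Rightarrow> 'n + 'n \<Rightarrow> 'n + 'n"
    where "e h i = (case i of Inl k \<Rightarrow> fst (h k) | Inr k \<Rightarrow> snd (h k))" for h i
  define P :: "('n \<Rightarrow> ('n + 'n) \<times> ('n + 'n)) set" where "P = PiE UNIV (\<lambda>_. UNIV)"
  define C where "C h = (\<Prod>k\<in>UNIV. J (h k))" for h :: "'n \<Rightarrow> _"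
  define \<kappa> where "\<kappa> = (\<Sum>h\<in>P. C h * (if e h permutes UNIV then of_int (sign (e h)) else 0)) / (2 ^ CARD('n) * fact CARD('n))"
  have "wedge_power_fact (\<lambda>u w. omega0 (M *v u) (M *v w)) (\<lambda>i. axis i 1) = \<kappa> * det M"
    for M :: "real ^ ('n + 'n) ^ ('n + 'n)"
  proof -
    have col: "(M *v axis i 1) $ a = M $ a $ i" for a i
      by (simp add: matrix_vector_mult_basis column_def)
    have om: "omega0 (M *v axis i 1) (M *v axis j 1) = (\<Sum>q\<in>UNIV. J q * (M $ fst q $ i * M $ snd q $ j))" for i j
      by (simp add: omega0_expand col J_def)
    have prodUN: "(\<Prod>i\<in>UNIV. F i) = (\<Prod>k\<in>UNIV. F (Inl k) * F (Inr k))" for F :: "'n + 'n \<Rightarrow> real"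
      using prod.Plus[of "UNIV :: 'n set" "UNIV :: 'n set" F] by (simp add: UNIV_Plus_UNIV prod.distrib)
    have 1: "(\<Prod>k\<in>UNIV. omega0 (M *v axis (p (Inl k)) 1) (M *v axis (p (Inr k)) 1))
      = (\<Sum>h\<in>P. C h * (\<Prod>i\<in>UNIV. (\<chi> i. M $ e h i) $ i $ p i))" for p
    proof -
      have "(\<Prod>k\<in>UNIV. omega0 (M *v axis (p (Inl k)) 1) (M *v axis (p (Inr k)) 1))
        = (\<Sum>h\<in>P. \<Prod>k\<in>UNIV. J (h k) * (M $ fst (h k) $ p (Inl k) * M $ snd (h k) $ p (Inr k)))"
        unfolding om P_def by (rule prod_sum_PiE) simp_all
      then show ?thesis by (simp add: C_def prodUN e_def prod.distrib)
    qed
    have 2: "det (\<chi> i. M $ e h i) = (if e h permutes UNIV then of_int (sign (e h)) else 0) * det M" for h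
    proof (cases "e h permutes UNIV")
      case True then show ?thesis by (simp add: det_permute_rows)
    next
      case False
      then have "\<not> inj (e h)" using finite_UNIV_inj_surj[of "e h"] by (auto simp: permutes_UNIV_bij bij_def)
      then obtain i j where "i \<noteq> j" "e h i = e h j" by (auto simp: inj_def)
      then have "det (\<chi> i. M $ e h i) = 0" by (intro det_identical_rows[of i j]) (simp_all add: row_def)
      then show ?thesis using False by simp
    qed
    have "(\<Sum>p | p permutes UNIV. of_int (sign p) * (\<Prod>k\<in>UNIV. omega0 (M *v axis (p (Inl k)) 1) (M *v axis (p (Inr k)) 1)))
      = (\<Sum>p | p permutes UNIV. \<Sum>h\<in>P. C h * (of_int (sign p) * (\<Prod>i\<in>UNIV. (\<chi> i. M $ e h i) $ i $ p i)))"
      unfolding 1 sum_distrib_left by (intro sum.cong refl) (simp add: mult_ac)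
    also have "\<dots> = (\<Sum>h\<in>P. C h * det (\<chi> i. M $ e h i))"
      by (subst sum.swap) (simp add: sum_distrib_left det_def)
    also have "\<dots> = (\<Sum>h\<in>P. C h * (if e h permutes UNIV then of_int (sign (e h)) else 0)) * det M"
      unfolding 2 by (simp add: sum_distrib_right mult.assoc)
    finally show ?thesis by (simp add: wedge_power_fact_def \<kappa>_def)
  qed
  then show ?thesis by (rule that)
qed

section \<open>The Liouville measure\<close>

lemma rsymplectic_abs_det:
  fixes M :: "real ^ ('n::finite + 'n) ^ ('n + 'n)"
  assumes "rsymplectic M" shows "\<bar>det M\<bar> = 1"
proof -
  have "x = 0" if "J0 *v x = 0" for x :: "real ^ ('n + 'n)" using J0_J0[of x] that by simp
  then have "invertible (J0 :: real ^ ('n + 'n) ^ ('n + 'n))" by (simp add: invertible_left_inverse matrix_left_invertible_ker)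
  then have "det (J0 :: real ^ ('n + 'n) ^ ('n + 'n)) \<noteq> 0" by (simp add: invertible_det_nz)
  moreover have "det M * det (J0 :: real ^ ('n + 'n) ^ ('n + 'n)) * det M = det (J0 :: real ^ ('n + 'n) ^ ('n + 'n))"
    using arg_cong[OF assms[unfolded rsymplectic_iff], of det] by (simp add: det_mul det_transpose)
  ultimately have "det M * det M = 1" by (simp add: mult.commute mult.left_commute)
  then show ?thesis using abs_square_eq_1[of "det M"] by (simp add: power2_eq_square)
qed

context hamiltonian_flow
begin

definition \<delta> :: "('a, 'n + 'n) chart \<Rightarrow> real ^ ('n + 'n) \<Rightarrow> real" where
  "\<delta> c x = \<bar>wedge_power_fact (form_in_chart \<A> \<omega> c x) (\<lambda>i. axis i 1)\<bar>"

definition \<nu> :: "('a, 'n + 'n) chart \<Rightarrow> 'a set \<Rightarrow> ennreal" where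
  "\<nu> c E = (\<integral>\<^sup>+ x. ennreal (indicator (snd c ` E) x * \<delta> c x) \<partial>lborel)"

lemma \<delta>_nonneg: "0 \<le> \<delta> c x"
  unfolding \<delta>_def by (rule abs_ge_zero)

lemma \<delta>_formula:
  obtains \<kappa> where "\<And>c x. c \<in> \<A> \<Longrightarrow> x \<in> chart_image c \<Longrightarrow> \<delta> c x = \<bar>\<kappa>\<bar> * \<bar>det (matrix (T c (chart_inv c x)))\<bar>"
proof -
  obtain \<kappa> where \<kappa>: "\<And>M :: real ^ ('n + 'n) ^ ('n + 'n).
    wedge_power_fact (\<lambda>u w. omega0 (M *v u) (M *v w)) (\<lambda>i. axis i 1) = \<kappa> * det M"
    by (rule wedge_power_fact_omega0) (rule that)
  have "\<delta> c x = \<bar>\<kappa>\<bar> * \<bar>det (matrix (T c (chart_inv c x)))\<bar>" if c: "c \<in> \<A>" and x: "x \<in> chart_image c" for c x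
  proof -
    have "c \<in> charts_at \<A> (chart_inv c x)" using c x by (simp add: charts_at_def chart_inv_in)
    then have "matrix (T c (chart_inv c x)) *v u = T c (chart_inv c x) u" for u
      using T_linear by (simp add: matrix_works linear_def scalar_mult_eq_scaleR)
    then have "form_in_chart \<A> \<omega> c x = (\<lambda>u w. omega0 (matrix (T c (chart_inv c x)) *v u) (matrix (T c (chart_inv c x)) *v w))"
      by (simp add: fun_eq_iff form_T[OF c x])
    then show ?thesis by (simp add: \<delta>_def \<kappa> abs_mult)
  qed
  then show ?thesis by (rule that)
qed

lemma \<delta>_continuous:
  assumes c: "c \<in> \<A>" shows "continuous_on (chart_image c) (\<delta> c)"
proof -
  obtain \<kappa> where \<kappa>: "\<And>c x. c \<in> \<A> \<Longrightarrow> x \<in> chart_image c \<Longrightarrow> \<delta> c x = \<bar>\<kappa>\<bar> * \<bar>det (matrix (T c (chart_inv c x)))\<bar>"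
    by (rule \<delta>_formula) (rule that)
  have h: "continuous_on (chart_image c) (\<lambda>x. matrix (T c (chart_inv c x)) $ i $ j)" for i j
    unfolding matrix_def vec_lambda_beta by (intro continuous_on_component C1_on_continuous C1_T c)
  have "continuous_on (chart_image c) (\<lambda>x. \<bar>\<kappa>\<bar> * \<bar>det (matrix (T c (chart_inv c x)))\<bar>)"
    by (intro continuous_on_mult continuous_on_const continuous_on_rabs continuous_on_det h)
  then show ?thesis by (rule continuous_on_eq) (simp add: \<kappa>[OF c])
qed

lemma chart_image_borel: "c \<in> \<A> \<Longrightarrow> chart_image c \<in> sets borel"
proof -
  assume c: "c \<in> \<A>"
  obtain v where v: "openin (top_of_set {x. 0 \<le> v \<bullet> x}) (chart_image c)"
    using chart(2)[OF c] unfolding half_open_def by (elim exE) (rule that)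
  then obtain W where "open W" "chart_image c = {x. 0 \<le> v \<bullet> x} \<inter> W" by (auto simp: openin_open)
  moreover have "closed {x. 0 \<le> v \<bullet> x}" using closed_halfspace_ge[of 0 v] by simp
  ultimately show ?thesis by auto
qed

lemma snd_image_borel:
  assumes c: "c \<in> \<A>" and E: "E \<in> sets borel" "E \<subseteq> fst c"
  shows "snd c ` E \<in> sets borel" "snd c ` E \<subseteq> chart_image c"
proof -
  have "snd c ` E = chart_inv c -` E \<inter> space (restrict_space borel (chart_image c))"
  proof (intro set_eqI iffI)
    fix x assume "x \<in> chart_inv c -` E \<inter> space (restrict_space borel (chart_image c))"
    then show "x \<in> snd c ` E" using c by (intro image_eqI[of _ _ "chart_inv c x"]) (auto simp: space_restrict_space snd_chart_inv)
  qed (use c E in \<open>auto simp: space_restrict_space chart_inv_snd intro!: snd_in\<close>)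
  also have "\<dots> \<in> sets (restrict_space borel (chart_image c))"
    by (rule measurable_sets[OF borel_measurable_continuous_on_restrict[OF continuous_chart_inv[OF c]] E(1)])
  finally show "snd c ` E \<in> sets borel" using chart_image_borel[OF c] by (simp add: sets_restrict_space_iff)
  show "snd c ` E \<subseteq> chart_image c" using E(2) by (auto intro!: snd_in)
qed

lemma \<delta>_measurable:
  assumes c: "c \<in> \<A>" and A: "A \<in> sets borel" "A \<subseteq> chart_image c"
  shows "(\<lambda>x. indicator A x * \<delta> c x) \<in> borel_measurable borel"
  using borel_measurable_continuous_on_indicator[OF A(1) continuous_on_subset[OF \<delta>_continuous[OF c] A(2)]] by simp

text \<open>In the trivialization the differential of g has determinant of absolute value 1, so the
  Jacobian of its chart expression turns the density of c' into that of c. With g the identity this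
  gives independence of the chart, with the time-one map the invariance of the measure.\<close>

lemma \<nu>_image:
  assumes c: "c \<in> \<A>" "c' \<in> \<A>" and E: "E \<in> sets borel" "E \<subseteq> fst c" and gE: "g ` E \<in> sets borel" "g ` E \<subseteq> fst c'"
    and g: "inj g" and D: "\<And>\<xi>. \<exists>M. rsymplectic M \<and> Dg g \<xi> M"
  shows "\<nu> c' (g ` E) = \<nu> c E"
proof -
  obtain \<kappa> where \<kappa>: "\<And>c x. c \<in> \<A> \<Longrightarrow> x \<in> chart_image c \<Longrightarrow> \<delta> c x = \<bar>\<kappa>\<bar> * \<bar>det (matrix (T c (chart_inv c x)))\<bar>"
    by (rule \<delta>_formula) (rule that)
  have "\<forall>\<xi>. \<exists>M. rsymplectic M \<and> Dg g \<xi> M" using D by (rule allI)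
  from choice[OF this] obtain M where M: "\<forall>\<xi>. rsymplectic (M \<xi>) \<and> Dg g \<xi> (M \<xi>)" by (elim exE) (rule that)
  define S where "S = snd c ` E"
  define \<psi> where "\<psi> x = snd c' (g (chart_inv c x))" for x
  define \<psi>' where "\<psi>' x u = Ti c' (g (chart_inv c x)) (M (chart_inv c x) *v T c (chart_inv c x) u)" for x u
  note S = snd_image_borel[OF c(1) E, folded S_def]
  have SE: "chart_inv c x \<in> E" "x \<in> chart_image c" if "x \<in> S" for x using that E c by (auto simp: S_def chart_inv_snd snd_in)
  have \<psi>S: "\<psi> ` S = snd c' ` (g ` E)"
    using E c by (force simp: S_def \<psi>_def chart_inv_snd image_image intro!: image_cong)
  have der: "(\<psi> has_derivative \<psi>' x) (at x within S)" if x: "x \<in> S" for x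
  proof -
    have "c \<in> charts_at \<A> (chart_inv c x)" "c' \<in> charts_at \<A> (g (chart_inv c x))"
      using SE[OF x] E(2) gE(2) c by (auto simp: charts_at_def)
    moreover have "Dg g (chart_inv c x) (M (chart_inv c x))" using M by blast
    ultimately have "dd g c c' (chart_inv c x) (\<psi>' x)" unfolding Dg_def \<psi>'_def by blast
    then have "(\<psi> has_derivative \<psi>' x) (at x within chart_image c)"
      using SE(2)[OF x] c(1) by (simp add: dd_def \<psi>_def[abs_def] snd_chart_inv)
    then show ?thesis by (rule has_derivative_subset[OF _ S(2)])
  qed
  have inj: "inj_on \<psi> S"
  proof (rule inj_onI)
    fix x y assume xy: "x \<in> S" "y \<in> S" "\<psi> x = \<psi> y"
    have "g (chart_inv c x) \<in> fst c'" "g (chart_inv c y) \<in> fst c'" using SE(1) xy gE(2) by auto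
    note inv = chart_inv_snd[OF c(2) this(1)] chart_inv_snd[OF c(2) this(2)]
    have "g (chart_inv c x) = g (chart_inv c y)" using arg_cong[OF xy(3), of "chart_inv c'"] unfolding \<psi>_def inv .
    then have "chart_inv c x = chart_inv c y" by (rule injD[OF g])
    from arg_cong[OF this, of "snd c"] show "x = y" using SE(2) xy c(1) by (simp add: snd_chart_inv)
  qed
  have fac: "\<bar>det (matrix (\<psi>' x))\<bar> * \<delta> c' (\<psi> x) = \<delta> c x" if x: "x \<in> S" for x
  proof -
    let ?\<xi> = "chart_inv c x"
    have cc: "c \<in> charts_at \<A> ?\<xi>" "c' \<in> charts_at \<A> (g ?\<xi>)" and gin: "g ?\<xi> \<in> fst c'"
      using SE[OF x] E(2) gE(2) c by (auto simp: charts_at_def)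
    have mT: "matrix (T c ?\<xi>) *v u = T c ?\<xi> u" "matrix (T c' (g ?\<xi>)) *v u = T c' (g ?\<xi>) u"
      "matrix (\<psi>' x) *v u = \<psi>' x u" for u
    proof -
      have "linear (\<lambda>u. M ?\<xi> *v T c ?\<xi> u)"
        using linear_compose[OF T_linear[OF cc(1)] matrix_vector_mul_linear] by (simp add: comp_def)
      from linear_compose[OF this Ti_linear[OF cc(2)]] have "linear (\<psi>' x)" by (simp add: comp_def \<psi>'_def[abs_def])
      then show "matrix (T c ?\<xi>) *v u = T c ?\<xi> u" "matrix (T c' (g ?\<xi>)) *v u = T c' (g ?\<xi>) u"
        "matrix (\<psi>' x) *v u = \<psi>' x u"
        using T_linear[OF cc(1)] T_linear[OF cc(2)] by (simp_all add: matrix_works linear_def scalar_mult_eq_scaleR)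
    qed
    have "matrix (T c' (g ?\<xi>)) ** matrix (\<psi>' x) = M ?\<xi> ** matrix (T c ?\<xi>)"
      by (rule matrix_eq[THEN iffD2]) (simp add: mT \<psi>'_def T_Ti[OF cc(2)] flip: matrix_vector_mul_assoc)
    from arg_cong[OF this, of "\<lambda>A. \<bar>det A\<bar>"]
    have "\<bar>det (matrix (T c' (g ?\<xi>)))\<bar> * \<bar>det (matrix (\<psi>' x))\<bar> = \<bar>det (matrix (T c ?\<xi>))\<bar>"
      using rsymplectic_abs_det[OF conjunct1[OF spec[OF M, of ?\<xi>]]] by (simp add: det_mul abs_mult)
    moreover have "\<delta> c' (\<psi> x) = \<bar>\<kappa>\<bar> * \<bar>det (matrix (T c' (g ?\<xi>)))\<bar>"
      using \<kappa>[OF c(2) snd_in[OF gin]] by (simp add: \<psi>_def chart_inv_snd[OF c(2) gin])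
    ultimately show ?thesis using \<kappa>[OF c(1) SE(2)[OF x]] by (simp add: mult_ac)
  qed
  have e: "indicator S x * (\<bar>det (matrix (\<psi>' x))\<bar> * \<delta> c' (\<psi> x)) = indicator S x * \<delta> c x" for x
    using fac by (simp add: indicator_def)
  have "(\<integral>\<^sup>+ y. ennreal (indicator (\<psi> ` S) y * \<delta> c' y) \<partial>lborel)
    = (\<integral>\<^sup>+ x. ennreal (indicator S x * (\<bar>det (matrix (\<psi>' x))\<bar> * \<delta> c' (\<psi> x))) \<partial>lborel)"
  proof (rule nn_integral_change_of_variables[OF S(1) der inj])
    show "(\<lambda>y. indicator (\<psi> ` S) y * \<delta> c' y) \<in> borel_measurable borel"
      unfolding \<psi>S by (rule \<delta>_measurable[OF c(2) snd_image_borel[OF c(2) gE]])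
    show "(\<lambda>x. indicator S x * (\<bar>det (matrix (\<psi>' x))\<bar> * \<delta> c' (\<psi> x))) \<in> borel_measurable borel"
      unfolding e by (rule \<delta>_measurable[OF c(1) S])
  qed (assumption, rule \<delta>_nonneg)
  then show ?thesis unfolding e \<psi>S \<nu>_def by (simp only: S_def)
qed

lemma \<nu>_chart_independent:
  assumes "c \<in> \<A>" "c' \<in> \<A>" "E \<in> sets borel" "E \<subseteq> fst c" "E \<subseteq> fst c'"
  shows "\<nu> c' E = \<nu> c E"
proof -
  have "rsymplectic (mat 1)" by (simp add: rsymplectic_def)
  then have "\<exists>M. rsymplectic M \<and> Dg (\<lambda>\<eta>. \<eta>) \<xi> M" for \<xi> using Dg_id by blast
  from \<nu>_image[where g="\<lambda>\<eta>. \<eta>", OF assms(1-4) _ _ _ this] show ?thesis using assms by simp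
qed

text \<open>\<open>\<nu> c\<close> is a measure with a density on the coordinate space, pulled back
  by the injective coordinate map.\<close>

lemma \<nu>_countably_additive:
  assumes c: "c \<in> \<A>" and E: "\<And>i::nat. E i \<in> sets borel" "\<And>i. E i \<subseteq> fst c" "disjoint_family E"
  shows "(\<Sum>i. \<nu> c (E i)) = \<nu> c (\<Union>i. E i)"
proof -
  define M where "M = density lborel (\<lambda>x. ennreal (indicator (chart_image c) x * \<delta> c x))"
  have m: "(\<lambda>x. ennreal (indicator (chart_image c) x * \<delta> c x)) \<in> borel_measurable lborel"
    using measurable_compose[OF \<delta>_measurable[OF c chart_image_borel[OF c] order_refl] measurable_ennreal] by simp
  have \<nu>: "\<nu> c A = emeasure M (snd c ` A)" if A: "A \<in> sets borel" "A \<subseteq> fst c" for A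
  proof -
    note im = snd_image_borel[OF c A]
    have "emeasure M (snd c ` A) = (\<integral>\<^sup>+ x. ennreal (indicator (chart_image c) x * \<delta> c x) * indicator (snd c ` A) x \<partial>lborel)"
      unfolding M_def using im(1) by (intro emeasure_density m) simp
    also have "\<dots> = \<nu> c A" unfolding \<nu>_def using im(2) by (intro nn_integral_cong) (auto simp: indicator_def)
    finally show ?thesis ..
  qed
  have "disjoint_family (\<lambda>i. snd c ` E i)"
    unfolding disjoint_family_on_def
  proof (intro ballI impI)
    fix i j :: nat assume "i \<noteq> j"
    then have d: "E i \<inter> E j = {}" using E(3) by (auto simp: disjoint_family_on_def)
    show "snd c ` E i \<inter> snd c ` E j = {}"
    proof (rule ccontr)
      assume "snd c ` E i \<inter> snd c ` E j \<noteq> {}"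
      then obtain \<xi> \<eta> where \<xi>: "\<xi> \<in> E i" "\<eta> \<in> E j" "snd c \<xi> = snd c \<eta>" by auto
      have "\<xi> \<in> fst c" "\<eta> \<in> fst c" using \<xi>(1,2) E(2) by blast+
      note inv = chart_inv_snd[OF c this(1)] chart_inv_snd[OF c this(2)]
      have "\<xi> = \<eta>" using arg_cong[OF \<xi>(3), of "chart_inv c"] unfolding inv .
      then show False using d \<xi>(1,2) by blast
    qed
  qed
  then have "(\<Sum>i. emeasure M (snd c ` E i)) = emeasure M (\<Union>i. snd c ` E i)"
    by (intro suminf_emeasure) (use snd_image_borel(1)[OF c E(1,2)] in \<open>auto simp: M_def\<close>)
  moreover have "(\<Union>i. E i) \<in> sets borel" "(\<Union>i. E i) \<subseteq> fst c" using E by auto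
  ultimately show ?thesis by (simp add: \<nu> E image_UN)
qed

section \<open>Existence, uniqueness, finiteness and invariance of the Liouville measure\<close>

lemma is_liouville_iff: "is_liouville_measure \<A> \<omega> \<mu> \<longleftrightarrow> sets \<mu> = sets borel \<and>
    (\<forall>c\<in>\<A>. \<forall>E\<in>sets borel. E \<subseteq> fst c \<longrightarrow> emeasure \<mu> E = \<nu> c E)"
proof -
  have "ennreal \<bar>wedge_power_fact (form_in_chart \<A> \<omega> c x) (\<lambda>i. axis i 1)\<bar> * indicator (snd c ` E) x
    = ennreal (indicator (snd c ` E) x * \<delta> c x)" for c E x by (simp add: \<delta>_def indicator_def)
  then show ?thesis unfolding is_liouville_measure_def \<nu>_def by simp
qed

text \<open>Compactness gives finitely many charts, and each domain loses the points of the earlier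
  ones.\<close>

lemma chart_partition:
  obtains N :: nat and c P where "\<And>i. i < N \<Longrightarrow> c i \<in> \<A>" "\<And>i. i < N \<Longrightarrow> P i \<in> sets borel" "\<And>i. i < N \<Longrightarrow> P i \<subseteq> fst (c i)"
    "disjoint_family_on P {..<N}" "(\<Union>i<N. P i) = UNIV"
proof -
  have "\<exists>c\<in>\<A>. \<xi> \<in> fst c" for \<xi> using ex_chart_at[of \<xi>] unfolding charts_at_def by blast
  then have sub: "UNIV \<subseteq> (\<Union>c\<in>\<A>. fst c)" by blast
  obtain K where K: "K \<subseteq> \<A>" "finite K" "UNIV \<subseteq> (\<Union>c\<in>K. fst c)"
    by (rule compactE_image[OF cpt chart(1) sub], assumption, rule that)
  obtain cs where cs: "set cs = K" using finite_list[OF K(2)] by (elim exE) (rule that)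
  let ?N = "length cs"
  define P where "P i = fst (cs ! i) - (\<Union>j<i. fst (cs ! j))" for i
  have in\<A>: "cs ! i \<in> \<A>" if "i < ?N" for i using that cs K(1) nth_mem by blast
  show ?thesis
  proof (rule that[of ?N "\<lambda>i. cs ! i" P])
    show "P i \<in> sets borel" if "i < ?N" for i
      unfolding P_def using that chart(1)[OF in\<A>] by (intro sets.Diff sets.finite_UN) auto
    show "disjoint_family_on P {..<?N}"
      unfolding disjoint_family_on_def
    proof (intro ballI impI)
      fix i j assume "i \<in> {..<?N}" "j \<in> {..<?N}" "i \<noteq> j"
      then show "P i \<inter> P j = {}" by (cases "i < j") (auto simp: P_def)
    qed
    show "(\<Union>i<?N. P i) = UNIV"
    proof -
      have "\<xi> \<in> (\<Union>i<?N. P i)" for \<xi>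
      proof -
        obtain c where "c \<in> set cs" "\<xi> \<in> fst c" using K(3) cs by blast
        then have "\<exists>i. i < ?N \<and> \<xi> \<in> fst (cs ! i)" unfolding in_set_conv_nth by blast
        from exists_least_iff[THEN iffD1, OF this] obtain i
          where i: "i < ?N" "\<xi> \<in> fst (cs ! i)" "\<forall>j<i. \<not> (j < ?N \<and> \<xi> \<in> fst (cs ! j))" by (elim exE conjE) (rule that)
        have "\<xi> \<notin> fst (cs ! j)" if "j < i" for j using i(1) i(3)[rule_format, OF that] that by simp
        then have "\<xi> \<in> P i" unfolding P_def using i(2) by blast
        then show ?thesis using i(1) by blast
      qed
      then show ?thesis by auto
    qed
  qed (auto simp: in\<A> P_def)
qed

lemma emeasure_partition:
  assumes "disjoint_family_on P {..<N::nat}" "(\<Union>i<N. P i) = UNIV" "\<And>i. i < N \<Longrightarrow> P i \<in> sets M" "E \<in> sets M"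
  shows "emeasure M E = (\<Sum>i<N. emeasure M (E \<inter> P i))"
proof -
  have "(\<Sum>i<N. emeasure M (E \<inter> P i)) = emeasure M (\<Union>i<N. E \<inter> P i)"
    using assms by (intro sum_emeasure) (auto simp: disjoint_family_on_def)
  also have "(\<Union>i<N. E \<inter> P i) = E" using assms(2) by blast
  finally show ?thesis ..
qed

lemma liouville_unique:
  assumes "is_liouville_measure \<A> \<omega> \<mu>" "is_liouville_measure \<A> \<omega> \<mu>'" shows "\<mu> = \<mu>'"
proof (rule measure_eqI)
  obtain N :: nat and c P where P: "\<And>i. i < N \<Longrightarrow> c i \<in> \<A>" "\<And>i. i < N \<Longrightarrow> P i \<in> sets borel" "\<And>i. i < N \<Longrightarrow> P i \<subseteq> fst (c i)"
    "disjoint_family_on P {..<N}" "(\<Union>i<N. P i) = UNIV" by (rule chart_partition) (rule that)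
  have f: "emeasure m E = (\<Sum>i<N. \<nu> (c i) (E \<inter> P i))" if m: "is_liouville_measure \<A> \<omega> m" and E: "E \<in> sets borel" for m E
  proof -
    have s: "sets m = sets borel" using m by (simp add: is_liouville_iff)
    have "emeasure m E = (\<Sum>i<N. emeasure m (E \<inter> P i))"
      by (rule emeasure_partition[OF P(4,5)]) (use P(2) E s in auto)
    also have "\<dots> = (\<Sum>i<N. \<nu> (c i) (E \<inter> P i))"
    proof (rule sum.cong[OF refl])
      fix i assume "i \<in> {..<N}"
      then have "c i \<in> \<A>" "E \<inter> P i \<in> sets borel" "E \<inter> P i \<subseteq> fst (c i)" using P(1-3)[of i] E by auto
      then show "emeasure m (E \<inter> P i) = \<nu> (c i) (E \<inter> P i)" using m by (simp add: is_liouville_iff)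
    qed
    finally show ?thesis .
  qed
  show s: "sets \<mu> = sets \<mu>'" using assms by (simp add: is_liouville_iff)
  fix A assume "A \<in> sets \<mu>"
  then have "A \<in> sets borel" using assms by (simp add: is_liouville_iff)
  then show "emeasure \<mu> A = emeasure \<mu>' A" using f assms by simp
qed

text \<open>The measure is glued from the chart masses of the pieces of a partition; chart
  independence on each piece shows that it has the right mass in every other chart.\<close>

lemma liouville_exists: "\<exists>\<mu>. is_liouville_measure \<A> \<omega> \<mu>"
proof -
  obtain N :: nat and c P where P: "\<And>i. i < N \<Longrightarrow> c i \<in> \<A>" "\<And>i. i < N \<Longrightarrow> P i \<in> sets borel" "\<And>i. i < N \<Longrightarrow> P i \<subseteq> fst (c i)"
    "disjoint_family_on P {..<N}" "(\<Union>i<N. P i) = UNIV" by (rule chart_partition) (rule that)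
  define m where "m E = (\<Sum>i<N. \<nu> (c i) (E \<inter> P i))" for E
  define \<mu> where "\<mu> = measure_of (UNIV :: 'a set) (sets borel) m"
  have sets: "sets \<mu> = sets borel" unfolding \<mu>_def using sets.sets_measure_of_eq[of borel] by simp
  have em: "emeasure \<mu> E = m E" if E: "E \<in> sets borel" for E
    unfolding \<mu>_def
  proof (rule emeasure_measure_of_sigma[OF _ _ _ E])
    show "sigma_algebra UNIV (sets (borel :: 'a measure))" using sets.sigma_algebra_axioms[of "borel :: 'a measure"] by simp
    show "positive (sets borel) m" by (simp add: positive_def m_def \<nu>_def)
    show "countably_additive (sets borel) m"
    proof (rule countably_additiveI)
      fix A :: "nat \<Rightarrow> 'a set" assume A: "range A \<subseteq> sets borel" "disjoint_family A"
      have "(\<Sum>k. m (A k)) = (\<Sum>i<N. \<Sum>k. \<nu> (c i) (A k \<inter> P i))"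
        unfolding m_def by (rule suminf_sum) (rule summableI)
      also have "\<dots> = (\<Sum>i<N. \<nu> (c i) (\<Union>k. A k \<inter> P i))"
      proof (rule sum.cong[OF refl], rule \<nu>_countably_additive)
        fix i assume "i \<in> {..<N}"
        then have i: "i < N" by simp
        show "c i \<in> \<A>" by (rule P(1)[OF i])
        show "A k \<inter> P i \<in> sets borel" "A k \<inter> P i \<subseteq> fst (c i)" for k using A(1) P(2,3)[OF i] by auto
        show "disjoint_family (\<lambda>k. A k \<inter> P i)" using A(2) by (auto simp: disjoint_family_on_def)
      qed
      also have "\<dots> = m (\<Union>k. A k)" unfolding m_def by (intro sum.cong refl arg_cong[of _ _ "\<nu> _"]) blast
      finally show "(\<Sum>k. m (A k)) = m (\<Union>k. A k)" .
    qed
  qed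
  have "emeasure \<mu> E = \<nu> b E" if b: "b \<in> \<A>" and E: "E \<in> sets borel" "E \<subseteq> fst b" for b E
  proof -
    have "emeasure \<mu> E = (\<Sum>i<N. \<nu> (c i) (E \<inter> P i))" using em[OF E(1)] by (simp add: m_def)
    also have "\<dots> = (\<Sum>i<N. \<nu> b (E \<inter> P i))"
    proof (rule sum.cong[OF refl], rule \<nu>_chart_independent[OF b])
      fix i assume "i \<in> {..<N}"
      then have i: "i < N" by simp
      show "c i \<in> \<A>" "E \<inter> P i \<in> sets borel" "E \<inter> P i \<subseteq> fst b" "E \<inter> P i \<subseteq> fst (c i)"
        using P(1-3)[OF i] E by auto
    qed
    \<comment> \<open>The finite family is padded with empty sets so that countable additivity
      applies.\<close>
    also have "\<dots> = (\<Sum>k. \<nu> b (if k < N then E \<inter> P k else {}))"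
      by (subst suminf_finite[of "{..<N}"]) (auto simp: \<nu>_def intro!: sum.cong)
    also have "\<dots> = \<nu> b (\<Union>k. if k < N then E \<inter> P k else {})"
    proof (rule \<nu>_countably_additive[OF b])
      show "disjoint_family (\<lambda>k. if k < N then E \<inter> P k else {})" using P(4) by (auto simp: disjoint_family_on_def)
    qed (use P(2) E in auto)
    also have "(\<Union>k. if k < N then E \<inter> P k else {}) = E"
    proof -
      have "(\<Union>k. if k < N then E \<inter> P k else {}) = E \<inter> (\<Union>k<N. P k)" by (auto split: if_splits)
      then show ?thesis by (simp add: P(5))
    qed
    finally show ?thesis .
  qed
  then have "is_liouville_measure \<A> \<omega> \<mu>" using sets by (simp add: is_liouville_iff)
  then show ?thesis by blast
qed

abbreviation "\<mu>\<^sub>L \<equiv> liouville_measure \<A> \<omega>"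

lemma liouville: "is_liouville_measure \<A> \<omega> \<mu>\<^sub>L"
proof -
  obtain m where m: "is_liouville_measure \<A> \<omega> m" using liouville_exists by (elim exE) (rule that)
  show ?thesis unfolding liouville_measure_def
    by (rule theI[of _ m]) (rule m, rule liouville_unique[OF _ m], assumption)
qed

lemma sets_liouville: "sets \<mu>\<^sub>L = sets borel" and space_liouville: "space \<mu>\<^sub>L = UNIV"
  and emeasure_liouville: "c \<in> \<A> \<Longrightarrow> E \<in> sets borel \<Longrightarrow> E \<subseteq> fst c \<Longrightarrow> emeasure \<mu>\<^sub>L E = \<nu> c E"
proof -
  show s: "sets \<mu>\<^sub>L = sets borel" using liouville by (simp add: is_liouville_iff)
  show "space \<mu>\<^sub>L = UNIV" using sets_eq_imp_space_eq[OF s] by simp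
  show "c \<in> \<A> \<Longrightarrow> E \<in> sets borel \<Longrightarrow> E \<subseteq> fst c \<Longrightarrow> emeasure \<mu>\<^sub>L E = \<nu> c E"
    using liouville by (simp add: is_liouville_iff)
qed

text \<open>Each point has a neighbourhood inside a compact part of a chart, where the density is
  bounded; finitely many of them cover the space.\<close>

lemma finite_liouville: "finite_measure \<mu>\<^sub>L"
proof
  have "\<exists>V. open V \<and> \<xi> \<in> V \<and> emeasure \<mu>\<^sub>L V < \<infinity>" for \<xi>
  proof -
    obtain c where c0: "c \<in> charts_at \<A> \<xi>" using ex_chart_at by blast
    note c = charts_atD[OF c0]
    obtain \<rho> where \<rho>: "0 < \<rho>" "\<And>r. r \<le> \<rho> \<Longrightarrow> compact (chart_image c \<inter> cball (snd c \<xi>) r)"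
      by (rule chart_nbhd[OF c(1) snd_in[OF c(2)]]) (rule that)
    let ?C = "chart_image c \<inter> cball (snd c \<xi>) \<rho>"
    have "bounded (\<delta> c ` ?C)"
      by (intro compact_imp_bounded compact_continuous_image \<rho>(2) continuous_on_subset[OF \<delta>_continuous[OF c(1)]]) auto
    then obtain b where b: "\<forall>y\<in>\<delta> c ` ?C. norm y \<le> b" unfolding bounded_iff by (elim exE) (rule that)
    let ?V = "{\<eta> \<in> fst c. dist (snd c \<xi>) (snd c \<eta>) < \<rho>}"
    have V: "open ?V" "\<xi> \<in> ?V" using open_chart_ball[OF c(1)] c(2) \<rho>(1) by auto
    have "emeasure \<mu>\<^sub>L ?V = \<nu> c ?V" using V by (intro emeasure_liouville c) auto
    also have "\<dots> \<le> (\<integral>\<^sup>+ x. ennreal b * indicator (cball (snd c \<xi>) \<rho>) x \<partial>lborel)"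
      unfolding \<nu>_def
    proof (rule nn_integral_mono)
      fix x
      show "ennreal (indicator (snd c ` ?V) x * \<delta> c x) \<le> ennreal b * indicator (cball (snd c \<xi>) \<rho>) x"
      proof (cases "x \<in> snd c ` ?V")
        case True
        then have x: "x \<in> ?C" by (auto simp: snd_in)
        then have "norm (\<delta> c x) \<le> b" using b by blast
        then show ?thesis using True x by (auto intro!: ennreal_leI)
      qed simp
    qed
    also have "\<dots> = ennreal b * emeasure lborel (cball (snd c \<xi>) \<rho>)" by (simp add: nn_integral_cmult_indicator)
    also have "\<dots> < \<infinity>" using emeasure_lborel_cball_finite[of "snd c \<xi>" \<rho>] by (simp add: ennreal_mult_less_top)
    finally show ?thesis using V by blast
  qed
  then have "\<forall>\<xi>. \<exists>V. open V \<and> \<xi> \<in> V \<and> emeasure \<mu>\<^sub>L V < \<infinity>" by (rule allI)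
  from choice[OF this] obtain V where V: "\<forall>\<xi>. open (V \<xi>) \<and> \<xi> \<in> V \<xi> \<and> emeasure \<mu>\<^sub>L (V \<xi>) < \<infinity>" by (elim exE) (rule that)
  have sub: "UNIV \<subseteq> (\<Union>\<xi>\<in>UNIV. V \<xi>)" using V by auto
  obtain K where K: "K \<subseteq> UNIV" "finite K" "UNIV \<subseteq> (\<Union>\<xi>\<in>K. V \<xi>)"
    by (rule compactE_image[OF cpt spec[OF V, THEN conjunct1] sub]) (rule that)
  have "emeasure \<mu>\<^sub>L (\<Union>\<xi>\<in>K. V \<xi>) \<le> (\<Sum>\<xi>\<in>K. emeasure \<mu>\<^sub>L (V \<xi>))"
    using V K(2) by (intro emeasure_subadditive_finite) (auto simp: sets_liouville)
  also have "\<dots> < \<infinity>" using V by (simp add: ennreal_sum_less_top K(2))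
  finally have "emeasure \<mu>\<^sub>L UNIV < \<infinity>" using K(3) by (simp add: top.extremum_unique)
  then show "emeasure \<mu>\<^sub>L (space \<mu>\<^sub>L) \<noteq> \<infinity>" by (simp add: space_liouville)
qed

text \<open>The pushforward under the inverse map gives E the mass of its image under
  \<open>\<phi> 1\<close>, which \<open>\<nu>_image\<close> evaluates in charts. It is therefore a
  Liouville measure, and uniqueness yields invariance under the inverse and hence under
  \<open>\<phi> 1\<close>.\<close>

lemma liouville_invariant: "distr \<mu>\<^sub>L \<mu>\<^sub>L (\<phi> 1) = \<mu>\<^sub>L"
proof -
  let ?g = "\<phi> 1" and ?k = "\<phi> (- 1)"
  have kg: "?k (?g \<xi>) = \<xi>" and gk: "?g (?k \<xi>) = \<xi>" for \<xi>
    using flow_add[of "- 1" 1 \<xi>] flow_add[of 1 "- 1" \<xi>] by (simp_all add: flow_0)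
  have cg: "continuous_on UNIV ?g" by (rule flow_continuous_space) simp
  have "\<xi> \<in> range ?g" for \<xi> by (rule image_eqI[of _ _ "?k \<xi>"]) (simp_all add: gk)
  then have "?g ` UNIV = UNIV" by blast
  \<comment> \<open>Continuity of the flow was obtained for nonnegative times; at time - 1 it holds
    because a continuous bijection of a compact Hausdorff space has a continuous inverse.\<close>
  then have ck: "continuous_on UNIV ?k" using continuous_on_inv[OF cg cpt, of ?k] kg by simp
  have mg: "?g \<in> borel_measurable borel" and mk: "?k \<in> borel_measurable borel"
    using cg ck by (simp_all add: borel_measurable_continuous_onI)
  have mk': "?k \<in> measurable \<mu>\<^sub>L borel" and mg': "?g \<in> measurable \<mu>\<^sub>L borel"
    using mk mg by (simp_all cong: measurable_cong_sets add: measurable_cong_sets[OF sets_liouville refl])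
  have img: "?g ` E = ?k -` E" for E
  proof (intro set_eqI iffI)
    fix \<xi> assume "\<xi> \<in> ?k -` E"
    then show "\<xi> \<in> ?g ` E" by (intro image_eqI[of _ _ "?k \<xi>"]) (simp_all add: gk)
  qed (auto simp: kg)
  have inj: "inj ?g" by (rule inj_on_inverseI) (rule kg)
  have gE: "?g ` E \<in> sets borel" if "E \<in> sets borel" for E
    unfolding img using measurable_sets[OF mk that] by simp
  have D: "\<exists>M. rsymplectic M \<and> Dg ?g \<xi> M" for \<xi> using \<gamma>_symplectic[of 1 \<xi>] \<gamma>_Dg[of 1 \<xi>] by auto
  obtain N :: nat and c P where P: "\<And>i. i < N \<Longrightarrow> c i \<in> \<A>" "\<And>i. i < N \<Longrightarrow> P i \<in> sets borel" "\<And>i. i < N \<Longrightarrow> P i \<subseteq> fst (c i)"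
    "disjoint_family_on P {..<N}" "(\<Union>i<N. P i) = UNIV" by (rule chart_partition) (rule that)
  have "is_liouville_measure \<A> \<omega> (distr \<mu>\<^sub>L borel ?k)"
    unfolding is_liouville_iff
  proof (intro conjI ballI impI)
    fix b E assume b: "b \<in> \<A>" and E: "E \<in> sets borel" "E \<subseteq> fst b"
    have "emeasure (distr \<mu>\<^sub>L borel ?k) E = emeasure \<mu>\<^sub>L (?g ` E)"
      unfolding img using emeasure_distr[OF mk' E(1)] by (simp add: space_liouville)
    also have "\<dots> = (\<Sum>i<N. emeasure \<mu>\<^sub>L (?g ` E \<inter> P i))"
      by (rule emeasure_partition[OF P(4,5)]) (use P(2) gE[OF E(1)] in \<open>auto simp: sets_liouville\<close>)
    also have "\<dots> = (\<Sum>i<N. emeasure \<mu>\<^sub>L (E \<inter> ?g -` P i))"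
    proof (rule sum.cong[OF refl])
      fix i assume "i \<in> {..<N}"
      then have i: "i < N" by simp
      have E': "E \<inter> ?g -` P i \<in> sets borel" "E \<inter> ?g -` P i \<subseteq> fst b"
        using E measurable_sets[OF mg P(2)[OF i]] by auto
      have eq: "?g ` (E \<inter> ?g -` P i) = ?g ` E \<inter> P i" by auto
      have "emeasure \<mu>\<^sub>L (?g ` E \<inter> P i) = \<nu> (c i) (?g ` (E \<inter> ?g -` P i))"
        unfolding eq by (rule emeasure_liouville[OF P(1)[OF i]]) (use gE[OF E(1)] P(2,3)[OF i] in auto)
      also have "\<dots> = \<nu> b (E \<inter> ?g -` P i)"
        by (rule \<nu>_image[OF b P(1)[OF i] E' gE[OF E'(1)] _ inj D]) (use P(3)[OF i] in auto)
      also have "\<dots> = emeasure \<mu>\<^sub>L (E \<inter> ?g -` P i)" by (rule emeasure_liouville[OF b E', symmetric])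
      finally show "emeasure \<mu>\<^sub>L (?g ` E \<inter> P i) = emeasure \<mu>\<^sub>L (E \<inter> ?g -` P i)" .
    qed
    also have "\<dots> = emeasure \<mu>\<^sub>L E"
    proof (rule emeasure_partition[symmetric])
      show "disjoint_family_on (\<lambda>i. ?g -` P i) {..<N}" using P(4) by (auto simp: disjoint_family_on_def)
      show "(\<Union>i<N. ?g -` P i) = UNIV" using P(5) by (simp flip: vimage_UN)
      show "?g -` P i \<in> sets \<mu>\<^sub>L" if "i < N" for i using measurable_sets[OF mg P(2)[OF that]] by (simp add: sets_liouville)
    qed (simp add: sets_liouville E)
    also have "\<dots> = \<nu> b E" by (rule emeasure_liouville[OF b E])
    finally show "emeasure (distr \<mu>\<^sub>L borel ?k) E = \<nu> b E" .
  qed simp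
  from liouville_unique[OF this liouville] have N: "distr \<mu>\<^sub>L borel ?k = \<mu>\<^sub>L" .
  have "distr \<mu>\<^sub>L \<mu>\<^sub>L ?g = distr \<mu>\<^sub>L borel ?g" by (rule distr_cong) (simp_all add: sets_liouville)
  also have "\<dots> = distr (distr \<mu>\<^sub>L borel ?k) borel ?g" by (simp only: N)
  also have "\<dots> = distr \<mu>\<^sub>L borel (?g \<circ> ?k)" by (rule distr_distr[OF mg mk'])
  also have "\<dots> = distr \<mu>\<^sub>L \<mu>\<^sub>L (\<lambda>x. x)" by (rule distr_cong) (simp_all add: sets_liouville gk)
  finally show ?thesis by (simp add: distr_id)
qed

end

theorem corollary5p9:
  fixes \<A> :: "('a::{t2_space,second_countable_topology}, 'n::finite + 'n) chart set"
    and \<omega> :: "('a, 'n + 'n) two_form"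
    and H :: "'a \<Rightarrow> real"
    and X_H :: "'a \<Rightarrow> ('a, 'n + 'n) tangent"
    and \<phi> :: "real \<Rightarrow> 'a \<Rightarrow> 'a"
    and f :: "'a \<times> ('a, 'n + 'n) tangent \<Rightarrow> 'a \<times> (real ^ ('n + 'n))"
  assumes "C2_manifold_with_boundary \<A>"
    and "compact (UNIV :: 'a set)"
    and "symplectic_form \<A> \<omega>"
    and "C2_function \<A> H"
    and "hamiltonian_vector_field \<A> \<omega> H X_H"
    and "complete_flow \<A> X_H \<phi>"
    and "C1_symplectic_trivialization \<A> \<omega> f"
  shows "\<exists>F :: 'a \<Rightarrow> real. F \<in> borel_measurable borel \<and>
    (\<forall>t\<ge>0. F \<circ> \<phi> t = F) \<and>
    integrable (liouville_measure \<A> \<omega>) F \<and>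
    (\<forall>\<tau>>0. integrable (liouville_measure \<A> \<omega>) (\<lambda>\<xi>. real_of_int (flow_index \<A> f \<phi> \<tau> \<xi>))) \<and>
    ((\<lambda>\<tau>. \<integral>\<xi>. \<bar>real_of_int (flow_index \<A> f \<phi> \<tau> \<xi>) / \<tau> - F \<xi>\<bar> \<partial>liouville_measure \<A> \<omega>)
       \<longlongrightarrow> 0) at_top \<and>
    (AE \<xi> in liouville_measure \<A> \<omega>.
       ((\<lambda>\<tau>. real_of_int (flow_index \<A> f \<phi> \<tau> \<xi>) / \<tau>) \<longlongrightarrow> F \<xi>) at_top)"
proof -
  interpret hamiltonian_flow \<A> \<omega> f H X_H \<phi>
    by unfold_locales (fact assms)+
  obtain C0 where C0: "\<forall>t\<in>{0..1}. \<forall>\<xi>. \<bar>index t \<xi>\<bar> \<le> C0" using index_bounded by (elim exE) (rule that)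
  \<comment> \<open>One constant serves both as the bound for times up to 1 and as the defect of
    additivity.\<close>
  define C where "C = max C0 (4 * CARD('n + 'n))"
  have "\<exists>F. F \<in> borel_measurable \<mu>\<^sub>L \<and> (\<forall>t\<ge>0. F \<circ> \<phi> t = F) \<and> integrable \<mu>\<^sub>L F \<and>
    (\<forall>\<tau>>0. integrable \<mu>\<^sub>L (index \<tau>)) \<and>
    ((\<lambda>\<tau>. \<integral>x. \<bar>index \<tau> x / \<tau> - F x\<bar> \<partial>\<mu>\<^sub>L) \<longlongrightarrow> 0) at_top \<and>
    (AE x in \<mu>\<^sub>L. ((\<lambda>\<tau>. index \<tau> x / \<tau>) \<longlongrightarrow> F x) at_top)"
  proof (rule quasi_additive_ergodic[OF finite_liouville space_liouville, where C=C])
    show "\<phi> 0 x = x" for x by (rule flow_0)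
    show "\<phi> (t + s) x = \<phi> s (\<phi> t x)" for s t x using flow_add[of s t x] by (simp only: add.commute)
    have "\<phi> 1 \<in> borel_measurable borel" by (intro borel_measurable_continuous_onI flow_continuous_space) simp
    then show "\<phi> 1 \<in> measurable \<mu>\<^sub>L \<mu>\<^sub>L" by (simp only: measurable_cong_sets[OF sets_liouville sets_liouville])
    show "distr \<mu>\<^sub>L \<mu>\<^sub>L (\<phi> 1) = \<mu>\<^sub>L" by (rule liouville_invariant)
    show "index t \<in> borel_measurable \<mu>\<^sub>L" if "0 \<le> t" for t
      using index_measurable[OF that] by (simp only: measurable_cong_sets[OF sets_liouville refl])
    show "\<bar>index (t + s) x - index t x - index s (\<phi> t x)\<bar> \<le> C" if "0 \<le> s" "0 \<le> t" for s t x
      using index_quasi_additive[OF that(2,1), of x] by (simp add: C_def)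
    show "\<bar>index t x\<bar> \<le> C" if "0 \<le> t" "t \<le> 1" for t x
      using C0[rule_format, of t x] that by (simp add: C_def)
  qed
  then show ?thesis by (simp only: measurable_cong_sets[OF sets_liouville refl])
qed

end
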